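(* A sheaf $X\in\mathcal F_T(\mathcal S)$ is a hyperbolic sheaf if and only if the projection $U\times\mathbb A^1\to U$ induces a bijection $$\mathrm{Hom}_{\mathcal F_T(\mathcal S)}(U,X)\to\mathrm{Hom}_{\mathcal F_T(\mathcal S)}(U\times\mathbb A^1,X)$$ for every object $U\in\mathcal S_T$. Moreover, under this hypothesis, for every $Y\in\mathcal F_T(\mathcal S)$ there exists a bijection $$\mathrm{Hom}_{\mathcal H}(Y,X)\cong\mathrm{Hom}_{\mathcal H_s}(Y,X)\cong\mathrm{Hom}_{\mathcal F_T(\mathcal S)}(Y,X).$$
   Context: $\mathcal S_T$ is one of the following sites. Complex case: the category of complex spaces and holomorphic maps with the strong topology (coverings are open coverings in the classical topology). Algebraic case: the category of schemes of finite type over a noetherian scheme $B$ of finite dimension, with a Grothendieck topology $T$ weaker than or as fine as the quasi-compact flat topology. $\mathbb A^1$ denotes the affine line $\mathbb A^1_B$ in the algebraic case and $\mathbb C$ in the complex case. $\mathcal F_T(\mathcal S)$ is the category of sheaves of sets on $\mathcal S_T$, and $\Delta^{op}\mathcal F_T(\mathcal S)$ the category of simplicial sheaves. Objects of $\mathcal S$ are identified with the sheaves they represent, and sheaves with constant simplicial sheaves. A morphism of simplicial sheaves is a simplicial weak equivalence if it induces weak equivalences of simplicial sets on all stalks. $\mathcal H_s$ is the localization of $\Delta^{op}\mathcal F_T(\mathcal S)$ at the simplicial weak equivalences. A simplicial sheaf $\mathcal X$ is hyperbolic (equivalently, $\mathbb A^1$-local) if for every simplicial sheaf $\mathcal Y$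 the projection $\mathcal Y\times\mathbb A^1\to\mathcal Y$ induces a bijection $\mathrm{Hom}_{\mathcal H_s}(\mathcal Y,\mathcal X)\to\mathrm{Hom}_{\mathcal H_s}(\mathcal Y\times\mathbb A^1,\mathcal X)$; a hyperbolic sheaf is a sheaf which is hyperbolic as a constant simplicial sheaf. A morphism $f:\mathcal X\to\mathcal Y$ is an affine weak equivalence if for every $\mathbb A^1$-local $\mathcal Z$ composition with $f$ is a bijection between $\mathrm{Hom}_{\mathcal H_s}(\mathcal Y,\mathcal Z)$ and $\mathrm{Hom}_{\mathcal H_s}(\mathcal X,\mathcal Z)$. $\mathcal H$ is the localization of $\Delta^{op}\mathcal F_T(\mathcal S)$ at the affine weak equivalences.
   Formalization: In the algebraic case the site is additionally assumed to have enough points; for an arbitrary topology weaker than the quasi-compact flat one this can fail, and then the bijection of Hom in H_s with Hom of sheaves can fail. Nothing is added in the complex case. *)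

theory Defs
  imports
    "HOL-Algebra.UnivPoly"
    "HOL-Algebra.QuotRing"
    "HOL-Algebra.Generated_Rings"
    "HOL-Algebra.Ring_Divisibility"
    "HOL-Homology.Homology"
begin

section \<open>Categories, sieves and topologies, localization\<close>

text \<open>\<open>Comp C g f\<close> is \<open>g\<close> after \<open>f\<close>. All categories below carry the source and target inside their arrows.\<close>

record ('o, 'm) category =
  Obj :: "'o set"
  Arr :: "'m set"
  Dom :: "'m \<Rightarrow> 'o"
  Cod :: "'m \<Rightarrow> 'o"
  Ide :: "'o \<Rightarrow> 'm"
  Comp :: "'m \<Rightarrow> 'm \<Rightarrow> 'm"

definition hom_set :: "('o, 'm) category \<Rightarrow> 'o \<Rightarrow> 'o \<Rightarrow> 'm set" where
  "hom_set C a b = {f \<in> Arr C. Dom C f = a \<and> Cod C f = b}"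

definition arrows_to :: "('o, 'm) category \<Rightarrow> 'o \<Rightarrow> 'm set" where
  "arrows_to C a = {f \<in> Arr C. Cod C f = a}"

definition sieve :: "('o, 'm) category \<Rightarrow> 'o \<Rightarrow> 'm set \<Rightarrow> bool" where
  "sieve C a R \<longleftrightarrow> R \<subseteq> arrows_to C a \<and> (\<forall>f\<in>R. \<forall>h\<in>arrows_to C (Dom C f). Comp C f h \<in> R)"

definition sieve_pullback :: "('o, 'm) category \<Rightarrow> 'm set \<Rightarrow> 'm \<Rightarrow> 'm set" where
  "sieve_pullback C R h = {g \<in> arrows_to C (Dom C h). Comp C h g \<in> R}"

definition grothendieck_topology :: "('o, 'm) category \<Rightarrow> ('o \<Rightarrow> 'm set set) \<Rightarrow> bool" where
  "grothendieck_topology C J \<longleftrightarrow> (\<forall>a\<in>Obj C.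
     (\<forall>R\<in>J a. sieve C a R) \<and>
     arrows_to C a \<in> J a \<and>
     (\<forall>R\<in>J a. \<forall>h\<in>arrows_to C a. sieve_pullback C R h \<in> J (Dom C h)) \<and>
     (\<forall>R\<in>J a. \<forall>R'. sieve C a R' \<and> (\<forall>h\<in>R. sieve_pullback C R' h \<in> J (Dom C h)) \<longrightarrow> R' \<in> J a))"

text \<open>
  The localization of a category at a set \<open>W\<close> of arrows, following Gabriel and Zisman: arrows
  are zigzags in which the arrows of \<open>W\<close> may be traversed backwards (the head of the list is
  traversed first), modulo the congruence generated by the relations in \<open>zig_step\<close>.
\<close>

datatype 'm zig = Fwd 'm | Bwd 'm

inductive zigzag :: "('o, 'm) category \<Rightarrow> 'm set \<Rightarrow> 'o \<Rightarrow> 'm zig list \<Rightarrow> 'o \<Rightarrow> bool"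
  for C W where
  zz_nil: "a \<in> Obj C \<Longrightarrow> zigzag C W a [] a"
| zz_fwd: "f \<in> Arr C \<Longrightarrow> zigzag C W (Cod C f) ps b \<Longrightarrow> zigzag C W (Dom C f) (Fwd f # ps) b"
| zz_bwd: "w \<in> Arr C \<Longrightarrow> w \<in> W \<Longrightarrow> zigzag C W (Dom C w) ps b \<Longrightarrow> zigzag C W (Cod C w) (Bwd w # ps) b"

inductive zig_step :: "('o, 'm) category \<Rightarrow> 'm set \<Rightarrow> 'm zig list \<Rightarrow> 'm zig list \<Rightarrow> bool"
  for C W where
  "a \<in> Obj C \<Longrightarrow> zig_step C W (ps @ [Fwd (Ide C a)] @ qs) (ps @ qs)"
| "f \<in> Arr C \<Longrightarrow> g \<in> Arr C \<Longrightarrow> Cod C f = Dom C g \<Longrightarrow>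
     zig_step C W (ps @ [Fwd f, Fwd g] @ qs) (ps @ [Fwd (Comp C g f)] @ qs)"
| "w \<in> W \<Longrightarrow> zig_step C W (ps @ [Fwd w, Bwd w] @ qs) (ps @ qs)"
| "w \<in> W \<Longrightarrow> zig_step C W (ps @ [Bwd w, Fwd w] @ qs) (ps @ qs)"

inductive zig_eq :: "('o, 'm) category \<Rightarrow> 'm set \<Rightarrow> 'o \<Rightarrow> 'o \<Rightarrow> 'm zig list \<Rightarrow> 'm zig list \<Rightarrow> bool"
  for C W a b where
  "zigzag C W a ps b \<Longrightarrow> zig_eq C W a b ps ps"
| "zigzag C W a ps b \<Longrightarrow> zigzag C W a qs b \<Longrightarrow> zig_step C W ps qs \<Longrightarrow> zig_eq C W a b ps qs"
| "zig_eq C W a b ps qs \<Longrightarrow> zig_eq C W a b qs ps"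
| "zig_eq C W a b ps qs \<Longrightarrow> zig_eq C W a b qs rs \<Longrightarrow> zig_eq C W a b ps rs"

definition loc_hom :: "('o, 'm) category \<Rightarrow> 'm set \<Rightarrow> 'o \<Rightarrow> 'o \<Rightarrow> 'm zig list set set" where
  "loc_hom C W a b = {ps. zigzag C W a ps b} // {(ps, qs). zig_eq C W a b ps qs}"

text \<open>Precomposition, in the localization, with the image of an arrow \<open>f\<close> of \<open>C\<close>.\<close>

definition loc_precomp ::
  "('o, 'm) category \<Rightarrow> 'm set \<Rightarrow> 'm \<Rightarrow> 'o \<Rightarrow> 'm zig list set \<Rightarrow> 'm zig list set" where
  "loc_precomp C W f b c = {qs. \<exists>ps\<in>c. zig_eq C W (Dom C f) b (Fwd f # ps) qs}"


section \<open>Sheaves of sets\<close>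

text \<open>
  Sheaves take values in the subsets of the type \<open>('e, 'm) univ\<close>, which plays the role of the
  universe of small sets. It contains a copy of the arbitrary type \<open>'e\<close>, and it is closed under
  pairs and under families indexed by the arrows \<open>'m\<close> of the site, hence
  under sheafification and under all limits and colimits of the size of the site.
\<close>

datatype ('e, 'm) univ =
    Elem 'e
  | Pair "('e, 'm) univ" "('e, 'm) univ"
  | Fam "'m \<Rightarrow> ('e, 'm) univ"
  | Rel "('m \<times> 'm) set"

record ('o, 'm, 'v) psh =
  Val :: "'o \<Rightarrow> 'v set"
  Act :: "'m \<Rightarrow> 'v \<Rightarrow> 'v"

definition presheaf :: "('o, 'm) category \<Rightarrow> ('o, 'm, 'v) psh \<Rightarrow> bool" where
  "presheaf C F \<longleftrightarrow>
     (\<forall>f\<in>Arr C. Act F f \<in> Val F (Cod C f) \<rightarrow> Val F (Dom C f)) \<and>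
     (\<forall>a\<in>Obj C. \<forall>x\<in>Val F a. Act F (Ide C a) x = x) \<and>
     (\<forall>f\<in>Arr C. \<forall>g\<in>Arr C. Cod C f = Dom C g \<longrightarrow>
        (\<forall>x\<in>Val F (Cod C g). Act F (Comp C g f) x = Act F f (Act F g x)))"

definition matching_family ::
  "('o, 'm) category \<Rightarrow> ('o, 'm, 'v) psh \<Rightarrow> 'm set \<Rightarrow> ('m \<Rightarrow> 'v) \<Rightarrow> bool" where
  "matching_family C F R s \<longleftrightarrow>
     (\<forall>f\<in>R. s f \<in> Val F (Dom C f) \<and>
        (\<forall>h\<in>arrows_to C (Dom C f). Act F h (s f) = s (Comp C f h)))"

definition sheaf :: "('o, 'm) category \<Rightarrow> ('o \<Rightarrow> 'm set set) \<Rightarrow> ('o, 'm, 'v) psh \<Rightarrow> bool" where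
  "sheaf C J F \<longleftrightarrow> presheaf C F \<and>
     (\<forall>a\<in>Obj C. \<forall>R\<in>J a. \<forall>s. matching_family C F R s \<longrightarrow>
        (\<exists>!x. x \<in> Val F a \<and> (\<forall>f\<in>R. Act F f x = s f)))"

definition nat_trans ::
  "('o, 'm) category \<Rightarrow> ('o, 'm, 'v) psh \<Rightarrow> ('o, 'm, 'v) psh \<Rightarrow> ('o \<Rightarrow> 'v \<Rightarrow> 'v) \<Rightarrow> bool" where
  "nat_trans C F G \<eta> \<longleftrightarrow>
     \<eta> \<in> extensional (Obj C) \<and>
     (\<forall>a\<in>Obj C. \<eta> a \<in> Val F a \<rightarrow>\<^sub>E Val G a) \<and>
     (\<forall>f\<in>Arr C. \<forall>x\<in>Val F (Cod C f). \<eta> (Dom C f) (Act F f x) = Act G f (\<eta> (Cod C f) x))"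

type_synonym ('o, 'm, 'v) psh_arr =
  "('o, 'm, 'v) psh \<times> ('o \<Rightarrow> 'v \<Rightarrow> 'v) \<times> ('o, 'm, 'v) psh"

definition sheaf_cat ::
  "('o, 'm) category \<Rightarrow> ('o \<Rightarrow> 'm set set) \<Rightarrow> (('o, 'm, 'v) psh, ('o, 'm, 'v) psh_arr) category" where
  "sheaf_cat C J =
     \<lparr>Obj = {F. sheaf C J F},
      Arr = {(F, \<eta>, G). sheaf C J F \<and> sheaf C J G \<and> nat_trans C F G \<eta>},
      Dom = (\<lambda>(F, \<eta>, G). F),
      Cod = (\<lambda>(F, \<eta>, G). G),
      Ide = (\<lambda>F. (F, (\<lambda>a\<in>Obj C. \<lambda>x\<in>Val F a. x), F)),
      Comp = (\<lambda>(G', \<epsilon>, H). \<lambda>(F, \<eta>, G). (F, (\<lambda>a\<in>Obj C. \<lambda>x\<in>Val F a. \<epsilon> a (\<eta> a x)), H))\<rparr>"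

text \<open>
  The sheaf represented by an object \<open>u\<close>, i.e. the sheaf associated with
  \<open>Hom(-, u)\<close>. If the topology is subcanonical, in particular in the complex case and for
  topologies weaker than the quasi-compact flat one, this is canonically \<open>Hom(-, u)\<close> itself,
  an arrow \<open>k : w \<rightarrow> u\<close> corresponding to the set of all pairs \<open>(f, k f)\<close>. In general a
  section over \<open>w\<close> is a local arrow \<open>\<sigma>\<close> from \<open>w\<close> to \<open>u\<close>, encoded by the set of all
  pairs \<open>(f : w' \<rightarrow> w, g : w' \<rightarrow> u)\<close> such that the restriction of \<open>\<sigma>\<close> along \<open>f\<close> is \<open>g\<close>.
\<close>

definition local_arrow ::
  "('o, 'm) category \<Rightarrow> ('o \<Rightarrow> 'm set set) \<Rightarrow> 'o \<Rightarrow> 'o \<Rightarrow> ('m \<times> 'm) set \<Rightarrow> bool" where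
  "local_arrow C J w u s \<longleftrightarrow>
     s \<subseteq> {(f, g). f \<in> arrows_to C w \<and> g \<in> hom_set C (Dom C f) u} \<and>
     (\<forall>(f, g)\<in>s. \<forall>h\<in>arrows_to C (Dom C f). (Comp C f h, Comp C g h) \<in> s) \<and>
     (\<forall>f g g'. (f, g) \<in> s \<and> (f, g') \<in> s \<longrightarrow>
        {h \<in> arrows_to C (Dom C f). Comp C g h = Comp C g' h} \<in> J (Dom C f)) \<and>
     (\<forall>f\<in>arrows_to C w. \<forall>g\<in>hom_set C (Dom C f) u.
        {h \<in> arrows_to C (Dom C f). (Comp C f h, Comp C g h) \<in> s} \<in> J (Dom C f) \<longrightarrow> (f, g) \<in> s) \<and>
     fst ` s \<in> J w"

definition rep ::
  "('o, 'm) category \<Rightarrow> ('o \<Rightarrow> 'm set set) \<Rightarrow> 'o \<Rightarrow> ('o, 'm, ('e, 'm) univ) psh" where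
  "rep C J u =
     \<lparr>Val = (\<lambda>w. Rel ` {s. local_arrow C J w u s}),
      Act = (\<lambda>h v. case v of
               Rel s \<Rightarrow> Rel {(f, g). f \<in> arrows_to C (Dom C h) \<and> (Comp C h f, g) \<in> s}
             | _ \<Rightarrow> v)\<rparr>"

definition psh_prod ::
  "('o, 'm, ('e, 'm) univ) psh \<Rightarrow> ('o, 'm, ('e, 'm) univ) psh \<Rightarrow> ('o, 'm, ('e, 'm) univ) psh" where
  "psh_prod F G =
     \<lparr>Val = (\<lambda>a. {Pair x y | x y. x \<in> Val F a \<and> y \<in> Val G a}),
      Act = (\<lambda>f v. case v of Pair x y \<Rightarrow> Pair (Act F f x) (Act G f y) | _ \<Rightarrow> v)\<rparr>"

definition pair_fst :: "('e, 'm) univ \<Rightarrow> ('e, 'm) univ" where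
  "pair_fst v = (case v of Pair x y \<Rightarrow> x | _ \<Rightarrow> v)"

definition psh_proj ::
  "('o, 'm) category \<Rightarrow> ('o, 'm, ('e, 'm) univ) psh \<Rightarrow> ('o, 'm, ('e, 'm) univ) psh \<Rightarrow>
   ('o, 'm, ('e, 'm) univ) psh_arr" where
  "psh_proj C F G =
     (psh_prod F G, (\<lambda>a\<in>Obj C. \<lambda>v\<in>Val (psh_prod F G) a. pair_fst v), F)"


section \<open>Points and stalks\<close>

text \<open>
  A point of the site is a set-valued functor \<open>u\<close> on objects and arrows that is flat (its
  category of elements is cofiltered) and continuous (it sends covering sieves to jointly
  surjective families).
\<close>

type_synonym ('o, 'm, 'v) pt_functor = "('o \<Rightarrow> 'v set) \<times> ('m \<Rightarrow> 'v \<Rightarrow> 'v)"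

definition site_point ::
  "('o, 'm) category \<Rightarrow> ('o \<Rightarrow> 'm set set) \<Rightarrow> ('o, 'm, 'v) pt_functor \<Rightarrow> bool" where
  "site_point C J u \<longleftrightarrow>
     (\<forall>f\<in>Arr C. snd u f \<in> fst u (Dom C f) \<rightarrow> fst u (Cod C f)) \<and>
     (\<forall>a\<in>Obj C. \<forall>x\<in>fst u a. snd u (Ide C a) x = x) \<and>
     (\<forall>f\<in>Arr C. \<forall>g\<in>Arr C. Cod C f = Dom C g \<longrightarrow>
        (\<forall>x\<in>fst u (Dom C f). snd u (Comp C g f) x = snd u g (snd u f x))) \<and>
     (\<forall>a\<in>Obj C. \<forall>R\<in>J a. \<forall>x\<in>fst u a. \<exists>f\<in>R. \<exists>y\<in>fst u (Dom C f). snd u f y = x) \<and>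
     (\<exists>a\<in>Obj C. fst u a \<noteq> {}) \<and>
     (\<forall>a\<in>Obj C. \<forall>b\<in>Obj C. \<forall>x\<in>fst u a. \<forall>y\<in>fst u b.
        \<exists>c\<in>Obj C. \<exists>f\<in>hom_set C c a. \<exists>g\<in>hom_set C c b. \<exists>z\<in>fst u c.
          snd u f z = x \<and> snd u g z = y) \<and>
     (\<forall>a\<in>Obj C. \<forall>b\<in>Obj C. \<forall>f\<in>hom_set C a b. \<forall>g\<in>hom_set C a b. \<forall>x\<in>fst u a.
        snd u f x = snd u g x \<longrightarrow>
        (\<exists>h\<in>arrows_to C a. \<exists>z\<in>fst u (Dom C h). snd u h z = x \<and> Comp C f h = Comp C g h))"

definition stalk_class ::
  "('o, 'm) category \<Rightarrow> ('o, 'm, 'v) psh \<Rightarrow> ('o, 'm, 'v) pt_functor \<Rightarrow>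
   'o \<times> 'v \<times> 'v \<Rightarrow> ('o \<times> 'v \<times> 'v) set" where
  "stalk_class C F u = (\<lambda>(a, x, s). {(b, y, t). b \<in> Obj C \<and> y \<in> fst u b \<and> t \<in> Val F b \<and>
     (\<exists>c\<in>Obj C. \<exists>f\<in>hom_set C c a. \<exists>g\<in>hom_set C c b. \<exists>z\<in>fst u c.
        snd u f z = x \<and> snd u g z = y \<and> Act F f s = Act F g t)})"

definition psh_stalk ::
  "('o, 'm) category \<Rightarrow> ('o, 'm, 'v) psh \<Rightarrow> ('o, 'm, 'v) pt_functor \<Rightarrow> ('o \<times> 'v \<times> 'v) set set" where
  "psh_stalk C F u = stalk_class C F u ` {(a, x, s). a \<in> Obj C \<and> x \<in> fst u a \<and> s \<in> Val F a}"

definition psh_stalk_map ::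
  "('o, 'm) category \<Rightarrow> ('o, 'm, 'v) psh \<Rightarrow> ('o, 'm, 'v) pt_functor \<Rightarrow> ('o \<Rightarrow> 'v \<Rightarrow> 'v) \<Rightarrow>
   ('o \<times> 'v \<times> 'v) set \<Rightarrow> ('o \<times> 'v \<times> 'v) set" where
  "psh_stalk_map C G u \<eta> c = (case SOME p. p \<in> c of (a, x, s) \<Rightarrow> stalk_class C G u (a, x, \<eta> a s))"

definition enough_points ::
  "('o, 'm) category \<Rightarrow> ('o \<Rightarrow> 'm set set) \<Rightarrow> 'v itself \<Rightarrow> bool" where
  "enough_points C J (_ :: 'v itself) \<longleftrightarrow>
     (\<forall>F G :: ('o, 'm, 'v) psh. \<forall>\<eta>. sheaf C J F \<and> sheaf C J G \<and> nat_trans C F G \<eta> \<and>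
        (\<forall>u :: ('o, 'm, 'v) pt_functor. site_point C J u \<longrightarrow>
           bij_betw (psh_stalk_map C G u \<eta>) (psh_stalk C F u) (psh_stalk C G u)) \<longrightarrow>
        (\<forall>a\<in>Obj C. bij_betw (\<eta> a) (Val F a) (Val G a)))"


section \<open>Weak equivalences of simplicial sets\<close>

definition Delta :: "nat \<Rightarrow> nat \<Rightarrow> (nat \<Rightarrow> nat) set" where
  "Delta m n = {\<theta> \<in> {..m} \<rightarrow>\<^sub>E {..n}. mono_on {..m} \<theta>}"

text \<open>\<open>SpxOp K m n \<theta>\<close> is the operator from \<open>n\<close>-simplices to \<open>m\<close>-simplices given by \<open>\<theta> : [m] \<rightarrow> [n]\<close>.\<close>

record 's sset =
  Spx :: "nat \<Rightarrow> 's set"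
  SpxOp :: "nat \<Rightarrow> nat \<Rightarrow> (nat \<Rightarrow> nat) \<Rightarrow> 's \<Rightarrow> 's"

type_synonym 's cell_point = "(nat \<times> 's) \<times> (nat \<Rightarrow> real)"

definition simplex_space :: "nat \<Rightarrow> (nat \<Rightarrow> real) topology" where
  "simplex_space n = subtopology (powertop_real UNIV) (standard_simplex n)"

definition simplex_push :: "nat \<Rightarrow> (nat \<Rightarrow> nat) \<Rightarrow> (nat \<Rightarrow> real) \<Rightarrow> nat \<Rightarrow> real" where
  "simplex_push m \<theta> t = (\<lambda>j. \<Sum>i | i \<le> m \<and> \<theta> i = j. t i)"

definition cell_space :: "'s sset \<Rightarrow> 's cell_point topology" where
  "cell_space K = sum_topology (\<lambda>(n, x). simplex_space n) {(n, x). x \<in> Spx K n}"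

definition cell_glue :: "'s sset \<Rightarrow> ('s cell_point \<times> 's cell_point) set" where
  "cell_glue K = {(((m, SpxOp K m n \<theta> x), t), ((n, x), simplex_push m \<theta> t)) | m n \<theta> x t.
     \<theta> \<in> Delta m n \<and> x \<in> Spx K n \<and> t \<in> standard_simplex m}"

definition cell_class :: "'s sset \<Rightarrow> 's cell_point \<Rightarrow> 's cell_point set" where
  "cell_class K p = (cell_glue K \<union> (cell_glue K)\<inverse>)\<^sup>* `` {p}"

text \<open>Geometric realization, with the quotient topology.\<close>

definition realization :: "'s sset \<Rightarrow> 's cell_point set topology" where
  "realization K = topology (\<lambda>\<U>. \<U> \<subseteq> cell_class K ` topspace (cell_space K) \<and>
     openin (cell_space K) (\<Union>\<U>))"

definition realization_map ::
  "'t sset \<Rightarrow> (nat \<Rightarrow> 's \<Rightarrow> 't) \<Rightarrow> 's cell_point set \<Rightarrow> 't cell_point set" where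
  "realization_map L \<eta> c = (case SOME p. p \<in> c of ((n, x), t) \<Rightarrow> cell_class L ((n, \<eta> n x), t))"

definition cube :: "nat \<Rightarrow> (nat \<Rightarrow> real) topology" where
  "cube n = subtopology (powertop_real UNIV)
     {t. (\<forall>i<n. 0 \<le> t i \<and> t i \<le> 1) \<and> (\<forall>i\<ge>n. t i = 0)}"

definition cube_boundary :: "nat \<Rightarrow> (nat \<Rightarrow> real) set" where
  "cube_boundary n = {t \<in> topspace (cube n). \<exists>i<n. t i = 0 \<or> t i = 1}"

definition spheroid :: "nat \<Rightarrow> 'a topology \<Rightarrow> 'a \<Rightarrow> ((nat \<Rightarrow> real) \<Rightarrow> 'a) \<Rightarrow> bool" where
  "spheroid n X x c \<longleftrightarrow> continuous_map (cube n) X c \<and> c ` cube_boundary n \<subseteq> {x}"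

definition spheroid_homotopic ::
  "nat \<Rightarrow> 'a topology \<Rightarrow> 'a \<Rightarrow> ((nat \<Rightarrow> real) \<Rightarrow> 'a) \<Rightarrow> ((nat \<Rightarrow> real) \<Rightarrow> 'a) \<Rightarrow> bool" where
  "spheroid_homotopic n X x = homotopic_with (\<lambda>h. h ` cube_boundary n \<subseteq> {x}) (cube n) X"

text \<open>Bijectivity on path components, and on all homotopy groups at all base points.\<close>

definition weak_homotopy_equivalence :: "'a topology \<Rightarrow> 'b topology \<Rightarrow> ('a \<Rightarrow> 'b) \<Rightarrow> bool" where
  "weak_homotopy_equivalence X Y f \<longleftrightarrow>
     continuous_map X Y f \<and>
     (\<forall>x\<in>topspace X. \<forall>x'\<in>topspace X.
        path_component_of Y (f x) (f x') \<longrightarrow> path_component_of X x x') \<and>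
     (\<forall>y\<in>topspace Y. \<exists>x\<in>topspace X. path_component_of Y (f x) y) \<and>
     (\<forall>n\<ge>1. \<forall>x\<in>topspace X.
        (\<forall>c d. spheroid n X x c \<and> spheroid n X x d \<and> spheroid_homotopic n Y (f x) (f \<circ> c) (f \<circ> d)
           \<longrightarrow> spheroid_homotopic n X x c d) \<and>
        (\<forall>d. spheroid n Y (f x) d
           \<longrightarrow> (\<exists>c. spheroid n X x c \<and> spheroid_homotopic n Y (f x) (f \<circ> c) d)))"

definition sset_weak_equivalence :: "'s sset \<Rightarrow> 't sset \<Rightarrow> (nat \<Rightarrow> 's \<Rightarrow> 't) \<Rightarrow> bool" where
  "sset_weak_equivalence K L \<eta> \<longleftrightarrow>
     weak_homotopy_equivalence (realization K) (realization L) (realization_map L \<eta>)"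


section \<open>Simplicial sheaves and their localizations\<close>

record ('o, 'm, 'v) spsh =
  Lev :: "nat \<Rightarrow> ('o, 'm, 'v) psh"
  LevOp :: "nat \<Rightarrow> nat \<Rightarrow> (nat \<Rightarrow> nat) \<Rightarrow> 'o \<Rightarrow> 'v \<Rightarrow> 'v"

definition simplicial_sheaf ::
  "('o, 'm) category \<Rightarrow> ('o \<Rightarrow> 'm set set) \<Rightarrow> ('o, 'm, 'v) spsh \<Rightarrow> bool" where
  "simplicial_sheaf C J X \<longleftrightarrow>
     (\<forall>n. sheaf C J (Lev X n)) \<and>
     (\<forall>m n. \<forall>\<theta>\<in>Delta m n. nat_trans C (Lev X n) (Lev X m) (LevOp X m n \<theta>)) \<and>
     (\<forall>n. \<forall>a\<in>Obj C. \<forall>x\<in>Val (Lev X n) a. LevOp X n n (\<lambda>i\<in>{..n}. i) a x = x) \<and>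
     (\<forall>k m n. \<forall>\<theta>\<in>Delta k m. \<forall>\<phi>\<in>Delta m n. \<forall>a\<in>Obj C. \<forall>x\<in>Val (Lev X n) a.
        LevOp X k n (compose {..k} \<phi> \<theta>) a x = LevOp X k m \<theta> a (LevOp X m n \<phi> a x))"

definition simplicial_nat_trans ::
  "('o, 'm) category \<Rightarrow> ('o, 'm, 'v) spsh \<Rightarrow> ('o, 'm, 'v) spsh \<Rightarrow> (nat \<Rightarrow> 'o \<Rightarrow> 'v \<Rightarrow> 'v) \<Rightarrow> bool" where
  "simplicial_nat_trans C X Y \<eta> \<longleftrightarrow>
     (\<forall>n. nat_trans C (Lev X n) (Lev Y n) (\<eta> n)) \<and>
     (\<forall>m n. \<forall>\<theta>\<in>Delta m n. \<forall>a\<in>Obj C. \<forall>x\<in>Val (Lev X n) a.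
        \<eta> m a (LevOp X m n \<theta> a x) = LevOp Y m n \<theta> a (\<eta> n a x))"

type_synonym ('o, 'm, 'v) spsh_arr =
  "('o, 'm, 'v) spsh \<times> (nat \<Rightarrow> 'o \<Rightarrow> 'v \<Rightarrow> 'v) \<times> ('o, 'm, 'v) spsh"

definition simplicial_sheaf_cat ::
  "('o, 'm) category \<Rightarrow> ('o \<Rightarrow> 'm set set) \<Rightarrow>
   (('o, 'm, 'v) spsh, ('o, 'm, 'v) spsh_arr) category" where
  "simplicial_sheaf_cat C J =
     \<lparr>Obj = {X. simplicial_sheaf C J X},
      Arr = {(X, \<eta>, Y). simplicial_sheaf C J X \<and> simplicial_sheaf C J Y \<and> simplicial_nat_trans C X Y \<eta>},
      Dom = (\<lambda>(X, \<eta>, Y). X),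
      Cod = (\<lambda>(X, \<eta>, Y). Y),
      Ide = (\<lambda>X. (X, (\<lambda>n. \<lambda>a\<in>Obj C. \<lambda>x\<in>Val (Lev X n) a. x), X)),
      Comp = (\<lambda>(Y', \<epsilon>, Z). \<lambda>(X, \<eta>, Y).
                (X, (\<lambda>n. \<lambda>a\<in>Obj C. \<lambda>x\<in>Val (Lev X n) a. \<epsilon> n a (\<eta> n a x)), Z))\<rparr>"

definition const_simplicial :: "('o, 'm) category \<Rightarrow> ('o, 'm, 'v) psh \<Rightarrow> ('o, 'm, 'v) spsh" where
  "const_simplicial C F =
     \<lparr>Lev = (\<lambda>n. F), LevOp = (\<lambda>m n \<theta>. \<lambda>a\<in>Obj C. \<lambda>x\<in>Val F a. x)\<rparr>"

definition spsh_prod ::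
  "('o, 'm) category \<Rightarrow> ('o, 'm, ('e, 'm) univ) spsh \<Rightarrow> ('o, 'm, ('e, 'm) univ) psh \<Rightarrow>
   ('o, 'm, ('e, 'm) univ) spsh" where
  "spsh_prod C Y G =
     \<lparr>Lev = (\<lambda>n. psh_prod (Lev Y n) G),
      LevOp = (\<lambda>m n \<theta>. \<lambda>a\<in>Obj C. \<lambda>v\<in>Val (psh_prod (Lev Y n) G) a.
                 case v of Pair x y \<Rightarrow> Pair (LevOp Y m n \<theta> a x) y | _ \<Rightarrow> v)\<rparr>"

definition spsh_proj ::
  "('o, 'm) category \<Rightarrow> ('o, 'm, ('e, 'm) univ) spsh \<Rightarrow> ('o, 'm, ('e, 'm) univ) psh \<Rightarrow>
   ('o, 'm, ('e, 'm) univ) spsh_arr" where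
  "spsh_proj C Y G =
     (spsh_prod C Y G, (\<lambda>n. \<lambda>a\<in>Obj C. \<lambda>v\<in>Val (psh_prod (Lev Y n) G) a. pair_fst v), Y)"

definition simplicial_stalk ::
  "('o, 'm) category \<Rightarrow> ('o, 'm, 'v) spsh \<Rightarrow> ('o, 'm, 'v) pt_functor \<Rightarrow> ('o \<times> 'v \<times> 'v) set sset" where
  "simplicial_stalk C X u =
     \<lparr>Spx = (\<lambda>n. psh_stalk C (Lev X n) u),
      SpxOp = (\<lambda>m n \<theta>. psh_stalk_map C (Lev X m) u (LevOp X m n \<theta>))\<rparr>"

definition simplicial_weak_equivalences ::
  "('o, 'm) category \<Rightarrow> ('o \<Rightarrow> 'm set set) \<Rightarrow> ('o, 'm, 'v) spsh_arr set" where
  "simplicial_weak_equivalences C J =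
     {(X, \<eta>, Y) \<in> Arr (simplicial_sheaf_cat C J).
        \<forall>u :: ('o, 'm, 'v) pt_functor. site_point C J u \<longrightarrow>
          sset_weak_equivalence (simplicial_stalk C X u) (simplicial_stalk C Y u)
            (\<lambda>n. psh_stalk_map C (Lev Y n) u (\<eta> n))}"

definition hom_Hs ::
  "('o, 'm) category \<Rightarrow> ('o \<Rightarrow> 'm set set) \<Rightarrow> ('o, 'm, 'v) spsh \<Rightarrow> ('o, 'm, 'v) spsh \<Rightarrow>
   ('o, 'm, 'v) spsh_arr zig list set set" where
  "hom_Hs C J = loc_hom (simplicial_sheaf_cat C J) (simplicial_weak_equivalences C J)"

definition precomp_Hs ::
  "('o, 'm) category \<Rightarrow> ('o \<Rightarrow> 'm set set) \<Rightarrow> ('o, 'm, 'v) spsh_arr \<Rightarrow> ('o, 'm, 'v) spsh \<Rightarrow>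
   ('o, 'm, 'v) spsh_arr zig list set \<Rightarrow> ('o, 'm, 'v) spsh_arr zig list set" where
  "precomp_Hs C J = loc_precomp (simplicial_sheaf_cat C J) (simplicial_weak_equivalences C J)"

text \<open>In the following \<open>A\<close> is the object of the site playing the role of the affine line.\<close>

definition hyperbolic ::
  "('o, 'm) category \<Rightarrow> ('o \<Rightarrow> 'm set set) \<Rightarrow> 'o \<Rightarrow> ('o, 'm, ('e, 'm) univ) spsh \<Rightarrow> bool" where
  "hyperbolic C J A X \<longleftrightarrow> simplicial_sheaf C J X \<and>
     (\<forall>Y. simplicial_sheaf C J Y \<longrightarrow>
        bij_betw (precomp_Hs C J (spsh_proj C Y (rep C J A)) X)
          (hom_Hs C J Y X) (hom_Hs C J (spsh_prod C Y (rep C J A)) X))"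

definition hyperbolic_sheaf ::
  "('o, 'm) category \<Rightarrow> ('o \<Rightarrow> 'm set set) \<Rightarrow> 'o \<Rightarrow> ('o, 'm, ('e, 'm) univ) psh \<Rightarrow> bool" where
  "hyperbolic_sheaf C J A X \<longleftrightarrow> sheaf C J X \<and> hyperbolic C J A (const_simplicial C X)"

definition affine_weak_equivalences ::
  "('o, 'm) category \<Rightarrow> ('o \<Rightarrow> 'm set set) \<Rightarrow> 'o \<Rightarrow> ('o, 'm, ('e, 'm) univ) spsh_arr set" where
  "affine_weak_equivalences C J A =
     {f \<in> Arr (simplicial_sheaf_cat C J). \<forall>Z. hyperbolic C J A Z \<longrightarrow>
        bij_betw (precomp_Hs C J f Z)
          (hom_Hs C J (Cod (simplicial_sheaf_cat C J) f) Z)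
          (hom_Hs C J (Dom (simplicial_sheaf_cat C J) f) Z)}"

definition hom_H ::
  "('o, 'm) category \<Rightarrow> ('o \<Rightarrow> 'm set set) \<Rightarrow> 'o \<Rightarrow>
   ('o, 'm, ('e, 'm) univ) spsh \<Rightarrow> ('o, 'm, ('e, 'm) univ) spsh \<Rightarrow>
   ('o, 'm, ('e, 'm) univ) spsh_arr zig list set set" where
  "hom_H C J A = loc_hom (simplicial_sheaf_cat C J) (affine_weak_equivalences C J A)"


section \<open>Locally ringed spaces\<close>

text \<open>\<open>Res X U V\<close> is the restriction from \<open>Sec X U\<close> to \<open>Sec X V\<close>, for \<open>V \<subseteq> U\<close>.\<close>

record ('p, 'r) rspace =
  Top :: "'p topology"
  Sec :: "'p set \<Rightarrow> 'r ring"
  Res :: "'p set \<Rightarrow> 'p set \<Rightarrow> 'r \<Rightarrow> 'r"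

abbreviation points :: "('p, 'r) rspace \<Rightarrow> 'p set" where
  "points X \<equiv> topspace (Top X)"

abbreviation global :: "('p, 'r) rspace \<Rightarrow> 'r ring" where
  "global X \<equiv> Sec X (points X)"

definition ringed_space :: "('p, 'r) rspace \<Rightarrow> bool" where
  "ringed_space X \<longleftrightarrow>
     (\<forall>U. openin (Top X) U \<longrightarrow> cring (Sec X U)) \<and>
     (\<forall>U V. openin (Top X) U \<and> openin (Top X) V \<and> V \<subseteq> U \<longrightarrow>
        Res X U V \<in> ring_hom (Sec X U) (Sec X V)) \<and>
     (\<forall>U. openin (Top X) U \<longrightarrow> (\<forall>s\<in>carrier (Sec X U). Res X U U s = s)) \<and>
     (\<forall>U V W. openin (Top X) U \<and> openin (Top X) V \<and> openin (Top X) W \<and> W \<subseteq> V \<and> V \<subseteq> U \<longrightarrow>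
        (\<forall>s\<in>carrier (Sec X U). Res X V W (Res X U V s) = Res X U W s)) \<and>
     (\<forall>\<U> s. (\<forall>U\<in>\<U>. openin (Top X) U \<and> s U \<in> carrier (Sec X U)) \<and>
        (\<forall>U\<in>\<U>. \<forall>V\<in>\<U>. Res X U (U \<inter> V) (s U) = Res X V (U \<inter> V) (s V)) \<longrightarrow>
        (\<exists>!t. t \<in> carrier (Sec X (\<Union>\<U>)) \<and> (\<forall>U\<in>\<U>. Res X (\<Union>\<U>) U t = s U)))"

definition germ :: "('p, 'r) rspace \<Rightarrow> 'p \<Rightarrow> 'p set \<times> 'r \<Rightarrow> ('p set \<times> 'r) set" where
  "germ X x = (\<lambda>(U, s). {(V, t). openin (Top X) V \<and> x \<in> V \<and> t \<in> carrier (Sec X V) \<and>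
     (\<exists>W. openin (Top X) W \<and> x \<in> W \<and> W \<subseteq> U \<inter> V \<and> Res X U W s = Res X V W t)})"

definition germ_lift ::
  "('p, 'r) rspace \<Rightarrow> 'p \<Rightarrow> ('p set \<Rightarrow> 'r \<Rightarrow> 'r \<Rightarrow> 'r) \<Rightarrow>
   ('p set \<times> 'r) set \<Rightarrow> ('p set \<times> 'r) set \<Rightarrow> ('p set \<times> 'r) set" where
  "germ_lift X x opn a b = (case (SOME p. p \<in> a, SOME q. q \<in> b) of ((U, s), (V, t)) \<Rightarrow>
     germ X x (U \<inter> V, opn (U \<inter> V) (Res X U (U \<inter> V) s) (Res X V (U \<inter> V) t)))"

definition stalk :: "('p, 'r) rspace \<Rightarrow> 'p \<Rightarrow> ('p set \<times> 'r) set ring" where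
  "stalk X x =
     \<lparr>carrier = germ X x ` {(U, s). openin (Top X) U \<and> x \<in> U \<and> s \<in> carrier (Sec X U)},
      monoid.mult = germ_lift X x (\<lambda>W. monoid.mult (Sec X W)),
      monoid.one = germ X x (points X, monoid.one (global X)),
      ring.zero = germ X x (points X, ring.zero (global X)),
      ring.add = germ_lift X x (\<lambda>W. ring.add (Sec X W))\<rparr>"

definition local_ring :: "'a ring \<Rightarrow> bool" where
  "local_ring R \<longleftrightarrow> cring R \<and> (\<exists>!M. maximalideal M R)"

definition locally_ringed_space :: "('p, 'r) rspace \<Rightarrow> bool" where
  "locally_ringed_space X \<longleftrightarrow> ringed_space X \<and> (\<forall>x\<in>points X. local_ring (stalk X x))"

definition preim :: "('p, 'r) rspace \<Rightarrow> ('p \<Rightarrow> 'q) \<Rightarrow> 'q set \<Rightarrow> 'p set" where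
  "preim X f V = {x \<in> points X. f x \<in> V}"

text \<open>
  A morphism from \<open>X\<close> to \<open>Y\<close> is a continuous map \<open>f\<close> together with ring homomorphisms
  \<open>\<psi> V\<close> from \<open>Sec Y V\<close> to the sections of \<open>X\<close> over the preimage of \<open>V\<close>.
\<close>

definition rs_morphism ::
  "('p, 'r) rspace \<Rightarrow> ('q, 's) rspace \<Rightarrow> ('p \<Rightarrow> 'q) \<Rightarrow> ('q set \<Rightarrow> 's \<Rightarrow> 'r) \<Rightarrow> bool" where
  "rs_morphism X Y f \<psi> \<longleftrightarrow>
     f \<in> extensional (points X) \<and> continuous_map (Top X) (Top Y) f \<and>
     \<psi> \<in> extensional {V. openin (Top Y) V} \<and>
     (\<forall>V. openin (Top Y) V \<longrightarrow>
        \<psi> V \<in> extensional (carrier (Sec Y V)) \<and>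
        \<psi> V \<in> ring_hom (Sec Y V) (Sec X (preim X f V))) \<and>
     (\<forall>V W. openin (Top Y) V \<and> openin (Top Y) W \<and> W \<subseteq> V \<longrightarrow>
        (\<forall>s\<in>carrier (Sec Y V).
           \<psi> W (Res Y V W s) = Res X (preim X f V) (preim X f W) (\<psi> V s)))"

definition stalk_hom ::
  "('p, 'r) rspace \<Rightarrow> ('p \<Rightarrow> 'q) \<Rightarrow> ('q set \<Rightarrow> 's \<Rightarrow> 'r) \<Rightarrow> 'p \<Rightarrow>
   ('q set \<times> 's) set \<Rightarrow> ('p set \<times> 'r) set" where
  "stalk_hom X f \<psi> x a = (case SOME p. p \<in> a of (V, s) \<Rightarrow> germ X x (preim X f V, \<psi> V s))"

definition lrs_morphism ::
  "('p, 'r) rspace \<Rightarrow> ('q, 's) rspace \<Rightarrow> ('p \<Rightarrow> 'q) \<Rightarrow> ('q set \<Rightarrow> 's \<Rightarrow> 'r) \<Rightarrow> bool" where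
  "lrs_morphism X Y f \<psi> \<longleftrightarrow> rs_morphism X Y f \<psi> \<and>
     (\<forall>x\<in>points X. \<forall>a\<in>carrier (stalk Y (f x)).
        stalk_hom X f \<psi> x a \<in> Units (stalk X x) \<longrightarrow> a \<in> Units (stalk Y (f x)))"

definition rs_iso ::
  "('p, 'r) rspace \<Rightarrow> ('q, 's) rspace \<Rightarrow> ('p \<Rightarrow> 'q) \<Rightarrow> ('q set \<Rightarrow> 's \<Rightarrow> 'r) \<Rightarrow> bool" where
  "rs_iso X Y f \<psi> \<longleftrightarrow> rs_morphism X Y f \<psi> \<and> homeomorphic_map (Top X) (Top Y) f \<and>
     (\<forall>V. openin (Top Y) V \<longrightarrow> \<psi> V \<in> ring_iso (Sec Y V) (Sec X (preim X f V)))"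

definition open_sub :: "('p, 'r) rspace \<Rightarrow> 'p set \<Rightarrow> ('p, 'r) rspace" where
  "open_sub X U = X\<lparr>Top := subtopology (Top X) U\<rparr>"

definition open_immersion ::
  "('p, 'r) rspace \<Rightarrow> ('q, 's) rspace \<Rightarrow> ('p \<Rightarrow> 'q) \<Rightarrow> ('q set \<Rightarrow> 's \<Rightarrow> 'r) \<Rightarrow> bool" where
  "open_immersion X Y f \<psi> \<longleftrightarrow> rs_morphism X Y f \<psi> \<and>
     openin (Top Y) (f ` points X) \<and>
     homeomorphic_map (Top X) (subtopology (Top Y) (f ` points X)) f \<and>
     (\<forall>V. openin (Top Y) V \<and> V \<subseteq> f ` points X \<longrightarrow> \<psi> V \<in> ring_iso (Sec Y V) (Sec X (preim X f V)))"


subsection \<open>Locally ringed spaces over a base\<close>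

text \<open>
  The categories of complex spaces and of schemes below consist of the spaces whose points and
  sections lie in the arbitrary types \<open>'p\<close> and \<open>'r\<close>; in particular they are small.
\<close>

record ('p, 'r) over =
  Space :: "('p, 'r) rspace"
  StrP :: "'p \<Rightarrow> 'p"
  StrS :: "'p set \<Rightarrow> 'r \<Rightarrow> 'r"

record ('p, 'r) over_arr =
  Src :: "('p, 'r) over"
  Tgt :: "('p, 'r) over"
  MapP :: "'p \<Rightarrow> 'p"
  MapS :: "'p set \<Rightarrow> 'r \<Rightarrow> 'r"

definition over_obj :: "('p, 'r) rspace \<Rightarrow> ('p, 'r) over \<Rightarrow> bool" where
  "over_obj B X \<longleftrightarrow> locally_ringed_space (Space X) \<and> lrs_morphism (Space X) B (StrP X) (StrS X)"

definition over_morphism :: "('p, 'r) rspace \<Rightarrow> ('p, 'r) over_arr \<Rightarrow> bool" where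
  "over_morphism B h \<longleftrightarrow>
     lrs_morphism (Space (Src h)) (Space (Tgt h)) (MapP h) (MapS h) \<and>
     (\<forall>x\<in>points (Space (Src h)). StrP (Tgt h) (MapP h x) = StrP (Src h) x) \<and>
     (\<forall>V. openin (Top B) V \<longrightarrow> (\<forall>s\<in>carrier (Sec B V).
        MapS h (preim (Space (Tgt h)) (StrP (Tgt h)) V) (StrS (Tgt h) V s) = StrS (Src h) V s))"

text \<open>The full subcategory of the category of locally ringed spaces over \<open>B\<close> on the objects in \<open>Ob\<close>.\<close>

definition over_cat ::
  "('p, 'r) rspace \<Rightarrow> ('p, 'r) over set \<Rightarrow> (('p, 'r) over, ('p, 'r) over_arr) category" where
  "over_cat B Ob =
     \<lparr>Obj = Ob,
      Arr = {h. Src h \<in> Ob \<and> Tgt h \<in> Ob \<and> over_morphism B h},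
      Dom = Src,
      Cod = Tgt,
      Ide = (\<lambda>X. \<lparr>Src = X, Tgt = X, MapP = (\<lambda>x\<in>points (Space X). x),
                   MapS = (\<lambda>V\<in>{V. openin (Top (Space X)) V}. \<lambda>s\<in>carrier (Sec (Space X) V). s)\<rparr>),
      Comp = (\<lambda>g f. \<lparr>Src = Src f, Tgt = Tgt g,
                   MapP = (\<lambda>x\<in>points (Space (Src f)). MapP g (MapP f x)),
                   MapS = (\<lambda>V\<in>{V. openin (Top (Space (Tgt g))) V}.
                             \<lambda>s\<in>carrier (Sec (Space (Tgt g)) V).
                               MapS f (preim (Space (Tgt f)) (MapP g) V) (MapS g V s))\<rparr>)\<rparr>"


section \<open>The complex case\<close>

definition complex_ring :: "complex ring" where
  "complex_ring = \<lparr>carrier = UNIV, monoid.mult = (*), monoid.one = 1, ring.zero = 0, ring.add = (+)\<rparr>"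

text \<open>
  Complex spaces are treated as locally ringed spaces over the one-point space \<open>B\<close> with ring
  of sections \<open>\<complex>\<close>, identified by \<open>\<phi>\<close>; a morphism to \<open>B\<close> is the same
  as a \<open>\<complex>\<close>-algebra structure on the structure sheaf.
\<close>

definition complex_point :: "('p, 'r) rspace \<Rightarrow> (complex \<Rightarrow> 'r) \<Rightarrow> bool" where
  "complex_point B \<phi> \<longleftrightarrow> locally_ringed_space B \<and> (\<exists>b. points B = {b}) \<and>
     \<phi> \<in> ring_iso complex_ring (global B)"

definition const_section :: "('p, 'r) rspace \<Rightarrow> (complex \<Rightarrow> 'r) \<Rightarrow> ('p, 'r) over \<Rightarrow> complex \<Rightarrow> 'r" where
  "const_section B \<phi> X c = StrS X (points B) (\<phi> c)"

definition Cn :: "nat \<Rightarrow> (nat \<Rightarrow> complex) topology" where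
  "Cn n = subtopology euclidean {z. \<forall>i\<ge>n. z i = 0}"

text \<open>Complex differentiability at all points of the open subset \<open>D\<close> of \<open>Cn n\<close>.\<close>

definition holomorphic_n :: "nat \<Rightarrow> (nat \<Rightarrow> complex) set \<Rightarrow> ((nat \<Rightarrow> complex) \<Rightarrow> complex) \<Rightarrow> bool" where
  "holomorphic_n n D g \<longleftrightarrow> (\<forall>z\<in>D. \<exists>c :: nat \<Rightarrow> complex. \<forall>\<epsilon>>0. \<exists>\<delta>>0. \<forall>w\<in>D.
     (\<Sum>i<n. norm (w i - z i)) < \<delta> \<longrightarrow>
     norm (g w - g z - (\<Sum>i<n. c i * (w i - z i))) \<le> \<epsilon> * (\<Sum>i<n. norm (w i - z i)))"

definition zero_locus ::
  "(nat \<Rightarrow> complex) set \<Rightarrow> ((nat \<Rightarrow> complex) \<Rightarrow> complex) list \<Rightarrow> (nat \<Rightarrow> complex) set" where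
  "zero_locus D fs = {z \<in> D. \<forall>f\<in>set fs. f z = 0}"

type_synonym hol_germ = "((nat \<Rightarrow> complex) set \<times> ((nat \<Rightarrow> complex) \<Rightarrow> complex)) set"

text \<open>
  The local model: the zero locus in the open set \<open>D\<close> of the holomorphic functions \<open>fs\<close>,
  with the (possibly nonreduced) sheaf of holomorphic functions on \<open>D\<close> modulo the ideal
  generated by \<open>fs\<close>. \<open>model_germ\<close> is an element of the stalk of this quotient at \<open>z\<close>;
  sections are the functions into the stalks that are locally induced by holomorphic functions.
\<close>

definition model_germ ::
  "nat \<Rightarrow> (nat \<Rightarrow> complex) set \<Rightarrow> ((nat \<Rightarrow> complex) \<Rightarrow> complex) list \<Rightarrow> (nat \<Rightarrow> complex) \<Rightarrow>
   (nat \<Rightarrow> complex) set \<times> ((nat \<Rightarrow> complex) \<Rightarrow> complex) \<Rightarrow> hol_germ" where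
  "model_germ n D fs z = (\<lambda>(N, g). {(N', g').
     openin (Cn n) N' \<and> N' \<subseteq> D \<and> z \<in> N' \<and> holomorphic_n n N' g' \<and>
     (\<exists>M h. openin (Cn n) M \<and> z \<in> M \<and> M \<subseteq> N \<inter> N' \<and>
        (\<forall>j<length fs. holomorphic_n n M (h j)) \<and>
        (\<forall>w\<in>M. g w - g' w = (\<Sum>j<length fs. h j w * (fs ! j) w)))})"

definition model_germ_lift ::
  "nat \<Rightarrow> (nat \<Rightarrow> complex) set \<Rightarrow> ((nat \<Rightarrow> complex) \<Rightarrow> complex) list \<Rightarrow> (nat \<Rightarrow> complex) \<Rightarrow>
   (complex \<Rightarrow> complex \<Rightarrow> complex) \<Rightarrow> hol_germ \<Rightarrow> hol_germ \<Rightarrow> hol_germ" where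
  "model_germ_lift n D fs z opn a b = (case (SOME p. p \<in> a, SOME q. q \<in> b) of ((N, g), (N', g')) \<Rightarrow>
     model_germ n D fs z (N \<inter> N', \<lambda>w. opn (g w) (g' w)))"

definition model_const ::
  "nat \<Rightarrow> (nat \<Rightarrow> complex) set \<Rightarrow> ((nat \<Rightarrow> complex) \<Rightarrow> complex) list \<Rightarrow> (nat \<Rightarrow> complex) set \<Rightarrow>
   complex \<Rightarrow> (nat \<Rightarrow> complex) \<Rightarrow> hol_germ" where
  "model_const n D fs W c = (\<lambda>z\<in>W. model_germ n D fs z (D, \<lambda>w. c))"

definition complex_model ::
  "nat \<Rightarrow> (nat \<Rightarrow> complex) set \<Rightarrow> ((nat \<Rightarrow> complex) \<Rightarrow> complex) list \<Rightarrow>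
   (nat \<Rightarrow> complex, (nat \<Rightarrow> complex) \<Rightarrow> hol_germ) rspace" where
  "complex_model n D fs =
     \<lparr>Top = subtopology (Cn n) (zero_locus D fs),
      Sec = (\<lambda>W.
        \<lparr>carrier = {s \<in> extensional W. \<forall>z\<in>W. \<exists>N g.
           openin (Cn n) N \<and> N \<subseteq> D \<and> z \<in> N \<and> holomorphic_n n N g \<and>
           (\<forall>w\<in>N \<inter> W. s w = model_germ n D fs w (N, g))},
         monoid.mult = (\<lambda>s t. \<lambda>z\<in>W. model_germ_lift n D fs z (*) (s z) (t z)),
         monoid.one = model_const n D fs W 1,
         ring.zero = model_const n D fs W 0,
         ring.add = (\<lambda>s t. \<lambda>z\<in>W. model_germ_lift n D fs z (+) (s z) (t z))\<rparr>),
      Res = (\<lambda>U V s. restrict s V)\<rparr>"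

definition complex_chart ::
  "('p, 'r) rspace \<Rightarrow> (complex \<Rightarrow> 'r) \<Rightarrow> ('p, 'r) over \<Rightarrow> 'p set \<Rightarrow>
   nat \<Rightarrow> (nat \<Rightarrow> complex) set \<Rightarrow> ((nat \<Rightarrow> complex) \<Rightarrow> complex) list \<Rightarrow> bool" where
  "complex_chart B \<phi> X U n D fs \<longleftrightarrow>
     openin (Top (Space X)) U \<and> openin (Cn n) D \<and> (\<forall>g\<in>set fs. holomorphic_n n D g) \<and>
     (\<exists>f \<psi>. rs_iso (open_sub (Space X) U) (complex_model n D fs) f \<psi> \<and>
        (\<forall>c. \<psi> (zero_locus D fs) (model_const n D fs (zero_locus D fs) c) =
             Res (Space X) (points (Space X)) U (const_section B \<phi> X c)))"

definition complex_space :: "('p, 'r) rspace \<Rightarrow> (complex \<Rightarrow> 'r) \<Rightarrow> ('p, 'r) over \<Rightarrow> bool" where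
  "complex_space B \<phi> X \<longleftrightarrow> over_obj B X \<and> Hausdorff_space (Top (Space X)) \<and>
     (\<forall>x\<in>points (Space X). \<exists>U n D fs. x \<in> U \<and> complex_chart B \<phi> X U n D fs)"

definition complex_cat ::
  "('p, 'r) rspace \<Rightarrow> (complex \<Rightarrow> 'r) \<Rightarrow> (('p, 'r) over, ('p, 'r) over_arr) category" where
  "complex_cat B \<phi> = over_cat B {X. complex_space B \<phi> X}"

definition strong_topology ::
  "(('p, 'r) over, ('p, 'r) over_arr) category \<Rightarrow> ('p, 'r) over \<Rightarrow> ('p, 'r) over_arr set set" where
  "strong_topology C X = {R. sieve C X R \<and>
     (\<forall>x\<in>points (Space X). \<exists>h\<in>R. x \<in> MapP h ` points (Space (Src h)) \<and>
        open_immersion (Space (Src h)) (Space X) (MapP h) (MapS h))}"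

definition complex_line :: "('p, 'r) rspace \<Rightarrow> (complex \<Rightarrow> 'r) \<Rightarrow> ('p, 'r) over \<Rightarrow> bool" where
  "complex_line B \<phi> A \<longleftrightarrow> complex_space B \<phi> A \<and>
     complex_chart B \<phi> A (points (Space A)) 1 (topspace (Cn 1)) []"


section \<open>The algebraic case\<close>

definition fraction :: "'a ring \<Rightarrow> 'a set \<Rightarrow> 'a \<times> 'a \<Rightarrow> ('a \<times> 'a) set" where
  "fraction R P = (\<lambda>(a, b). {(c, d). c \<in> carrier R \<and> d \<in> carrier R - P \<and>
     (\<exists>u\<in>carrier R - P. u \<otimes>\<^bsub>R\<^esub> (a \<otimes>\<^bsub>R\<^esub> d) = u \<otimes>\<^bsub>R\<^esub> (b \<otimes>\<^bsub>R\<^esub> c))})"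

definition fraction_mult ::
  "'a ring \<Rightarrow> 'a set \<Rightarrow> ('a \<times> 'a) set \<Rightarrow> ('a \<times> 'a) set \<Rightarrow> ('a \<times> 'a) set" where
  "fraction_mult R P x y = (case (SOME p. p \<in> x, SOME q. q \<in> y) of ((a, b), (c, d)) \<Rightarrow>
     fraction R P (a \<otimes>\<^bsub>R\<^esub> c, b \<otimes>\<^bsub>R\<^esub> d))"

definition fraction_add ::
  "'a ring \<Rightarrow> 'a set \<Rightarrow> ('a \<times> 'a) set \<Rightarrow> ('a \<times> 'a) set \<Rightarrow> ('a \<times> 'a) set" where
  "fraction_add R P x y = (case (SOME p. p \<in> x, SOME q. q \<in> y) of ((a, b), (c, d)) \<Rightarrow>
     fraction R P (a \<otimes>\<^bsub>R\<^esub> d \<oplus>\<^bsub>R\<^esub> c \<otimes>\<^bsub>R\<^esub> b, b \<otimes>\<^bsub>R\<^esub> d))"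

definition zariski :: "'a ring \<Rightarrow> 'a set topology" where
  "zariski R = topology (\<lambda>U. \<exists>S\<subseteq>carrier R. U = {P. primeideal P R \<and> \<not> S \<subseteq> P})"

definition Spec :: "'a ring \<Rightarrow> ('a set, 'a set \<Rightarrow> ('a \<times> 'a) set) rspace" where
  "Spec R =
     \<lparr>Top = zariski R,
      Sec = (\<lambda>U.
        \<lparr>carrier = {s \<in> extensional U. \<forall>P\<in>U. \<exists>V a b.
           openin (zariski R) V \<and> P \<in> V \<and> V \<subseteq> U \<and> a \<in> carrier R \<and> b \<in> carrier R \<and>
           (\<forall>Q\<in>V. b \<notin> Q \<and> s Q = fraction R Q (a, b))},
         monoid.mult = (\<lambda>s t. \<lambda>P\<in>U. fraction_mult R P (s P) (t P)),
         monoid.one = (\<lambda>P\<in>U. fraction R P (\<one>\<^bsub>R\<^esub>, \<one>\<^bsub>R\<^esub>)),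
         ring.zero = (\<lambda>P\<in>U. fraction R P (\<zero>\<^bsub>R\<^esub>, \<one>\<^bsub>R\<^esub>)),
         ring.add = (\<lambda>s t. \<lambda>P\<in>U. fraction_add R P (s P) (t P))\<rparr>),
      Res = (\<lambda>U V s. restrict s V)\<rparr>"

definition affine_open :: "('p, 'r) rspace \<Rightarrow> 'p set \<Rightarrow> bool" where
  "affine_open X U \<longleftrightarrow> openin (Top X) U \<and>
     (\<exists>R :: 'r ring. cring R \<and> (\<exists>f \<psi>. rs_iso (open_sub X U) (Spec R) f \<psi>))"

definition scheme :: "('p, 'r) rspace \<Rightarrow> bool" where
  "scheme X \<longleftrightarrow> locally_ringed_space X \<and> (\<forall>x\<in>points X. \<exists>U. affine_open X U \<and> x \<in> U)"

definition noetherian_scheme :: "('p, 'r) rspace \<Rightarrow> bool" where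
  "noetherian_scheme X \<longleftrightarrow> scheme X \<and> compact_space (Top X) \<and>
     (\<forall>x\<in>points X. \<exists>U. affine_open X U \<and> x \<in> U \<and> noetherian_ring (Sec X U))"

definition irreducible_closed :: "'p topology \<Rightarrow> 'p set \<Rightarrow> bool" where
  "irreducible_closed T Z \<longleftrightarrow> closedin T Z \<and> Z \<noteq> {} \<and>
     (\<forall>Z1 Z2. closedin T Z1 \<and> closedin T Z2 \<and> Z = Z1 \<union> Z2 \<longrightarrow> Z = Z1 \<or> Z = Z2)"

definition finite_krull_dim :: "'p topology \<Rightarrow> bool" where
  "finite_krull_dim T \<longleftrightarrow> (\<exists>d. \<forall>k (Z :: nat \<Rightarrow> 'p set).
     (\<forall>i\<le>k. irreducible_closed T (Z i)) \<and> (\<forall>i<k. Z i \<subset> Z (Suc i)) \<longrightarrow> k \<le> d)"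

definition finite_type_hom :: "'a ring \<Rightarrow> 'b ring \<Rightarrow> ('a \<Rightarrow> 'b) \<Rightarrow> bool" where
  "finite_type_hom R S h \<longleftrightarrow>
     (\<exists>G\<subseteq>carrier S. finite G \<and> carrier S = generate_ring S (h ` carrier R \<union> G))"

definition finite_type :: "('p, 'r) rspace \<Rightarrow> ('p, 'r) over \<Rightarrow> bool" where
  "finite_type B X \<longleftrightarrow> (\<forall>b\<in>points B. \<exists>V. affine_open B V \<and> b \<in> V \<and>
     (\<exists>\<U>. finite \<U> \<and> preim (Space X) (StrP X) V = \<Union>\<U> \<and>
        (\<forall>U\<in>\<U>. affine_open (Space X) U \<and>
           finite_type_hom (Sec B V) (Sec (Space X) U)
             (\<lambda>s. Res (Space X) (preim (Space X) (StrP X) V) U (StrS X V s)))))"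

definition algebraic_cat ::
  "('p, 'r) rspace \<Rightarrow> (('p, 'r) over, ('p, 'r) over_arr) category" where
  "algebraic_cat B = over_cat B {X. over_obj B X \<and> scheme (Space X) \<and> finite_type B X}"

text \<open>
  The tensor product of a submodule \<open>H\<close> of \<open>N\<close> with a module \<open>M\<close> over \<open>R\<close>: formal sums
  of pairs modulo the bilinearity relations.
\<close>

inductive tensor_eq ::
  "'a ring \<Rightarrow> ('a, 'n) module \<Rightarrow> 'n set \<Rightarrow> ('a, 'b) module \<Rightarrow> ('n \<times> 'b) list \<Rightarrow> ('n \<times> 'b) list \<Rightarrow> bool"
  for R N H M where
  "set xs \<subseteq> H \<times> carrier M \<Longrightarrow> tensor_eq R N H M xs xs"
| "tensor_eq R N H M xs ys \<Longrightarrow> tensor_eq R N H M ys xs"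
| "tensor_eq R N H M xs ys \<Longrightarrow> tensor_eq R N H M ys zs \<Longrightarrow> tensor_eq R N H M xs zs"
| "tensor_eq R N H M xs xs' \<Longrightarrow> tensor_eq R N H M ys ys' \<Longrightarrow> tensor_eq R N H M (xs @ ys) (xs' @ ys')"
| "set (xs @ ys) \<subseteq> H \<times> carrier M \<Longrightarrow> tensor_eq R N H M (xs @ ys) (ys @ xs)"
| "x \<in> H \<Longrightarrow> x' \<in> H \<Longrightarrow> y \<in> carrier M \<Longrightarrow> tensor_eq R N H M [(x \<oplus>\<^bsub>N\<^esub> x', y)] [(x, y), (x', y)]"
| "x \<in> H \<Longrightarrow> y \<in> carrier M \<Longrightarrow> y' \<in> carrier M \<Longrightarrow>
     tensor_eq R N H M [(x, y \<oplus>\<^bsub>M\<^esub> y')] [(x, y), (x, y')]"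
| "r \<in> carrier R \<Longrightarrow> x \<in> H \<Longrightarrow> y \<in> carrier M \<Longrightarrow>
     tensor_eq R N H M [(r \<odot>\<^bsub>N\<^esub> x, y)] [(x, r \<odot>\<^bsub>M\<^esub> y)]"
| "y \<in> carrier M \<Longrightarrow> tensor_eq R N H M [(\<zero>\<^bsub>N\<^esub>, y)] []"

text \<open>
  Tensoring with \<open>M\<close> preserves injectivity. It suffices to test on finitely generated modules
  \<open>N\<close>, and these have isomorphic copies on the type \<open>nat \<Rightarrow> 'a\<close>.
\<close>

definition flat_module :: "'a ring \<Rightarrow> ('a, 'b) module \<Rightarrow> bool" where
  "flat_module R M \<longleftrightarrow> (\<forall>(N :: ('a, nat \<Rightarrow> 'a) module) H. module R N \<and> submodule H R N \<longrightarrow>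
     (\<forall>xs ys. set xs \<subseteq> H \<times> carrier M \<and> set ys \<subseteq> H \<times> carrier M \<and>
        tensor_eq R N (carrier N) M xs ys \<longrightarrow> tensor_eq R N H M xs ys))"

definition flat_hom :: "'a ring \<Rightarrow> 'b ring \<Rightarrow> ('a \<Rightarrow> 'b) \<Rightarrow> bool" where
  "flat_hom R S h \<longleftrightarrow> flat_module R
     \<lparr>carrier = carrier S, monoid.mult = monoid.mult S, monoid.one = monoid.one S,
      ring.zero = ring.zero S, ring.add = ring.add S,
      smult = (\<lambda>r x. h r \<otimes>\<^bsub>S\<^esub> x)\<rparr>"

definition flat_morphism :: "('p, 'r) over_arr \<Rightarrow> bool" where
  "flat_morphism h \<longleftrightarrow> (\<forall>x\<in>points (Space (Src h)).
     flat_hom (stalk (Space (Tgt h)) (MapP h x)) (stalk (Space (Src h)) x)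
       (stalk_hom (Space (Src h)) (MapP h) (MapS h) x))"

text \<open>
  The quasi-compact flat topology: a family of flat morphisms is a covering if every affine open
  of the target is the union of the images of finitely many affine opens of the sources.
\<close>

definition qc_flat_covering :: "('p, 'r) over \<Rightarrow> ('p, 'r) over_arr set \<Rightarrow> bool" where
  "qc_flat_covering X K \<longleftrightarrow> (\<forall>h\<in>K. Tgt h = X \<and> flat_morphism h) \<and>
     (\<forall>V. affine_open (Space X) V \<longrightarrow>
        (\<exists>P. finite P \<and> (\<forall>(h, W)\<in>P. h \<in> K \<and> affine_open (Space (Src h)) W) \<and>
           V = (\<Union>(h, W)\<in>P. MapP h ` W)))"

definition qc_flat_topology ::
  "(('p, 'r) over, ('p, 'r) over_arr) category \<Rightarrow> ('p, 'r) over \<Rightarrow> ('p, 'r) over_arr set set" where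
  "qc_flat_topology C X = {R. sieve C X R \<and> (\<exists>K\<subseteq>R. qc_flat_covering X K)}"

text \<open>
  The relative spectrum of the polynomial algebra in one variable over the structure sheaf
  of \<open>B\<close>; \<open>t\<close> is the coordinate.
\<close>

definition affine_line :: "('p, 'r) rspace \<Rightarrow> ('p, 'r) over \<Rightarrow> bool" where
  "affine_line B A \<longleftrightarrow> A \<in> Obj (algebraic_cat B) \<and>
     (\<exists>t\<in>carrier (global (Space A)). \<forall>V. affine_open B V \<longrightarrow>
        (let W = preim (Space A) (StrP A) V in
           affine_open (Space A) W \<and>
           eval (Sec B V) (Sec (Space A) W) (StrS A V) (Res (Space A) (points (Space A)) W t)
             \<in> ring_iso (UP (Sec B V)) (Sec (Space A) W)))"


section \<open>The two kinds of sites\<close>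

definition complex_site ::
  "(('p, 'r) over, ('p, 'r) over_arr) category \<Rightarrow> (('p, 'r) over \<Rightarrow> ('p, 'r) over_arr set set) \<Rightarrow>
   ('p, 'r) over \<Rightarrow> bool" where
  "complex_site S T A \<longleftrightarrow> (\<exists>B \<phi>. complex_point B \<phi> \<and>
     S = complex_cat B \<phi> \<and> T = strong_topology S \<and> complex_line B \<phi> A)"

text \<open>
  Defining weak equivalences through stalks presupposes that the site has enough points. This is
  automatic in the complex case, but not for an arbitrary topology in the algebraic case.
\<close>

definition algebraic_site ::
  "(('p, 'r) over, ('p, 'r) over_arr) category \<Rightarrow> (('p, 'r) over \<Rightarrow> ('p, 'r) over_arr set set) \<Rightarrow>
   ('p, 'r) over \<Rightarrow> 'v itself \<Rightarrow> bool" where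
  "algebraic_site S T A v \<longleftrightarrow> (\<exists>B. noetherian_scheme B \<and> finite_krull_dim (Top B) \<and>
     S = algebraic_cat B \<and> grothendieck_topology S T \<and>
     (\<forall>X\<in>Obj S. T X \<subseteq> qc_flat_topology S X) \<and> affine_line B A \<and> enough_points S T v)"

end

theory Submission
  imports Defs "HOL-Analysis.Abstract_Topological_Spaces"
begin

text \<open>
  Maps from a simplicial sheaf \<open>Y\<close> to a constant one \<open>X\<close> are the maps \<open>Y\<^sub>0 \<rightarrow> X\<close> which identify the
  two ends of every edge, so on stalks they are functions on path components. A simplicial weak
  equivalence \<open>Y \<rightarrow> Y'\<close> induces bijections on the path components of the stalks, and since there are
  enough points, composition with it is a bijection from \<open>Hom(Y', X)\<close> to \<open>Hom(Y, X)\<close>: two maps on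
  \<open>Y'\<close> agreeing on \<open>Y\<close> have an equalizer with full stalks, and a map on \<open>Y\<close> extends because the
  pairs in \<open>Y'\<^sub>0 \<times> X\<close> whose germs are joined through \<open>Y\<close> form the graph of a map on \<open>Y'\<^sub>0\<close>. Hence
  every zigzag into \<open>X\<close> has a unique value in \<open>Hom(Y, X)\<close>, that is, morphisms to \<open>X\<close> in the
  simplicial homotopy category are morphisms of simplicial sheaves. If \<open>X\<close> is hyperbolic, the same
  argument applies to the localization at the affine weak equivalences. Hyperbolicity of \<open>X\<close> now
  says that \<open>Hom(Y, X) \<rightarrow> Hom(Y \<times> A, X)\<close> is bijective for all \<open>Y\<close>, which by the Yoneda lemma may be
  tested on represented sheaves.

  The site of complex spaces has enough points because the germs at a point \<open>x\<close> of arrows from a space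
  \<open>M\<close> define a fibre functor; this uses that open subspaces of complex spaces are complex spaces.
\<close>

section \<open>Categories and localizations\<close>

text \<open>Morphisms in the two localizations are never described in general, only those to a
  target for which composition with every inverted arrow is bijective on arrows; a zigzag ending
  there has a value. The delicate step is the extension of a map from \<open>Y\<close> to
  \<open>Y'\<close>. A germ of \<open>Y'\<close> is joined to one of \<open>Y\<close> in each stalk
  separately, without any uniform choice, so the extension cannot be written down on sections. The
  graph avoids this: it is a subsheaf cut out by a condition at all points at once, the continuity
  of points makes the condition local, and enough points make its projection an isomorphism. Points
  take values in the same type as the sheaves, so in the complex case germs of arrows must be coded
  as sets of pairs of arrows inside \<open>Rel\<close>; this is the origin of
  \<open>nb_point\<close>. Sections of represented sheaves are arrows given locally up to local
  equality, and the Yoneda lemma has to be proved in this form. Enough points are part of the notion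
  of algebraic site; for complex spaces they must be constructed, and the base change of open
  immersions which this requires is the source of the part on locally ringed spaces and local
  models.\<close>

locale cat =
  fixes C :: "('o, 'm) category"
  assumes dom_obj [simp]: "f \<in> Arr C \<Longrightarrow> Dom C f \<in> Obj C"
    and cod_obj [simp]: "f \<in> Arr C \<Longrightarrow> Cod C f \<in> Obj C"
    and arr_ide [simp]: "a \<in> Obj C \<Longrightarrow> Ide C a \<in> Arr C"
    and dom_ide [simp]: "a \<in> Obj C \<Longrightarrow> Dom C (Ide C a) = a"
    and cod_ide [simp]: "a \<in> Obj C \<Longrightarrow> Cod C (Ide C a) = a"
    and arr_comp [simp]: "f \<in> Arr C \<Longrightarrow> g \<in> Arr C \<Longrightarrow> Cod C f = Dom C g \<Longrightarrow> Comp C g f \<in> Arr C"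
    and dom_comp [simp]:
      "f \<in> Arr C \<Longrightarrow> g \<in> Arr C \<Longrightarrow> Cod C f = Dom C g \<Longrightarrow> Dom C (Comp C g f) = Dom C f"
    and cod_comp [simp]:
      "f \<in> Arr C \<Longrightarrow> g \<in> Arr C \<Longrightarrow> Cod C f = Dom C g \<Longrightarrow> Cod C (Comp C g f) = Cod C g"
    and comp_ide_right [simp]: "f \<in> Arr C \<Longrightarrow> Dom C f = a \<Longrightarrow> Comp C f (Ide C a) = f"
    and comp_ide_left [simp]: "f \<in> Arr C \<Longrightarrow> Cod C f = a \<Longrightarrow> Comp C (Ide C a) f = f"
    and comp_assoc:
      "f \<in> Arr C \<Longrightarrow> g \<in> Arr C \<Longrightarrow> h \<in> Arr C \<Longrightarrow> Cod C f = Dom C g \<Longrightarrow> Cod C g = Dom C h \<Longrightarrow>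
         Comp C (Comp C h g) f = Comp C h (Comp C g f)"

text \<open>Arrows to \<open>z\<close> are contravariant in their source, so a zigzag ending at
  \<open>z\<close> is evaluated from its end: a forward letter is a precomposition, a backward
  letter is the unique extension along \<open>w\<close>. The description by \<open>THE\<close> has a
  meaning only when composition with \<open>w\<close> is bijective.\<close>

fun zig_eval :: "('o, 'm) category \<Rightarrow> 'o \<Rightarrow> 'm zig list \<Rightarrow> 'm" where
  "zig_eval C z [] = Ide C z"
| "zig_eval C z (Fwd f # ps) = Comp C (zig_eval C z ps) f"
| "zig_eval C z (Bwd w # ps) =
     (THE g. g \<in> hom_set C (Cod C w) z \<and> Comp C g w = zig_eval C z ps)"

definition loc_class :: "('o, 'm) category \<Rightarrow> 'm set \<Rightarrow> 'o \<Rightarrow> 'o \<Rightarrow> 'm \<Rightarrow> 'm zig list set" where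
  "loc_class C W a b f = {qs. zig_eq C W a b [Fwd f] qs}"

text \<open>Evaluation starts at the end of the list, so a rewriting in the middle only has to
  preserve the value of the tail.\<close>

lemma zig_eval_append_cong:
  "zig_eval C z qs = zig_eval C z rs \<Longrightarrow> zig_eval C z (ps @ qs) = zig_eval C z (ps @ rs)"
proof (induction ps)
  case (Cons p ps)
  then show ?case by (cases p) auto
qed simp

text \<open>\<open>zig_step\<close> does not mention end points; this recovers the start of the tail
  on which a rewriting acts.\<close>

lemma zigzag_appendD: "zigzag C W a (ps @ qs) b \<Longrightarrow> \<exists>c. zigzag C W c qs b"
proof (induction ps arbitrary: a)
  case (Cons p ps)
  then show ?case by (cases p) (auto elim: zigzag.cases)
qed auto

lemma zig_eq_zigzag: "zig_eq C W a b ps qs \<Longrightarrow> zigzag C W a ps b \<and> zigzag C W a qs b"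
  by (induction rule: zig_eq.induct) auto

lemma zig_step_Cons: "zig_step C W ps qs \<Longrightarrow> zig_step C W (p # ps) (p # qs)"
proof (induction rule: zig_step.induct)
  case (1 a ps qs)
  then show ?case using zig_step.intros(1)[of a C W "p # ps" qs] by simp
next
  case (2 f g ps qs)
  then show ?case using zig_step.intros(2)[of f C g W "p # ps" qs] by simp
next
  case (3 w ps qs)
  then show ?case using zig_step.intros(3)[of w W C "p # ps" qs] by simp
next
  case (4 w ps qs)
  then show ?case using zig_step.intros(4)[of w W C "p # ps" qs] by simp
qed

text \<open>The premise on \<open>p\<close> is abstract so that it covers a forward and a backward
  letter alike.\<close>

lemma zig_eq_Cons:
  assumes "zig_eq C W a b ps qs"
    and p: "\<And>ps. zigzag C W a ps b \<Longrightarrow> zigzag C W a' (p # ps) b"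
  shows "zig_eq C W a' b (p # ps) (p # qs)"
  using assms(1)
proof (induction rule: zig_eq.induct)
  case (1 ps)
  then show ?case by (simp add: p zig_eq.intros(1))
next
  case (2 ps qs)
  then show ?case by (simp add: p zig_eq.intros(2) zig_step_Cons)
next
  case (3 ps qs)
  show ?case using 3(2) by (rule zig_eq.intros(3))
next
  case (4 ps qs rs)
  show ?case using 4(3,4) by (rule zig_eq.intros(4))
qed

text \<open>The usual notion of a \<open>W\<close>-local object. It is instantiated twice with the
  same target, for the simplicial and for the affine weak equivalences.\<close>

locale local_object = cat C for C :: "('o, 'm) category" +
  fixes W :: "'m set" and z :: 'o
  assumes z: "z \<in> Obj C"
    and local: "w \<in> W \<Longrightarrow> w \<in> Arr C \<Longrightarrow>
      bij_betw (\<lambda>g. Comp C g w) (hom_set C (Cod C w) z) (hom_set C (Dom C w) z)"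
begin

lemma zig_eval_Bwd:
  assumes "w \<in> W" "w \<in> Arr C" "zig_eval C z ps \<in> hom_set C (Dom C w) z"
  shows "zig_eval C z (Bwd w # ps) \<in> hom_set C (Cod C w) z \<and>
    Comp C (zig_eval C z (Bwd w # ps)) w = zig_eval C z ps"
proof -
  have "\<exists>!g. g \<in> hom_set C (Cod C w) z \<and> Comp C g w = zig_eval C z ps"
    using local[OF assms(1,2)] assms(3) unfolding bij_betw_def inj_on_def
    by (smt (verit) image_iff)
  then show ?thesis
    unfolding zig_eval.simps by (rule theI')
qed

lemma zig_eval_hom: "zigzag C W a ps z \<Longrightarrow> zig_eval C z ps \<in> hom_set C a z"
proof (induction ps arbitrary: a)
  case Nil
  then have "a = z" by (auto elim: zigzag.cases)
  then show ?case using z by (simp add: hom_set_def)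
next
  case (Cons p ps)
  show ?case
  proof (cases p)
    case (Fwd f)
    with Cons.prems have "f \<in> Arr C" "a = Dom C f" "zigzag C W (Cod C f) ps z"
      by (auto elim: zigzag.cases)
    then show ?thesis using Cons.IH[of "Cod C f"] Fwd by (auto simp: hom_set_def)
  next
    case (Bwd w)
    with Cons.prems have "w \<in> Arr C" "w \<in> W" "a = Cod C w" "zigzag C W (Dom C w) ps z"
      by (auto elim: zigzag.cases)
    then show ?thesis using Cons.IH[of "Dom C w"] Bwd zig_eval_Bwd by auto
  qed
qed

lemma zigzag_FwdD: "zigzag C W a (Fwd f # ps) b \<Longrightarrow> a = Dom C f \<and> f \<in> Arr C \<and> zigzag C W (Cod C f) ps b"
  by (auto elim: zigzag.cases)

lemma zigzag_BwdD:
  "zigzag C W a (Bwd f # ps) b \<Longrightarrow> a = Cod C f \<and> f \<in> W \<and> f \<in> Arr C \<and> zigzag C W (Dom C f) ps b"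
  by (auto elim: zigzag.cases)

text \<open>The four relations correspond to the unit law, to associativity and to the two halves of
  locality: cancelling \<open>w\<close> followed by its inverse is the defining equation of the
  extension, cancelling in the other order is its uniqueness.\<close>

lemma zig_eval_step:
  assumes "zig_step C W ps qs" "zigzag C W a ps z" "zigzag C W a qs z"
  shows "zig_eval C z ps = zig_eval C z qs"
  using assms
proof (induction rule: zig_step.induct)
  case (1 b ps qs)
  obtain c where "zigzag C W c ([Fwd (Ide C b)] @ qs) z" using 1(2) zigzag_appendD by metis
  then have "zigzag C W b qs z" using zigzag_FwdD 1(1) by fastforce
  then have "zig_eval C z ([Fwd (Ide C b)] @ qs) = zig_eval C z qs"
    using zig_eval_hom[of b qs] by (auto simp: hom_set_def)
  then show ?case by (rule zig_eval_append_cong)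
next
  case (2 f g ps qs)
  obtain c where "zigzag C W c ([Fwd f, Fwd g] @ qs) z" using 2(4) zigzag_appendD by metis
  then have "zigzag C W (Cod C g) qs z" using zigzag_FwdD[of c f "Fwd g # qs" z] zigzag_FwdD[of "Cod C f" g qs z] by simp
  then have "zig_eval C z ([Fwd f, Fwd g] @ qs) = zig_eval C z ([Fwd (Comp C g f)] @ qs)"
    using zig_eval_hom[of "Cod C g" qs] 2(1,2,3) by (auto simp: hom_set_def comp_assoc)
  then show ?case by (rule zig_eval_append_cong)
next
  case (3 w ps qs)
  obtain c where "zigzag C W c ([Fwd w, Bwd w] @ qs) z" using 3(2) zigzag_appendD by metis
  then have w: "zigzag C W (Dom C w) qs z" "w \<in> Arr C" using zigzag_FwdD zigzag_BwdD by fastforce+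
  have "zig_eval C z ([Fwd w, Bwd w] @ qs) = zig_eval C z qs"
    using zig_eval_Bwd[OF 3(1) w(2) zig_eval_hom[OF w(1)]] by simp
  then have "zig_eval C z (ps @ ([Fwd w, Bwd w] @ qs)) = zig_eval C z (ps @ qs)"
    by (rule zig_eval_append_cong)
  then show ?case by simp
next
  case (4 w ps qs)
  obtain c where "zigzag C W c ([Bwd w, Fwd w] @ qs) z" using 4(2) zigzag_appendD by metis
  then have w: "zigzag C W (Cod C w) qs z" "w \<in> Arr C" "zigzag C W (Dom C w) (Fwd w # qs) z"
    using zigzag_FwdD zigzag_BwdD by fastforce+
  have "Comp C (zig_eval C z ([Bwd w, Fwd w] @ qs)) w = Comp C (zig_eval C z qs) w"
    "zig_eval C z ([Bwd w, Fwd w] @ qs) \<in> hom_set C (Cod C w) z"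
    using zig_eval_Bwd[OF 4(1) w(2) zig_eval_hom[OF w(3)]] by simp_all
  then have "zig_eval C z ([Bwd w, Fwd w] @ qs) = zig_eval C z qs"
    using local[OF 4(1) w(2)] zig_eval_hom[OF w(1)] unfolding bij_betw_def inj_on_def by blast
  then have "zig_eval C z (ps @ ([Bwd w, Fwd w] @ qs)) = zig_eval C z (ps @ qs)"
    by (rule zig_eval_append_cong)
  then show ?case by simp
qed

lemma zig_eval_eq: "zig_eq C W a z ps qs \<Longrightarrow> zig_eval C z ps = zig_eval C z qs"
  by (induction rule: zig_eq.induct) (auto intro: zig_eval_step)

lemma zigzag_Fwd: "f \<in> hom_set C a z \<Longrightarrow> zigzag C W a [Fwd f] z"
  using zz_fwd[of f C W "[]" z] zz_nil[OF z] by (auto simp: hom_set_def)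

text \<open>Induction from the end. Behind a backward letter the value of the tail factors as
  \<open>g\<close> after \<open>w\<close>; then the letters \<open>Bwd w\<close> and
  \<open>Fwd w\<close> meet and cancel.\<close>

lemma zig_eq_eval: "zigzag C W a ps z \<Longrightarrow> zig_eq C W a z ps [Fwd (zig_eval C z ps)]"
proof (induction ps arbitrary: a)
  case Nil
  then have "a = z" by (auto elim: zigzag.cases)
  moreover have "zig_step C W [Fwd (Ide C z)] []"
    using zig_step.intros(1)[OF z, of W "[]" "[]"] by simp
  moreover have "zigzag C W z [Fwd (Ide C z)] z" using zigzag_Fwd[of "Ide C z" z] z by (simp add: hom_set_def)
  ultimately show ?case using Nil by (simp add: zig_eq.intros)
next
  case (Cons p ps)
  show ?case
  proof (cases p)
    case (Fwd f)
    with Cons.prems have f: "f \<in> Arr C" "a = Dom C f" "zigzag C W (Cod C f) ps z"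
      by (auto elim: zigzag.cases)
    let ?e = "zig_eval C z ps"
    have e: "?e \<in> hom_set C (Cod C f) z" using zig_eval_hom f(3) .
    have 1: "zig_eq C W a z (Fwd f # ps) [Fwd f, Fwd ?e]"
      by (rule zig_eq_Cons[OF Cons.IH[OF f(3)]]) (use f in \<open>auto intro: zigzag.intros\<close>)
    have "zig_step C W [Fwd f, Fwd ?e] [Fwd (Comp C ?e f)]"
      using zig_step.intros(2)[of f C ?e W "[]" "[]"] f e by (simp add: hom_set_def)
    moreover have "zigzag C W a [Fwd (Comp C ?e f)] z"
      using f e by (intro zigzag_Fwd) (auto simp: hom_set_def)
    ultimately have "zig_eq C W a z [Fwd f, Fwd ?e] [Fwd (Comp C ?e f)]"
      using zig_eq_zigzag[OF 1] by (simp add: zig_eq.intros)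
    then show ?thesis unfolding Fwd zig_eval.simps by (rule zig_eq.intros(4)[OF 1])
  next
    case (Bwd w)
    with Cons.prems have w: "w \<in> Arr C" "w \<in> W" "a = Cod C w" "zigzag C W (Dom C w) ps z"
      by (auto elim: zigzag.cases)
    let ?e = "zig_eval C z ps"
    define g where "g = zig_eval C z (Bwd w # ps)"
    have g: "g \<in> hom_set C (Cod C w) z" "Comp C g w = ?e"
      using zig_eval_Bwd[OF w(2,1) zig_eval_hom[OF w(4)]] unfolding g_def by auto
    have 1: "zig_eq C W a z (Bwd w # ps) [Bwd w, Fwd ?e]"
      by (rule zig_eq_Cons[OF Cons.IH[OF w(4)]]) (use w in \<open>auto intro: zigzag.intros\<close>)
    have z3: "zigzag C W a [Bwd w, Fwd w, Fwd g] z"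
      using w zigzag_Fwd[OF g(1)] by (auto intro!: zigzag.intros)
    have "zig_step C W [Bwd w, Fwd w, Fwd g] [Bwd w, Fwd ?e]"
      using zig_step.intros(2)[of w C g W "[Bwd w]" "[]"] w g by (simp add: hom_set_def)
    then have 2: "zig_eq C W a z [Bwd w, Fwd ?e] [Bwd w, Fwd w, Fwd g]"
      using zig_eq_zigzag[OF 1] z3 by (simp add: zig_eq.intros)
    have "zig_step C W [Bwd w, Fwd w, Fwd g] [Fwd g]"
      using zig_step.intros(4)[of w W C "[]" "[Fwd g]"] w by simp
    then have 3: "zig_eq C W a z [Bwd w, Fwd w, Fwd g] [Fwd g]"
      using z3 w zigzag_Fwd[OF g(1)] by (simp add: zig_eq.intros)
    show ?thesis using zig_eq.intros(4)[OF 1 zig_eq.intros(4)[OF 2 3]] unfolding Bwd g_def .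
  qed
qed

text \<open>Injective because the value of a zigzag is an invariant and that of
  \<open>[Fwd f]\<close> is \<open>f\<close>; surjective because every zigzag is equivalent to its
  value.\<close>

lemma loc_class_bij: "bij_betw (loc_class C W a z) (hom_set C a z) (loc_hom C W a z)"
  unfolding bij_betw_def
proof (intro conjI inj_onI subset_antisym subsetI)
  fix f g assume f: "f \<in> hom_set C a z" "g \<in> hom_set C a z"
    "loc_class C W a z f = loc_class C W a z g"
  then have "zig_eq C W a z [Fwd f] [Fwd g]"
    using zig_eq.intros(1)[OF zigzag_Fwd[OF f(2)]] by (auto simp: loc_class_def)
  from zig_eval_eq[OF this] show "f = g" using f by (auto simp: hom_set_def)
next
  fix c assume "c \<in> loc_class C W a z ` hom_set C a z"
  then obtain f where "f \<in> hom_set C a z" "c = loc_class C W a z f" by blast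
  then show "c \<in> loc_hom C W a z"
    by (auto simp: loc_class_def loc_hom_def quotient_def dest: zigzag_Fwd)
next
  fix c assume "c \<in> loc_hom C W a z"
  then obtain ps where ps: "zigzag C W a ps z" "c = {qs. zig_eq C W a z ps qs}"
    by (auto simp: loc_hom_def quotient_def)
  then have "c = loc_class C W a z (zig_eval C z ps)"
    unfolding loc_class_def using zig_eq_eval[OF ps(1)] by (auto intro: zig_eq.intros)
  then show "c \<in> loc_class C W a z ` hom_set C a z" using zig_eval_hom[OF ps(1)] by blast
qed

lemma loc_precomp_class:
  assumes "f \<in> Arr C" "g \<in> hom_set C (Cod C f) z"
  shows "loc_precomp C W f z (loc_class C W (Cod C f) z g) = loc_class C W (Dom C f) z (Comp C g f)"
proof -
  have cons: "zig_eq C W (Cod C f) z ps qs \<Longrightarrow> zig_eq C W (Dom C f) z (Fwd f # ps) (Fwd f # qs)" for ps qs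
    using assms(1) by (auto intro: zig_eq_Cons zigzag.intros)
  have "zig_eq C W (Dom C f) z [Fwd f, Fwd g] [Fwd (Comp C g f)]"
  proof (rule zig_eq.intros(2))
    show "zigzag C W (Dom C f) [Fwd f, Fwd g] z"
      using assms by (intro zz_fwd zigzag_Fwd) auto
    show "zigzag C W (Dom C f) [Fwd (Comp C g f)] z"
      using assms by (intro zigzag_Fwd) (auto simp: hom_set_def)
    show "zig_step C W [Fwd f, Fwd g] [Fwd (Comp C g f)]"
      using zig_step.intros(2)[of f C g W "[]" "[]"] assms by (simp add: hom_set_def)
  qed
  moreover have "zig_eq C W (Cod C f) z [Fwd g] [Fwd g]"
    using assms(2) by (intro zig_eq.intros(1) zigzag_Fwd)
  ultimately show ?thesis
    unfolding loc_precomp_def loc_class_def by (auto intro: zig_eq.intros(3,4) dest: cons)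
qed

text \<open>\<open>loc_class\<close> intertwines the two precompositions and is bijective at both
  ends, so bijectivity passes in either direction.\<close>

lemma loc_precomp_bij_iff:
  assumes f: "f \<in> Arr C"
  shows "bij_betw (loc_precomp C W f z) (loc_hom C W (Cod C f) z) (loc_hom C W (Dom C f) z) \<longleftrightarrow>
    bij_betw (\<lambda>g. Comp C g f) (hom_set C (Cod C f) z) (hom_set C (Dom C f) z)"
proof -
  have "bij_betw (\<lambda>g. Comp C g f) (hom_set C (Cod C f) z) (hom_set C (Dom C f) z) \<longleftrightarrow>
    bij_betw (loc_class C W (Dom C f) z \<circ> (\<lambda>g. Comp C g f)) (hom_set C (Cod C f) z) (loc_hom C W (Dom C f) z)"
    by (rule bij_betw_comp_iff2[OF loc_class_bij]) (use f in \<open>auto simp: hom_set_def\<close>)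
  also have "\<dots> \<longleftrightarrow> bij_betw (loc_precomp C W f z \<circ> loc_class C W (Cod C f) z)
      (hom_set C (Cod C f) z) (loc_hom C W (Dom C f) z)"
    by (rule bij_betw_cong) (simp add: f loc_precomp_class)
  also have "\<dots> \<longleftrightarrow> bij_betw (loc_precomp C W f z) (loc_hom C W (Cod C f) z) (loc_hom C W (Dom C f) z)"
    by (rule bij_betw_comp_iff[symmetric, OF loc_class_bij])
  finally show ?thesis by blast
qed

end

section \<open>Presheaves and their stalks\<close>

lemma presheaf_act: "presheaf C F \<Longrightarrow> f \<in> Arr C \<Longrightarrow> s \<in> Val F (Cod C f) \<Longrightarrow> Act F f s \<in> Val F (Dom C f)"
  by (auto simp: presheaf_def)

lemma presheaf_ide: "presheaf C F \<Longrightarrow> a \<in> Obj C \<Longrightarrow> s \<in> Val F a \<Longrightarrow> Act F (Ide C a) s = s"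
  by (auto simp: presheaf_def)

lemma presheaf_comp:
  "presheaf C F \<Longrightarrow> f \<in> Arr C \<Longrightarrow> g \<in> Arr C \<Longrightarrow> Cod C f = Dom C g \<Longrightarrow> s \<in> Val F (Cod C g) \<Longrightarrow>
    Act F (Comp C g f) s = Act F f (Act F g s)"
  by (auto simp: presheaf_def)

lemma sheaf_presheaf: "sheaf C J F \<Longrightarrow> presheaf C F"
  by (simp add: sheaf_def)

lemma nat_trans_in: "nat_trans C F G \<eta> \<Longrightarrow> a \<in> Obj C \<Longrightarrow> s \<in> Val F a \<Longrightarrow> \<eta> a s \<in> Val G a"
  by (fastforce simp: nat_trans_def)

lemma nat_trans_act:
  "nat_trans C F G \<eta> \<Longrightarrow> f \<in> Arr C \<Longrightarrow> s \<in> Val F (Cod C f) \<Longrightarrow>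
    \<eta> (Dom C f) (Act F f s) = Act G f (\<eta> (Cod C f) s)"
  by (auto simp: nat_trans_def)

lemma nat_trans_ext:
  assumes "nat_trans C F G \<eta>" "nat_trans C F G' \<epsilon>" "\<And>a s. a \<in> Obj C \<Longrightarrow> s \<in> Val F a \<Longrightarrow> \<eta> a s = \<epsilon> a s"
  shows "\<eta> = \<epsilon>"
proof
  fix a show "\<eta> a = \<epsilon> a"
  proof (cases "a \<in> Obj C")
    case True
    then have "\<eta> a \<in> Val F a \<rightarrow>\<^sub>E Val G a" "\<epsilon> a \<in> Val F a \<rightarrow>\<^sub>E Val G' a"
      using assms(1,2) by (auto simp: nat_trans_def)
    then show ?thesis using assms(3)[OF True]
      by (intro extensionalityI[where A = "Val F a"]) (auto simp: PiE_def)
  next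
    case False
    then show ?thesis using assms(1,2) by (auto simp: nat_trans_def extensional_def)
  qed
qed

text \<open>The representation of natural transformations is extensional.\<close>

definition nat_restrict ::
  "('o, 'm) category \<Rightarrow> ('o, 'm, 'v) psh \<Rightarrow> ('o \<Rightarrow> 'v \<Rightarrow> 'v) \<Rightarrow> 'o \<Rightarrow> 'v \<Rightarrow> 'v" where
  "nat_restrict C F \<eta> = (\<lambda>a\<in>Obj C. \<lambda>s\<in>Val F a. \<eta> a s)"

lemma nat_restrict_apply [simp]: "a \<in> Obj C \<Longrightarrow> s \<in> Val F a \<Longrightarrow> nat_restrict C F \<eta> a s = \<eta> a s"
  by (simp add: nat_restrict_def)

lemma nat_restrict_cong:
  "(\<And>a s. a \<in> Obj C \<Longrightarrow> s \<in> Val F a \<Longrightarrow> \<eta> a s = \<epsilon> a s) \<Longrightarrow> nat_restrict C F \<eta> = nat_restrict C F \<epsilon>"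
  unfolding nat_restrict_def by (intro restrict_ext) auto

lemma nat_restrict_nat_trans: "nat_trans C F G \<eta> \<Longrightarrow> nat_restrict C F \<eta> = \<eta>"
  by (fastforce simp: nat_trans_def nat_restrict_def extensional_def fun_eq_iff)

context cat begin

lemma nat_transI:
  assumes "presheaf C F"
    and "\<And>a s. a \<in> Obj C \<Longrightarrow> s \<in> Val F a \<Longrightarrow> \<eta> a s \<in> Val G a"
    and "\<And>f s. f \<in> Arr C \<Longrightarrow> s \<in> Val F (Cod C f) \<Longrightarrow> \<eta> (Dom C f) (Act F f s) = Act G f (\<eta> (Cod C f) s)"
  shows "nat_trans C F G (nat_restrict C F \<eta>)"
  using assms by (auto simp: nat_trans_def nat_restrict_def presheaf_act)

lemma nat_trans_comp:
  assumes "presheaf C F" "nat_trans C F G \<eta>" "nat_trans C G H \<epsilon>"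
  shows "nat_trans C F H (nat_restrict C F (\<lambda>a s. \<epsilon> a (\<eta> a s)))"
  using assms by (intro nat_transI) (auto simp: nat_trans_in nat_trans_act)

end

section \<open>Germs at a point of the site\<close>

locale point = cat C for C :: "('o, 'm) category" +
  fixes J :: "'o \<Rightarrow> 'm set set" and u :: "('o, 'm, 'v) pt_functor"
  assumes point: "site_point C J u"
begin

abbreviation germ_at :: "('o, 'm, 'v) psh \<Rightarrow> 'o \<Rightarrow> 'v \<Rightarrow> 'v \<Rightarrow> ('o \<times> 'v \<times> 'v) set" where
  "germ_at F a x s \<equiv> stalk_class C F u (a, x, s)"

lemma pt_map: "f \<in> Arr C \<Longrightarrow> x \<in> fst u (Dom C f) \<Longrightarrow> snd u f x \<in> fst u (Cod C f)"
  using point by (auto simp: site_point_def)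

lemma pt_ide: "a \<in> Obj C \<Longrightarrow> x \<in> fst u a \<Longrightarrow> snd u (Ide C a) x = x"
  using point by (auto simp: site_point_def)

lemma pt_comp: "f \<in> Arr C \<Longrightarrow> g \<in> Arr C \<Longrightarrow> Cod C f = Dom C g \<Longrightarrow> x \<in> fst u (Dom C f) \<Longrightarrow>
    snd u (Comp C g f) x = snd u g (snd u f x)"
  using point by (auto simp: site_point_def)

lemma pt_cover:
  assumes "a \<in> Obj C" "R \<in> J a" "x \<in> fst u a"
  obtains f y where "f \<in> R" "y \<in> fst u (Dom C f)" "snd u f y = x"
  using point assms unfolding site_point_def by metis

lemma pt_refine:
  assumes "x \<in> fst u a" "y \<in> fst u b" "a \<in> Obj C" "b \<in> Obj C"
  obtains f g z where "f \<in> Arr C" "g \<in> Arr C" "Dom C f = Dom C g" "Cod C f = a" "Cod C g = b"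
    "z \<in> fst u (Dom C g)" "snd u f z = x" "snd u g z = y"
proof -
  have "\<forall>a\<in>Obj C. \<forall>b\<in>Obj C. \<forall>x\<in>fst u a. \<forall>y\<in>fst u b.
        \<exists>c\<in>Obj C. \<exists>f\<in>hom_set C c a. \<exists>g\<in>hom_set C c b. \<exists>z\<in>fst u c.
          snd u f z = x \<and> snd u g z = y"
    using point unfolding site_point_def by (elim conjE)
  then obtain c f g z where "f\<in>hom_set C c a" "g\<in>hom_set C c b" "z\<in>fst u c"
          "snd u f z = x" "snd u g z = y" using assms by metis
  then show ?thesis using that[of f g z] by (auto simp: hom_set_def)
qed

lemma pt_equalize:
  assumes "f \<in> Arr C" "g \<in> Arr C" "Dom C f = Dom C g" "Cod C f = Cod C g"
    "x \<in> fst u (Dom C g)" "snd u f x = snd u g x"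
  obtains h z where "h \<in> Arr C" "Cod C h = Dom C g" "z \<in> fst u (Dom C h)" "snd u h z = x"
    "Comp C f h = Comp C g h"
proof -
  have eq: "\<forall>a\<in>Obj C. \<forall>b\<in>Obj C. \<forall>f\<in>hom_set C a b. \<forall>g\<in>hom_set C a b. \<forall>x\<in>fst u a.
        snd u f x = snd u g x \<longrightarrow>
        (\<exists>h\<in>arrows_to C a. \<exists>z\<in>fst u (Dom C h). snd u h z = x \<and> Comp C f h = Comp C g h)"
    using point unfolding site_point_def by (elim conjE)
  then obtain h z where "h\<in>arrows_to C (Dom C g)" "z\<in>fst u (Dom C h)" "snd u h z = x"
    "Comp C f h = Comp C g h"
    using bspec[OF bspec[OF bspec[OF bspec[OF bspec[OF eq, of "Dom C g"], of "Cod C g"], of f], of g], of x]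
      assms by (auto simp: hom_set_def)
  then show ?thesis using that[of h z] by (auto simp: arrows_to_def)
qed

text \<open>Replaces the fibre product, which the site need not have: both elements are lifted to
  one element by \<open>pt_refine\<close>, the two composites then agree on it, and
  \<open>pt_equalize\<close> makes the square commute.\<close>

lemma pt_square:
  assumes "f \<in> Arr C" "g \<in> Arr C" "Cod C f = Cod C g" "x \<in> fst u (Dom C f)" "y \<in> fst u (Dom C g)"
    "snd u f x = snd u g y"
  obtains h k z where "h \<in> Arr C" "k \<in> Arr C" "Dom C h = Dom C k" "Cod C h = Dom C f" "Cod C k = Dom C g"
    "z \<in> fst u (Dom C k)" "snd u h z = x" "snd u k z = y" "Comp C f h = Comp C g k"
proof -
  obtain h k z where 1: "h \<in> Arr C" "k \<in> Arr C" "Dom C h = Dom C k" "Cod C h = Dom C f" "Cod C k = Dom C g"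
    "z \<in> fst u (Dom C k)" "snd u h z = x" "snd u k z = y"
    using pt_refine[OF assms(4,5)] assms(1,2) by auto
  have "snd u (Comp C f h) z = snd u (Comp C g k) z" using 1 assms by (simp add: pt_comp)
  then obtain l w where 2: "l \<in> Arr C" "Cod C l = Dom C k" "w \<in> fst u (Dom C l)" "snd u l w = z"
    "Comp C (Comp C f h) l = Comp C (Comp C g k) l"
    using pt_equalize[of "Comp C f h" "Comp C g k" z] 1 assms by auto
  show ?thesis
    by (rule that[of "Comp C h l" "Comp C k l" w]) (use 1 2 assms in \<open>simp_all add: pt_comp comp_assoc\<close>)
qed

text \<open>The relation inside \<open>stalk_class\<close> without the membership conditions, which
  makes it symmetric on all triples.\<close>

definition germ_eq :: "('o, 'm, 'v) psh \<Rightarrow> 'o \<times> 'v \<times> 'v \<Rightarrow> 'o \<times> 'v \<times> 'v \<Rightarrow> bool" where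
  "germ_eq F = (\<lambda>(a, x, s) (b, y, t). \<exists>f g z. f \<in> Arr C \<and> g \<in> Arr C \<and> Dom C f = Dom C g \<and> Cod C f = a \<and>
     Cod C g = b \<and> z \<in> fst u (Dom C g) \<and> snd u f z = x \<and> snd u g z = y \<and> Act F f s = Act F g t)"

lemma stalk_class_germ_eq:
  "stalk_class C F u p = {(b, y, t). b \<in> Obj C \<and> y \<in> fst u b \<and> t \<in> Val F b \<and> germ_eq F p (b, y, t)}"
proof -
  have *: "(\<exists>c\<in>Obj C. \<exists>f\<in>hom_set C c a. \<exists>g\<in>hom_set C c b. \<exists>z\<in>fst u c.
        snd u f z = x \<and> snd u g z = y \<and> Act F f s = Act F g t) \<longleftrightarrow> germ_eq F (a, x, s) (b, y, t)"
    for a x s b y t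
    unfolding germ_eq_def hom_set_def by (auto; metis dom_obj)
  show ?thesis unfolding stalk_class_def * by (cases p) auto
qed

lemma germ_eq_sym: "germ_eq F p q \<Longrightarrow> germ_eq F q p"
  unfolding germ_eq_def by (fastforce split: prod.splits)

text \<open>Both refinements have a leg to the middle object \<open>b\<close> with the same value
  \<open>y\<close>; \<open>pt_square\<close> completes these legs to a common refinement on which
  the two equalities can be chained.\<close>

lemma germ_eq_trans:
  assumes F: "presheaf C F" and v: "s \<in> Val F a" "t \<in> Val F b" "r \<in> Val F c"
    and 1: "germ_eq F (a, x, s) (b, y, t)" and 2: "germ_eq F (b, y, t) (c, w, r)"
  shows "germ_eq F (a, x, s) (c, w, r)"
proof -
  obtain f g z where f: "f \<in> Arr C" "g \<in> Arr C" "Dom C f = Dom C g" "Cod C f = a"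
    "Cod C g = b" "z \<in> fst u (Dom C g)" "snd u f z = x" "snd u g z = y" "Act F f s = Act F g t"
    using 1 unfolding germ_eq_def by auto
  obtain f' g' z' where f': "f' \<in> Arr C" "g' \<in> Arr C" "Dom C f' = Dom C g'" "Cod C f' = b"
    "Cod C g' = c" "z' \<in> fst u (Dom C g')" "snd u f' z' = y" "snd u g' z' = w" "Act F f' t = Act F g' r"
    using 2 unfolding germ_eq_def by auto
  obtain h k v where h: "h \<in> Arr C" "k \<in> Arr C" "Dom C h = Dom C k" "Cod C h = Dom C g" "Cod C k = Dom C f'"
    "v \<in> fst u (Dom C k)" "snd u h v = z" "snd u k v = z'" "Comp C g h = Comp C f' k"
    using pt_square[of g f' z z'] f f' by auto
  have "Act F (Comp C f h) s = Act F h (Act F f s)"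
    using F f h v by (simp add: presheaf_comp)
  also have "\<dots> = Act F (Comp C g h) t"
    unfolding f(9) by (rule presheaf_comp[symmetric]) (use F f h v in simp_all)
  also have "\<dots> = Act F k (Act F f' t)"
    unfolding h(9) by (rule presheaf_comp) (use F f' h v in simp_all)
  also have "\<dots> = Act F (Comp C g' k) r" using F f' h v by (simp add: presheaf_comp)
  finally have "Act F (Comp C f h) s = Act F (Comp C g' k) r" .
  then show ?thesis
    unfolding germ_eq_def prod.case
    by (intro exI[of _ "Comp C f h"] exI[of _ "Comp C g' k"] exI[of _ v])
      (use f f' h v in \<open>simp add: pt_comp\<close>)
qed

lemma germ_eq_refl: "a \<in> Obj C \<Longrightarrow> x \<in> fst u a \<Longrightarrow> germ_eq F (a, x, s) (a, x, s)"
  unfolding germ_eq_def prod.case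
  by (intro exI[of _ "Ide C a"] exI[of _ x]) (simp add: pt_ide)

lemma germ_in: "a \<in> Obj C \<Longrightarrow> x \<in> fst u a \<Longrightarrow> s \<in> Val F a \<Longrightarrow> (a, x, s) \<in> germ_at F a x s"
  unfolding stalk_class_germ_eq by (simp add: germ_eq_refl)

lemma germ_at_eq_iff:
  assumes "presheaf C F" "a \<in> Obj C" "x \<in> fst u a" "s \<in> Val F a" "b \<in> Obj C" "y \<in> fst u b" "t \<in> Val F b"
  shows "germ_at F a x s = germ_at F b y t \<longleftrightarrow> germ_eq F (a, x, s) (b, y, t)"
proof
  assume "germ_at F a x s = germ_at F b y t"
  then have "(b, y, t) \<in> germ_at F a x s" using germ_in[of b y t F] assms by simp
  then show "germ_eq F (a, x, s) (b, y, t)"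
    by (simp add: stalk_class_germ_eq)
next
  assume "germ_eq F (a, x, s) (b, y, t)"
  then show "germ_at F a x s = germ_at F b y t"
    unfolding stalk_class_germ_eq using assms
    by (auto intro: germ_eq_trans germ_eq_sym)
qed

lemma germ_at_eqE:
  assumes "presheaf C F" "a \<in> Obj C" "x \<in> fst u a" "s \<in> Val F a" "b \<in> Obj C" "y \<in> fst u b" "t \<in> Val F b"
    "germ_at F a x s = germ_at F b y t"
  obtains f g z where "f \<in> Arr C" "g \<in> Arr C" "Dom C f = Dom C g" "Cod C f = a"
     "Cod C g = b" "z \<in> fst u (Dom C g)" "snd u f z = x" "snd u g z = y" "Act F f s = Act F g t"
  using germ_at_eq_iff[OF assms(1-7)] assms(8) unfolding germ_eq_def by auto

lemma germ_at_act:
  assumes "presheaf C F" "f \<in> Arr C" "z \<in> fst u (Dom C f)" "s \<in> Val F (Cod C f)"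
  shows "germ_at F (Dom C f) z (Act F f s) = germ_at F (Cod C f) (snd u f z) s"
proof -
  have "germ_eq F (Dom C f, z, Act F f s) (Cod C f, snd u f z, s)"
    unfolding germ_eq_def prod.case
    by (intro exI[of _ "Ide C (Dom C f)"] exI[of _ f] exI[of _ z])
      (use assms in \<open>simp add: pt_ide presheaf_ide presheaf_act\<close>)
  then show ?thesis
    using assms by (subst germ_at_eq_iff) (auto simp: presheaf_act pt_map)
qed

text \<open>Equality of germs gives two legs \<open>f\<close> and \<open>g\<close> to
  \<open>a\<close>. Both send the refined element to \<open>x\<close>, so they can be equalized, and
  a single neighbourhood of \<open>x\<close> remains on which the sections agree.\<close>

lemma germ_at_eq_sameE:
  assumes "presheaf C F" "a \<in> Obj C" "x \<in> fst u a" "s \<in> Val F a" "t \<in> Val F a"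
    "germ_at F a x s = germ_at F a x t"
  obtains f z where "f \<in> Arr C" "Cod C f = a" "z \<in> fst u (Dom C f)" "snd u f z = x" "Act F f s = Act F f t"
proof -
  obtain f g z where f: "f \<in> Arr C" "g \<in> Arr C" "Dom C f = Dom C g" "Cod C f = a"
     "Cod C g = a" "z \<in> fst u (Dom C g)" "snd u f z = x" "snd u g z = x" "Act F f s = Act F g t"
    using germ_at_eqE[OF assms(1-4) assms(2,3,5,6)] by blast
  obtain h w where h: "h \<in> Arr C" "Cod C h = Dom C g" "w \<in> fst u (Dom C h)" "snd u h w = z"
    "Comp C f h = Comp C g h"
    using pt_equalize[of f g z] f by auto
  have "Act F (Comp C f h) s = Act F h (Act F f s)" "Act F (Comp C g h) t = Act F h (Act F g t)"
    by (rule presheaf_comp; use f h assms in simp)+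
  then have "Act F (Comp C f h) s = Act F (Comp C f h) t" using f h by simp
  then show ?thesis using that[of "Comp C f h" w] f h by (simp add: pt_comp)
qed

lemma psh_stalkI: "a \<in> Obj C \<Longrightarrow> x \<in> fst u a \<Longrightarrow> s \<in> Val F a \<Longrightarrow> germ_at F a x s \<in> psh_stalk C F u"
  unfolding psh_stalk_def by blast

lemma psh_stalkE:
  assumes "c \<in> psh_stalk C F u"
  obtains a x s where "a \<in> Obj C" "x \<in> fst u a" "s \<in> Val F a" "c = germ_at F a x s"
  using assms unfolding psh_stalk_def by auto

lemma germ_eq_map:
  assumes "nat_trans C F G \<eta>" "s \<in> Val F a" "t \<in> Val F b" "germ_eq F (a, x, s) (b, y, t)"
  shows "germ_eq G (a, x, \<eta> a s) (b, y, \<eta> b t)"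
proof -
  obtain f g z where f: "f \<in> Arr C" "g \<in> Arr C" "Dom C f = Dom C g" "Cod C f = a"
     "Cod C g = b" "z \<in> fst u (Dom C g)" "snd u f z = x" "snd u g z = y" "Act F f s = Act F g t"
    using assms(4) unfolding germ_eq_def by auto
  have "Act G f (\<eta> a s) = Act G g (\<eta> b t)"
    using nat_trans_act[OF assms(1), of f s] nat_trans_act[OF assms(1), of g t] f assms by simp
  then show ?thesis unfolding germ_eq_def using f by auto
qed

text \<open>\<open>psh_stalk_map\<close> evaluates on a representative chosen by
  \<open>SOME\<close>; naturality makes the result independent of the choice.\<close>

lemma psh_stalk_map_germ:
  assumes "presheaf C F" "presheaf C G" "nat_trans C F G \<eta>" "a \<in> Obj C" "x \<in> fst u a" "s \<in> Val F a"
  shows "psh_stalk_map C G u \<eta> (germ_at F a x s) = germ_at G a x (\<eta> a s)"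
proof -
  define p where "p = (SOME p. p \<in> germ_at F a x s)"
  have "p \<in> germ_at F a x s" unfolding p_def by (rule someI) (rule germ_in[OF assms(4-6)])
  then obtain b y t where p: "p = (b, y, t)" "b \<in> Obj C" "y \<in> fst u b" "t \<in> Val F b"
    "germ_eq F (a, x, s) (b, y, t)"
    unfolding stalk_class_germ_eq by auto
  have "germ_at G a x (\<eta> a s) = germ_at G b y (\<eta> b t)"
    using germ_eq_map[OF assms(3) assms(6) p(4,5)] assms p by (simp add: germ_at_eq_iff nat_trans_in)
  then show ?thesis unfolding psh_stalk_map_def p_def[symmetric] p(1) by simp
qed

end

section \<open>Path components of geometric realizations\<close>

definition vert :: "nat \<Rightarrow> nat \<Rightarrow> nat" where
  "vert i = (\<lambda>k\<in>{..0}. i)"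

text \<open>Its equivalence closure \<open>pi0_rel\<close> is the combinatorial counterpart of the
  path components of the realization.\<close>

definition edge_rel :: "'s sset \<Rightarrow> ('s \<times> 's) set" where
  "edge_rel K = {(SpxOp K 0 1 (vert 0) e, SpxOp K 0 1 (vert 1) e) | e. e \<in> Spx K 1}"

definition pi0_rel :: "'s sset \<Rightarrow> ('s \<times> 's) set" where
  "pi0_rel K = (edge_rel K \<union> (edge_rel K)\<inverse>)\<^sup>*"

definition origin :: "nat \<Rightarrow> real" where
  "origin = (\<lambda>j. if j = 0 then 1 else 0)"

lemma vert_Delta [simp]: "i \<le> n \<Longrightarrow> vert i \<in> Delta 0 n"
  by (auto simp: vert_def Delta_def mono_on_def)

lemma compose_vert: "i \<le> n \<Longrightarrow> compose {..0} \<theta> (vert i) = vert (\<theta> i)"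
  by (auto simp: compose_def vert_def)

lemma equiv_closure_class_eq:
  assumes "(p, q) \<in> (R \<union> R\<inverse>)\<^sup>*"
  shows "(R \<union> R\<inverse>)\<^sup>* `` {p} = (R \<union> R\<inverse>)\<^sup>* `` {q}"
proof -
  have "sym ((R \<union> R\<inverse>)\<^sup>*)" by (intro sym_rtrancl) (auto simp: sym_def)
  then have "(q, p) \<in> (R \<union> R\<inverse>)\<^sup>*" using assms by (auto dest: symD)
  then show ?thesis using assms by (auto intro: rtrancl_trans)
qed

lemma pi0_rel_sym: "(v, w) \<in> pi0_rel K \<Longrightarrow> (w, v) \<in> pi0_rel K"
proof -
  have "sym (pi0_rel K)" unfolding pi0_rel_def by (intro sym_rtrancl) (auto simp: sym_def)
  then show "(v, w) \<in> pi0_rel K \<Longrightarrow> (w, v) \<in> pi0_rel K" by (auto dest: symD)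
qed

lemma pi0_rel_trans: "(v, w) \<in> pi0_rel K \<Longrightarrow> (w, x) \<in> pi0_rel K \<Longrightarrow> (v, x) \<in> pi0_rel K"
  unfolding pi0_rel_def by (rule rtrancl_trans)

lemma pi0_rel_refl [simp]: "(v, v) \<in> pi0_rel K"
  by (simp add: pi0_rel_def)

lemma pi0_rel_edge: "(v, w) \<in> edge_rel K \<Longrightarrow> (v, w) \<in> pi0_rel K"
  by (auto simp: pi0_rel_def)

lemma standard_simplex_0': "standard_simplex 0 = {origin}"
  by (simp add: standard_simplex_0 origin_def)

text \<open>The pushed coordinates are the sums of \<open>t\<close> over the fibres of \<theta>,
  which partition the index set, so the total remains 1.\<close>

lemma simplex_push_in:
  assumes "\<theta> \<in> Delta m n" "t \<in> standard_simplex m"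
  shows "simplex_push m \<theta> t \<in> standard_simplex n"
proof -
  have \<theta>: "\<theta> i \<le> n" if "i \<le> m" for i using assms(1) that by (auto simp: Delta_def)
  have t: "\<And>i. 0 \<le> t i" "(\<Sum>i\<le>m. t i) = 1" using assms(2) by (auto simp: standard_simplex_def)
  have sum: "(\<Sum>j\<le>n. simplex_push m \<theta> t j) = 1"
  proof -
    have "(\<Sum>j\<le>n. simplex_push m \<theta> t j) = (\<Sum>j\<le>n. sum t {i \<in> {..m}. \<theta> i = j})"
      by (simp add: simplex_push_def)
    also have "\<dots> = sum t {..m}" by (rule sum.group) (use \<theta> in auto)
    finally show ?thesis using t by simp
  qed
  have nonneg: "0 \<le> simplex_push m \<theta> t j" for j
    unfolding simplex_push_def by (intro sum_nonneg) (use t in auto)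
  have zero: "simplex_push m \<theta> t j = 0" if "j > n" for j
  proof -
    have "{i. i \<le> m \<and> \<theta> i = j} = {}" using \<theta> that by fastforce
    then show ?thesis by (simp only: simplex_push_def sum.empty)
  qed
  have "simplex_push m \<theta> t j \<le> 1" for j
  proof (cases "j \<le> n")
    case True
    then have "simplex_push m \<theta> t j \<le> (\<Sum>j\<le>n. simplex_push m \<theta> t j)"
      by (intro member_le_sum) (use nonneg in auto)
    then show ?thesis using sum by simp
  qed (use zero in auto)
  then show ?thesis using nonneg sum zero by (auto simp: standard_simplex_def)
qed

section \<open>Vertices, edges and the realization of a simplicial set\<close>

locale simplicial_set =
  fixes K :: "'s sset"
  assumes op_in: "\<theta> \<in> Delta m n \<Longrightarrow> x \<in> Spx K n \<Longrightarrow> SpxOp K m n \<theta> x \<in> Spx K m"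
    and op_comp: "\<theta> \<in> Delta k m \<Longrightarrow> \<phi> \<in> Delta m n \<Longrightarrow> x \<in> Spx K n \<Longrightarrow>
      SpxOp K k n (compose {..k} \<phi> \<theta>) x = SpxOp K k m \<theta> (SpxOp K m n \<phi> x)"
    and op_ide: "x \<in> Spx K n \<Longrightarrow> SpxOp K n n (\<lambda>i\<in>{..n}. i) x = x"
begin

abbreviation vertex :: "nat \<Rightarrow> nat \<Rightarrow> 's \<Rightarrow> 's" where
  "vertex n i \<equiv> SpxOp K 0 n (vert i)"

lemma vertex_in: "x \<in> Spx K n \<Longrightarrow> i \<le> n \<Longrightarrow> vertex n i x \<in> Spx K 0"
  by (simp add: op_in)

lemma vertex_op: "\<theta> \<in> Delta m n \<Longrightarrow> x \<in> Spx K n \<Longrightarrow> i \<le> m \<Longrightarrow> vertex m i (SpxOp K m n \<theta> x) = vertex n (\<theta> i) x"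
  using op_comp[of "vert i" 0 m \<theta> n x] by (simp only: compose_vert[of i m] vert_Delta)

lemma vertex_0: "x \<in> Spx K 0 \<Longrightarrow> vertex 0 0 x = x"
proof -
  have "vert 0 = (\<lambda>i\<in>{..0}. i)" by (auto simp: vert_def)
  then show "x \<in> Spx K 0 \<Longrightarrow> vertex 0 0 x = x" using op_ide[of x 0] by simp
qed

text \<open>The operator \<phi> from [1] to [n] with values \<open>i\<close> and \<open>j\<close>
  cuts the required edge out of the simplex; for \<open>i = j\<close> it is a degenerate
  edge.\<close>

lemma vertex_connected:
  assumes x: "x \<in> Spx K n" and ij: "i \<le> j" "j \<le> n"
  shows "(vertex n i x, vertex n j x) \<in> edge_rel K"
proof -
  define \<phi> :: "nat \<Rightarrow> nat" where "\<phi> = (\<lambda>k\<in>{..1}. if k = 0 then i else j)"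
  have \<phi>: "\<phi> \<in> Delta 1 n" using ij by (auto simp: \<phi>_def Delta_def mono_on_def)
  have "vertex n i x = vertex 1 0 (SpxOp K 1 n \<phi> x)" "vertex n j x = vertex 1 1 (SpxOp K 1 n \<phi> x)"
    using vertex_op[OF \<phi> x] by (auto simp: \<phi>_def)
  moreover have "SpxOp K 1 n \<phi> x \<in> Spx K 1" using op_in[OF \<phi> x] .
  ultimately show ?thesis unfolding edge_rel_def by auto
qed

lemma topspace_cell_space: "topspace (cell_space K) = {((n, x), t). x \<in> Spx K n \<and> t \<in> standard_simplex n}"
  by (auto simp: cell_space_def simplex_space_def topspace_standard_simplex)

lemma cell_glue_in: "(p, q) \<in> cell_glue K \<Longrightarrow> p \<in> topspace (cell_space K) \<and> q \<in> topspace (cell_space K)"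
  by (auto simp: cell_glue_def topspace_cell_space op_in simplex_push_in)

lemma cell_class_refl: "p \<in> cell_class K p"
  by (simp add: cell_class_def)

lemma cell_class_eq: "q \<in> cell_class K p \<Longrightarrow> cell_class K q = cell_class K p"
  unfolding cell_class_def using equiv_closure_class_eq by fastforce

lemma cell_class_subset: "p \<in> topspace (cell_space K) \<Longrightarrow> cell_class K p \<subseteq> topspace (cell_space K)"
proof -
  have "(p, q) \<in> (cell_glue K \<union> (cell_glue K)\<inverse>)\<^sup>* \<Longrightarrow> p \<in> topspace (cell_space K) \<Longrightarrow> q \<in> topspace (cell_space K)" for q
    by (induction rule: rtrancl_induct) (use cell_glue_in in auto)
  then show "p \<in> topspace (cell_space K) \<Longrightarrow> cell_class K p \<subseteq> topspace (cell_space K)"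
    by (auto simp: cell_class_def)
qed

lemma cell_class_glue:
  assumes "\<theta> \<in> Delta m n" "x \<in> Spx K n" "t \<in> standard_simplex m"
  shows "cell_class K ((m, SpxOp K m n \<theta> x), t) = cell_class K ((n, x), simplex_push m \<theta> t)"
proof -
  have "(((m, SpxOp K m n \<theta> x), t), ((n, x), simplex_push m \<theta> t)) \<in> cell_glue K"
    using assms unfolding cell_glue_def by blast
  then show ?thesis unfolding cell_class_def by (intro equiv_closure_class_eq) auto
qed

text \<open>The union of a set of classes is saturated. This is what makes unions of sets of classes
  commute with intersections, so that the quotient topology is a topology.\<close>

lemma Union_cell_classes:
  assumes "\<U> \<subseteq> cell_class K ` topspace (cell_space K)"
  shows "\<Union>\<U> = {p \<in> topspace (cell_space K). cell_class K p \<in> \<U>}"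
proof (intro subset_antisym subsetI)
  fix p assume "p \<in> \<Union>\<U>"
  then obtain q where q: "q \<in> topspace (cell_space K)" "cell_class K q \<in> \<U>" "p \<in> cell_class K q"
    using assms by blast
  then show "p \<in> {p \<in> topspace (cell_space K). cell_class K p \<in> \<U>}"
    using cell_class_eq[OF q(3)] cell_class_subset[OF q(1)] by auto
next
  fix p assume "p \<in> {p \<in> topspace (cell_space K). cell_class K p \<in> \<U>}"
  then show "p \<in> \<Union>\<U>" using cell_class_refl[of p] by blast
qed

lemma openin_realization:
  "openin (realization K) \<U> \<longleftrightarrow> \<U> \<subseteq> cell_class K ` topspace (cell_space K) \<and>
     openin (cell_space K) {p \<in> topspace (cell_space K). cell_class K p \<in> \<U>}"
proof -
  let ?C = "cell_class K ` topspace (cell_space K)"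
  have "istopology (\<lambda>\<U>. \<U> \<subseteq> ?C \<and> openin (cell_space K) (\<Union>\<U>))"
    unfolding istopology_def
  proof (intro conjI allI impI)
    fix \<U> \<V> assume 1: "\<U> \<subseteq> ?C \<and> openin (cell_space K) (\<Union>\<U>)" "\<V> \<subseteq> ?C \<and> openin (cell_space K) (\<Union>\<V>)"
    then have sub: "\<U> \<subseteq> ?C" "\<V> \<subseteq> ?C" "\<U> \<inter> \<V> \<subseteq> ?C" by blast+
    then show "\<U> \<inter> \<V> \<subseteq> ?C" by blast
    have "\<Union>(\<U> \<inter> \<V>) = \<Union>\<U> \<inter> \<Union>\<V>"
      unfolding sub[THEN Union_cell_classes] by blast
    then show "openin (cell_space K) (\<Union>(\<U> \<inter> \<V>))" using 1 by auto
  next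
    fix \<K> assume 1: "\<forall>\<U>\<in>\<K>. \<U> \<subseteq> ?C \<and> openin (cell_space K) (\<Union>\<U>)"
    then show "\<Union>\<K> \<subseteq> ?C" by blast
    have "\<Union>(\<Union>\<K>) = \<Union>(Union ` \<K>)" by blast
    moreover have "openin (cell_space K) (\<Union>(Union ` \<K>))" using 1 by (intro openin_Union) blast
    ultimately show "openin (cell_space K) (\<Union>(\<Union>\<K>))" by simp
  qed
  then have "openin (realization K) \<U> \<longleftrightarrow> \<U> \<subseteq> ?C \<and> openin (cell_space K) (\<Union>\<U>)"
    unfolding realization_def by (simp add: topology_inverse')
  then show ?thesis using Union_cell_classes[of \<U>] by auto
qed

lemma topspace_realization: "topspace (realization K) = cell_class K ` topspace (cell_space K)"
proof -
  have "openin (realization K) (cell_class K ` topspace (cell_space K))"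
    unfolding openin_realization
  proof
    have "{p \<in> topspace (cell_space K). cell_class K p \<in> cell_class K ` topspace (cell_space K)} =
      topspace (cell_space K)"
      by blast
    then show "openin (cell_space K)
       {p \<in> topspace (cell_space K). cell_class K p \<in> cell_class K ` topspace (cell_space K)}"
      by (simp only: openin_topspace)
  qed (rule subset_refl)
  moreover have "topspace (realization K) \<subseteq> cell_class K ` topspace (cell_space K)"
    using openin_topspace[of "realization K"] unfolding openin_realization by (rule conjunct1)
  ultimately show ?thesis by (simp add: openin_subset subset_antisym)
qed

lemma continuous_cell_class: "continuous_map (cell_space K) (realization K) (cell_class K)"
  unfolding continuous_map_def topspace_realization by (auto simp: openin_realization)

lemma cell_path_connected:
  assumes "x \<in> Spx K n" "s \<in> standard_simplex n" "t \<in> standard_simplex n"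
  shows "path_component_of (realization K) (cell_class K ((n, x), s)) (cell_class K ((n, x), t))"
proof -
  have "continuous_map (simplex_space n) (cell_space K) (\<lambda>t. ((n, x), t))"
    unfolding cell_space_def
    using continuous_map_component_injection[of "(n, x)" "{(n, x). x \<in> Spx K n}" "\<lambda>(n, x). simplex_space n"]
      assms(1) by simp
  then have "continuous_map (simplex_space n) (realization K) (cell_class K \<circ> (\<lambda>t. ((n, x), t)))"
    by (rule continuous_map_compose) (rule continuous_cell_class)
  moreover have "path_connectedin (simplex_space n) (standard_simplex n)"
    using path_connectedin_standard_simplex by (simp add: simplex_space_def path_connectedin_subtopology)
  ultimately have "path_connectedin (realization K) ((cell_class K \<circ> (\<lambda>t. ((n, x), t))) ` standard_simplex n)"
    by (rule path_connectedin_continuous_map_image)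
  then show ?thesis
    using assms unfolding path_component_of by fastforce
qed

text \<open>The vertex is glued to a point of the cell of \<open>x\<close>, and a cell is path
  connected.\<close>

lemma vertex_path_component:
  assumes "x \<in> Spx K n" "i \<le> n" "t \<in> standard_simplex n"
  shows "path_component_of (realization K) (cell_class K ((0, vertex n i x), origin)) (cell_class K ((n, x), t))"
proof -
  have o: "origin \<in> standard_simplex 0" by (simp add: standard_simplex_0')
  have "cell_class K ((0, vertex n i x), origin) = cell_class K ((n, x), simplex_push 0 (vert i) origin)"
    using assms by (intro cell_class_glue o) auto
  then show ?thesis
    using cell_path_connected[OF assms(1) simplex_push_in[OF vert_Delta[OF assms(2)] o] assms(3)] by simp
qed

text \<open>Induction along the chain of edges: both ends of an edge are joined to one and the same
  point of its cell.\<close>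

lemma pi0_imp_path_component:
  assumes "(v, w) \<in> pi0_rel K" "v \<in> Spx K 0"
  shows "w \<in> Spx K 0 \<and>
    path_component_of (realization K) (cell_class K ((0, v), origin)) (cell_class K ((0, w), origin))"
  using assms(1) unfolding pi0_rel_def
proof (induction rule: rtrancl_induct)
  case base
  have "origin \<in> standard_simplex 0" by (simp add: standard_simplex_0')
  then show ?case using assms(2) cell_path_connected by blast
next
  case (step w w')
  obtain e where e: "e \<in> Spx K 1" "{w, w'} = {vertex 1 0 e, vertex 1 1 e}"
    using step(2) unfolding edge_rel_def by fastforce
  have "standard_simplex 1 \<noteq> {}" by (rule nonempty_standard_simplex)
  then obtain t where t: "t \<in> standard_simplex 1" by blast
  have y: "path_component_of (realization K) (cell_class K ((0, y), origin)) (cell_class K ((1, e), t))"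
    if "y \<in> {w, w'}" for y
    using that vertex_path_component[OF e(1) _ t, of 0] vertex_path_component[OF e(1) _ t, of 1]
    unfolding e(2) by auto
  have "path_component_of (realization K) (cell_class K ((0, w), origin)) (cell_class K ((0, w'), origin))"
    by (rule path_component_of_trans[OF y path_component_of_sym[OF y]]) simp_all
  moreover have "w' \<in> Spx K 0" using e(2) vertex_in[OF e(1), of 0] vertex_in[OF e(1), of 1] by (auto simp: doubleton_eq_iff)
  ultimately show ?case using step.IH path_component_of_trans[of "realization K"] by fast
qed

text \<open>The cells whose first vertex lies in the class of \<open>v\<close> form a clopen subset
  of the realization, and a path, being connected, cannot leave it.\<close>

lemma path_component_imp_pi0:
  assumes pc: "path_component_of (realization K) (cell_class K ((0, v), origin)) (cell_class K ((0, w), origin))"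
    and v: "v \<in> Spx K 0" "w \<in> Spx K 0"
  shows "(v, w) \<in> pi0_rel K"
proof -
  \<comment> \<open>The first vertex, whatever the position in the cell. Gluing does not preserve it
    on the nose, since \<theta> need not send 0 to 0, but it does so up to an edge of the larger
    simplex.\<close>
  define \<pi> :: "'s cell_point \<Rightarrow> 's" where "\<pi> = (\<lambda>((n, x), t). vertex n 0 x)"
  have glue: "(\<pi> p, \<pi> q) \<in> pi0_rel K" if pq: "(p, q) \<in> cell_glue K" for p q
  proof -
    obtain m n \<theta> x t where 1: "p = ((m, SpxOp K m n \<theta> x), t)" "q = ((n, x), simplex_push m \<theta> t)"
      "\<theta> \<in> Delta m n" "x \<in> Spx K n"
      using pq unfolding cell_glue_def by blast
    have "\<theta> 0 \<le> n" using 1 by (auto simp: Delta_def)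
    then have "(vertex n 0 x, vertex n (\<theta> 0) x) \<in> edge_rel K" using vertex_connected 1 by simp
    then show ?thesis unfolding \<pi>_def 1 by (auto simp: vertex_op 1 intro: pi0_rel_sym pi0_rel_edge)
  qed
  have cls: "(\<pi> p, \<pi> q) \<in> pi0_rel K" if "q \<in> cell_class K p" for p q
  proof -
    have "(p, q) \<in> (cell_glue K \<union> (cell_glue K)\<inverse>)\<^sup>*" using that by (simp add: cell_class_def)
    then show ?thesis
      by (induction rule: rtrancl_induct) (auto intro: pi0_rel_trans pi0_rel_sym dest: glue)
  qed
  \<comment> \<open>As \<open>P\<close> is constant on classes of \<open>pi0_rel\<close>, the set is
    saturated, and since \<open>\<pi>\<close> ignores \<open>t\<close> its preimage is a union of
    whole cells.\<close>
  have op: "openin (realization K) (cell_class K ` {p \<in> topspace (cell_space K). P (\<pi> p)})"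
    if P: "\<And>v w. (v, w) \<in> pi0_rel K \<Longrightarrow> P v \<longleftrightarrow> P w" for P
  proof -
    have "{p \<in> topspace (cell_space K). cell_class K p \<in> cell_class K ` {p \<in> topspace (cell_space K). P (\<pi> p)}} =
      {p \<in> topspace (cell_space K). P (\<pi> p)}"
      using cls P by (auto, metis cell_class_refl)
    moreover have "openin (cell_space K) {p \<in> topspace (cell_space K). P (\<pi> p)}"
    proof -
      have "{t. ((n, x), t) \<in> topspace (cell_space K) \<and> P (\<pi> ((n, x), t))} =
        (if P (vertex n 0 x) then standard_simplex n else {})" if "x \<in> Spx K n" for n x
        using that by (auto simp: \<pi>_def topspace_cell_space)
      moreover have "openin (simplex_space n) (standard_simplex n)" for n
        unfolding simplex_space_def using topspace_standard_simplex openin_topspace by metis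
      ultimately show ?thesis
        unfolding cell_space_def openin_sum_topology
        by (auto simp: cell_space_def[symmetric] topspace_cell_space simplex_space_def topspace_standard_simplex)
    qed
    ultimately show ?thesis unfolding openin_realization by auto
  qed
  define P where "P = (\<lambda>x. (v, x) \<in> pi0_rel K)"
  have P: "P x \<longleftrightarrow> P y" if "(x, y) \<in> pi0_rel K" for x y
    using that pi0_rel_trans pi0_rel_sym unfolding P_def by metis
  let ?S = "cell_class K ` {p \<in> topspace (cell_space K). P (\<pi> p)}"
  let ?T = "cell_class K ` {p \<in> topspace (cell_space K). \<not> P (\<pi> p)}"
  have "topspace (realization K) - ?S = ?T"
    unfolding topspace_realization using cls P by (auto, metis cell_class_refl)
  then have clopen: "openin (realization K) ?S" "closedin (realization K) ?S"
    using op[of P] op[of "\<lambda>x. \<not> P x"] P by (auto simp: closedin_def openin_subset topspace_realization)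
  obtain S where S: "connectedin (realization K) S" "cell_class K ((0, v), origin) \<in> S"
    "cell_class K ((0, w), origin) \<in> S"
    using pc path_connectedin_imp_connectedin unfolding path_component_of by blast
  have o: "((0, v), origin) \<in> topspace (cell_space K)"
    using v by (simp add: topspace_cell_space standard_simplex_0')
  have "P (\<pi> ((0, v), origin))" unfolding P_def \<pi>_def by (simp add: vertex_0 v)
  then have "cell_class K ((0, v), origin) \<in> ?S" using o by blast
  then have "S \<subseteq> ?S" using connectedin_clopen_cases[OF S(1) clopen(2,1)] S(2) by (auto simp: disjnt_def)
  then obtain p where p: "cell_class K ((0, w), origin) = cell_class K p" "P (\<pi> p)" using S(3) by blast
  then have "P (\<pi> ((0, w), origin))" using cls P cell_class_refl by metis
  then show ?thesis unfolding P_def \<pi>_def by (simp add: vertex_0 v)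
qed

lemma realization_vertex:
  assumes "c \<in> topspace (realization K)"
  obtains v where "v \<in> Spx K 0" "path_component_of (realization K) (cell_class K ((0, v), origin)) c"
proof -
  obtain n x t where "x \<in> Spx K n" "t \<in> standard_simplex n" "c = cell_class K ((n, x), t)"
    using assms unfolding topspace_realization topspace_cell_space by auto
  then show ?thesis using that[of "vertex n 0 x"] vertex_path_component vertex_in by simp
qed

end

text \<open>The class of the image of a representative is unchanged by gluing, because \<eta>
  commutes with the operators; hence the choice made in \<open>realization_map\<close> does not
  matter.\<close>

lemma realization_map_class:
  assumes K: "simplicial_set K" and L: "simplicial_set L"
    and \<eta>: "\<And>n x. x \<in> Spx K n \<Longrightarrow> \<eta> n x \<in> Spx L n"
    "\<And>m n \<theta> x. \<theta> \<in> Delta m n \<Longrightarrow> x \<in> Spx K n \<Longrightarrow> \<eta> m (SpxOp K m n \<theta> x) = SpxOp L m n \<theta> (\<eta> n x)"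
    and x: "x \<in> Spx K n" "t \<in> standard_simplex n"
  shows "realization_map L \<eta> (cell_class K ((n, x), t)) = cell_class L ((n, \<eta> n x), t)"
proof -
  define F where "F = (\<lambda>((n, x), t). cell_class L ((n, \<eta> n x), t))"
  have glue: "F p = F q" if pq: "(p, q) \<in> cell_glue K" for p q
  proof -
    obtain m n \<theta> x t where 1: "p = ((m, SpxOp K m n \<theta> x), t)" "q = ((n, x), simplex_push m \<theta> t)"
      "\<theta> \<in> Delta m n" "x \<in> Spx K n" "t \<in> standard_simplex m"
      using pq unfolding cell_glue_def by blast
    then show ?thesis
      unfolding F_def by (simp add: \<eta> simplicial_set.cell_class_glue[OF L])
  qed
  have "F p = F q" if "q \<in> cell_class K p" for p q
  proof -
    have "(p, q) \<in> (cell_glue K \<union> (cell_glue K)\<inverse>)\<^sup>*" using that by (simp add: cell_class_def)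
    then show ?thesis by (induction rule: rtrancl_induct) (auto dest: glue)
  qed
  moreover have "(SOME p. p \<in> cell_class K ((n, x), t)) \<in> cell_class K ((n, x), t)"
    by (rule someI) (rule simplicial_set.cell_class_refl[OF K])
  ultimately have "F (SOME p. p \<in> cell_class K ((n, x), t)) = F ((n, x), t)" by metis
  then show ?thesis by (simp add: realization_map_def F_def split_beta)
qed

text \<open>Every point of a realization lies in the path component of a vertex, so bijectivity on
  path components can be read off on vertices, where \<open>pi0_rel\<close> describes the
  components.\<close>

theorem sset_weak_equivalence_pi0:
  assumes we: "sset_weak_equivalence K L \<eta>"
    and K: "simplicial_set K" and L: "simplicial_set L"
    and \<eta>: "\<And>n x. x \<in> Spx K n \<Longrightarrow> \<eta> n x \<in> Spx L n"
    "\<And>m n \<theta> x. \<theta> \<in> Delta m n \<Longrightarrow> x \<in> Spx K n \<Longrightarrow> \<eta> m (SpxOp K m n \<theta> x) = SpxOp L m n \<theta> (\<eta> n x)"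
  shows "\<And>v w. v \<in> Spx K 0 \<Longrightarrow> w \<in> Spx K 0 \<Longrightarrow> (\<eta> 0 v, \<eta> 0 w) \<in> pi0_rel L \<Longrightarrow> (v, w) \<in> pi0_rel K"
    and "\<And>y. y \<in> Spx L 0 \<Longrightarrow> \<exists>v\<in>Spx K 0. (\<eta> 0 v, y) \<in> pi0_rel L"
proof -
  let ?f = "realization_map L \<eta>"
  let ?c = "\<lambda>v. cell_class K ((0, v), origin)" and ?d = "\<lambda>v. cell_class L ((0, v), origin)"
  have f: "?f (?c v) = ?d (\<eta> 0 v)" if "v \<in> Spx K 0" for v
    using realization_map_class[OF K L \<eta> that] by (simp add: standard_simplex_0')
  have cont: "continuous_map (realization K) (realization L) ?f"
    and inj: "\<And>x x'. x \<in> topspace (realization K) \<Longrightarrow> x' \<in> topspace (realization K) \<Longrightarrow>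
      path_component_of (realization L) (?f x) (?f x') \<Longrightarrow> path_component_of (realization K) x x'"
    and surj: "\<And>y. y \<in> topspace (realization L) \<Longrightarrow>
      \<exists>x\<in>topspace (realization K). path_component_of (realization L) (?f x) y"
    using we unfolding sset_weak_equivalence_def weak_homotopy_equivalence_def by auto
  have top: "?c v \<in> topspace (realization K)" if "v \<in> Spx K 0" for v
    using that unfolding simplicial_set.topspace_realization[OF K] simplicial_set.topspace_cell_space[OF K]
    by (auto simp: standard_simplex_0')
  have topL: "?d v \<in> topspace (realization L)" if "v \<in> Spx L 0" for v
    using that unfolding simplicial_set.topspace_realization[OF L] simplicial_set.topspace_cell_space[OF L]
    by (auto simp: standard_simplex_0')
  fix v w assume v: "v \<in> Spx K 0" "w \<in> Spx K 0" "(\<eta> 0 v, \<eta> 0 w) \<in> pi0_rel L"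
  have "path_component_of (realization L) (?d (\<eta> 0 v)) (?d (\<eta> 0 w))"
    using simplicial_set.pi0_imp_path_component[OF L v(3)] \<eta>(1) v by blast
  then have "path_component_of (realization K) (?c v) (?c w)"
    using inj[OF top[OF v(1)] top[OF v(2)]] f v by simp
  then show "(v, w) \<in> pi0_rel K" using simplicial_set.path_component_imp_pi0[OF K] v by blast
next
  let ?f = "realization_map L \<eta>"
  let ?c = "\<lambda>v. cell_class K ((0, v), origin)" and ?d = "\<lambda>v. cell_class L ((0, v), origin)"
  fix y assume y: "y \<in> Spx L 0"
  have cont: "continuous_map (realization K) (realization L) ?f"
    and surj: "\<And>y. y \<in> topspace (realization L) \<Longrightarrow>
      \<exists>x\<in>topspace (realization K). path_component_of (realization L) (?f x) y"
    using we unfolding sset_weak_equivalence_def weak_homotopy_equivalence_def by auto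
  have "?d y \<in> topspace (realization L)"
    using y unfolding simplicial_set.topspace_realization[OF L] simplicial_set.topspace_cell_space[OF L]
    by (auto simp: standard_simplex_0')
  then obtain c where c: "c \<in> topspace (realization K)" "path_component_of (realization L) (?f c) (?d y)"
    using surj by blast
  obtain v where v: "v \<in> Spx K 0" "path_component_of (realization K) (?c v) c"
    using simplicial_set.realization_vertex[OF K c(1)] by blast
  have "path_component_of (realization L) (?f (?c v)) (?f c)"
    using path_component_of_continuous_image[OF cont v(2)] .
  then have "path_component_of (realization L) (?d (\<eta> 0 v)) (?d y)"
    using c(2) realization_map_class[OF K L \<eta> v(1)] path_component_of_trans by (fastforce simp: standard_simplex_0')
  then have "(\<eta> 0 v, y) \<in> pi0_rel L"
    using simplicial_set.path_component_imp_pi0[OF L] y v \<eta>(1) by blast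
  then show "\<exists>v\<in>Spx K 0. (\<eta> 0 v, y) \<in> pi0_rel L" using v by blast
qed

section \<open>Simplicial sheaves\<close>

definition pair_snd :: "('e, 'm) univ \<Rightarrow> ('e, 'm) univ" where
  "pair_snd v = (case v of Pair x y \<Rightarrow> y | _ \<Rightarrow> v)"

lemma pair_simps [simp]: "pair_fst (Pair x y) = x" "pair_snd (Pair x y) = y"
  by (simp_all add: pair_fst_def pair_snd_def)

lemma Val_psh_prod: "Val (psh_prod F G) a = {Pair x y | x y. x \<in> Val F a \<and> y \<in> Val G a}"
  by (simp add: psh_prod_def)

lemma Act_psh_prod [simp]: "Act (psh_prod F G) f (Pair x y) = Pair (Act F f x) (Act G f y)"
  by (simp add: psh_prod_def)

lemma psh_proj_eq: "psh_proj C F G = (psh_prod F G, nat_restrict C (psh_prod F G) (\<lambda>_. pair_fst), F)"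
  by (simp add: psh_proj_def nat_restrict_def)

lemma presheafI:
  assumes "\<And>f s. f \<in> Arr C \<Longrightarrow> s \<in> Val F (Cod C f) \<Longrightarrow> Act F f s \<in> Val F (Dom C f)"
    and "\<And>a s. a \<in> Obj C \<Longrightarrow> s \<in> Val F a \<Longrightarrow> Act F (Ide C a) s = s"
    and "\<And>f g s. f \<in> Arr C \<Longrightarrow> g \<in> Arr C \<Longrightarrow> Cod C f = Dom C g \<Longrightarrow> s \<in> Val F (Cod C g) \<Longrightarrow>
      Act F (Comp C g f) s = Act F f (Act F g s)"
  shows "presheaf C F"
  unfolding presheaf_def using assms by simp

lemma presheaf_psh_prod: "presheaf C F \<Longrightarrow> presheaf C G \<Longrightarrow> presheaf C (psh_prod F G)"
  by (rule presheafI) (auto simp: Val_psh_prod presheaf_act presheaf_ide presheaf_comp)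

lemma sheaf_glue:
  assumes "sheaf C J F" "a \<in> Obj C" "R \<in> J a" "matching_family C F R s"
  obtains x where "x \<in> Val F a" "\<And>f. f \<in> R \<Longrightarrow> Act F f x = s f"
    "\<And>y. y \<in> Val F a \<Longrightarrow> (\<And>f. f \<in> R \<Longrightarrow> Act F f y = s f) \<Longrightarrow> y = x"
proof -
  have "\<exists>!x. x \<in> Val F a \<and> (\<forall>f\<in>R. Act F f x = s f)"
    using assms unfolding sheaf_def by blast
  then show ?thesis using that by (elim ex1E) blast
qed

lemma sheafI:
  assumes "presheaf C F"
    and "\<And>a R s. a \<in> Obj C \<Longrightarrow> R \<in> J a \<Longrightarrow> matching_family C F R s \<Longrightarrow>
      \<exists>x. x \<in> Val F a \<and> (\<forall>f\<in>R. Act F f x = s f) \<and>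
        (\<forall>y. y \<in> Val F a \<and> (\<forall>f\<in>R. Act F f y = s f) \<longrightarrow> y = x)"
  shows "sheaf C J F"
  unfolding sheaf_def
proof (intro conjI ballI allI impI assms(1))
  fix a R s assume "a \<in> Obj C" "R \<in> J a" "matching_family C F R s"
  from assms(2)[OF this] show "\<exists>!x. x \<in> Val F a \<and> (\<forall>f\<in>R. Act F f x = s f)"
    unfolding Ex1_def conj_assoc .
qed

definition sub_psh :: "('o, 'm, 'v) psh \<Rightarrow> ('o \<Rightarrow> 'v set) \<Rightarrow> ('o, 'm, 'v) psh" where
  "sub_psh F E = \<lparr>Val = E, Act = Act F\<rparr>"

lemma sub_psh_simps [simp]: "Val (sub_psh F E) = E" "Act (sub_psh F E) = Act F"
  by (simp_all add: sub_psh_def)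

text \<open>Sections over one object form a simplicial set, which makes the calculus of vertices and
  edges available before passing to stalks.\<close>

definition sections_sset :: "('o, 'm, 'v) spsh \<Rightarrow> 'o \<Rightarrow> 'v sset" where
  "sections_sset Y a = \<lparr>Spx = (\<lambda>n. Val (Lev Y n) a), SpxOp = (\<lambda>m n \<theta>. LevOp Y m n \<theta> a)\<rparr>"

lemma simplicial_sheaf_Lev: "simplicial_sheaf C J Y \<Longrightarrow> sheaf C J (Lev Y n)"
  by (simp add: simplicial_sheaf_def)

lemma simplicial_sheaf_LevOp:
  "simplicial_sheaf C J Y \<Longrightarrow> \<theta> \<in> Delta m n \<Longrightarrow> nat_trans C (Lev Y n) (Lev Y m) (LevOp Y m n \<theta>)"
  by (simp add: simplicial_sheaf_def)

lemma simplicial_sheaf_presheaf: "simplicial_sheaf C J Y \<Longrightarrow> presheaf C (Lev Y n)"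
  by (simp add: simplicial_sheaf_def sheaf_def)

lemma simplicial_sheaf_ide:
  "simplicial_sheaf C J Y \<Longrightarrow> a \<in> Obj C \<Longrightarrow> s \<in> Val (Lev Y n) a \<Longrightarrow> LevOp Y n n (\<lambda>i\<in>{..n}. i) a s = s"
  unfolding simplicial_sheaf_def by blast

lemma simplicial_sheaf_comp:
  assumes "simplicial_sheaf C J Y" "\<theta> \<in> Delta k m" "\<phi> \<in> Delta m n" "a \<in> Obj C" "s \<in> Val (Lev Y n) a"
  shows "LevOp Y k n (compose {..k} \<phi> \<theta>) a s = LevOp Y k m \<theta> a (LevOp Y m n \<phi> a s)"
proof -
  have "\<forall>k m n. \<forall>\<theta>\<in>Delta k m. \<forall>\<phi>\<in>Delta m n. \<forall>a\<in>Obj C. \<forall>x\<in>Val (Lev Y n) a.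
        LevOp Y k n (compose {..k} \<phi> \<theta>) a x = LevOp Y k m \<theta> a (LevOp Y m n \<phi> a x)"
    using assms(1) unfolding simplicial_sheaf_def by (elim conjE)
  then show ?thesis using assms(2-5) by blast
qed

lemma simplicial_nat_trans_level: "simplicial_nat_trans C Y Z \<eta> \<Longrightarrow> nat_trans C (Lev Y n) (Lev Z n) (\<eta> n)"
  by (simp add: simplicial_nat_trans_def)

lemma simplicial_nat_trans_op:
  "simplicial_nat_trans C Y Z \<eta> \<Longrightarrow> \<theta> \<in> Delta m n \<Longrightarrow> a \<in> Obj C \<Longrightarrow> s \<in> Val (Lev Y n) a \<Longrightarrow>
    \<eta> m a (LevOp Y m n \<theta> a s) = LevOp Z m n \<theta> a (\<eta> n a s)"
  unfolding simplicial_nat_trans_def by blast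

lemma Lev_const [simp]: "Lev (const_simplicial C X) n = X"
  by (simp add: const_simplicial_def)

lemma LevOp_const [simp]:
  "a \<in> Obj C \<Longrightarrow> s \<in> Val X a \<Longrightarrow> LevOp (const_simplicial C X) m n \<theta> a s = s"
  by (simp add: const_simplicial_def)

lemma sections_simplicial_set:
  assumes Y: "simplicial_sheaf C J Y" and a: "a \<in> Obj C"
  shows "simplicial_set (sections_sset Y a)"
  unfolding simplicial_set_def sections_sset_def
  using nat_trans_in[OF simplicial_sheaf_LevOp[OF Y] a] simplicial_sheaf_comp[OF Y _ _ a]
    simplicial_sheaf_ide[OF Y a]
  by simp

lemma const_map_level:
  assumes "simplicial_sheaf C J Y" "simplicial_nat_trans C Y (const_simplicial C X) \<eta>" "a \<in> Obj C"
    "s \<in> Val (Lev Y n) a" "\<theta> \<in> Delta m n"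
  shows "\<eta> m a (LevOp Y m n \<theta> a s) = \<eta> n a s"
  using simplicial_nat_trans_op[OF assms(2,5,3,4)] nat_trans_in[OF simplicial_nat_trans_level[OF assms(2)] assms(3,4)]
    assms(3) by simp

text \<open>The operators of the target are identities, so the value at a simplex is the value at
  its vertex 0.\<close>

lemma const_map_ext:
  assumes Y: "simplicial_sheaf C J Y"
    and \<eta>: "simplicial_nat_trans C Y (const_simplicial C X) \<eta>"
    and \<epsilon>: "simplicial_nat_trans C Y (const_simplicial C X) \<epsilon>"
    and eq: "\<And>a s. a \<in> Obj C \<Longrightarrow> s \<in> Val (Lev Y 0) a \<Longrightarrow> \<eta> 0 a s = \<epsilon> 0 a s"
  shows "\<eta> = \<epsilon>"
proof
  fix n
  show "\<eta> n = \<epsilon> n"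
  proof (rule nat_trans_ext[OF simplicial_nat_trans_level[OF \<eta>] simplicial_nat_trans_level[OF \<epsilon>]])
    fix a s assume a: "a \<in> Obj C" "s \<in> Val (Lev Y n) a"
    have v: "vert 0 \<in> Delta 0 n" by simp
    have "LevOp Y 0 n (vert 0) a s \<in> Val (Lev Y 0) a"
      using nat_trans_in[OF simplicial_sheaf_LevOp[OF Y v]] a .
    then show "\<eta> n a s = \<epsilon> n a s"
      using const_map_level[OF Y \<eta> a v] const_map_level[OF Y \<epsilon> a v] eq a by simp
  qed
qed

context cat begin

text \<open>A matching family in \<open>E\<close> has a unique gluing in \<open>F\<close>; the
  premise \<open>local\<close> puts it into \<open>E\<close>.\<close>

lemma sub_sheaf:
  assumes F: "sheaf C J F"
    and sub: "\<And>a s. a \<in> Obj C \<Longrightarrow> s \<in> E a \<Longrightarrow> s \<in> Val F a"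
    and act: "\<And>f s. f \<in> Arr C \<Longrightarrow> s \<in> E (Cod C f) \<Longrightarrow> Act F f s \<in> E (Dom C f)"
    and local: "\<And>a R s. a \<in> Obj C \<Longrightarrow> R \<in> J a \<Longrightarrow> s \<in> Val F a \<Longrightarrow>
      (\<And>f. f \<in> R \<Longrightarrow> Act F f s \<in> E (Dom C f)) \<Longrightarrow> s \<in> E a"
    and J: "\<And>a R f. a \<in> Obj C \<Longrightarrow> R \<in> J a \<Longrightarrow> f \<in> R \<Longrightarrow> f \<in> Arr C"
  shows "sheaf C J (sub_psh F E)"
proof (rule sheafI)
  note P = sheaf_presheaf[OF F]
  show "presheaf C (sub_psh F E)"
  proof (rule presheafI)
    fix f s assume "f \<in> Arr C" "s \<in> Val (sub_psh F E) (Cod C f)"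
    then show "Act (sub_psh F E) f s \<in> Val (sub_psh F E) (Dom C f)" using act by simp
  next
    fix a s assume "a \<in> Obj C" "s \<in> Val (sub_psh F E) a"
    then show "Act (sub_psh F E) (Ide C a) s = s" using presheaf_ide[OF P] sub by simp
  next
    fix f g s assume "f \<in> Arr C" "g \<in> Arr C" "Cod C f = Dom C g" "s \<in> Val (sub_psh F E) (Cod C g)"
    then show "Act (sub_psh F E) (Comp C g f) s = Act (sub_psh F E) f (Act (sub_psh F E) g s)"
      using presheaf_comp[OF P] sub by simp
  qed
next
  fix a R s assume a: "a \<in> Obj C" "R \<in> J a" and m: "matching_family C (sub_psh F E) R s"
  have s: "s f \<in> E (Dom C f)" "s f \<in> Val F (Dom C f)" if "f \<in> R" for f
    using m that sub[OF dom_obj[OF J[OF a that]]] unfolding matching_family_def by auto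
  then have "matching_family C F R s" using m unfolding matching_family_def by simp
  then obtain x where x: "x \<in> Val F a" "\<And>f. f \<in> R \<Longrightarrow> Act F f x = s f"
    "\<And>y. y \<in> Val F a \<Longrightarrow> (\<And>f. f \<in> R \<Longrightarrow> Act F f y = s f) \<Longrightarrow> y = x"
    using sheaf_glue[OF F a] by blast
  have "x \<in> E a" by (rule local[OF a x(1)]) (simp add: x(2) s(1))
  then show "\<exists>x. x \<in> Val (sub_psh F E) a \<and> (\<forall>f\<in>R. Act (sub_psh F E) f x = s f) \<and>
    (\<forall>y. y \<in> Val (sub_psh F E) a \<and> (\<forall>f\<in>R. Act (sub_psh F E) f y = s f) \<longrightarrow> y = x)"
    unfolding sub_psh_simps using \<open>x \<in> E a\<close> x(2) x(3)[OF sub[OF a(1)]] by blast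
qed

lemma sheaf_psh_prod:
  assumes F: "sheaf C J F" and G: "sheaf C J G"
  shows "sheaf C J (psh_prod F G)"
proof (intro sheafI presheaf_psh_prod sheaf_presheaf[OF F] sheaf_presheaf[OF G])
  fix a R s assume a: "a \<in> Obj C" "R \<in> J a" and m: "matching_family C (psh_prod F G) R s"
  define s1 where "s1 f = pair_fst (s f)" for f
  define s2 where "s2 f = pair_snd (s f)" for f
  have s: "s f = Pair (s1 f) (s2 f)" "s1 f \<in> Val F (Dom C f)" "s2 f \<in> Val G (Dom C f)" if "f \<in> R" for f
    using m that unfolding matching_family_def s1_def s2_def by (auto simp: Val_psh_prod)
  have act: "Act F h (s1 f) = s1 (Comp C f h)" "Act G h (s2 f) = s2 (Comp C f h)"
    if "f \<in> R" "h \<in> arrows_to C (Dom C f)" for f h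
  proof -
    have "Act (psh_prod F G) h (s f) = s (Comp C f h)" using m that unfolding matching_family_def by blast
    then have "Pair (Act F h (s1 f)) (Act G h (s2 f)) = s (Comp C f h)" by (simp add: s(1)[OF that(1)])
    then show "Act F h (s1 f) = s1 (Comp C f h)" "Act G h (s2 f) = s2 (Comp C f h)"
      by (metis pair_simps s1_def, metis pair_simps s2_def)
  qed
  have "matching_family C F R s1" "matching_family C G R s2"
    unfolding matching_family_def using s(2,3) act by simp_all
  obtain x where x: "x \<in> Val F a" "\<And>f. f \<in> R \<Longrightarrow> Act F f x = s1 f"
    "\<And>y. y \<in> Val F a \<Longrightarrow> (\<And>f. f \<in> R \<Longrightarrow> Act F f y = s1 f) \<Longrightarrow> y = x"
    using sheaf_glue[OF F a \<open>matching_family C F R s1\<close>] by blast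
  obtain y where y: "y \<in> Val G a" "\<And>f. f \<in> R \<Longrightarrow> Act G f y = s2 f"
    "\<And>z. z \<in> Val G a \<Longrightarrow> (\<And>f. f \<in> R \<Longrightarrow> Act G f z = s2 f) \<Longrightarrow> z = y"
    using sheaf_glue[OF G a \<open>matching_family C G R s2\<close>] by blast
  have "v = Pair x y" if v: "v \<in> Val (psh_prod F G) a" "\<forall>f\<in>R. Act (psh_prod F G) f v = s f" for v
  proof -
    obtain x' y' where v': "v = Pair x' y'" "x' \<in> Val F a" "y' \<in> Val G a"
      using v(1) by (auto simp: Val_psh_prod)
    then have "Pair (Act F f x') (Act G f y') = Pair (s1 f) (s2 f)" if "f \<in> R" for f
      using v(2) that unfolding s(1)[OF that, symmetric] by simp
    then have "Act F f x' = s1 f \<and> Act G f y' = s2 f" if "f \<in> R" for f using that by simp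
    then show "v = Pair x y" using x(3)[OF v'(2)] y(3)[OF v'(3)] v'(1) by simp
  qed
  moreover have "Pair x y \<in> Val (psh_prod F G) a" "\<forall>f\<in>R. Act (psh_prod F G) f (Pair x y) = s f"
    using x(1,2) y(1,2) s(1) by (simp_all add: Val_psh_prod)
  ultimately show "\<exists>v. v \<in> Val (psh_prod F G) a \<and> (\<forall>f\<in>R. Act (psh_prod F G) f v = s f) \<and>
    (\<forall>w. w \<in> Val (psh_prod F G) a \<and> (\<forall>f\<in>R. Act (psh_prod F G) f w = s f) \<longrightarrow> w = v)"
    by blast
qed

lemma sheaf_eqI:
  assumes "sheaf C J F" "a \<in> Obj C" "R \<in> J a" "sieve C a R" "s \<in> Val F a" "t \<in> Val F a"
    and eq: "\<And>f. f \<in> R \<Longrightarrow> Act F f s = Act F f t"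
  shows "s = t"
proof -
  have R: "f \<in> Arr C" "Cod C f = a" if "f \<in> R" for f
    using assms(4) that by (auto simp: sieve_def arrows_to_def)
  have "matching_family C F R (\<lambda>f. Act F f s)"
    unfolding matching_family_def arrows_to_def using assms(5) R sheaf_presheaf[OF assms(1)]
    by (simp add: presheaf_act presheaf_comp)
  then show ?thesis
    using sheaf_glue[OF assms(1-3)] assms(5,6) eq by metis
qed

text \<open>By \<open>const_map_ext\<close> the value at vertex 0 is the only candidate; the premise
  on edges makes it independent of the vertex and hence compatible with the operators.\<close>

lemma const_map_extend:
  assumes Y: "simplicial_sheaf C J Y" and \<phi>: "nat_trans C (Lev Y 0) X \<phi>"
    and edge: "\<And>a e. a \<in> Obj C \<Longrightarrow> e \<in> Val (Lev Y 1) a \<Longrightarrow>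
      \<phi> a (LevOp Y 0 1 (vert 0) a e) = \<phi> a (LevOp Y 0 1 (vert 1) a e)"
  defines "\<psi> \<equiv> \<lambda>n. nat_restrict C (Lev Y n) (\<lambda>a s. \<phi> a (LevOp Y 0 n (vert 0) a s))"
  shows "simplicial_nat_trans C Y (const_simplicial C X) \<psi>" and "\<psi> 0 = \<phi>"
proof -
  have P: "presheaf C (Lev Y n)" for n using simplicial_sheaf_presheaf[OF Y] .
  have vert: "nat_trans C (Lev Y n) (Lev Y 0) (LevOp Y 0 n (vert 0))" for n
    by (rule simplicial_sheaf_LevOp[OF Y]) simp
  have nt: "nat_trans C (Lev Y n) X (\<psi> n)" for n
    unfolding \<psi>_def by (rule nat_trans_comp[OF P vert \<phi>])
  show "simplicial_nat_trans C Y (const_simplicial C X) \<psi>"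
    unfolding simplicial_nat_trans_def Lev_const
  proof (intro conjI allI ballI nt)
    fix m n \<theta> a s assume \<theta>: "\<theta> \<in> Delta m n" and a: "a \<in> Obj C" "s \<in> Val (Lev Y n) a"
    interpret simplicial_set "sections_sset Y a" by (rule sections_simplicial_set[OF Y a(1)])
    have s: "s \<in> Spx (sections_sset Y a) n" using a by (simp add: sections_sset_def)
    have \<theta>0: "\<theta> 0 \<le> n" using \<theta> by (auto simp: Delta_def)
    have in_m: "LevOp Y m n \<theta> a s \<in> Val (Lev Y m) a"
      using nat_trans_in[OF simplicial_sheaf_LevOp[OF Y \<theta>] a] .
    have "\<psi> m a (LevOp Y m n \<theta> a s) = \<phi> a (vertex m 0 (SpxOp (sections_sset Y a) m n \<theta> s))"
      unfolding \<psi>_def using a in_m by (simp add: sections_sset_def)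
    also have "\<dots> = \<phi> a (vertex n (\<theta> 0) s)" using vertex_op[OF \<theta> s] by simp
    \<comment> \<open>\<theta> may send 0 to a vertex other than 0; the edge of \<open>s\<close>
      between these two vertices repairs this.\<close>
    also have "\<dots> = \<phi> a (vertex n 0 s)"
      using vertex_connected[OF s, of 0 "\<theta> 0"] \<theta>0 edge[OF a(1)]
      by (auto simp: edge_rel_def sections_sset_def)
    also have "\<dots> = \<psi> n a s" unfolding \<psi>_def using a by (simp add: sections_sset_def)
    finally show "\<psi> m a (LevOp Y m n \<theta> a s) = LevOp (const_simplicial C X) m n \<theta> a (\<psi> n a s)"
      using nat_trans_in[OF nt a] a by simp
  qed
  show "\<psi> 0 = \<phi>"
  proof (rule nat_trans_ext[OF nt \<phi>])
    fix a s assume a: "a \<in> Obj C" "s \<in> Val (Lev Y 0) a"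
    interpret simplicial_set "sections_sset Y a" by (rule sections_simplicial_set[OF Y a(1)])
    show "\<psi> 0 a s = \<phi> a s"
      unfolding \<psi>_def using vertex_0[of s] a by (simp add: sections_sset_def)
  qed
qed

lemma const_simplicial_sheaf: "sheaf C J X \<Longrightarrow> simplicial_sheaf C J (const_simplicial C X)"
proof -
  assume X: "sheaf C J X"
  have "nat_trans C X X (nat_restrict C X (\<lambda>a s. s))"
    using sheaf_presheaf[OF X] by (intro nat_transI) (auto simp: presheaf_act)
  then show ?thesis
    using X unfolding simplicial_sheaf_def by (simp add: const_simplicial_def nat_restrict_def)
qed

lemma sheaf_cat_simps [simp]:
  "Obj (sheaf_cat C J) = {F. sheaf C J F}"
  "Arr (sheaf_cat C J) = {(F, \<eta>, G). sheaf C J F \<and> sheaf C J G \<and> nat_trans C F G \<eta>}"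
  "Dom (sheaf_cat C J) (F, \<eta>, G) = F" "Cod (sheaf_cat C J) (F, \<eta>, G) = G"
  "Comp (sheaf_cat C J) (G', \<epsilon>, H) (F, \<eta>, G) = (F, nat_restrict C F (\<lambda>a s. \<epsilon> a (\<eta> a s)), H)"
  by (simp_all add: sheaf_cat_def nat_restrict_def)

lemma hom_sheaf_cat:
  "hom_set (sheaf_cat C J) F G = {(F, \<eta>, G) | \<eta>. sheaf C J F \<and> sheaf C J G \<and> nat_trans C F G \<eta>}"
  by (auto simp: hom_set_def)

lemma simplicial_sheaf_cat_simps [simp]:
  "Obj (simplicial_sheaf_cat C J) = {X. simplicial_sheaf C J X}"
  "Arr (simplicial_sheaf_cat C J) =
    {(X, \<eta>, Y). simplicial_sheaf C J X \<and> simplicial_sheaf C J Y \<and> simplicial_nat_trans C X Y \<eta>}"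
  "Dom (simplicial_sheaf_cat C J) (X, \<eta>, Y) = X" "Cod (simplicial_sheaf_cat C J) (X, \<eta>, Y) = Y"
  "Ide (simplicial_sheaf_cat C J) X = (X, \<lambda>n. nat_restrict C (Lev X n) (\<lambda>a s. s), X)"
  "Comp (simplicial_sheaf_cat C J) (Y', \<epsilon>, Z) (X, \<eta>, Y) =
     (X, \<lambda>n. nat_restrict C (Lev X n) (\<lambda>a s. \<epsilon> n a (\<eta> n a s)), Z)"
  by (simp_all add: simplicial_sheaf_cat_def nat_restrict_def)

lemma hom_simplicial_sheaf_cat:
  "hom_set (simplicial_sheaf_cat C J) X Y =
    {(X, \<eta>, Y) | \<eta>. simplicial_sheaf C J X \<and> simplicial_sheaf C J Y \<and> simplicial_nat_trans C X Y \<eta>}"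
  by (auto simp: hom_set_def)

lemma simplicial_nat_trans_comp:
  assumes X: "simplicial_sheaf C J X"
    and \<eta>: "simplicial_nat_trans C X Y \<eta>" and \<epsilon>: "simplicial_nat_trans C Y Z \<epsilon>"
  shows "simplicial_nat_trans C X Z (\<lambda>n. nat_restrict C (Lev X n) (\<lambda>a s. \<epsilon> n a (\<eta> n a s)))"
  unfolding simplicial_nat_trans_def
proof (intro conjI allI ballI)
  fix n show "nat_trans C (Lev X n) (Lev Z n) (nat_restrict C (Lev X n) (\<lambda>a s. \<epsilon> n a (\<eta> n a s)))"
    by (rule nat_trans_comp[OF simplicial_sheaf_presheaf[OF X] simplicial_nat_trans_level[OF \<eta>]
          simplicial_nat_trans_level[OF \<epsilon>]])
next
  fix m n \<theta> a s assume a: "\<theta> \<in> Delta m n" "a \<in> Obj C" "s \<in> Val (Lev X n) a"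
  have "LevOp X m n \<theta> a s \<in> Val (Lev X m) a" "\<eta> n a s \<in> Val (Lev Y n) a"
    using nat_trans_in[OF simplicial_sheaf_LevOp[OF X a(1)] a(2,3)]
      nat_trans_in[OF simplicial_nat_trans_level[OF \<eta>] a(2,3)] by auto
  then show "nat_restrict C (Lev X m) (\<lambda>a s. \<epsilon> m a (\<eta> m a s)) a (LevOp X m n \<theta> a s) =
       LevOp Z m n \<theta> a (nat_restrict C (Lev X n) (\<lambda>a s. \<epsilon> n a (\<eta> n a s)) a s)"
    using a simplicial_nat_trans_op[OF \<eta> a] simplicial_nat_trans_op[OF \<epsilon> a(1,2)] by simp
qed

lemma simplicial_nat_trans_ide:
  assumes X: "simplicial_sheaf C J X"
  shows "simplicial_nat_trans C X X (\<lambda>n. nat_restrict C (Lev X n) (\<lambda>a s. s))"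
  unfolding simplicial_nat_trans_def
proof (intro conjI allI ballI)
  fix n show "nat_trans C (Lev X n) (Lev X n) (nat_restrict C (Lev X n) (\<lambda>a s. s))"
    by (rule nat_transI[OF simplicial_sheaf_presheaf[OF X]])
      (simp_all add: presheaf_act[OF simplicial_sheaf_presheaf[OF X]])
next
  fix m n \<theta> a s assume a: "\<theta> \<in> Delta m n" "a \<in> Obj C" "s \<in> Val (Lev X n) a"
  have "LevOp X m n \<theta> a s \<in> Val (Lev X m) a"
    using nat_trans_in[OF simplicial_sheaf_LevOp[OF X a(1)] a(2,3)] .
  then show "nat_restrict C (Lev X m) (\<lambda>a s. s) a (LevOp X m n \<theta> a s) =
       LevOp X m n \<theta> a (nat_restrict C (Lev X n) (\<lambda>a s. s) a s)"
    using a by simp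
qed

lemma simplicial_nat_trans_restrict:
  "simplicial_nat_trans C X Y \<eta> \<Longrightarrow> nat_restrict C (Lev X n) (\<eta> n) = \<eta> n"
  by (rule nat_restrict_nat_trans[OF simplicial_nat_trans_level])

lemma cat_simplicial_sheaf_cat: "cat (simplicial_sheaf_cat C J)"
proof unfold_locales
  fix f g h assume "f \<in> Arr (simplicial_sheaf_cat C J)" "g \<in> Arr (simplicial_sheaf_cat C J)"
    "h \<in> Arr (simplicial_sheaf_cat C J)"
    "Cod (simplicial_sheaf_cat C J) f = Dom (simplicial_sheaf_cat C J) g"
    "Cod (simplicial_sheaf_cat C J) g = Dom (simplicial_sheaf_cat C J) h"
  then obtain X \<eta> Y \<epsilon> Z \<delta> Z' where "f = (X, \<eta>, Y)" "g = (Y, \<epsilon>, Z)" "h = (Z, \<delta>, Z')"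
     "simplicial_nat_trans C X Y \<eta>" by auto
  then show "Comp (simplicial_sheaf_cat C J) (Comp (simplicial_sheaf_cat C J) h g) f =
    Comp (simplicial_sheaf_cat C J) h (Comp (simplicial_sheaf_cat C J) g f)"
    by (auto simp: fun_eq_iff nat_trans_in[OF simplicial_nat_trans_level]
        intro!: nat_restrict_cong[THEN fun_cong, THEN fun_cong])
next
  fix f a assume "f \<in> Arr (simplicial_sheaf_cat C J)" "Dom (simplicial_sheaf_cat C J) f = a"
  then obtain \<eta> Y where f: "f = (a, \<eta>, Y)" "simplicial_nat_trans C a Y \<eta>" by auto
  have "nat_restrict C (Lev a n) (\<lambda>b s. \<eta> n b (nat_restrict C (Lev a n) (\<lambda>a s. s) b s)) =
    nat_restrict C (Lev a n) (\<eta> n)" for n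
    by (rule nat_restrict_cong) simp
  then show "Comp (simplicial_sheaf_cat C J) f (Ide (simplicial_sheaf_cat C J) a) = f"
    using f by (simp add: simplicial_nat_trans_restrict)
next
  fix f a assume "f \<in> Arr (simplicial_sheaf_cat C J)" "Cod (simplicial_sheaf_cat C J) f = a"
  then obtain \<eta> Y where f: "f = (Y, \<eta>, a)" "simplicial_nat_trans C Y a \<eta>" by auto
  have "nat_restrict C (Lev Y n) (\<lambda>b s. nat_restrict C (Lev a n) (\<lambda>a s. s) b (\<eta> n b s)) =
    nat_restrict C (Lev Y n) (\<eta> n)" for n
    by (rule nat_restrict_cong) (simp add: nat_trans_in[OF simplicial_nat_trans_level[OF f(2)]])
  then show "Comp (simplicial_sheaf_cat C J) (Ide (simplicial_sheaf_cat C J) a) f = f"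
    using f by (simp add: simplicial_nat_trans_restrict)
qed (auto intro: simplicial_nat_trans_ide simplicial_nat_trans_comp)

end

section \<open>Weak equivalences and maps into sheaves\<close>

context point begin

section \<open>Components of the simplicial sets of germs\<close>

lemma SpxOp_stalk_germ:
  assumes "simplicial_sheaf C J Y" "\<theta> \<in> Delta m n" "a \<in> Obj C" "x \<in> fst u a" "s \<in> Val (Lev Y n) a"
  shows "SpxOp (simplicial_stalk C Y u) m n \<theta> (germ_at (Lev Y n) a x s) =
    germ_at (Lev Y m) a x (LevOp Y m n \<theta> a s)"
  unfolding simplicial_stalk_def sset.simps
  by (rule psh_stalk_map_germ[OF simplicial_sheaf_presheaf[OF assms(1)] simplicial_sheaf_presheaf[OF assms(1)]
        simplicial_sheaf_LevOp[OF assms(1,2)] assms(3-5)])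

lemma Spx_stalk [simp]: "Spx (simplicial_stalk C Y u) n = psh_stalk C (Lev Y n) u"
  by (simp add: simplicial_stalk_def)

lemma stalk_simplicial_set:
  assumes Y: "simplicial_sheaf C J Y"
  shows "simplicial_set (simplicial_stalk C Y u)"
proof
  fix \<theta> m n p assume \<theta>: "\<theta> \<in> Delta m n" and "p \<in> Spx (simplicial_stalk C Y u) n"
  then obtain a x s where p: "a \<in> Obj C" "x \<in> fst u a" "s \<in> Val (Lev Y n) a" "p = germ_at (Lev Y n) a x s"
    by (auto elim: psh_stalkE)
  then show "SpxOp (simplicial_stalk C Y u) m n \<theta> p \<in> Spx (simplicial_stalk C Y u) m"
    using nat_trans_in[OF simplicial_sheaf_LevOp[OF Y \<theta>] p(1,3)]
    by (simp add: SpxOp_stalk_germ[OF Y \<theta>] psh_stalkI)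
next
  fix \<theta> k m \<phi> n p assume \<theta>: "\<theta> \<in> Delta k m" and \<phi>: "\<phi> \<in> Delta m n" and "p \<in> Spx (simplicial_stalk C Y u) n"
  then obtain a x s where p: "a \<in> Obj C" "x \<in> fst u a" "s \<in> Val (Lev Y n) a" "p = germ_at (Lev Y n) a x s"
    by (auto elim: psh_stalkE)
  have comp: "compose {..k} \<phi> \<theta> \<in> Delta k n"
    using \<theta> \<phi> by (auto simp: Delta_def compose_def mono_on_def PiE_def Pi_iff)
  show "SpxOp (simplicial_stalk C Y u) k n (compose {..k} \<phi> \<theta>) p =
    SpxOp (simplicial_stalk C Y u) k m \<theta> (SpxOp (simplicial_stalk C Y u) m n \<phi> p)"
    using p nat_trans_in[OF simplicial_sheaf_LevOp[OF Y \<phi>] p(1,3)]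
    by (simp add: SpxOp_stalk_germ[OF Y] comp \<theta> \<phi> simplicial_sheaf_comp[OF Y \<theta> \<phi>])
next
  fix p n assume "p \<in> Spx (simplicial_stalk C Y u) n"
  then obtain a x s where p: "a \<in> Obj C" "x \<in> fst u a" "s \<in> Val (Lev Y n) a" "p = germ_at (Lev Y n) a x s"
    by (auto elim: psh_stalkE)
  have "(\<lambda>i\<in>{..n}. i) \<in> Delta n n" by (auto simp: Delta_def mono_on_def)
  then show "SpxOp (simplicial_stalk C Y u) n n (\<lambda>i\<in>{..n}. i) p = p"
    using p by (simp add: SpxOp_stalk_germ[OF Y] simplicial_sheaf_ide[OF Y])
qed

text \<open>On germs \<eta> induces a function \<open>F\<close> of vertices. Both ends of an edge
  are sent to the germ of the value of \<eta> at the edge itself, so \<open>F\<close> is constant on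
  components.\<close>

lemma const_map_pi0:
  assumes Y: "simplicial_sheaf C J Y" and X: "sheaf C J X"
    and \<eta>: "simplicial_nat_trans C Y (const_simplicial C X) \<eta>"
    and a: "a \<in> Obj C" "x \<in> fst u a" "s \<in> Val (Lev Y 0) a"
    and b: "b \<in> Obj C" "y \<in> fst u b" "t \<in> Val (Lev Y 0) b"
    and rel: "(germ_at (Lev Y 0) a x s, germ_at (Lev Y 0) b y t) \<in> pi0_rel (simplicial_stalk C Y u)"
  shows "germ_at X a x (\<eta> 0 a s) = germ_at X b y (\<eta> 0 b t)"
proof -
  define F where "F = psh_stalk_map C X u (\<eta> 0)"
  note PY = simplicial_sheaf_presheaf[OF Y] and PX = sheaf_presheaf[OF X]
  have nt: "nat_trans C (Lev Y 0) X (\<eta> 0)" using simplicial_nat_trans_level[OF \<eta>, of 0] by simp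
  have F: "F (germ_at (Lev Y 0) a x s) = germ_at X a x (\<eta> 0 a s)"
    if "a \<in> Obj C" "x \<in> fst u a" "s \<in> Val (Lev Y 0) a" for a x s
    unfolding F_def by (rule psh_stalk_map_germ[OF PY PX nt that])
  have edge: "F p = F q" if pq: "(p, q) \<in> edge_rel (simplicial_stalk C Y u)" for p q
  proof -
    obtain c z e where e: "c \<in> Obj C" "z \<in> fst u c" "e \<in> Val (Lev Y 1) c"
      "p = SpxOp (simplicial_stalk C Y u) 0 1 (vert 0) (germ_at (Lev Y 1) c z e)"
      "q = SpxOp (simplicial_stalk C Y u) 0 1 (vert 1) (germ_at (Lev Y 1) c z e)"
      using pq unfolding edge_rel_def by (auto elim: psh_stalkE)
    have "F (SpxOp (simplicial_stalk C Y u) 0 1 (vert i) (germ_at (Lev Y 1) c z e)) = germ_at X c z (\<eta> 1 c e)"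
      if "i \<le> 1" for i
      using const_map_level[OF Y \<eta> e(1,3) vert_Delta[OF that]]
        nat_trans_in[OF simplicial_sheaf_LevOp[OF Y vert_Delta[OF that]] e(1,3)]
      by (simp add: SpxOp_stalk_germ[OF Y vert_Delta[OF that] e(1-3)] F e(1,2) del: One_nat_def)
    then show ?thesis using e(4,5) by simp
  qed
  have "F p = F q" if "(p, q) \<in> pi0_rel (simplicial_stalk C Y u)" for p q
    using that unfolding pi0_rel_def by (induction rule: rtrancl_induct) (auto dest: edge)
  from this[OF rel] show ?thesis unfolding F[OF a] F[OF b] .
qed

text \<open>Rewrites \<open>sset_weak_equivalence_pi0\<close> in terms of sections representing the
  germs, the form in which both halves of the bijectivity argument use it.\<close>

lemma weak_equivalence_pi0:
  assumes Y: "simplicial_sheaf C J Y" and Y': "simplicial_sheaf C J Y'"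
    and w: "simplicial_nat_trans C Y Y' w"
    and we: "sset_weak_equivalence (simplicial_stalk C Y u) (simplicial_stalk C Y' u)
            (\<lambda>n. psh_stalk_map C (Lev Y' n) u (w n))"
  shows "\<And>a x s b y t. a \<in> Obj C \<Longrightarrow> x \<in> fst u a \<Longrightarrow> s \<in> Val (Lev Y 0) a \<Longrightarrow>
      b \<in> Obj C \<Longrightarrow> y \<in> fst u b \<Longrightarrow> t \<in> Val (Lev Y 0) b \<Longrightarrow>
      (germ_at (Lev Y' 0) a x (w 0 a s), germ_at (Lev Y' 0) b y (w 0 b t)) \<in> pi0_rel (simplicial_stalk C Y' u) \<Longrightarrow>
      (germ_at (Lev Y 0) a x s, germ_at (Lev Y 0) b y t) \<in> pi0_rel (simplicial_stalk C Y u)"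
    and "\<And>b y t. b \<in> Obj C \<Longrightarrow> y \<in> fst u b \<Longrightarrow> t \<in> Val (Lev Y' 0) b \<Longrightarrow>
      \<exists>a x s. a \<in> Obj C \<and> x \<in> fst u a \<and> s \<in> Val (Lev Y 0) a \<and>
        (germ_at (Lev Y' 0) a x (w 0 a s), germ_at (Lev Y' 0) b y t) \<in> pi0_rel (simplicial_stalk C Y' u)"
proof -
  let ?K = "simplicial_stalk C Y u" and ?L = "simplicial_stalk C Y' u"
  let ?w = "\<lambda>n. psh_stalk_map C (Lev Y' n) u (w n)"
  have map: "?w n (germ_at (Lev Y n) a x s) = germ_at (Lev Y' n) a x (w n a s)"
    if "a \<in> Obj C" "x \<in> fst u a" "s \<in> Val (Lev Y n) a" for n a x s
    by (rule psh_stalk_map_germ[OF simplicial_sheaf_presheaf[OF Y] simplicial_sheaf_presheaf[OF Y']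
          simplicial_nat_trans_level[OF w] that])
  have w_in: "w n a s \<in> Val (Lev Y' n) a" if "a \<in> Obj C" "s \<in> Val (Lev Y n) a" for n a s
    by (rule nat_trans_in[OF simplicial_nat_trans_level[OF w] that])
  have 1: "?w n p \<in> Spx ?L n" if "p \<in> Spx ?K n" for n p
  proof -
    obtain a x s where p: "a \<in> Obj C" "x \<in> fst u a" "s \<in> Val (Lev Y n) a" "p = germ_at (Lev Y n) a x s"
      using \<open>p \<in> Spx ?K n\<close> by (auto elim: psh_stalkE)
    then show ?thesis by (simp add: map w_in psh_stalkI)
  qed
  have 2: "?w m (SpxOp ?K m n \<theta> p) = SpxOp ?L m n \<theta> (?w n p)" if \<theta>: "\<theta> \<in> Delta m n" and p: "p \<in> Spx ?K n" for m n \<theta> p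
  proof -
    obtain a x s where a: "a \<in> Obj C" "x \<in> fst u a" "s \<in> Val (Lev Y n) a" "p = germ_at (Lev Y n) a x s"
      using p by (auto elim: psh_stalkE)
    then show ?thesis
      using nat_trans_in[OF simplicial_sheaf_LevOp[OF Y \<theta>] a(1,3)] simplicial_nat_trans_op[OF w \<theta> a(1,3)]
      by (simp add: map w_in SpxOp_stalk_germ[OF Y \<theta>] SpxOp_stalk_germ[OF Y' \<theta>])
  qed
  note pi0 = sset_weak_equivalence_pi0[OF we stalk_simplicial_set[OF Y] stalk_simplicial_set[OF Y']]
  show "(germ_at (Lev Y 0) a x s, germ_at (Lev Y 0) b y t) \<in> pi0_rel ?K"
    if "a \<in> Obj C" "x \<in> fst u a" "s \<in> Val (Lev Y 0) a" "b \<in> Obj C" "y \<in> fst u b" "t \<in> Val (Lev Y 0) b"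
      "(germ_at (Lev Y' 0) a x (w 0 a s), germ_at (Lev Y' 0) b y (w 0 b t)) \<in> pi0_rel ?L" for a x s b y t
    by (rule pi0(1)[OF 1 2]) (use that in \<open>simp_all add: map psh_stalkI\<close>)
  show "\<exists>a x s. a \<in> Obj C \<and> x \<in> fst u a \<and> s \<in> Val (Lev Y 0) a \<and>
        (germ_at (Lev Y' 0) a x (w 0 a s), germ_at (Lev Y' 0) b y t) \<in> pi0_rel ?L"
    if b: "b \<in> Obj C" "y \<in> fst u b" "t \<in> Val (Lev Y' 0) b" for b y t
  proof -
    have "germ_at (Lev Y' 0) b y t \<in> Spx ?L 0" using b by (simp add: psh_stalkI)
    then have "\<exists>v\<in>Spx ?K 0. (?w 0 v, germ_at (Lev Y' 0) b y t) \<in> pi0_rel ?L"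
      by - (rule pi0(2)[OF 1 2])
    then obtain v where v: "v \<in> psh_stalk C (Lev Y 0) u"
      "(?w 0 v, germ_at (Lev Y' 0) b y t) \<in> pi0_rel ?L" by auto
    then obtain a x s where a: "a \<in> Obj C" "x \<in> fst u a" "s \<in> Val (Lev Y 0) a" "v = germ_at (Lev Y 0) a x s"
      by (auto elim: psh_stalkE)
    show ?thesis using v(2) unfolding a(4) map[OF a(1-3)] using a by blast
  qed
qed

text \<open>Injectivity may be tested on sections over one object whose images agree on the nose: an
  equality of germs in \<open>G\<close> is an equality of sections on some refinement, to which both
  sections are restricted.\<close>

lemma psh_stalk_map_bijI:
  assumes F: "presheaf C F" and G: "presheaf C G" and \<eta>: "nat_trans C F G \<eta>"
    and inj: "\<And>a x s t. a \<in> Obj C \<Longrightarrow> x \<in> fst u a \<Longrightarrow> s \<in> Val F a \<Longrightarrow> t \<in> Val F a \<Longrightarrow> \<eta> a s = \<eta> a t \<Longrightarrow>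
      germ_at F a x s = germ_at F a x t"
    and surj: "\<And>a x t. a \<in> Obj C \<Longrightarrow> x \<in> fst u a \<Longrightarrow> t \<in> Val G a \<Longrightarrow>
      \<exists>b y s. b \<in> Obj C \<and> y \<in> fst u b \<and> s \<in> Val F b \<and> germ_at G b y (\<eta> b s) = germ_at G a x t"
  shows "bij_betw (psh_stalk_map C G u \<eta>) (psh_stalk C F u) (psh_stalk C G u)"
proof (rule bij_betw_imageI)
  note map = psh_stalk_map_germ[OF F G \<eta>]
  show "inj_on (psh_stalk_map C G u \<eta>) (psh_stalk C F u)"
  proof (rule inj_onI)
    fix p q assume "p \<in> psh_stalk C F u" "q \<in> psh_stalk C F u" and eq: "psh_stalk_map C G u \<eta> p = psh_stalk_map C G u \<eta> q"
    then obtain a x s b y t where a: "a \<in> Obj C" "x \<in> fst u a" "s \<in> Val F a" "p = germ_at F a x s"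
      and b: "b \<in> Obj C" "y \<in> fst u b" "t \<in> Val F b" "q = germ_at F b y t"
      by (metis psh_stalkE)
    have "germ_at G a x (\<eta> a s) = germ_at G b y (\<eta> b t)" using eq a b by (simp add: map)
    then obtain f g z where f: "f \<in> Arr C" "g \<in> Arr C" "Dom C f = Dom C g" "Cod C f = a"
       "Cod C g = b" "z \<in> fst u (Dom C g)" "snd u f z = x" "snd u g z = y" "Act G f (\<eta> a s) = Act G g (\<eta> b t)"
      using germ_at_eqE[OF G a(1,2) nat_trans_in[OF \<eta> a(1,3)] b(1,2) nat_trans_in[OF \<eta> b(1,3)]] by metis
    have eq: "\<eta> (Dom C g) (Act F f s) = \<eta> (Dom C g) (Act F g t)"
      using nat_trans_act[OF \<eta> f(1)] nat_trans_act[OF \<eta> f(2)] f a b by simp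
    have "germ_at F (Dom C g) z (Act F f s) = germ_at F (Dom C g) z (Act F g t)"
      by (rule inj) (use eq f a b presheaf_act[OF F f(1), of s] presheaf_act[OF F f(2), of t] in auto)
    then show "p = q"
      using germ_at_act[OF F f(1), of z s] germ_at_act[OF F f(2), of z t] f a b by simp
  qed
  show "psh_stalk_map C G u \<eta> ` psh_stalk C F u = psh_stalk C G u"
  proof (intro subset_antisym subsetI)
    fix q assume "q \<in> psh_stalk_map C G u \<eta> ` psh_stalk C F u"
    then obtain a x s where "a \<in> Obj C" "x \<in> fst u a" "s \<in> Val F a" "q = psh_stalk_map C G u \<eta> (germ_at F a x s)"
      by (auto elim: psh_stalkE)
    then show "q \<in> psh_stalk C G u" by (simp add: map psh_stalkI nat_trans_in[OF \<eta>])
  next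
    fix q assume "q \<in> psh_stalk C G u"
    then obtain a x t where q: "a \<in> Obj C" "x \<in> fst u a" "t \<in> Val G a" "q = germ_at G a x t"
      by (auto elim: psh_stalkE)
    obtain b y s where s: "b \<in> Obj C" "y \<in> fst u b" "s \<in> Val F b" "germ_at G b y (\<eta> b s) = germ_at G a x t"
      using surj[OF q(1-3)] by blast
    then have "q = psh_stalk_map C G u \<eta> (germ_at F b y s)" using q by (simp add: map)
    then show "q \<in> psh_stalk_map C G u \<eta> ` psh_stalk C F u" using psh_stalkI[OF s(1-3)] by blast
  qed
qed

end

section \<open>Constant simplicial sheaves are local for weak equivalences\<close>

locale weak_equivalence = cat C for C :: "('o, 'm) category" +
  fixes J :: "'o \<Rightarrow> 'm set set" and Y Y' :: "('o, 'm, ('e, 'm) univ) spsh"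
    and w :: "nat \<Rightarrow> 'o \<Rightarrow> ('e, 'm) univ \<Rightarrow> ('e, 'm) univ" and X :: "('o, 'm, ('e, 'm) univ) psh"
  assumes cover_sieve: "a \<in> Obj C \<Longrightarrow> R \<in> J a \<Longrightarrow> sieve C a R"
    and enough: "enough_points C J TYPE(('e, 'm) univ)"
    and X: "sheaf C J X"
    and w_equiv: "(Y, w, Y') \<in> simplicial_weak_equivalences C J"
begin

lemma Y: "simplicial_sheaf C J Y" and Y': "simplicial_sheaf C J Y'" and w: "simplicial_nat_trans C Y Y' w"
  using w_equiv by (auto simp: simplicial_weak_equivalences_def)

lemma cover_arr: "a \<in> Obj C \<Longrightarrow> R \<in> J a \<Longrightarrow> f \<in> R \<Longrightarrow> f \<in> Arr C \<and> Cod C f = a"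
  using cover_sieve by (auto simp: sieve_def arrows_to_def)

lemma w_in: "a \<in> Obj C \<Longrightarrow> s \<in> Val (Lev Y n) a \<Longrightarrow> w n a s \<in> Val (Lev Y' n) a"
  by (rule nat_trans_in[OF simplicial_nat_trans_level[OF w]])

lemma w_stalk: "site_point C J u \<Longrightarrow>
  sset_weak_equivalence (simplicial_stalk C Y u) (simplicial_stalk C Y' u) (\<lambda>n. psh_stalk_map C (Lev Y' n) u (w n))"
  using w_equiv unfolding simplicial_weak_equivalences_def by blast

lemma point_locale: "site_point C J u \<Longrightarrow> point C J u"
  by (intro point.intro point_axioms.intro cat_axioms)

lemma const_map_in:
  assumes "simplicial_nat_trans C Z (const_simplicial C X) \<psi>" "a \<in> Obj C" "s \<in> Val (Lev Z n) a"
  shows "\<psi> n a s \<in> Val X a"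
  using nat_trans_in[OF simplicial_nat_trans_level[OF assms(1)] assms(2,3)] by simp

lemma enough_isoI:
  fixes F G :: "('o, 'm, ('e, 'm) univ) psh"
  assumes "sheaf C J F" "sheaf C J G" "nat_trans C F G \<eta>"
    and "\<And>u. site_point C J u \<Longrightarrow> bij_betw (psh_stalk_map C G u \<eta>) (psh_stalk C F u) (psh_stalk C G u)"
    and "a \<in> Obj C"
  shows "bij_betw (\<eta> a) (Val F a) (Val G a)"
  using enough assms unfolding enough_points_def by blast

text \<open>Every germ of \<open>Y' 0\<close> lies in the component of a germ coming from
  \<open>Y\<close>, where both maps agree, and maps to a constant object are constant on components.
  Agreement of two germs in \<open>X\<close> spreads to a neighbourhood, so the restriction of the
  section to it lies in the equalizer \<open>E\<close>.\<close>

lemma precomp_inj: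
  assumes \<eta>: "simplicial_nat_trans C Y' (const_simplicial C X) \<eta>"
    and \<epsilon>: "simplicial_nat_trans C Y' (const_simplicial C X) \<epsilon>"
    and eq: "\<And>a s. a \<in> Obj C \<Longrightarrow> s \<in> Val (Lev Y 0) a \<Longrightarrow> \<eta> 0 a (w 0 a s) = \<epsilon> 0 a (w 0 a s)"
  shows "\<eta> = \<epsilon>"
proof -
  let ?F = "Lev Y' 0"
  define E where "E a = {y \<in> Val ?F a. \<eta> 0 a y = \<epsilon> 0 a y}" for a
  note F = simplicial_sheaf_Lev[OF Y', of 0] and PF = simplicial_sheaf_presheaf[OF Y', of 0] and PX = sheaf_presheaf[OF X]
  have nt: "nat_trans C ?F X (\<eta> 0)" "nat_trans C ?F X (\<epsilon> 0)"
    using simplicial_nat_trans_level[OF \<eta>, of 0] simplicial_nat_trans_level[OF \<epsilon>, of 0] by simp_all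
  have E: "sheaf C J (sub_psh ?F E)"
  proof (rule sub_sheaf[OF F])
    fix a s assume "s \<in> E a" then show "s \<in> Val ?F a" by (simp add: E_def)
  next
    fix f s assume f: "f \<in> Arr C" "s \<in> E (Cod C f)"
    then show "Act ?F f s \<in> E (Dom C f)"
      using nat_trans_act[OF nt(1) f(1)] nat_trans_act[OF nt(2) f(1)] presheaf_act[OF PF f(1)] by (simp add: E_def)
  next
    fix a R s assume a: "a \<in> Obj C" "R \<in> J a" "s \<in> Val ?F a" and E: "\<And>f. f \<in> R \<Longrightarrow> Act ?F f s \<in> E (Dom C f)"
    have "\<eta> 0 a s = \<epsilon> 0 a s"
    proof (rule sheaf_eqI[OF X a(1,2) cover_sieve[OF a(1,2)]])
      show "\<eta> 0 a s \<in> Val X a" "\<epsilon> 0 a s \<in> Val X a"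
        by (rule nat_trans_in[OF nt(1) a(1,3)], rule nat_trans_in[OF nt(2) a(1,3)])
      fix f assume f: "f \<in> R"
      note R = cover_arr[OF a(1,2) f]
      have "\<eta> 0 (Dom C f) (Act ?F f s) = \<epsilon> 0 (Dom C f) (Act ?F f s)" using E[OF f] by (simp add: E_def)
      then show "Act X f (\<eta> 0 a s) = Act X f (\<epsilon> 0 a s)"
        using nat_trans_act[OF nt(1), of f s] nat_trans_act[OF nt(2), of f s] R a(3) by simp
    qed
    then show "s \<in> E a" using a(3) by (simp add: E_def)
  qed (use cover_arr in blast)
  have incl: "nat_trans C (sub_psh ?F E) ?F (nat_restrict C (sub_psh ?F E) (\<lambda>a s. s))"
    by (rule nat_transI[OF sheaf_presheaf[OF E]])
      (use presheaf_act[OF sheaf_presheaf[OF E]] in \<open>auto simp: E_def\<close>)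
  have "bij_betw (nat_restrict C (sub_psh ?F E) (\<lambda>a s. s) a) (Val (sub_psh ?F E) a) (Val ?F a)" if "a \<in> Obj C" for a
  proof (rule enough_isoI[OF E F incl _ that])
    fix u :: "('o, 'm, ('e, 'm) univ) pt_functor" assume u: "site_point C J u"
    interpret point C J u by (rule point_locale[OF u])
    show "bij_betw (psh_stalk_map C ?F u (nat_restrict C (sub_psh ?F E) (\<lambda>a s. s)))
      (psh_stalk C (sub_psh ?F E) u) (psh_stalk C ?F u)"
    proof (rule psh_stalk_map_bijI[OF sheaf_presheaf[OF E] PF incl])
      fix a x y assume a: "a \<in> Obj C" "x \<in> fst u a" "y \<in> Val ?F a"
      obtain b r s where b: "b \<in> Obj C" "r \<in> fst u b" "s \<in> Val (Lev Y 0) b"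
        "(germ_at ?F b r (w 0 b s), germ_at ?F a x y) \<in> pi0_rel (simplicial_stalk C Y' u)"
        using weak_equivalence_pi0(2)[OF Y Y' w w_stalk[OF u] a] by blast
      have "germ_at X a x (\<eta> 0 a y) = germ_at X a x (\<epsilon> 0 a y)"
        using const_map_pi0[OF Y' X \<eta> b(1,2) w_in[OF b(1,3)] a b(4)]
          const_map_pi0[OF Y' X \<epsilon> b(1,2) w_in[OF b(1,3)] a b(4)] eq[OF b(1,3)] by simp
      then obtain f z where f: "f \<in> Arr C" "Cod C f = a" "z \<in> fst u (Dom C f)" "snd u f z = x"
        "Act X f (\<eta> 0 a y) = Act X f (\<epsilon> 0 a y)"
        using germ_at_eq_sameE[OF PX a(1,2) const_map_in[OF \<eta> a(1,3)] const_map_in[OF \<epsilon> a(1,3)]] by blast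
      have "Act ?F f y \<in> E (Dom C f)"
        using nat_trans_act[OF nt(1) f(1), of y] nat_trans_act[OF nt(2) f(1), of y] presheaf_act[OF PF f(1), of y] f a
        by (simp add: E_def)
      moreover have "germ_at ?F (Dom C f) z (Act ?F f y) = germ_at ?F a x y"
        using germ_at_act[OF PF f(1,3), of y] f a by simp
      ultimately show "\<exists>b r s. b \<in> Obj C \<and> r \<in> fst u b \<and> s \<in> Val (sub_psh ?F E) b \<and>
        germ_at ?F b r (nat_restrict C (sub_psh ?F E) (\<lambda>a s. s) b s) = germ_at ?F a x y"
        using f by (intro exI[of _ "Dom C f"] exI[of _ z] exI[of _ "Act ?F f y"]) simp
    qed simp
  qed
  then have "Val ?F a \<subseteq> E a" if "a \<in> Obj C" for a
    using that unfolding bij_betw_def by auto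
  then show ?thesis by (intro const_map_ext[OF Y' \<eta> \<epsilon>]) (auto simp: E_def)
qed

text \<open>Says that \<psi> forces the germ of \<open>x\<close> as value at the germ of
  \<open>y\<close>: some germ of \<open>Y\<close> is mapped by \<open>w\<close> into the component
  of \<open>y\<close> and by \<psi> to \<open>x\<close>. It speaks of germs only and is therefore
  compatible with restriction.\<close>

definition linked ::
  "('o, 'm, ('e, 'm) univ) pt_functor \<Rightarrow> (nat \<Rightarrow> 'o \<Rightarrow> ('e, 'm) univ \<Rightarrow> ('e, 'm) univ) \<Rightarrow>
    'o \<Rightarrow> ('e, 'm) univ \<Rightarrow> ('e, 'm) univ \<Rightarrow> ('e, 'm) univ \<Rightarrow> bool" where
  "linked u \<psi> a t y x \<longleftrightarrow> (\<exists>b r s. b \<in> Obj C \<and> r \<in> fst u b \<and> s \<in> Val (Lev Y 0) b \<and>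
     (stalk_class C (Lev Y' 0) u (b, r, w 0 b s), stalk_class C (Lev Y' 0) u (a, t, y))
       \<in> pi0_rel (simplicial_stalk C Y' u) \<and>
     stalk_class C X u (b, r, \<psi> 0 b s) = stalk_class C X u (a, t, x))"

text \<open>The graph of the map on \<open>Y' 0\<close> which is to be constructed from \<open>\<psi>\<close>.\<close>

definition graph_psh ::
  "(nat \<Rightarrow> 'o \<Rightarrow> ('e, 'm) univ \<Rightarrow> ('e, 'm) univ) \<Rightarrow> ('o, 'm, ('e, 'm) univ) psh" where
  "graph_psh \<psi> = sub_psh (psh_prod (Lev Y' 0) X)
     (\<lambda>a. {Pair y x | y x. y \<in> Val (Lev Y' 0) a \<and> x \<in> Val X a \<and>
        (\<forall>u. site_point C J u \<longrightarrow> (\<forall>t\<in>fst u a. linked u \<psi> a t y x))})"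

lemma linked_germ_eq:
  assumes "stalk_class C (Lev Y' 0) u (a, t, y) = stalk_class C (Lev Y' 0) u (b, r, y')"
    "stalk_class C X u (a, t, x) = stalk_class C X u (b, r, x')"
  shows "linked u \<psi> a t y x \<longleftrightarrow> linked u \<psi> b r y' x'"
  unfolding linked_def assms ..

lemma linked_pi0:
  assumes "linked u \<psi> a t y x"
    and "(stalk_class C (Lev Y' 0) u (a, t, y), stalk_class C (Lev Y' 0) u (a, t, y')) \<in> pi0_rel (simplicial_stalk C Y' u)"
  shows "linked u \<psi> a t y' x"
  using assms(1) pi0_rel_trans[OF _ assms(2)] unfolding linked_def by blast

lemma linked_act:
  assumes u: "site_point C J u" and f: "f \<in> Arr C" "t \<in> fst u (Dom C f)"
    and y: "y \<in> Val (Lev Y' 0) (Cod C f)" "x \<in> Val X (Cod C f)"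
  shows "linked u \<psi> (Dom C f) t (Act (Lev Y' 0) f y) (Act X f x) \<longleftrightarrow> linked u \<psi> (Cod C f) (snd u f t) y x"
proof -
  interpret point C J u by (rule point_locale[OF u])
  show ?thesis
    by (rule linked_germ_eq[OF germ_at_act[OF simplicial_sheaf_presheaf[OF Y'] f y(1)]
          germ_at_act[OF sheaf_presheaf[OF X] f y(2)]])
qed

lemma Pair_in_graph_psh: "Pair y x \<in> Val (graph_psh \<psi>) a \<longleftrightarrow> y \<in> Val (Lev Y' 0) a \<and> x \<in> Val X a \<and>
    (\<forall>u. site_point C J u \<longrightarrow> (\<forall>t\<in>fst u a. linked u \<psi> a t y x))"
  by (simp add: graph_psh_def)

lemma graph_psh_linked:
  "Pair y x \<in> Val (graph_psh \<psi>) a \<Longrightarrow> site_point C J u \<Longrightarrow> t \<in> fst u a \<Longrightarrow> linked u \<psi> a t y x"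
  unfolding Pair_in_graph_psh by blast

lemma graph_pshE:
  assumes "v \<in> Val (graph_psh \<psi>) a"
  obtains y x where "v = Pair y x" "y \<in> Val (Lev Y' 0) a" "x \<in> Val X a"
    "\<And>u t. site_point C J u \<Longrightarrow> t \<in> fst u a \<Longrightarrow> linked u \<psi> a t y x"
  using assms unfolding graph_psh_def by auto

lemma Act_graph_psh [simp]: "Act (graph_psh \<psi>) f (Pair y x) = Pair (Act (Lev Y' 0) f y) (Act X f x)"
  by (simp add: graph_psh_def)

lemma graph_psh_act:
  assumes "f \<in> Arr C" "Pair y x \<in> Val (graph_psh \<psi>) (Cod C f)"
  shows "Pair (Act (Lev Y' 0) f y) (Act X f x) \<in> Val (graph_psh \<psi>) (Dom C f)"
proof -
  have yx: "y \<in> Val (Lev Y' 0) (Cod C f)" "x \<in> Val X (Cod C f)"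
    "\<And>u t. site_point C J u \<Longrightarrow> t \<in> fst u (Cod C f) \<Longrightarrow> linked u \<psi> (Cod C f) t y x"
    using assms(2) by (auto simp: Pair_in_graph_psh)
  have "linked u \<psi> (Dom C f) t (Act (Lev Y' 0) f y) (Act X f x)"
    if u: "site_point C J u" and t: "t \<in> fst u (Dom C f)" for u t
    unfolding linked_act[OF u assms(1) t yx(1,2)]
    by (rule yx(3)[OF u point.pt_map[OF point_locale[OF u] assms(1) t]])
  then show ?thesis
    using yx presheaf_act[OF simplicial_sheaf_presheaf[OF Y'] assms(1)] presheaf_act[OF sheaf_presheaf[OF X] assms(1)]
    by (simp add: Pair_in_graph_psh)
qed

text \<open>Membership is local because an element of the fibre over \<open>a\<close> lifts along
  some arrow of any covering sieve, so that the condition at this element can be checked on the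
  covering.\<close>

lemma sheaf_graph_psh: "sheaf C J (graph_psh \<psi>)"
  unfolding graph_psh_def
proof (rule sub_sheaf[OF sheaf_psh_prod[OF simplicial_sheaf_Lev[OF Y', of 0] X]])
  let ?E = "\<lambda>a. {Pair y x | y x. y \<in> Val (Lev Y' 0) a \<and> x \<in> Val X a \<and>
        (\<forall>u. site_point C J u \<longrightarrow> (\<forall>t\<in>fst u a. linked u \<psi> a t y x))}"
  have E: "?E = Val (graph_psh \<psi>)" by (simp add: graph_psh_def)
  show "s \<in> Val (psh_prod (Lev Y' 0) X) a" if "s \<in> ?E a" for a s
    using that by (auto simp: Val_psh_prod)
  show "Act (psh_prod (Lev Y' 0) X) f s \<in> ?E (Dom C f)" if f: "f \<in> Arr C" and s: "s \<in> ?E (Cod C f)" for f s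
  proof -
    obtain y x where yx: "s = Pair y x" using s by blast
    then have "Pair y x \<in> Val (graph_psh \<psi>) (Cod C f)" using s by (simp add: graph_psh_def)
    from graph_psh_act[OF f this] show ?thesis unfolding yx by (simp add: graph_psh_def)
  qed
  show "s \<in> ?E a" if a: "a \<in> Obj C" "R \<in> J a" "s \<in> Val (psh_prod (Lev Y' 0) X) a"
    and R: "\<And>f. f \<in> R \<Longrightarrow> Act (psh_prod (Lev Y' 0) X) f s \<in> ?E (Dom C f)" for a R s
  proof -
    obtain y x where yx: "s = Pair y x" "y \<in> Val (Lev Y' 0) a" "x \<in> Val X a"
      using a(3) by (auto simp: Val_psh_prod)
    have "linked u \<psi> a t y x" if u: "site_point C J u" and t: "t \<in> fst u a" for u t
    proof -
      obtain f r where f: "f \<in> R" "r \<in> fst u (Dom C f)" "snd u f r = t"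
        using point.pt_cover[OF point_locale[OF u] a(1,2) t] by blast
      have f': "f \<in> Arr C" "Cod C f = a" using cover_arr[OF a(1,2) f(1)] by auto
      have "linked u \<psi> (Dom C f) r (Act (Lev Y' 0) f y) (Act X f x)"
        using R[OF f(1)] f(2) by (intro graph_psh_linked u) (auto simp: graph_psh_def yx(1))
      then show ?thesis using linked_act[OF u f'(1) f(2)] yx f' f(3) by simp
    qed
    then show ?thesis unfolding E yx(1) Pair_in_graph_psh using yx by blast
  qed
qed (use cover_arr in blast)

text \<open>Connectedness in the stalk lifts to the graph, since a path in the stalk at one point is
  defined on a neighbourhood, where it connects the germs at all points.\<close>

lemma graph_psh_stalk:
  assumes \<psi>: "simplicial_nat_trans C Y (const_simplicial C X) \<psi>" and u: "site_point C J u"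
    and b: "b \<in> Obj C" "r \<in> fst u b" "s \<in> Val (Lev Y 0) b"
    and rel: "(stalk_class C (Lev Y' 0) u (b, r, w 0 b s), q) \<in> pi0_rel (simplicial_stalk C Y' u)"
  shows "\<exists>a t y x. a \<in> Obj C \<and> t \<in> fst u a \<and> Pair y x \<in> Val (graph_psh \<psi>) a \<and>
    stalk_class C (Lev Y' 0) u (a, t, y) = q"
  using rel unfolding pi0_rel_def
proof (induction rule: rtrancl_induct)
  case base
  have "linked u \<psi> b t (w 0 b s) (\<psi> 0 b s)" if "t \<in> fst u b" for u t
    unfolding linked_def using b that by (intro exI[of _ b] exI[of _ t] exI[of _ s]) simp
  then have "Pair (w 0 b s) (\<psi> 0 b s) \<in> Val (graph_psh \<psi>) b"
    using w_in[OF b(1,3)] const_map_in[OF \<psi> b(1,3)] by (simp add: Pair_in_graph_psh)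
  then show ?case using b by blast
next
  case (step p q)
  interpret point C J u by (rule point_locale[OF u])
  let ?F = "Lev Y' 0" and ?L = "simplicial_stalk C Y' u"
  note PF = simplicial_sheaf_presheaf[OF Y', of 0] and PX = sheaf_presheaf[OF X]
  obtain a t y x where a: "a \<in> Obj C" "t \<in> fst u a" "Pair y x \<in> Val (graph_psh \<psi>) a" "germ_at ?F a t y = p"
    using step.IH by blast
  have yx: "y \<in> Val ?F a" "x \<in> Val X a" using a(3) by (auto simp: Pair_in_graph_psh)
  define d where "d i = LevOp Y' 0 1 (vert i)" for i
  have d: "nat_trans C (Lev Y' 1) ?F (d i)" if "i \<le> 1" for i
    unfolding d_def by (rule simplicial_sheaf_LevOp[OF Y' vert_Delta[OF that]])
  \<comment> \<open>An elementary step may run along the edge in either direction; \<open>i\<close>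
    marks the end already reached and \<open>j\<close> the new one.\<close>
  obtain i j e where ij: "i \<le> 1" "j \<le> 1" "{i, j} = {0, 1}"
    and e: "e \<in> psh_stalk C (Lev Y' 1) u" "p = SpxOp ?L 0 1 (vert i) e" "q = SpxOp ?L 0 1 (vert j) e"
  proof -
    from step(2) consider "(p, q) \<in> edge_rel ?L" | "(q, p) \<in> edge_rel ?L" by blast
    then show ?thesis
    proof cases
      case 1
      then obtain e where "p = SpxOp ?L 0 1 (vert 0) e" "q = SpxOp ?L 0 1 (vert 1) e" "e \<in> Spx ?L 1"
        unfolding edge_rel_def by blast
      then show ?thesis using that[of 0 1 e] by simp
    next
      case 2
      then obtain e where "q = SpxOp ?L 0 1 (vert 0) e" "p = SpxOp ?L 0 1 (vert 1) e" "e \<in> Spx ?L 1"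
        unfolding edge_rel_def by blast
      then show ?thesis using that[of 1 0 e] by (simp add: insert_commute)
    qed
  qed
  obtain c z \<epsilon> where c: "c \<in> Obj C" "z \<in> fst u c" "\<epsilon> \<in> Val (Lev Y' 1) c" "e = germ_at (Lev Y' 1) c z \<epsilon>"
    using psh_stalkE[OF e(1)] by blast
  have SpxOp: "SpxOp (simplicial_stalk C Y' v) 0 1 (vert k) (stalk_class C (Lev Y' 1) v (b, l, \<epsilon>)) =
      stalk_class C ?F v (b, l, d k b \<epsilon>)"
    if "site_point C J v" "k \<le> 1" "b \<in> Obj C" "l \<in> fst v b" "\<epsilon> \<in> Val (Lev Y' 1) b" for v k b l \<epsilon>
    unfolding d_def by (rule point.SpxOp_stalk_germ[OF point_locale[OF that(1)] Y' vert_Delta[OF that(2)] that(3-5)])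
  have p: "germ_at ?F a t y = germ_at ?F c z (d i c \<epsilon>)" and q: "q = germ_at ?F c z (d j c \<epsilon>)"
    using a(4) e(2,3) SpxOp[OF u _ c(1-3)] ij c(4) by simp_all
  obtain f g m where f: "f \<in> Arr C" "g \<in> Arr C" "Dom C f = Dom C g" "Cod C f = a"
     "Cod C g = c" "m \<in> fst u (Dom C g)" "snd u f m = t" "snd u g m = z" "Act ?F f y = Act ?F g (d i c \<epsilon>)"
    using germ_at_eqE[OF PF a(1,2) yx(1) c(1,2) nat_trans_in[OF d[OF ij(1)] c(1,3)] p] by blast
  let ?b = "Dom C g" and ?\<epsilon> = "Act (Lev Y' 1) g \<epsilon>"
  have \<epsilon>: "?\<epsilon> \<in> Val (Lev Y' 1) ?b"
    using presheaf_act[OF simplicial_sheaf_presheaf[OF Y'] f(2)] c f(5) by simp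
  have di: "Act ?F g (d k c \<epsilon>) = d k ?b ?\<epsilon>" if "k \<le> 1" for k
    using nat_trans_act[OF d[OF that] f(2), of \<epsilon>] c f(5) by simp
  have G: "Pair (d i ?b ?\<epsilon>) (Act X f x) \<in> Val (graph_psh \<psi>) ?b"
    using graph_psh_act[OF f(1), of y x \<psi>] a(3) f(3,4,9) di[OF ij(1)] by simp
  \<comment> \<open>The edge itself is a section over \<open>Dom C g\<close>. Hence its two ends
    have germs in one component at every point \<open>v\<close> of the site, not only at
    \<open>u\<close>, and the second coordinate can be kept while the first one moves along the
    edge.\<close>
  have "linked v \<psi> ?b l (d j ?b ?\<epsilon>) (Act X f x)" if v: "site_point C J v" and l: "l \<in> fst v ?b" for v l
  proof -
    have "linked v \<psi> ?b l (d i ?b ?\<epsilon>) (Act X f x)" by (rule graph_psh_linked[OF G v l])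
    moreover have "(stalk_class C ?F v (?b, l, d i ?b ?\<epsilon>), stalk_class C ?F v (?b, l, d j ?b ?\<epsilon>))
      \<in> pi0_rel (simplicial_stalk C Y' v)"
    proof -
      have "stalk_class C (Lev Y' 1) v (?b, l, ?\<epsilon>) \<in> Spx (simplicial_stalk C Y' v) 1"
        using point.psh_stalkI[OF point_locale[OF v] _ l \<epsilon>] f(2) by (simp add: simplicial_stalk_def)
      then have "(stalk_class C ?F v (?b, l, d 0 ?b ?\<epsilon>), stalk_class C ?F v (?b, l, d 1 ?b ?\<epsilon>))
        \<in> edge_rel (simplicial_stalk C Y' v)"
        unfolding edge_rel_def
        using SpxOp[OF v _ _ l \<epsilon>, of 0] SpxOp[OF v _ _ l \<epsilon>, of 1] f(2)
        by (intro CollectI exI[of _ "stalk_class C (Lev Y' 1) v (?b, l, ?\<epsilon>)"]) simp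
      then show ?thesis using ij(3) pi0_rel_edge pi0_rel_sym by (fastforce simp: doubleton_eq_iff)
    qed
    ultimately show ?thesis by (rule linked_pi0)
  qed
  then have "Pair (d j ?b ?\<epsilon>) (Act X f x) \<in> Val (graph_psh \<psi>) ?b"
    using G nat_trans_in[OF d[OF ij(2)] _ \<epsilon>] f(2) by (simp add: Pair_in_graph_psh)
  moreover have "germ_at ?F ?b m (d j ?b ?\<epsilon>) = q"
    using germ_at_act[OF PF f(2,6), of "d j c \<epsilon>"] nat_trans_in[OF d[OF ij(2)] c(1,3)] f(5,8) di[OF ij(2)] q by simp
  ultimately show ?case using f(2,6) dom_obj by blast
qed

text \<open>The two witnesses in \<open>Y\<close> have images in one component of the stalk of
  \<open>Y'\<close>; injectivity on components joins them already in \<open>Y\<close>, and there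
  \<psi> is constant on components.\<close>

lemma graph_psh_unique:
  assumes \<psi>: "simplicial_nat_trans C Y (const_simplicial C X) \<psi>" and u: "site_point C J u"
    and a: "a \<in> Obj C" "t \<in> fst u a" and y: "y \<in> Val (Lev Y' 0) a"
    and x: "linked u \<psi> a t y x" "linked u \<psi> a t y x'"
  shows "stalk_class C X u (a, t, x) = stalk_class C X u (a, t, x')"
proof -
  interpret point C J u by (rule point_locale[OF u])
  obtain b r s where b: "b \<in> Obj C" "r \<in> fst u b" "s \<in> Val (Lev Y 0) b"
    "(germ_at (Lev Y' 0) b r (w 0 b s), germ_at (Lev Y' 0) a t y) \<in> pi0_rel (simplicial_stalk C Y' u)"
    "germ_at X b r (\<psi> 0 b s) = germ_at X a t x"
    using x(1) unfolding linked_def by blast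
  obtain b' r' s' where b': "b' \<in> Obj C" "r' \<in> fst u b'" "s' \<in> Val (Lev Y 0) b'"
    "(germ_at (Lev Y' 0) b' r' (w 0 b' s'), germ_at (Lev Y' 0) a t y) \<in> pi0_rel (simplicial_stalk C Y' u)"
    "germ_at X b' r' (\<psi> 0 b' s') = germ_at X a t x'"
    using x(2) unfolding linked_def by blast
  have "(germ_at (Lev Y 0) b r s, germ_at (Lev Y 0) b' r' s') \<in> pi0_rel (simplicial_stalk C Y u)"
    by (rule weak_equivalence_pi0(1)[OF Y Y' w w_stalk[OF u] b(1-3) b'(1-3)
          pi0_rel_trans[OF b(4) pi0_rel_sym[OF b'(4)]]])
  from const_map_pi0[OF Y X \<psi> b(1-3) b'(1-3) this] show ?thesis using b(5) b'(5) by simp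
qed

text \<open>On stalks the projection from the graph to \<open>Y' 0\<close> is injective by
  \<open>graph_psh_unique\<close> and surjective by \<open>graph_psh_stalk\<close>. Thus it is an
  isomorphism of sheaves, and the second coordinate of its inverse is the extension at level
  0.\<close>

lemma precomp_surj:
  assumes \<psi>: "simplicial_nat_trans C Y (const_simplicial C X) \<psi>"
  obtains \<phi> where "simplicial_nat_trans C Y' (const_simplicial C X) \<phi>"
    "\<And>a s. a \<in> Obj C \<Longrightarrow> s \<in> Val (Lev Y 0) a \<Longrightarrow> \<phi> 0 a (w 0 a s) = \<psi> 0 a s"
proof -
  let ?F = "Lev Y' 0" and ?G = "graph_psh \<psi>"
  note PF = simplicial_sheaf_presheaf[OF Y', of 0] and PX = sheaf_presheaf[OF X]
    and PG = sheaf_presheaf[OF sheaf_graph_psh[of \<psi>]]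
  define pr where "pr = nat_restrict C ?G (\<lambda>_. pair_fst)"
  have pr: "nat_trans C ?G ?F pr"
    unfolding pr_def by (rule nat_transI[OF PG]) (auto elim!: graph_pshE)
  have bij: "bij_betw (pr a) (Val ?G a) (Val ?F a)" if "a \<in> Obj C" for a
  proof (rule enough_isoI[OF sheaf_graph_psh simplicial_sheaf_Lev[OF Y'] pr _ that])
    fix u :: "('o, 'm, ('e, 'm) univ) pt_functor" assume u: "site_point C J u"
    interpret point C J u by (rule point_locale[OF u])
    show "bij_betw (psh_stalk_map C ?F u pr) (psh_stalk C ?G u) (psh_stalk C ?F u)"
    proof (rule psh_stalk_map_bijI[OF PG PF pr])
      fix a t v v' assume a: "a \<in> Obj C" "t \<in> fst u a" and v: "v \<in> Val ?G a" "v' \<in> Val ?G a" "pr a v = pr a v'"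
      obtain y x where yx: "v = Pair y x" "y \<in> Val ?F a" "x \<in> Val X a" "linked u \<psi> a t y x"
        using graph_pshE[OF v(1)] u a(2) by metis
      obtain y' x' where yx': "v' = Pair y' x'" "x' \<in> Val X a" "linked u \<psi> a t y' x'"
        using graph_pshE[OF v(2)] u a(2) by metis
      have "y' = y" using v a(1) yx(1) yx'(1) by (simp add: pr_def)
      then have "germ_at X a t x = germ_at X a t x'"
        using graph_psh_unique[OF \<psi> u a yx(2,4)] yx' by simp
      then obtain f z where f: "f \<in> Arr C" "Cod C f = a" "z \<in> fst u (Dom C f)" "snd u f z = t" "Act X f x = Act X f x'"
        using germ_at_eq_sameE[OF PX a yx(3) yx'(2)] by blast
      then have "Act ?G f v = Act ?G f v'" using yx(1) yx'(1) \<open>y' = y\<close> by simp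
      then show "germ_at ?G a t v = germ_at ?G a t v'"
        using germ_at_act[OF PG f(1,3), of v] germ_at_act[OF PG f(1,3), of v'] v f(2,4) by simp
    next
      fix a t y assume a: "a \<in> Obj C" "t \<in> fst u a" "y \<in> Val ?F a"
      obtain b r s where b: "b \<in> Obj C" "r \<in> fst u b" "s \<in> Val (Lev Y 0) b"
        "(germ_at ?F b r (w 0 b s), germ_at ?F a t y) \<in> pi0_rel (simplicial_stalk C Y' u)"
        using weak_equivalence_pi0(2)[OF Y Y' w w_stalk[OF u] a] by blast
      obtain a' t' y' x' where a': "a' \<in> Obj C" "t' \<in> fst u a'" "Pair y' x' \<in> Val ?G a'"
        "germ_at ?F a' t' y' = germ_at ?F a t y"
        using graph_psh_stalk[OF \<psi> u b] by blast
      then show "\<exists>b r s. b \<in> Obj C \<and> r \<in> fst u b \<and> s \<in> Val ?G b \<and> germ_at ?F b r (pr b s) = germ_at ?F a t y"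
        by (intro exI[of _ a'] exI[of _ t'] exI[of _ "Pair y' x'"]) (simp add: pr_def)
    qed
  qed
  have ex1: "\<exists>!x. Pair y x \<in> Val ?G a" if a: "a \<in> Obj C" and y: "y \<in> Val ?F a" for a y
  proof -
    have "y \<in> pr a ` Val ?G a" unfolding bij_betw_imp_surj_on[OF bij[OF a]] by (rule y)
    then obtain v where v: "v \<in> Val ?G a" "pr a v = y" by (metis imageE)
    obtain y' x where "v = Pair y' x" using graph_pshE[OF v(1)] by metis
    then have x: "v = Pair y x" using v a by (simp add: pr_def)
    have "x' = x" if "Pair y x' \<in> Val ?G a" for x'
    proof -
      have "pr a (Pair y x') = pr a v" using that v x a by (simp add: pr_def)
      from inj_onD[OF bij_betw_imp_inj_on[OF bij[OF a]] this that v(1)] show ?thesis using x by simp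
    qed
    then show ?thesis using v(1) x by blast
  qed
  define \<phi>0 where "\<phi>0 = nat_restrict C ?F (\<lambda>a y. THE x. Pair y x \<in> Val ?G a)"
  have \<phi>0: "Pair y (\<phi>0 a y) \<in> Val ?G a" if "a \<in> Obj C" "y \<in> Val ?F a" for a y
    using theI'[OF ex1[OF that]] that by (simp add: \<phi>0_def)
  have \<phi>0_eq: "\<phi>0 a y = x" if "a \<in> Obj C" "Pair y x \<in> Val ?G a" for a y x
  proof -
    have y: "y \<in> Val ?F a" using that(2) by (simp add: Pair_in_graph_psh)
    show ?thesis using ex1[OF that(1) y] \<phi>0[OF that(1) y] that(2) by blast
  qed
  have nt: "nat_trans C ?F X (nat_restrict C ?F \<phi>0)"
  proof (rule nat_transI[OF PF])
    fix a s assume "a \<in> Obj C" "s \<in> Val ?F a"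
    then show "\<phi>0 a s \<in> Val X a" using \<phi>0 by (simp add: Pair_in_graph_psh)
  next
    fix f s assume f: "f \<in> Arr C" "s \<in> Val ?F (Cod C f)"
    show "\<phi>0 (Dom C f) (Act ?F f s) = Act X f (\<phi>0 (Cod C f) s)"
      by (rule \<phi>0_eq[OF dom_obj[OF f(1)] graph_psh_act[OF f(1) \<phi>0[OF cod_obj[OF f(1)] f(2)]]])
  qed
  have "nat_restrict C ?F \<phi>0 = \<phi>0" unfolding \<phi>0_def by (rule nat_restrict_cong) simp
  then have nt: "nat_trans C ?F X \<phi>0" using nt by simp
  \<comment> \<open>\<open>linked\<close> is invariant when \<open>y\<close> moves within its
    component, so the value at one end of an edge also lies in the graph over the other end;
    uniqueness identifies it with the value there.\<close>
  have edge: "\<phi>0 a (LevOp Y' 0 1 (vert 0) a e) = \<phi>0 a (LevOp Y' 0 1 (vert 1) a e)"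
    if a: "a \<in> Obj C" "e \<in> Val (Lev Y' 1) a" for a e
  proof -
    define d where "d i = LevOp Y' 0 1 (vert i) a e" for i
    have d: "d i \<in> Val ?F a" if "i \<le> 1" for i
      unfolding d_def by (rule nat_trans_in[OF simplicial_sheaf_LevOp[OF Y' vert_Delta[OF that]] a])
    have G: "Pair (d 0) (\<phi>0 a (d 0)) \<in> Val ?G a" by (rule \<phi>0[OF a(1) d]) simp
    have "linked u \<psi> a t (d 1) (\<phi>0 a (d 0))" if u: "site_point C J u" and t: "t \<in> fst u a" for u t
    proof -
      interpret point C J u by (rule point_locale[OF u])
      have "linked u \<psi> a t (d 0) (\<phi>0 a (d 0))" by (rule graph_psh_linked[OF G u t])
      moreover have "(germ_at ?F a t (d 0), germ_at ?F a t (d 1)) \<in> edge_rel (simplicial_stalk C Y' u)"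
        unfolding edge_rel_def d_def
        using SpxOp_stalk_germ[OF Y' vert_Delta a(1) t a(2), of 0] SpxOp_stalk_germ[OF Y' vert_Delta a(1) t a(2), of 1]
          psh_stalkI[OF a(1) t a(2)]
        by (intro CollectI exI[of _ "germ_at (Lev Y' 1) a t e"]) simp
      ultimately show ?thesis by (rule linked_pi0[OF _ pi0_rel_edge])
    qed
    then have "Pair (d 1) (\<phi>0 a (d 0)) \<in> Val ?G a"
      using G d[of 1] by (simp add: Pair_in_graph_psh)
    from \<phi>0_eq[OF a(1) this] show ?thesis by (simp add: d_def)
  qed
  define \<phi> where "\<phi> n = nat_restrict C (Lev Y' n) (\<lambda>a s. \<phi>0 a (LevOp Y' 0 n (vert 0) a s))" for n
  note ext = const_map_extend[OF Y' nt edge, folded \<phi>_def]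
  have "\<phi>0 a (w 0 a s) = \<psi> 0 a s" if a: "a \<in> Obj C" "s \<in> Val (Lev Y 0) a" for a s
  proof (rule \<phi>0_eq[OF a(1)])
    have "linked u \<psi> a t (w 0 a s) (\<psi> 0 a s)" if "t \<in> fst u a" for u t
      unfolding linked_def using a that by (intro exI[of _ a] exI[of _ t] exI[of _ s]) simp
    then show "Pair (w 0 a s) (\<psi> 0 a s) \<in> Val ?G a"
      using w_in[OF a] const_map_in[OF \<psi> a] by (simp add: Pair_in_graph_psh)
  qed
  then show ?thesis using that[of \<phi>] ext by simp
qed

lemma precomp_bij:
  "bij_betw (\<lambda>g. Comp (simplicial_sheaf_cat C J) g (Y, w, Y'))
     (hom_set (simplicial_sheaf_cat C J) Y' (const_simplicial C X))
     (hom_set (simplicial_sheaf_cat C J) Y (const_simplicial C X))"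
proof (rule bij_betw_imageI)
  let ?S = "simplicial_sheaf_cat C J" and ?X = "const_simplicial C X"
  note cX = const_simplicial_sheaf[OF X]
  show "inj_on (\<lambda>g. Comp ?S g (Y, w, Y')) (hom_set ?S Y' ?X)"
  proof (rule inj_onI)
    fix g h assume "g \<in> hom_set ?S Y' ?X" "h \<in> hom_set ?S Y' ?X" and eq: "Comp ?S g (Y, w, Y') = Comp ?S h (Y, w, Y')"
    then obtain \<eta> \<epsilon> where g: "g = (Y', \<eta>, ?X)" "simplicial_nat_trans C Y' ?X \<eta>"
      and h: "h = (Y', \<epsilon>, ?X)" "simplicial_nat_trans C Y' ?X \<epsilon>"
      by (auto simp: hom_simplicial_sheaf_cat)
    have eq0: "nat_restrict C (Lev Y 0) (\<lambda>a s. \<eta> 0 a (w 0 a s)) = nat_restrict C (Lev Y 0) (\<lambda>a s. \<epsilon> 0 a (w 0 a s))"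
      using eq g h by (auto dest: fun_cong)
    have "\<eta> = \<epsilon>"
    proof (rule precomp_inj[OF g(2) h(2)])
      fix a s assume "a \<in> Obj C" "s \<in> Val (Lev Y 0) a"
      then show "\<eta> 0 a (w 0 a s) = \<epsilon> 0 a (w 0 a s)" using fun_cong[OF fun_cong[OF eq0, of a], of s] by simp
    qed
    then show "g = h" using g h by simp
  qed
  show "(\<lambda>g. Comp ?S g (Y, w, Y')) ` hom_set ?S Y' ?X = hom_set ?S Y ?X"
  proof (intro subset_antisym subsetI)
    fix g assume "g \<in> (\<lambda>g. Comp ?S g (Y, w, Y')) ` hom_set ?S Y' ?X"
    then show "g \<in> hom_set ?S Y ?X"
      using simplicial_nat_trans_comp[OF Y w] Y cX by (auto simp: hom_simplicial_sheaf_cat)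
  next
    fix g assume "g \<in> hom_set ?S Y ?X"
    then obtain \<psi> where g: "g = (Y, \<psi>, ?X)" "simplicial_nat_trans C Y ?X \<psi>"
      by (auto simp: hom_simplicial_sheaf_cat)
    obtain \<phi> where \<phi>: "simplicial_nat_trans C Y' ?X \<phi>"
      "\<And>a s. a \<in> Obj C \<Longrightarrow> s \<in> Val (Lev Y 0) a \<Longrightarrow> \<phi> 0 a (w 0 a s) = \<psi> 0 a s"
      using precomp_surj[OF g(2)] by blast
    have "(\<lambda>n. nat_restrict C (Lev Y n) (\<lambda>a s. \<phi> n a (w n a s))) = \<psi>"
      by (rule const_map_ext[OF Y simplicial_nat_trans_comp[OF Y w \<phi>(1)] g(2)]) (simp add: \<phi>(2))
    then have "g = Comp ?S (Y', \<phi>, ?X) (Y, w, Y')" using g by simp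
    moreover have "(Y', \<phi>, ?X) \<in> hom_set ?S Y' ?X" using \<phi>(1) Y' cX by (simp add: hom_simplicial_sheaf_cat)
    ultimately show "g \<in> (\<lambda>g. Comp ?S g (Y, w, Y')) ` hom_set ?S Y' ?X" by blast
  qed
qed

end

section \<open>Represented sheaves\<close>

locale site = cat C for C :: "('o, 'm) category" +
  fixes J :: "'o \<Rightarrow> 'm set set"
  assumes topology: "grothendieck_topology C J"
begin

section \<open>Covering sieves and local equality of arrows\<close>

lemma cover_sieve: "a \<in> Obj C \<Longrightarrow> R \<in> J a \<Longrightarrow> sieve C a R"
  using topology unfolding grothendieck_topology_def by blast

lemma cover_max: "a \<in> Obj C \<Longrightarrow> arrows_to C a \<in> J a"
  using topology unfolding grothendieck_topology_def by blast

lemma cover_pullback: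
  "a \<in> Obj C \<Longrightarrow> R \<in> J a \<Longrightarrow> h \<in> Arr C \<Longrightarrow> Cod C h = a \<Longrightarrow> sieve_pullback C R h \<in> J (Dom C h)"
  using topology unfolding grothendieck_topology_def arrows_to_def by blast

lemma cover_trans:
  "a \<in> Obj C \<Longrightarrow> R \<in> J a \<Longrightarrow> sieve C a R' \<Longrightarrow> (\<And>h. h \<in> R \<Longrightarrow> sieve_pullback C R' h \<in> J (Dom C h)) \<Longrightarrow> R' \<in> J a"
  using topology unfolding grothendieck_topology_def by blast

lemma sieveD: "sieve C a R \<Longrightarrow> f \<in> R \<Longrightarrow> f \<in> Arr C \<and> Cod C f = a"
  by (auto simp: sieve_def arrows_to_def)

lemma sieve_comp: "sieve C a R \<Longrightarrow> f \<in> R \<Longrightarrow> h \<in> Arr C \<Longrightarrow> Cod C h = Dom C f \<Longrightarrow> Comp C f h \<in> R"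
  by (auto simp: sieve_def arrows_to_def)

lemma cover_superset:
  assumes a: "a \<in> Obj C" and R: "R \<in> J a" and R': "sieve C a R'" and sub: "R \<subseteq> R'"
  shows "R' \<in> J a"
proof (rule cover_trans[OF a R R'])
  fix h assume h: "h \<in> R"
  then have "h \<in> Arr C" "h \<in> R'" using sieveD[OF cover_sieve[OF a R]] sub by auto
  then have "sieve_pullback C R' h = arrows_to C (Dom C h)"
    using sieve_comp[OF R'] by (auto simp: sieve_pullback_def arrows_to_def)
  then show "sieve_pullback C R' h \<in> J (Dom C h)" using cover_max \<open>h \<in> Arr C\<close> by simp
qed

lemma cover_inter:
  assumes a: "a \<in> Obj C" and R: "R \<in> J a" "R' \<in> J a"
  shows "R \<inter> R' \<in> J a"
proof (rule cover_trans[OF a R(1)])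
  note s = cover_sieve[OF a R(1)] cover_sieve[OF a R(2)]
  show "sieve C a (R \<inter> R')" using s unfolding sieve_def by blast
  fix h assume h: "h \<in> R"
  then have h': "h \<in> Arr C" "Cod C h = a" using sieveD[OF s(1)] by auto
  have "sieve_pullback C (R \<inter> R') h = sieve_pullback C R' h"
    using sieve_comp[OF s(1) h] by (auto simp: sieve_pullback_def arrows_to_def)
  then show "sieve_pullback C (R \<inter> R') h \<in> J (Dom C h)" using cover_pullback[OF a R(2) h'] by simp
qed

definition agree :: "'m \<Rightarrow> 'm \<Rightarrow> 'm set" where
  "agree f g = {h \<in> arrows_to C (Dom C f). Comp C f h = Comp C g h}"

definition parallel :: "'m \<Rightarrow> 'm \<Rightarrow> bool" where
  "parallel f g \<longleftrightarrow> f \<in> Arr C \<and> g \<in> Arr C \<and> Dom C f = Dom C g \<and> Cod C f = Cod C g"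

text \<open>Equality of \<open>f\<close> and \<open>g\<close> after sheafification of the presheaf
  of arrows.\<close>

definition loc_eq :: "'m \<Rightarrow> 'm \<Rightarrow> bool" where
  "loc_eq f g \<longleftrightarrow> parallel f g \<and> agree f g \<in> J (Dom C f)"

lemma sieve_agree: "parallel f g \<Longrightarrow> sieve C (Dom C f) (agree f g)"
  by (auto simp: sieve_def agree_def parallel_def arrows_to_def comp_assoc[symmetric])

lemma loc_eq_refl: "f \<in> Arr C \<Longrightarrow> loc_eq f f"
  using cover_max[OF dom_obj] by (simp add: loc_eq_def parallel_def agree_def)

lemma loc_eq_sym: "loc_eq f g \<Longrightarrow> loc_eq g f"
proof -
  assume fg: "loc_eq f g"
  then have "agree g f = agree f g" by (auto simp: loc_eq_def agree_def parallel_def)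
  then show ?thesis using fg by (auto simp: loc_eq_def parallel_def)
qed

lemma loc_eq_trans:
  assumes fg: "loc_eq f g" and gh: "loc_eq g h"
  shows "loc_eq f h"
proof -
  have p: "parallel f g" "parallel g h" using fg gh by (simp_all add: loc_eq_def)
  then have p': "parallel f h" by (simp add: parallel_def)
  have "agree f g \<inter> agree g h \<in> J (Dom C f)"
    using fg gh p by (intro cover_inter) (auto simp: loc_eq_def parallel_def)
  moreover have "agree f g \<inter> agree g h \<subseteq> agree f h" by (auto simp: agree_def)
  ultimately have "agree f h \<in> J (Dom C f)"
    using p by (intro cover_superset[OF _ _ sieve_agree[OF p']]) (auto simp: parallel_def)
  then show ?thesis using p' by (simp add: loc_eq_def)
qed

lemma parallel_comp:
  "parallel f g \<Longrightarrow> h \<in> Arr C \<Longrightarrow> Cod C h = Dom C f \<Longrightarrow> parallel (Comp C f h) (Comp C g h)"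
  by (simp add: parallel_def)

lemma agree_pullback:
  "parallel f g \<Longrightarrow> h \<in> Arr C \<Longrightarrow> Cod C h = Dom C f \<Longrightarrow>
    sieve_pullback C (agree f g) h = agree (Comp C f h) (Comp C g h)"
  by (auto simp: sieve_pullback_def agree_def parallel_def arrows_to_def comp_assoc)

lemma loc_eq_comp:
  "loc_eq f g \<Longrightarrow> h \<in> Arr C \<Longrightarrow> Cod C h = Dom C f \<Longrightarrow> loc_eq (Comp C f h) (Comp C g h)"
  using cover_pullback[of "Dom C f" "agree f g" h]
  by (simp add: loc_eq_def parallel_comp agree_pullback) (simp add: parallel_def)

lemma loc_eq_local:
  assumes p: "parallel f g" and R: "R \<in> J (Dom C f)" and eq: "\<And>h. h \<in> R \<Longrightarrow> loc_eq (Comp C f h) (Comp C g h)"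
  shows "loc_eq f g"
proof -
  have a: "Dom C f \<in> Obj C" using p by (simp add: parallel_def)
  have "agree f g \<in> J (Dom C f)"
  proof (rule cover_trans[OF a R sieve_agree[OF p]])
    fix h assume h: "h \<in> R"
    have h': "h \<in> Arr C" "Cod C h = Dom C f" using sieveD[OF cover_sieve[OF a R] h] by auto
    show "sieve_pullback C (agree f g) h \<in> J (Dom C h)"
      unfolding agree_pullback[OF p h'] using eq[OF h] p h' by (simp add: loc_eq_def parallel_def)
  qed
  then show ?thesis using p by (simp add: loc_eq_def)
qed

text \<open>Both restrictions agree along every arrow of the covering sieve
  \<open>agree f g\<close>, and sections of a sheaf are determined on a covering.\<close>

lemma act_loc_eq:
  assumes F: "sheaf C J F" and fg: "loc_eq f g" and x: "x \<in> Val F (Cod C f)"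
  shows "Act F f x = Act F g x"
proof -
  have p: "f \<in> Arr C" "g \<in> Arr C" "Dom C f = Dom C g" "Cod C f = Cod C g" "parallel f g"
    and R: "agree f g \<in> J (Dom C f)"
    using fg by (auto simp: loc_eq_def parallel_def)
  note P = sheaf_presheaf[OF F]
  show ?thesis
  proof (rule sheaf_eqI[OF F _ R sieve_agree[OF p(5)]])
    show "Act F f x \<in> Val F (Dom C f)" "Act F g x \<in> Val F (Dom C f)"
      using presheaf_act[OF P p(1)] presheaf_act[OF P p(2)] x p by auto
    fix h assume "h \<in> agree f g"
    then have h: "h \<in> Arr C" "Cod C h = Dom C f" "Comp C f h = Comp C g h"
      by (auto simp: agree_def arrows_to_def)
    have "Act F h (Act F f x) = Act F (Comp C f h) x"
      using presheaf_comp[OF P h(1) p(1) h(2) x] by simp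
    moreover have "Act F h (Act F g x) = Act F (Comp C g h) x"
      using presheaf_comp[OF P h(1) p(2)] h(2) x p by simp
    ultimately show "Act F h (Act F f x) = Act F h (Act F g x)" using h by simp
  qed (use p in simp)
qed

lemma local_arrowI:
  assumes "\<And>f g. (f, g) \<in> s \<Longrightarrow> f \<in> Arr C \<and> Cod C f = w \<and> g \<in> Arr C \<and> Dom C g = Dom C f \<and> Cod C g = u"
    and "\<And>f g h. (f, g) \<in> s \<Longrightarrow> h \<in> Arr C \<Longrightarrow> Cod C h = Dom C f \<Longrightarrow> (Comp C f h, Comp C g h) \<in> s"
    and "\<And>f g g'. (f, g) \<in> s \<Longrightarrow> (f, g') \<in> s \<Longrightarrow> loc_eq g g'"
    and "\<And>f g. f \<in> Arr C \<Longrightarrow> Cod C f = w \<Longrightarrow> g \<in> Arr C \<Longrightarrow> Dom C g = Dom C f \<Longrightarrow> Cod C g = u \<Longrightarrow>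
        {h \<in> arrows_to C (Dom C f). (Comp C f h, Comp C g h) \<in> s} \<in> J (Dom C f) \<Longrightarrow> (f, g) \<in> s"
    and "fst ` s \<in> J w"
  shows "local_arrow C J w u s"
proof -
  have "{h \<in> arrows_to C (Dom C f). Comp C g h = Comp C g' h} \<in> J (Dom C f)"
    if fg: "(f, g) \<in> s" and fg': "(f, g') \<in> s" for f g g'
  proof -
    have "Dom C g = Dom C f" using assms(1)[OF fg] by simp
    then show ?thesis using assms(3)[OF fg fg'] by (simp add: loc_eq_def agree_def)
  qed
  moreover have "s \<subseteq> {(f, g). f \<in> arrows_to C w \<and> g \<in> hom_set C (Dom C f) u}"
    using assms(1) by (auto simp: arrows_to_def hom_set_def)
  moreover have "\<forall>(f, g)\<in>s. \<forall>h\<in>arrows_to C (Dom C f). (Comp C f h, Comp C g h) \<in> s"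
    using assms(2) by (auto simp: arrows_to_def)
  moreover have "\<forall>f\<in>arrows_to C w. \<forall>g\<in>hom_set C (Dom C f) u.
        {h \<in> arrows_to C (Dom C f). (Comp C f h, Comp C g h) \<in> s} \<in> J (Dom C f) \<longrightarrow> (f, g) \<in> s"
    using assms(4) by (simp add: arrows_to_def hom_set_def)
  ultimately show ?thesis using assms(5) unfolding local_arrow_def by blast
qed

lemma local_arrow_in:
  "local_arrow C J w u s \<Longrightarrow> (f, g) \<in> s \<Longrightarrow>
    f \<in> Arr C \<and> Cod C f = w \<and> g \<in> Arr C \<and> Dom C g = Dom C f \<and> Cod C g = u"
  unfolding local_arrow_def by (auto simp: arrows_to_def hom_set_def)

lemma local_arrow_comp:
  "local_arrow C J w u s \<Longrightarrow> (f, g) \<in> s \<Longrightarrow> h \<in> Arr C \<Longrightarrow> Cod C h = Dom C f \<Longrightarrow> (Comp C f h, Comp C g h) \<in> s"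
  unfolding local_arrow_def by (auto simp: arrows_to_def)

lemma local_arrow_functional:
  assumes s: "local_arrow C J w u s" and fg: "(f, g) \<in> s" "(f, g') \<in> s"
  shows "loc_eq g g'"
proof -
  have "{h \<in> arrows_to C (Dom C f). Comp C g h = Comp C g' h} \<in> J (Dom C f)"
    using s fg unfolding local_arrow_def by blast
  then show ?thesis
    using local_arrow_in[OF s fg(1)] local_arrow_in[OF s fg(2)] by (simp add: loc_eq_def agree_def parallel_def)
qed

lemma local_arrow_local:
  assumes "local_arrow C J w u s" "f \<in> Arr C" "Cod C f = w" "g \<in> Arr C" "Dom C g = Dom C f" "Cod C g = u"
    "{h \<in> arrows_to C (Dom C f). (Comp C f h, Comp C g h) \<in> s} \<in> J (Dom C f)"
  shows "(f, g) \<in> s"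
proof -
  have "\<forall>f\<in>arrows_to C w. \<forall>g\<in>hom_set C (Dom C f) u.
        {h \<in> arrows_to C (Dom C f). (Comp C f h, Comp C g h) \<in> s} \<in> J (Dom C f) \<longrightarrow> (f, g) \<in> s"
    using assms(1) unfolding local_arrow_def by blast
  then show ?thesis using assms(2-) by (auto simp: arrows_to_def hom_set_def)
qed

lemma local_arrow_cover: "local_arrow C J w u s \<Longrightarrow> fst ` s \<in> J w"
  by (simp add: local_arrow_def)

text \<open>The saturation clause of \<open>local_arrow\<close> speaks of one particular sieve; the
  present form accepts any covering sieve contained in it.\<close>

lemma local_arrow_localI:
  assumes s: "local_arrow C J w u s" and f: "f \<in> Arr C" "Cod C f = w" "g \<in> Arr C" "Dom C g = Dom C f" "Cod C g = u"
    and R: "R \<in> J (Dom C f)" and h: "\<And>h. h \<in> R \<Longrightarrow> (Comp C f h, Comp C g h) \<in> s"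
  shows "(f, g) \<in> s"
proof (rule local_arrow_local[OF s f])
  have a: "Dom C f \<in> Obj C" using f by simp
  have sv: "sieve C (Dom C f) {h \<in> arrows_to C (Dom C f). (Comp C f h, Comp C g h) \<in> s}"
    unfolding sieve_def
  proof (intro conjI ballI)
    fix h k assume h: "h \<in> {h \<in> arrows_to C (Dom C f). (Comp C f h, Comp C g h) \<in> s}" and k: "k \<in> arrows_to C (Dom C h)"
    then have "(Comp C (Comp C f h) k, Comp C (Comp C g h) k) \<in> s"
      using f by (intro local_arrow_comp[OF s, of "Comp C f h" "Comp C g h" k]) (auto simp: arrows_to_def)
    then show "Comp C h k \<in> {h \<in> arrows_to C (Dom C f). (Comp C f h, Comp C g h) \<in> s}"
      using h k f by (simp add: arrows_to_def comp_assoc)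
  qed blast
  show "{h \<in> arrows_to C (Dom C f). (Comp C f h, Comp C g h) \<in> s} \<in> J (Dom C f)"
    by (rule cover_superset[OF a R sv]) (use h cover_sieve[OF a R] in \<open>auto simp: sieve_def\<close>)
qed

section \<open>The sheaf of local arrows\<close>

definition rep_res :: "'m \<Rightarrow> ('m \<times> 'm) set \<Rightarrow> ('m \<times> 'm) set" where
  "rep_res h s = {(f, g). f \<in> arrows_to C (Dom C h) \<and> (Comp C h f, g) \<in> s}"

text \<open>The local arrow defined by a global arrow \<open>k\<close>. The graph of
  \<open>k\<close> itself need not be saturated, whence \<open>loc_eq\<close> in place of
  equality.\<close>

definition rep_arr :: "'m \<Rightarrow> ('m \<times> 'm) set" where
  "rep_arr k = {(f, g). f \<in> arrows_to C (Dom C k) \<and> loc_eq (Comp C k f) g}"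

lemma Val_rep: "Val (rep C J u) w = Rel ` {s. local_arrow C J w u s}"
  and Act_rep [simp]: "Act (rep C J u) h (Rel s) = Rel (rep_res h s)"
  by (simp_all add: rep_def rep_res_def)

lemma local_arrow_res:
  assumes s: "local_arrow C J w u s" and h: "h \<in> Arr C" "Cod C h = w"
  shows "local_arrow C J (Dom C h) u (rep_res h s)"
proof (rule local_arrowI)
  fix f g assume fg: "(f, g) \<in> rep_res h s"
  then have f: "f \<in> Arr C" "Cod C f = Dom C h" "(Comp C h f, g) \<in> s"
    by (auto simp: rep_res_def arrows_to_def)
  then show "f \<in> Arr C \<and> Cod C f = Dom C h \<and> g \<in> Arr C \<and> Dom C g = Dom C f \<and> Cod C g = u"
    using local_arrow_in[OF s f(3)] h by simp
  fix k assume k: "k \<in> Arr C" "Cod C k = Dom C f"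
  then show "(Comp C f k, Comp C g k) \<in> rep_res h s"
    using local_arrow_comp[OF s f(3) k(1)] f h by (simp add: rep_res_def arrows_to_def comp_assoc)
next
  fix f g g' assume "(f, g) \<in> rep_res h s" "(f, g') \<in> rep_res h s"
  then show "loc_eq g g'" by (auto simp: rep_res_def intro: local_arrow_functional[OF s])
next
  fix f g assume f: "f \<in> Arr C" "Cod C f = Dom C h" "g \<in> Arr C" "Dom C g = Dom C f" "Cod C g = u"
    and R: "{k \<in> arrows_to C (Dom C f). (Comp C f k, Comp C g k) \<in> rep_res h s} \<in> J (Dom C f)"
  have "(Comp C h f, g) \<in> s"
    by (rule local_arrow_localI[OF s, where R = "{k \<in> arrows_to C (Dom C f). (Comp C f k, Comp C g k) \<in> rep_res h s}"])
      (use f h R in \<open>auto simp: rep_res_def arrows_to_def comp_assoc\<close>)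
  then show "(f, g) \<in> rep_res h s" using f by (simp add: rep_res_def arrows_to_def)
next
  have "fst ` rep_res h s = sieve_pullback C (fst ` s) h"
    by (force simp: rep_res_def sieve_pullback_def)
  then show "fst ` rep_res h s \<in> J (Dom C h)"
    using cover_pullback[OF _ local_arrow_cover[OF s] h] cod_obj[OF h(1)] h by simp
qed

lemma local_arrow_rep_arr:
  assumes k: "k \<in> Arr C"
  shows "local_arrow C J (Dom C k) (Cod C k) (rep_arr k)"
proof (rule local_arrowI)
  fix f g assume "(f, g) \<in> rep_arr k"
  then have f: "f \<in> Arr C" "Cod C f = Dom C k" "loc_eq (Comp C k f) g"
    by (auto simp: rep_arr_def arrows_to_def)
  then show g: "f \<in> Arr C \<and> Cod C f = Dom C k \<and> g \<in> Arr C \<and> Dom C g = Dom C f \<and> Cod C g = Cod C k"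
    using k by (simp add: loc_eq_def parallel_def)
  fix h assume h: "h \<in> Arr C" "Cod C h = Dom C f"
  then show "(Comp C f h, Comp C g h) \<in> rep_arr k"
    using f k loc_eq_comp[OF f(3) h(1)] by (simp add: rep_arr_def arrows_to_def comp_assoc)
next
  fix f g g' assume "(f, g) \<in> rep_arr k" "(f, g') \<in> rep_arr k"
  then show "loc_eq g g'" by (auto simp: rep_arr_def intro: loc_eq_trans loc_eq_sym)
next
  fix f g assume f: "f \<in> Arr C" "Cod C f = Dom C k" "g \<in> Arr C" "Dom C g = Dom C f" "Cod C g = Cod C k"
    and R: "{h \<in> arrows_to C (Dom C f). (Comp C f h, Comp C g h) \<in> rep_arr k} \<in> J (Dom C f)"
  have "loc_eq (Comp C k f) g"
  proof (rule loc_eq_local[where R = "{h \<in> arrows_to C (Dom C f). (Comp C f h, Comp C g h) \<in> rep_arr k}"])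
    show "parallel (Comp C k f) g" using f k by (simp add: parallel_def)
  qed (use f k R in \<open>auto simp: rep_arr_def arrows_to_def comp_assoc\<close>)
  then show "(f, g) \<in> rep_arr k" using f by (simp add: rep_arr_def arrows_to_def)
next
  have "fst ` rep_arr k = arrows_to C (Dom C k)"
    using k by (force simp: rep_arr_def arrows_to_def intro: loc_eq_refl)
  then show "fst ` rep_arr k \<in> J (Dom C k)" using cover_max k by simp
qed

lemma rep_res_ide: "local_arrow C J w u s \<Longrightarrow> w \<in> Obj C \<Longrightarrow> rep_res (Ide C w) s = s"
  unfolding rep_res_def arrows_to_def by (auto dest: local_arrow_in)

lemma rep_res_comp:
  "f \<in> Arr C \<Longrightarrow> g \<in> Arr C \<Longrightarrow> Cod C f = Dom C g \<Longrightarrow> rep_res (Comp C g f) s = rep_res f (rep_res g s)"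
  by (auto simp: rep_res_def arrows_to_def comp_assoc)

lemma presheaf_rep: "presheaf C (rep C J u)"
  by (rule presheafI) (auto simp: Val_rep local_arrow_res rep_res_ide rep_res_comp)

text \<open>After pulling back to the covering, a pair of \<open>s\<close> appears over an identity
  in the common restriction, hence in \<open>s'\<close>; saturation of \<open>s'\<close> brings the
  pair itself into \<open>s'\<close>.\<close>

lemma local_arrow_subset:
  assumes s: "local_arrow C J w u s" and s': "local_arrow C J w u s'" and w: "w \<in> Obj C" "R \<in> J w"
    and eq: "\<And>f. f \<in> R \<Longrightarrow> rep_res f s = rep_res f s'"
  shows "s \<subseteq> s'"
proof clarify
  fix f g assume fg: "(f, g) \<in> s"
  note f = local_arrow_in[OF s fg]
  show "(f, g) \<in> s'"
  proof (rule local_arrow_localI[OF s', where R = "sieve_pullback C R f"])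
    show "sieve_pullback C R f \<in> J (Dom C f)" using cover_pullback[OF w] f by simp
    fix h assume "h \<in> sieve_pullback C R f"
    then have h: "h \<in> Arr C" "Cod C h = Dom C f" "Comp C f h \<in> R"
      by (auto simp: sieve_pullback_def arrows_to_def)
    have "(Comp C f h, Comp C g h) \<in> s" by (rule local_arrow_comp[OF s fg h(1,2)])
    then have "(Ide C (Dom C h), Comp C g h) \<in> rep_res (Comp C f h) s"
      using h f by (simp add: rep_res_def arrows_to_def)
    then show "(Comp C f h, Comp C g h) \<in> s'"
      unfolding eq[OF h(3)] using h f by (simp add: rep_res_def)
  qed (use f in auto)
qed

text \<open>The values of a matching family along the arrows of its sieve form a relation
  \<open>q\<close>. The glued section is the saturation of \<open>q\<close>: a pair belongs to it
  when its restrictions belong to \<open>q\<close> on a covering.\<close>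

lemma sheaf_rep: "sheaf C J (rep C J u)"
proof (rule sheafI[OF presheaf_rep])
  fix w R \<sigma> assume w: "w \<in> Obj C" "R \<in> J w" and m: "matching_family C (rep C J u) R \<sigma>"
  note R = sieveD[OF cover_sieve[OF w]]
  define t where "t f = (THE s. \<sigma> f = Rel s)" for f
  have \<sigma>: "\<sigma> f = Rel (t f)" "local_arrow C J (Dom C f) u (t f)" if f: "f \<in> R" for f
  proof -
    obtain s where s: "\<sigma> f = Rel s" "local_arrow C J (Dom C f) u s"
      using m f unfolding matching_family_def by (auto simp: Val_rep)
    then have "t f = s" by (simp add: t_def)
    then show "\<sigma> f = Rel (t f)" "local_arrow C J (Dom C f) u (t f)" using s by auto
  qed
  have res: "rep_res h (t f) = t (Comp C f h)" if "f \<in> R" "h \<in> Arr C" "Cod C h = Dom C f" for f h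
  proof -
    have "Act (rep C J u) h (\<sigma> f) = \<sigma> (Comp C f h)"
      using m that unfolding matching_family_def by (auto simp: arrows_to_def)
    then show ?thesis
      using \<sigma>(1)[OF that(1)] \<sigma>(1)[OF sieve_comp[OF cover_sieve[OF w] that]] by simp
  qed
  \<comment> \<open>The section \<open>t f\<close> lives over \<open>Dom C f\<close>; its values
    along \<open>f\<close> are read off at the identity.\<close>
  define q where "q f g \<longleftrightarrow> f \<in> R \<and> (Ide C (Dom C f), g) \<in> t f" for f g
  have q_comp: "q (Comp C f h) g \<longleftrightarrow> (h, g) \<in> t f" if "f \<in> R" "h \<in> Arr C" "Cod C h = Dom C f" for f g h
    unfolding q_def res[OF that, symmetric] using that R[OF that(1)] sieve_comp[OF cover_sieve[OF w] that]
    by (simp add: rep_res_def arrows_to_def)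
  have q_in: "f \<in> Arr C" "Cod C f = w" "g \<in> Arr C" "Dom C g = Dom C f" "Cod C g = u" if "q f g" for f g
    using that R[of f] local_arrow_in[OF \<sigma>(2)[of f]] unfolding q_def by fastforce+
  have q_stable: "q (Comp C f h) (Comp C g h)" if "q f g" "h \<in> Arr C" "Cod C h = Dom C f" for f g h
  proof -
    have f: "f \<in> R" "(Ide C (Dom C f), g) \<in> t f" using that(1) by (auto simp: q_def)
    have "(Comp C (Ide C (Dom C f)) h, Comp C g h) \<in> t f"
      using local_arrow_comp[OF \<sigma>(2)[OF f(1)] f(2) that(2)] that(3) R[OF f(1)] by simp
    then show ?thesis using q_comp[OF f(1) that(2,3)] that by simp
  qed
  \<comment> \<open>The sieve of all refinements that bring the pair into \<open>q\<close>.\<close>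
  define T where "T f g = {h \<in> arrows_to C (Dom C f). q (Comp C f h) (Comp C g h)}" for f g
  have sieve_T: "sieve C (Dom C f) (T f g)" if "f \<in> Arr C" "g \<in> Arr C" "Dom C g = Dom C f" for f g
    unfolding sieve_def
  proof (intro conjI ballI)
    fix h k assume "h \<in> T f g" "k \<in> arrows_to C (Dom C h)"
    then show "Comp C h k \<in> T f g"
      using q_stable[of "Comp C f h" "Comp C g h" k] that by (simp add: T_def arrows_to_def comp_assoc)
  qed (auto simp: T_def)
  have pullback_T: "sieve_pullback C (T f g) h = T (Comp C f h) (Comp C g h)"
    if "f \<in> Arr C" "g \<in> Arr C" "Dom C g = Dom C f" "h \<in> Arr C" "Cod C h = Dom C f" for f g h
    using that by (auto simp: T_def sieve_pullback_def arrows_to_def comp_assoc)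
  define s where "s = {(f, g). f \<in> Arr C \<and> Cod C f = w \<and> g \<in> Arr C \<and> Dom C g = Dom C f \<and> Cod C g = u \<and> T f g \<in> J (Dom C f)}"
  have s_q: "(f, g) \<in> s" if "q f g" for f g
  proof -
    have "T f g = arrows_to C (Dom C f)" using q_stable[OF that] by (auto simp: T_def arrows_to_def)
    then show ?thesis using q_in[OF that] cover_max by (simp add: s_def)
  qed
  have s: "local_arrow C J w u s"
  proof (rule local_arrowI)
    fix f g assume fg: "(f, g) \<in> s"
    then show f: "f \<in> Arr C \<and> Cod C f = w \<and> g \<in> Arr C \<and> Dom C g = Dom C f \<and> Cod C g = u" by (simp add: s_def)
    fix h assume h: "h \<in> Arr C" "Cod C h = Dom C f"
    have "sieve_pullback C (T f g) h \<in> J (Dom C h)"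
      using fg h by (intro cover_pullback[of "Dom C f"]) (auto simp: s_def)
    then show "(Comp C f h, Comp C g h) \<in> s" using pullback_T f h by (simp add: s_def)
  next
    fix f g g' assume fg: "(f, g) \<in> s" "(f, g') \<in> s"
    show "loc_eq g g'"
    proof (rule loc_eq_local[where R = "T f g \<inter> T f g'"])
      show "parallel g g'" using fg by (simp add: s_def parallel_def)
      show "T f g \<inter> T f g' \<in> J (Dom C g)" using fg by (auto simp: s_def intro: cover_inter)
      fix h assume "h \<in> T f g \<inter> T f g'"
      then have h: "q (Comp C f h) (Comp C g h)" "q (Comp C f h) (Comp C g' h)" by (auto simp: T_def)
      then show "loc_eq (Comp C g h) (Comp C g' h)"
        using local_arrow_functional[OF \<sigma>(2)] unfolding q_def by blast
    qed
  next
    fix f g assume f: "f \<in> Arr C" "Cod C f = w" "g \<in> Arr C" "Dom C g = Dom C f" "Cod C g = u"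
      and S: "{h \<in> arrows_to C (Dom C f). (Comp C f h, Comp C g h) \<in> s} \<in> J (Dom C f)"
    have "T f g \<in> J (Dom C f)"
    proof (rule cover_trans[OF dom_obj[OF f(1)] S sieve_T[OF f(1,3,4)]])
      fix h assume "h \<in> {h \<in> arrows_to C (Dom C f). (Comp C f h, Comp C g h) \<in> s}"
      then show "sieve_pullback C (T f g) h \<in> J (Dom C h)"
        using pullback_T[OF f(1,3,4)] f by (auto simp: s_def arrows_to_def)
    qed
    then show "(f, g) \<in> s" using f by (simp add: s_def)
  next
    have "sieve C w (fst ` s)"
      unfolding sieve_def
    proof (intro conjI ballI)
      show "fst ` s \<subseteq> arrows_to C w" by (auto simp: s_def arrows_to_def)
      fix f h assume "f \<in> fst ` s" "h \<in> arrows_to C (Dom C f)"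
      then obtain g where fg: "(f, g) \<in> s" and h: "h \<in> Arr C" "Cod C h = Dom C f" by (auto simp: arrows_to_def)
      have f: "f \<in> Arr C" "g \<in> Arr C" "Dom C g = Dom C f" using fg by (auto simp: s_def)
      have "sieve_pullback C (T f g) h \<in> J (Dom C h)"
        using fg h by (intro cover_pullback[of "Dom C f"]) (auto simp: s_def)
      then have "(Comp C f h, Comp C g h) \<in> s" using pullback_T[OF f h] fg h by (simp add: s_def)
      then show "Comp C f h \<in> fst ` s" by force
    qed
    then show "fst ` s \<in> J w"
    proof (rule cover_trans[OF w])
      fix f assume f: "f \<in> R"
      note fR = R[OF f]
      \<comment> \<open>Over a member \<open>f\<close> of \<open>R\<close> the domain of the glued
        section contains the domain of \<open>t f\<close>, which is covering; transitivity of the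
        topology does the rest.\<close>
      have sub: "fst ` t f \<subseteq> sieve_pullback C (fst ` s) f"
      proof clarify
        fix h g assume hg: "(h, g) \<in> t f"
        note h = local_arrow_in[OF \<sigma>(2)[OF f] hg]
        have "(Comp C f h, g) \<in> s" using q_comp[OF f, of h g] h hg by (intro s_q) simp
        then have "Comp C f h \<in> fst ` s" by force
        then show "fst (h, g) \<in> sieve_pullback C (fst ` s) f" using h by (simp add: sieve_pullback_def arrows_to_def)
      qed
      show "sieve_pullback C (fst ` s) f \<in> J (Dom C f)"
      proof (rule cover_superset[OF _ local_arrow_cover[OF \<sigma>(2)[OF f]] _ sub])
        show "sieve C (Dom C f) (sieve_pullback C (fst ` s) f)"
          unfolding sieve_def
        proof (intro conjI ballI)
          show "sieve_pullback C (fst ` s) f \<subseteq> arrows_to C (Dom C f)" by (auto simp: sieve_pullback_def)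
          fix h k assume "h \<in> sieve_pullback C (fst ` s) f" and "k \<in> arrows_to C (Dom C h)"
          then show "Comp C h k \<in> sieve_pullback C (fst ` s) f"
            using sieve_comp[OF \<open>sieve C w (fst ` s)\<close>, of "Comp C f h" k] fR
            by (auto simp: sieve_pullback_def arrows_to_def comp_assoc)
        qed
      qed (use fR in simp)
    qed
  qed
  have res_s: "rep_res f s = t f" if f: "f \<in> R" for f
  proof -
    note fR = R[OF f]
    have "(h, g) \<in> rep_res f s \<longleftrightarrow> (h, g) \<in> t f" for h g
    proof
      assume "(h, g) \<in> rep_res f s"
      then have h: "h \<in> Arr C" "Cod C h = Dom C f" "(Comp C f h, g) \<in> s"
        by (auto simp: rep_res_def arrows_to_def)
      then have g: "g \<in> Arr C" "Dom C g = Dom C h" "Cod C g = u" "T (Comp C f h) g \<in> J (Dom C h)"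
        using fR by (auto simp: s_def)
      show "(h, g) \<in> t f"
      proof (rule local_arrow_localI[OF \<sigma>(2)[OF f] h(1,2) g])
        fix k assume "k \<in> T (Comp C f h) g"
        then have k: "k \<in> Arr C" "Cod C k = Dom C h" "q (Comp C (Comp C f h) k) (Comp C g k)"
          using h fR by (auto simp: T_def arrows_to_def)
        then have "q (Comp C f (Comp C h k)) (Comp C g k)" using h fR by (simp add: comp_assoc)
        then show "(Comp C h k, Comp C g k) \<in> t f" using q_comp[OF f, of "Comp C h k"] k h by simp
      qed
    next
      assume hg: "(h, g) \<in> t f"
      note h = local_arrow_in[OF \<sigma>(2)[OF f] hg]
      have "(Comp C f h, g) \<in> s" using q_comp[OF f, of h g] h hg by (intro s_q) simp
      then show "(h, g) \<in> rep_res f s" using h by (simp add: rep_res_def arrows_to_def)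
    qed
    then show ?thesis by auto
  qed
  have "v = Rel s" if v: "v \<in> Val (rep C J u) w" "\<forall>f\<in>R. Act (rep C J u) f v = \<sigma> f" for v
  proof -
    obtain s' where s': "v = Rel s'" "local_arrow C J w u s'" using v(1) by (auto simp: Val_rep)
    have eq: "rep_res f s' = rep_res f s" if "f \<in> R" for f
    proof -
      have "Rel (rep_res f s') = \<sigma> f" using v(2) that s'(1) by simp
      then show ?thesis unfolding res_s[OF that] \<sigma>(1)[OF that] by simp
    qed
    have "s' = s"
      using local_arrow_subset[OF s'(2) s w eq] local_arrow_subset[OF s s'(2) w eq[symmetric]] by blast
    then show ?thesis using s'(1) by simp
  qed
  moreover have "Rel s \<in> Val (rep C J u) w" "\<forall>f\<in>R. Act (rep C J u) f (Rel s) = \<sigma> f"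
    using s res_s \<sigma>(1) by (auto simp: Val_rep)
  ultimately show "\<exists>v. v \<in> Val (rep C J u) w \<and> (\<forall>f\<in>R. Act (rep C J u) f v = \<sigma> f) \<and>
        (\<forall>y. y \<in> Val (rep C J u) w \<and> (\<forall>f\<in>R. Act (rep C J u) f y = \<sigma> f) \<longrightarrow> y = v)"
    by blast
qed

end

context site begin

abbreviation rep_id :: "'o \<Rightarrow> ('e, 'm) univ" where
  "rep_id a \<equiv> Rel (rep_arr (Ide C a))"

lemma rep_id_in [simp]: "a \<in> Obj C \<Longrightarrow> rep_id a \<in> Val (rep C J a) a"
  using local_arrow_rep_arr[of "Ide C a"] by (auto simp: Val_rep)

lemma rep_res_rep_id: "g \<in> Arr C \<Longrightarrow> Cod C g = a \<Longrightarrow> rep_res g (rep_arr (Ide C a)) = rep_arr g"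
  by (auto simp: rep_res_def rep_arr_def arrows_to_def)

text \<open>Along \<open>f\<close> the section is represented by the honest arrow \<open>g\<close>;
  all other representatives differ from it by \<open>loc_eq\<close>, which is exactly the freedom
  built into \<open>rep_arr\<close>.\<close>

lemma rep_res_local_arrow:
  assumes s: "local_arrow C J w u s" and fg: "(f, g) \<in> s"
  shows "rep_res f s = rep_arr g"
proof -
  note f = local_arrow_in[OF s fg]
  have "(h, k) \<in> rep_res f s \<longleftrightarrow> (h, k) \<in> rep_arr g" for h k
  proof
    assume "(h, k) \<in> rep_res f s"
    then have h: "h \<in> Arr C" "Cod C h = Dom C f" "(Comp C f h, k) \<in> s" by (auto simp: rep_res_def arrows_to_def)
    then have "loc_eq (Comp C g h) k"
      using local_arrow_functional[OF s local_arrow_comp[OF s fg]] by blast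
    then show "(h, k) \<in> rep_arr g" using h f by (simp add: rep_arr_def arrows_to_def)
  next
    assume "(h, k) \<in> rep_arr g"
    then have h: "h \<in> Arr C" "Cod C h = Dom C f" "loc_eq (Comp C g h) k"
      using f by (auto simp: rep_arr_def arrows_to_def)
    then have k: "k \<in> Arr C" "Dom C k = Dom C h" "Cod C k = u" "agree (Comp C g h) k \<in> J (Dom C h)"
      using f by (auto simp: loc_eq_def parallel_def)
    have "(Comp C f h, k) \<in> s"
    proof (rule local_arrow_localI[OF s, where R = "agree (Comp C g h) k"])
      fix l assume "l \<in> agree (Comp C g h) k"
      then have l: "l \<in> Arr C" "Cod C l = Dom C h" "Comp C (Comp C g h) l = Comp C k l"
        using h f by (auto simp: agree_def arrows_to_def)
      have "(Comp C (Comp C f h) l, Comp C (Comp C g h) l) \<in> s"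
        using l h f by (intro local_arrow_comp[OF s local_arrow_comp[OF s fg h(1,2)]]) auto
      then show "(Comp C (Comp C f h) l, Comp C k l) \<in> s" using l by simp
    qed (use h k f in simp_all)
    then show "(h, k) \<in> rep_res f s" using h by (simp add: rep_res_def arrows_to_def)
  qed
  then show ?thesis by auto
qed

text \<open>Where the section \<open>s\<close> is represented by an arrow \<open>g\<close>, its
  image is the restriction along \<open>g\<close> of the image of the universal section
  \<open>rep_id\<close>. Such places cover \<open>w\<close>, so a map out of a represented sheaf is
  determined by that one image.\<close>

lemma yoneda_act:
  assumes \<psi>: "nat_trans C (rep C J a) F \<psi>" and w: "w \<in> Obj C" and s: "local_arrow C J w a s" and fg: "(f, g) \<in> s"
  shows "Act F f (\<psi> w (Rel s)) = Act F g (\<psi> a (rep_id a))"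
proof -
  note f = local_arrow_in[OF s fg]
  have a: "a \<in> Obj C" using f by auto
  have "Act F f (\<psi> w (Rel s)) = \<psi> (Dom C f) (Rel (rep_arr g))"
    using nat_trans_act[OF \<psi>, of f "Rel s"] f s rep_res_local_arrow[OF s fg] by (auto simp: Val_rep)
  also have "\<dots> = Act F g (\<psi> a (rep_id a))"
    using nat_trans_act[OF \<psi>, of g "rep_id a"] f rep_id_in[OF a] rep_res_rep_id[of g a] by simp
  finally show ?thesis .
qed

lemma sieve_fst_local_arrow:
  assumes "local_arrow C J w u s" "w \<in> Obj C"
  shows "sieve C w (fst ` s)"
  using cover_sieve[OF assms(2) local_arrow_cover[OF assms(1)]] .

lemma yoneda_ext:
  fixes F :: "('o, 'm, ('e, 'm) univ) psh"
  assumes F: "sheaf C J F" and \<psi>: "nat_trans C (rep C J a) F \<psi>" "nat_trans C (rep C J a) F \<phi>"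
    and eq: "\<psi> a (rep_id a) = \<phi> a (rep_id a)"
  shows "\<psi> = \<phi>"
proof (rule nat_trans_ext[OF \<psi>])
  fix w and v :: "('e, 'm) univ" assume w: "w \<in> Obj C" and v: "v \<in> Val (rep C J a) w"
  then obtain s where s: "v = Rel s" "local_arrow C J w a s" by (auto simp: Val_rep)
  show "\<psi> w v = \<phi> w v"
  proof (rule sheaf_eqI[OF F w local_arrow_cover[OF s(2)] sieve_fst_local_arrow[OF s(2) w]])
    show "\<psi> w v \<in> Val F w" "\<phi> w v \<in> Val F w"
      using nat_trans_in[OF \<psi>(1) w v] nat_trans_in[OF \<psi>(2) w v] .
    fix f assume "f \<in> fst ` s"
    then obtain g where "(f, g) \<in> s" by auto
    then show "Act F f (\<psi> w v) = Act F f (\<phi> w v)"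
      using yoneda_act[OF \<psi>(1) w s(2)] yoneda_act[OF \<psi>(2) w s(2)] eq s(1) by simp
  qed
qed

text \<open>The image of a local arrow \<open>s\<close> is glued from the restrictions of
  \<open>x\<close> along its representatives; \<open>act_loc_eq\<close> makes these restrictions
  independent of the choice of a representative.\<close>

lemma yoneda_ex:
  fixes F :: "('o, 'm, ('e, 'm) univ) psh"
  assumes F: "sheaf C J F" and a: "a \<in> Obj C" and x: "x \<in> Val F a"
  obtains \<psi> where "nat_trans C (rep C J a) F \<psi>" "\<psi> a (rep_id a) = x"
proof -
  note P = sheaf_presheaf[OF F]
  have ex: "\<exists>y. y \<in> Val F w \<and> (\<forall>(f, g)\<in>s. Act F f y = Act F g x)"
    if w: "w \<in> Obj C" and s: "local_arrow C J w a s" for w s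
  proof -
    define t where "t f = Act F (SOME g. (f, g) \<in> s) x" for f
    have t: "t f = Act F g x" if fg: "(f, g) \<in> s" for f g
    proof -
      have "(f, SOME g. (f, g) \<in> s) \<in> s" by (rule someI[of "\<lambda>g. (f, g) \<in> s"]) (rule fg)
      then show ?thesis
        unfolding t_def using act_loc_eq[OF F local_arrow_functional[OF s _ fg]] local_arrow_in[OF s] x by metis
    qed
    have "matching_family C F (fst ` s) t"
      unfolding matching_family_def
    proof (intro ballI conjI)
      fix f assume "f \<in> fst ` s"
      then obtain g where fg: "(f, g) \<in> s" by auto
      note f = local_arrow_in[OF s fg]
      show "t f \<in> Val F (Dom C f)" unfolding t[OF fg] using presheaf_act[OF P, of g x] f x by simp
      fix h assume "h \<in> arrows_to C (Dom C f)"
      then have h: "h \<in> Arr C" "Cod C h = Dom C f" by (auto simp: arrows_to_def)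
      show "Act F h (t f) = t (Comp C f h)"
        unfolding t[OF fg] t[OF local_arrow_comp[OF s fg h]] using presheaf_comp[OF P h(1), of g x] f x h by simp
    qed
    from sheaf_glue[OF F w local_arrow_cover[OF s] this] obtain y where
      "y \<in> Val F w" "\<And>f. f \<in> fst ` s \<Longrightarrow> Act F f y = t f" by metis
    then show ?thesis using t by (intro exI[of _ y]) force
  qed
  define \<psi> where "\<psi> w (v :: ('e, 'm) univ) = (SOME y. y \<in> Val F w \<and> (\<forall>(f, g)\<in>(THE s. v = Rel s). Act F f y = Act F g x))" for w v
  have \<psi>: "\<psi> w (Rel s) \<in> Val F w \<and> (\<forall>(f, g)\<in>s. Act F f (\<psi> w (Rel s)) = Act F g x)"
    if "w \<in> Obj C" "local_arrow C J w a s" for w s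
    unfolding \<psi>_def using someI_ex[OF ex[OF that]] by simp
  have \<psi>_eq: "\<psi> w (Rel s) = y" if w: "w \<in> Obj C" and s: "local_arrow C J w a s" and y: "y \<in> Val F w"
    and eq: "\<And>f g. (f, g) \<in> s \<Longrightarrow> Act F f y = Act F g x" for w s y
  proof (rule sheaf_eqI[OF F w local_arrow_cover[OF s] sieve_fst_local_arrow[OF s w] _ y])
    show "\<psi> w (Rel s) \<in> Val F w" using \<psi>[OF w s] by simp
    fix f assume "f \<in> fst ` s"
    then obtain g where "(f, g) \<in> s" by auto
    then show "Act F f (\<psi> w (Rel s)) = Act F f y" using \<psi>[OF w s] eq by auto
  qed
  have nt: "nat_trans C (rep C J a) F (nat_restrict C (rep C J a) \<psi>)"
  proof (rule nat_transI[OF presheaf_rep])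
    fix w and v :: "('e, 'm) univ" assume "w \<in> Obj C" "v \<in> Val (rep C J a) w"
    then show "\<psi> w v \<in> Val F w" using \<psi> by (auto simp: Val_rep)
  next
    fix h and v :: "('e, 'm) univ" assume h: "h \<in> Arr C" and "v \<in> Val (rep C J a) (Cod C h)"
    then obtain s where s: "v = Rel s" "local_arrow C J (Cod C h) a s" by (auto simp: Val_rep)
    note \<psi>s = \<psi>[OF cod_obj[OF h] s(2)]
    have "\<psi> (Dom C h) (Rel (rep_res h s)) = Act F h (\<psi> (Cod C h) (Rel s))"
    proof (rule \<psi>_eq[OF dom_obj[OF h] local_arrow_res[OF s(2) h refl]])
      show "Act F h (\<psi> (Cod C h) (Rel s)) \<in> Val F (Dom C h)" using presheaf_act[OF P h] \<psi>s by simp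
      fix f g assume "(f, g) \<in> rep_res h s"
      then have f: "f \<in> Arr C" "Cod C f = Dom C h" "(Comp C h f, g) \<in> s" by (auto simp: rep_res_def arrows_to_def)
      have "Act F f (Act F h (\<psi> (Cod C h) (Rel s))) = Act F (Comp C h f) (\<psi> (Cod C h) (Rel s))"
        using presheaf_comp[OF P f(1) h f(2)] \<psi>s by simp
      then show "Act F f (Act F h (\<psi> (Cod C h) (Rel s))) = Act F g x" using \<psi>s f(3) by auto
    qed
    then show "\<psi> (Dom C h) (Act (rep C J a) h v) = Act F h (\<psi> (Cod C h) v)" using s by simp
  qed
  have "\<psi> a (rep_id a) = x"
  proof (rule \<psi>_eq[OF a _ x])
    show "local_arrow C J a a (rep_arr (Ide C a))" using local_arrow_rep_arr[of "Ide C a"] a by simp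
    fix f g assume "(f, g) \<in> rep_arr (Ide C a)"
    then have f: "f \<in> Arr C" "Cod C f = a" "loc_eq f g" using a by (auto simp: rep_arr_def arrows_to_def)
    then show "Act F f x = Act F g x" using act_loc_eq[OF F f(3)] x by simp
  qed
  then show ?thesis by (intro that[OF nt]) (use a in simp)
qed

end


section \<open>The criterion for hyperbolicity\<close>

text \<open>Hom sets of sheaves consist of transformations tagged with source and target;
  \<open>e\<close> and \<open>e'\<close> are the taggings, and \<open>c\<close> is the map between
  the untagged transformations.\<close>

lemma bij_betw_Collect_iff:
  assumes "inj e" "inj e'" "\<And>x. P x \<Longrightarrow> f (e x) = e' (c x)" "\<And>x. P x \<Longrightarrow> Q (c x)"
  shows "bij_betw f (e ` {x. P x}) (e' ` {y. Q y}) \<longleftrightarrow>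
    (\<forall>x y. P x \<and> P y \<and> c x = c y \<longrightarrow> x = y) \<and> (\<forall>y. Q y \<longrightarrow> (\<exists>x. P x \<and> c x = y))"
proof -
  have "f ` e ` {x. P x} = e' ` c ` {x. P x}" using assms(3) by (auto simp: image_iff)
  then have "f ` e ` {x. P x} = e' ` {y. Q y} \<longleftrightarrow> c ` {x. P x} = {y. Q y}"
    by (simp add: inj_image_eq_iff[OF assms(2)])
  moreover have "c ` {x. P x} = {y. Q y} \<longleftrightarrow> (\<forall>y. Q y \<longrightarrow> (\<exists>x. P x \<and> c x = y))"
    using assms(4) by (auto simp: set_eq_iff image_iff; metis)
  moreover have "inj_on f (e ` {x. P x}) \<longleftrightarrow> (\<forall>x y. P x \<and> P y \<and> c x = c y \<longrightarrow> x = y)"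
  proof -
    have "inj_on f (e ` {x. P x}) \<longleftrightarrow> (\<forall>x y. P x \<and> P y \<and> f (e x) = f (e y) \<longrightarrow> e x = e y)"
      unfolding inj_on_def by auto
    then show ?thesis
      by (simp add: assms(3) inj_eq[OF assms(1)] inj_eq[OF assms(2)] cong: conj_cong)
  qed
  ultimately show ?thesis unfolding bij_betw_def by simp
qed

text \<open>Bijectivity of composition with the projection from \<open>F\<close> \<times>
  \<open>G\<close> to \<open>F\<close>, in terms of transformations. \<open>G\<close> may have no
  section over some objects, so the first clause compares values only where an \<open>r\<close>
  exists: this is what the composites see.\<close>

definition proj_bij ::
  "('o, 'm) category \<Rightarrow> ('o, 'm, ('e, 'm) univ) psh \<Rightarrow> ('o, 'm, ('e, 'm) univ) psh \<Rightarrow>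
    ('o, 'm, ('e, 'm) univ) psh \<Rightarrow> bool" where
  "proj_bij C G X F \<longleftrightarrow>
     (\<forall>\<phi> \<psi>. nat_trans C F X \<phi> \<and> nat_trans C F X \<psi> \<and>
        (\<forall>a\<in>Obj C. \<forall>s\<in>Val F a. \<forall>r\<in>Val G a. \<phi> a s = \<psi> a s) \<longrightarrow> \<phi> = \<psi>) \<and>
     (\<forall>\<psi>. nat_trans C (psh_prod F G) X \<psi> \<longrightarrow>
        (\<exists>\<phi>. nat_trans C F X \<phi> \<and> (\<forall>a\<in>Obj C. \<forall>s\<in>Val F a. \<forall>r\<in>Val G a. \<psi> a (Pair s r) = \<phi> a s)))"

lemma proj_bij_inj:
  "proj_bij C G X F \<Longrightarrow> nat_trans C F X \<phi> \<Longrightarrow> nat_trans C F X \<psi> \<Longrightarrow>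
    (\<And>a s r. a \<in> Obj C \<Longrightarrow> s \<in> Val F a \<Longrightarrow> r \<in> Val G a \<Longrightarrow> \<phi> a s = \<psi> a s) \<Longrightarrow> \<phi> = \<psi>"
  unfolding proj_bij_def by blast

lemma proj_bij_surj:
  assumes "proj_bij C G X F" "nat_trans C (psh_prod F G) X \<psi>"
  obtains \<phi> where "nat_trans C F X \<phi>"
    "\<And>a s r. a \<in> Obj C \<Longrightarrow> s \<in> Val F a \<Longrightarrow> r \<in> Val G a \<Longrightarrow> \<psi> a (Pair s r) = \<phi> a s"
  using assms unfolding proj_bij_def by blast

context cat begin

lemma pair_fst_comp:
  "nat_restrict C (psh_prod F G) (\<lambda>a v. \<phi> a (nat_restrict C (psh_prod F G) (\<lambda>_. pair_fst) a v)) =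
    nat_restrict C (psh_prod F G) (\<lambda>a v. \<phi> a (pair_fst v))"
  by (rule nat_restrict_cong) simp

lemma nat_trans_pair_fst:
  assumes "presheaf C F" "presheaf C G"
  shows "nat_trans C (psh_prod F G) F (nat_restrict C (psh_prod F G) (\<lambda>_. pair_fst))"
  by (rule nat_transI[OF presheaf_psh_prod[OF assms]]) (auto simp: Val_psh_prod)

lemma psh_proj_bij_iff:
  assumes F: "sheaf C J F" and G: "sheaf C J G" and X: "sheaf C J X"
  shows "bij_betw (\<lambda>g. Comp (sheaf_cat C J) g (psh_proj C F G))
      (hom_set (sheaf_cat C J) F X) (hom_set (sheaf_cat C J) (psh_prod F G) X) \<longleftrightarrow> proj_bij C G X F"
proof -
  let ?P = "psh_prod F G"
  let ?c = "\<lambda>\<phi>. nat_restrict C ?P (\<lambda>a v. \<phi> a (pair_fst v))"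
  let ?f = "\<lambda>g. Comp (sheaf_cat C J) g (psh_proj C F G)"
  note P = sheaf_presheaf[OF F] sheaf_presheaf[OF G] and FG = sheaf_psh_prod[OF F G]
  have c: "nat_trans C ?P X (?c \<phi>)" if "nat_trans C F X \<phi>" for \<phi>
    using nat_trans_comp[OF presheaf_psh_prod[OF P] nat_trans_pair_fst[OF P] that] unfolding pair_fst_comp .
  have f: "?f (F, \<phi>, X) = (?P, ?c \<phi>, X)" for \<phi> unfolding psh_proj_eq by (simp add: pair_fst_comp)
  have c_eq: "?c \<phi> = \<psi> \<longleftrightarrow> (\<forall>a\<in>Obj C. \<forall>s\<in>Val F a. \<forall>r\<in>Val G a. \<psi> a (Pair s r) = \<phi> a s)"
    if \<psi>: "nat_trans C ?P X \<psi>" for \<phi> \<psi>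
  proof
    assume "?c \<phi> = \<psi>"
    then show "\<forall>a\<in>Obj C. \<forall>s\<in>Val F a. \<forall>r\<in>Val G a. \<psi> a (Pair s r) = \<phi> a s"
      by (auto simp: Val_psh_prod)
  next
    assume *: "\<forall>a\<in>Obj C. \<forall>s\<in>Val F a. \<forall>r\<in>Val G a. \<psi> a (Pair s r) = \<phi> a s"
    have "?c \<phi> = nat_restrict C ?P \<psi>" by (rule nat_restrict_cong) (use * in \<open>auto simp: Val_psh_prod\<close>)
    then show "?c \<phi> = \<psi>" by (simp add: nat_restrict_nat_trans[OF \<psi>])
  qed
  have hom: "hom_set (sheaf_cat C J) F X = (\<lambda>\<phi>. (F, \<phi>, X)) ` {\<phi>. nat_trans C F X \<phi>}"
    "hom_set (sheaf_cat C J) ?P X = (\<lambda>\<phi>. (?P, \<phi>, X)) ` {\<phi>. nat_trans C ?P X \<phi>}"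
    using F X FG by (auto simp: hom_sheaf_cat)
  have "bij_betw ?f (hom_set (sheaf_cat C J) F X) (hom_set (sheaf_cat C J) ?P X) \<longleftrightarrow>
    (\<forall>\<phi> \<psi>. nat_trans C F X \<phi> \<and> nat_trans C F X \<psi> \<and> ?c \<phi> = ?c \<psi> \<longrightarrow> \<phi> = \<psi>) \<and>
    (\<forall>\<psi>. nat_trans C ?P X \<psi> \<longrightarrow> (\<exists>\<phi>. nat_trans C F X \<phi> \<and> ?c \<phi> = \<psi>))"
    unfolding hom by (rule bij_betw_Collect_iff) (auto simp only: f prod.inject inj_def c)
  also have "\<dots> \<longleftrightarrow> proj_bij C G X F"
  proof -
    have "?c \<phi> = ?c \<psi> \<longleftrightarrow> (\<forall>a\<in>Obj C. \<forall>s\<in>Val F a. \<forall>r\<in>Val G a. \<phi> a s = \<psi> a s)"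
      if "nat_trans C F X \<psi>" for \<phi> \<psi>
      unfolding c_eq[OF c[OF that]] by (auto simp: Val_psh_prod)
    then show ?thesis unfolding proj_bij_def by (simp only: c_eq cong: conj_cong imp_cong)
  qed
  finally show ?thesis .
qed

lemma spsh_proj_eq:
  "spsh_proj C Y G = (spsh_prod C Y G, \<lambda>n. nat_restrict C (psh_prod (Lev Y n) G) (\<lambda>_. pair_fst), Y)"
  by (simp add: spsh_proj_def nat_restrict_def)

lemma Lev_spsh_prod [simp]: "Lev (spsh_prod C Y G) n = psh_prod (Lev Y n) G"
  by (simp add: spsh_prod_def)

lemma LevOp_spsh_prod [simp]:
  "a \<in> Obj C \<Longrightarrow> s \<in> Val (Lev Y n) a \<Longrightarrow> r \<in> Val G a \<Longrightarrow>
    LevOp (spsh_prod C Y G) m n \<theta> a (Pair s r) = Pair (LevOp Y m n \<theta> a s) r"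
  by (simp add: spsh_prod_def Val_psh_prod)

lemma LevOp_spsh_prod_restrict:
  "LevOp (spsh_prod C Y G) m n \<theta> = nat_restrict C (psh_prod (Lev Y n) G)
    (\<lambda>a v. Pair (LevOp Y m n \<theta> a (pair_fst v)) (pair_snd v))"
proof -
  have "LevOp (spsh_prod C Y G) m n \<theta> = nat_restrict C (psh_prod (Lev Y n) G)
    (\<lambda>a v. case v of Pair x y \<Rightarrow> Pair (LevOp Y m n \<theta> a x) y | _ \<Rightarrow> v)"
    by (simp add: spsh_prod_def nat_restrict_def)
  also have "\<dots> = nat_restrict C (psh_prod (Lev Y n) G) (\<lambda>a v. Pair (LevOp Y m n \<theta> a (pair_fst v)) (pair_snd v))"
    by (rule nat_restrict_cong) (auto simp: Val_psh_prod)
  finally show ?thesis .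
qed

lemma spsh_prod_const: "spsh_prod C (const_simplicial C F) G = const_simplicial C (psh_prod F G)"
proof (rule spsh.equality)
  have "LevOp (spsh_prod C (const_simplicial C F) G) m n \<theta> = nat_restrict C (psh_prod F G) (\<lambda>a v. v)" for m n \<theta>
    unfolding LevOp_spsh_prod_restrict Lev_const by (rule nat_restrict_cong) (auto simp: Val_psh_prod)
  then show "LevOp (spsh_prod C (const_simplicial C F) G) = LevOp (const_simplicial C (psh_prod F G))"
    by (simp add: fun_eq_iff const_simplicial_def nat_restrict_def)
qed (simp_all add: fun_eq_iff)

lemma simplicial_sheaf_spsh_prod:
  assumes Y: "simplicial_sheaf C J Y" and G: "sheaf C J G"
  shows "simplicial_sheaf C J (spsh_prod C Y G)"
  unfolding simplicial_sheaf_def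
proof (intro conjI allI ballI)
  fix n show "sheaf C J (Lev (spsh_prod C Y G) n)"
    using sheaf_psh_prod[OF simplicial_sheaf_Lev[OF Y] G] by simp
next
  fix m n \<theta> assume \<theta>: "\<theta> \<in> Delta m n"
  note op = simplicial_sheaf_LevOp[OF Y \<theta>]
  show "nat_trans C (Lev (spsh_prod C Y G) n) (Lev (spsh_prod C Y G) m) (LevOp (spsh_prod C Y G) m n \<theta>)"
    unfolding LevOp_spsh_prod_restrict Lev_spsh_prod
    by (rule nat_transI[OF presheaf_psh_prod[OF simplicial_sheaf_presheaf[OF Y] sheaf_presheaf[OF G]]])
      (auto simp: Val_psh_prod nat_trans_in[OF op] nat_trans_act[OF op])
next
  fix n a v assume "a \<in> Obj C" "v \<in> Val (Lev (spsh_prod C Y G) n) a"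
  then show "LevOp (spsh_prod C Y G) n n (\<lambda>i\<in>{..n}. i) a v = v"
    by (auto simp: Val_psh_prod simplicial_sheaf_ide[OF Y])
next
  fix k m n \<theta> \<phi> a v assume \<theta>: "\<theta> \<in> Delta k m" "\<phi> \<in> Delta m n" and a: "a \<in> Obj C" "v \<in> Val (Lev (spsh_prod C Y G) n) a"
  then show "LevOp (spsh_prod C Y G) k n (compose {..k} \<phi> \<theta>) a v =
    LevOp (spsh_prod C Y G) k m \<theta> a (LevOp (spsh_prod C Y G) m n \<phi> a v)"
    by (auto simp: Val_psh_prod simplicial_sheaf_comp[OF Y \<theta> a(1)] nat_trans_in[OF simplicial_sheaf_LevOp[OF Y]])
qed

lemma spsh_proj_arr:
  assumes Y: "simplicial_sheaf C J Y" and G: "sheaf C J G"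
  shows "spsh_proj C Y G \<in> Arr (simplicial_sheaf_cat C J)"
proof -
  have "simplicial_nat_trans C (spsh_prod C Y G) Y (\<lambda>n. nat_restrict C (psh_prod (Lev Y n) G) (\<lambda>_. pair_fst))"
    unfolding simplicial_nat_trans_def Lev_spsh_prod
    using nat_trans_pair_fst[OF simplicial_sheaf_presheaf[OF Y] sheaf_presheaf[OF G]]
    by (auto simp: Val_psh_prod nat_trans_in[OF simplicial_sheaf_LevOp[OF Y]])
  then show ?thesis unfolding spsh_proj_eq using simplicial_sheaf_spsh_prod[OF assms] Y by simp
qed

lemma spsh_proj_comp:
  "Comp (simplicial_sheaf_cat C J) (Y, \<eta>, Z) (spsh_proj C Y G) =
    (spsh_prod C Y G, \<lambda>n. nat_restrict C (psh_prod (Lev Y n) G) (\<lambda>a v. \<eta> n a (pair_fst v)), Z)"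
  unfolding spsh_proj_eq by (simp add: pair_fst_comp)

text \<open>Each level descends on its own. That the descended maps commute with the simplicial
  operators follows from uniqueness of descent, since both sides pull back to the same map on the
  product.\<close>

lemma spsh_proj_bij:
  assumes Y: "simplicial_sheaf C J Y" and G: "sheaf C J G" and X: "sheaf C J X"
    and bij: "\<And>n. proj_bij C G X (Lev Y n)"
  shows "bij_betw (\<lambda>g. Comp (simplicial_sheaf_cat C J) g (spsh_proj C Y G))
    (hom_set (simplicial_sheaf_cat C J) Y (const_simplicial C X))
    (hom_set (simplicial_sheaf_cat C J) (spsh_prod C Y G) (const_simplicial C X))"
proof (rule bij_betw_imageI)
  let ?S = "simplicial_sheaf_cat C J" and ?X = "const_simplicial C X" and ?P = "spsh_prod C Y G"
  note cX = const_simplicial_sheaf[OF X] and P = simplicial_sheaf_spsh_prod[OF Y G]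
  have lev: "nat_trans C (Lev Z n) X (\<eta> n)" if "simplicial_nat_trans C Z ?X \<eta>" for Z \<eta> n
    using simplicial_nat_trans_level[OF that, of n] by simp
  show "inj_on (\<lambda>g. Comp ?S g (spsh_proj C Y G)) (hom_set ?S Y ?X)"
  proof (rule inj_onI)
    fix g h assume "g \<in> hom_set ?S Y ?X" "h \<in> hom_set ?S Y ?X"
      and eq: "Comp ?S g (spsh_proj C Y G) = Comp ?S h (spsh_proj C Y G)"
    then obtain \<eta> \<epsilon> where g: "g = (Y, \<eta>, ?X)" "simplicial_nat_trans C Y ?X \<eta>"
      and h: "h = (Y, \<epsilon>, ?X)" "simplicial_nat_trans C Y ?X \<epsilon>"
      by (auto simp: hom_simplicial_sheaf_cat)
    have "\<eta> n = \<epsilon> n" for n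
    proof (rule proj_bij_inj[OF bij lev[OF g(2)] lev[OF h(2)]])
      fix a s r assume a: "a \<in> Obj C" "s \<in> Val (Lev Y n) a" "r \<in> Val G a"
      have "nat_restrict C (psh_prod (Lev Y n) G) (\<lambda>a v. \<eta> n a (pair_fst v)) =
        nat_restrict C (psh_prod (Lev Y n) G) (\<lambda>a v. \<epsilon> n a (pair_fst v))"
        using eq unfolding g h spsh_proj_comp by (auto dest: fun_cong)
      from fun_cong[OF fun_cong[OF this, of a], of "Pair s r"] show "\<eta> n a s = \<epsilon> n a s"
        using a by (simp add: Val_psh_prod)
    qed
    then show "g = h" using g h by auto
  qed
  show "(\<lambda>g. Comp ?S g (spsh_proj C Y G)) ` hom_set ?S Y ?X = hom_set ?S ?P ?X"
  proof (intro subset_antisym subsetI)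
    fix g assume "g \<in> (\<lambda>g. Comp ?S g (spsh_proj C Y G)) ` hom_set ?S Y ?X"
    then obtain h where h: "h \<in> hom_set ?S Y ?X" "g = Comp ?S h (spsh_proj C Y G)" by blast
    interpret S: cat ?S by (rule cat_simplicial_sheaf_cat)
    have p: "spsh_proj C Y G \<in> Arr ?S" "Dom ?S (spsh_proj C Y G) = ?P" "Cod ?S (spsh_proj C Y G) = Y"
      using spsh_proj_arr[OF Y G] by (auto simp: spsh_proj_eq)
    have hh: "h \<in> Arr ?S" "Dom ?S h = Y" "Cod ?S h = ?X" using h(1) by (simp_all only: hom_set_def mem_Collect_eq)
    have eq: "Cod ?S (spsh_proj C Y G) = Dom ?S h" by (simp only: p hh)
    show "g \<in> hom_set ?S ?P ?X"
      unfolding h(2) hom_set_def mem_Collect_eq S.dom_comp[OF p(1) hh(1) eq] S.cod_comp[OF p(1) hh(1) eq]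
      by (intro conjI S.arr_comp[OF p(1) hh(1) eq] p hh)
  next
    fix g assume "g \<in> hom_set ?S ?P ?X"
    then obtain \<psi> where g: "g = (?P, \<psi>, ?X)" "simplicial_nat_trans C ?P ?X \<psi>"
      by (auto simp: hom_simplicial_sheaf_cat)
    have "\<exists>\<phi>. nat_trans C (Lev Y n) X \<phi> \<and>
      (\<forall>a s r. a \<in> Obj C \<longrightarrow> s \<in> Val (Lev Y n) a \<longrightarrow> r \<in> Val G a \<longrightarrow> \<psi> n a (Pair s r) = \<phi> a s)" for n
      using proj_bij_surj[OF bij lev[OF g(2), unfolded Lev_spsh_prod], of n] by metis
    then obtain \<phi> where \<phi>: "\<And>n. nat_trans C (Lev Y n) X (\<phi> n)"
      "\<And>n a s r. a \<in> Obj C \<Longrightarrow> s \<in> Val (Lev Y n) a \<Longrightarrow> r \<in> Val G a \<Longrightarrow> \<psi> n a (Pair s r) = \<phi> n a s"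
      by metis
    have "simplicial_nat_trans C Y ?X \<phi>"
      unfolding simplicial_nat_trans_def Lev_const
    proof (intro conjI allI ballI \<phi>(1))
      fix m n \<theta> a s assume \<theta>: "\<theta> \<in> Delta m n" and a: "a \<in> Obj C" "s \<in> Val (Lev Y n) a"
      note op = simplicial_sheaf_LevOp[OF Y \<theta>]
      have nt: "nat_trans C (Lev Y n) X (nat_restrict C (Lev Y n) (\<lambda>a s. \<phi> m a (LevOp Y m n \<theta> a s)))"
        by (rule nat_trans_comp[OF simplicial_sheaf_presheaf[OF Y] op \<phi>(1)])
      have "nat_restrict C (Lev Y n) (\<lambda>a s. \<phi> m a (LevOp Y m n \<theta> a s)) = \<phi> n"
      proof (rule proj_bij_inj[OF bij nt \<phi>(1)])
        fix a s r assume b: "a \<in> Obj C" "s \<in> Val (Lev Y n) a" "r \<in> Val G a"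
        have "\<phi> m a (LevOp Y m n \<theta> a s) = \<psi> m a (LevOp ?P m n \<theta> a (Pair s r))"
          using b \<phi>(2)[OF b(1) nat_trans_in[OF op b(1,2)] b(3)] by simp
        \<comment> \<open>The target is constant, so the value of \<psi> does not change along a
          simplicial operator.\<close>
        also have "\<dots> = \<psi> n a (Pair s r)"
          by (rule const_map_level[OF P g(2) b(1) _ \<theta>]) (use b in \<open>simp add: Val_psh_prod\<close>)
        also have "\<dots> = \<phi> n a s" by (rule \<phi>(2)[OF b])
        finally show "nat_restrict C (Lev Y n) (\<lambda>a s. \<phi> m a (LevOp Y m n \<theta> a s)) a s = \<phi> n a s" using b by simp
      qed
      from fun_cong[OF fun_cong[OF this, of a], of s]
      show "\<phi> m a (LevOp Y m n \<theta> a s) = LevOp ?X m n \<theta> a (\<phi> n a s)"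
        using a nat_trans_in[OF \<phi>(1) a] by simp
    qed
    then have "(Y, \<phi>, ?X) \<in> hom_set ?S Y ?X" using Y cX by (simp add: hom_simplicial_sheaf_cat)
    moreover have "Comp ?S (Y, \<phi>, ?X) (spsh_proj C Y G) = g"
    proof -
      have "nat_restrict C (psh_prod (Lev Y n) G) (\<lambda>a v. \<phi> n a (pair_fst v)) =
          nat_restrict C (psh_prod (Lev Y n) G) (\<psi> n)" for n
        by (rule nat_restrict_cong) (auto simp: Val_psh_prod \<phi>(2))
      also have "nat_restrict C (psh_prod (Lev Y n) G) (\<psi> n) = \<psi> n" for n
        using nat_restrict_nat_trans[OF lev[OF g(2)]] by simp
      finally show ?thesis unfolding spsh_proj_comp g by simp
    qed
    ultimately show "g \<in> (\<lambda>g. Comp ?S g (spsh_proj C Y G)) ` hom_set ?S Y ?X" by blast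
  qed
qed

definition const_arr :: "('o, 'm, 'v) psh_arr \<Rightarrow> ('o, 'm, 'v) spsh_arr" where
  "const_arr = (\<lambda>(F, \<phi>, X). (const_simplicial C F, \<lambda>n. \<phi>, const_simplicial C X))"

text \<open>Constant simplicial sheaves form a full subcategory, because a simplicial map between
  them is determined at level 0.\<close>

lemma const_arr_bij:
  assumes F: "sheaf C J F" and X: "sheaf C J X"
  shows "bij_betw const_arr (hom_set (sheaf_cat C J) F X)
    (hom_set (simplicial_sheaf_cat C J) (const_simplicial C F) (const_simplicial C X))"
proof (rule bij_betw_imageI)
  let ?F = "const_simplicial C F" and ?X = "const_simplicial C X"
  have nt: "simplicial_nat_trans C ?F ?X (\<lambda>n. \<phi>) \<longleftrightarrow> nat_trans C F X \<phi>" for \<phi>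
    unfolding simplicial_nat_trans_def using nat_trans_in[of C F X \<phi>] by auto
  show "inj_on const_arr (hom_set (sheaf_cat C J) F X)"
    by (auto simp: inj_on_def hom_sheaf_cat const_arr_def dest: fun_cong)
  show "const_arr ` hom_set (sheaf_cat C J) F X = hom_set (simplicial_sheaf_cat C J) ?F ?X"
  proof (intro subset_antisym subsetI)
    fix g assume "g \<in> const_arr ` hom_set (sheaf_cat C J) F X"
    then show "g \<in> hom_set (simplicial_sheaf_cat C J) ?F ?X"
      using const_simplicial_sheaf[OF F] const_simplicial_sheaf[OF X] nt
      by (auto simp: hom_sheaf_cat hom_simplicial_sheaf_cat const_arr_def)
  next
    fix g assume "g \<in> hom_set (simplicial_sheaf_cat C J) ?F ?X"
    then obtain \<eta> where g: "g = (?F, \<eta>, ?X)" "simplicial_nat_trans C ?F ?X \<eta>"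
      by (auto simp: hom_simplicial_sheaf_cat)
    have \<eta>0: "nat_trans C F X (\<eta> 0)" using simplicial_nat_trans_level[OF g(2), of 0] by simp
    have "(\<lambda>n. \<eta> 0) = \<eta>"
      by (rule const_map_ext[OF const_simplicial_sheaf[OF F] _ g(2)]) (use nt \<eta>0 in auto)
    then have "g = const_arr (F, \<eta> 0, X)" using g by (simp add: const_arr_def)
    then show "g \<in> const_arr ` hom_set (sheaf_cat C J) F X" using \<eta>0 F X by (auto simp: hom_sheaf_cat)
  qed
qed

text \<open>The product of a constant simplicial sheaf with \<open>G\<close> is again constant, so
  the full embedding \<open>const_arr\<close> carries the bijection for simplicial sheaves back to
  sheaves of sets.\<close>

lemma proj_bij_const:
  assumes F: "sheaf C J F" and G: "sheaf C J G" and X: "sheaf C J X"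
    and bij: "bij_betw (\<lambda>g. Comp (simplicial_sheaf_cat C J) g (spsh_proj C (const_simplicial C F) G))
      (hom_set (simplicial_sheaf_cat C J) (const_simplicial C F) (const_simplicial C X))
      (hom_set (simplicial_sheaf_cat C J) (spsh_prod C (const_simplicial C F) G) (const_simplicial C X))"
  shows "bij_betw (\<lambda>g. Comp (sheaf_cat C J) g (psh_proj C F G))
      (hom_set (sheaf_cat C J) F X) (hom_set (sheaf_cat C J) (psh_prod F G) X)"
proof -
  let ?S = "simplicial_sheaf_cat C J" and ?F = "const_simplicial C F" and ?X = "const_simplicial C X"
    and ?P = "psh_prod F G"
  have "bij_betw ((\<lambda>g. Comp ?S g (spsh_proj C ?F G)) \<circ> const_arr) (hom_set (sheaf_cat C J) F X)
    (hom_set ?S (const_simplicial C ?P) ?X)"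
    using bij_betw_trans[OF const_arr_bij[OF F X] bij] by (simp add: spsh_prod_const)
  also have "bij_betw ((\<lambda>g. Comp ?S g (spsh_proj C ?F G)) \<circ> const_arr) (hom_set (sheaf_cat C J) F X)
    (hom_set ?S (const_simplicial C ?P) ?X) =
    bij_betw (const_arr \<circ> (\<lambda>g. Comp (sheaf_cat C J) g (psh_proj C F G))) (hom_set (sheaf_cat C J) F X)
    (hom_set ?S (const_simplicial C ?P) ?X)"
    by (rule bij_betw_cong)
      (auto simp: hom_sheaf_cat const_arr_def spsh_proj_comp psh_proj_eq pair_fst_comp spsh_prod_const)
  also have "\<dots> \<longleftrightarrow> ?thesis"
  proof (rule bij_betw_comp_iff2[symmetric])
    show "bij_betw const_arr (hom_set (sheaf_cat C J) ?P X) (hom_set ?S (const_simplicial C ?P) ?X)"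
      by (rule const_arr_bij[OF sheaf_psh_prod[OF F G] X])
    have "nat_trans C ?P X (nat_restrict C ?P (\<lambda>a v. \<phi> a (pair_fst v)))" if "nat_trans C F X \<phi>" for \<phi>
      using nat_trans_comp[OF presheaf_psh_prod nat_trans_pair_fst that, of G] sheaf_presheaf F G
      unfolding pair_fst_comp by blast
    then show "(\<lambda>g. Comp (sheaf_cat C J) g (psh_proj C F G)) ` hom_set (sheaf_cat C J) F X
      \<subseteq> hom_set (sheaf_cat C J) ?P X"
      using sheaf_psh_prod[OF F G] X by (auto simp: hom_sheaf_cat psh_proj_eq pair_fst_comp)
  qed
  finally show ?thesis .
qed

end

context site begin

text \<open>A map from \<open>F \<times> G\<close> to \<open>X\<close> is determined by its restrictions along the maps from
  represented sheaves to \<open>F\<close>.\<close>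

lemma proj_bij_rep_imp:
  fixes F :: "('o, 'm, ('e, 'm) univ) psh"
  assumes F: "sheaf C J F" and G: "sheaf C J G" and X: "sheaf C J X"
    and rep: "\<And>U. U \<in> Obj C \<Longrightarrow> proj_bij C G X (rep C J U)"
  shows "proj_bij C G X F"
  unfolding proj_bij_def
proof (intro conjI allI impI)
  note PF = sheaf_presheaf[OF F] and PG = sheaf_presheaf[OF G]
  fix \<phi> \<psi> assume *: "nat_trans C F X \<phi> \<and> nat_trans C F X \<psi> \<and>
        (\<forall>a\<in>Obj C. \<forall>s\<in>Val F a. \<forall>r\<in>Val G a. \<phi> a s = \<psi> a s)"
  show "\<phi> = \<psi>"
  proof (rule nat_trans_ext)
    show \<phi>: "nat_trans C F X \<phi>" and \<psi>: "nat_trans C F X \<psi>" using * by auto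
    fix a s assume a: "a \<in> Obj C" "s \<in> Val F a"
    obtain \<sigma> where \<sigma>: "nat_trans C (rep C J a) F \<sigma>" "\<sigma> a (rep_id a) = s" by (rule yoneda_ex[OF F a])
    have "nat_restrict C (rep C J a) (\<lambda>b t. \<phi> b (\<sigma> b t)) = nat_restrict C (rep C J a) (\<lambda>b t. \<psi> b (\<sigma> b t))"
    proof (rule proj_bij_inj[OF rep[OF a(1)] nat_trans_comp[OF presheaf_rep \<sigma>(1) \<phi>] nat_trans_comp[OF presheaf_rep \<sigma>(1) \<psi>]])
      fix b r and t :: "('e, 'm) univ" assume "b \<in> Obj C" "t \<in> Val (rep C J a) b" "r \<in> Val G b"
      then show "nat_restrict C (rep C J a) (\<lambda>b t. \<phi> b (\<sigma> b t)) b t = nat_restrict C (rep C J a) (\<lambda>b t. \<psi> b (\<sigma> b t)) b t"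
        using * nat_trans_in[OF \<sigma>(1)] by auto
    qed
    from fun_cong[OF fun_cong[OF this, of a], of "rep_id a"] show "\<phi> a s = \<psi> a s"
      using a \<sigma>(2) by simp
  qed
next
  note PF = sheaf_presheaf[OF F] and PG = sheaf_presheaf[OF G]
  fix \<psi> assume \<psi>: "nat_trans C (psh_prod F G) X \<psi>"
  \<comment> \<open>By the Yoneda lemma a section \<open>s\<close> over \<open>a\<close> is a map
    \<sigma> from the sheaf represented by \<open>a\<close> to \<open>F\<close>; the relation says
    that \<xi> is the descent of the pullback of \<psi> along \<sigma>.\<close>
  define Q where "Q a s \<xi> \<longleftrightarrow> nat_trans C (rep C J a) X \<xi> \<and>
    (\<exists>\<sigma>. nat_trans C (rep C J a) F \<sigma> \<and> \<sigma> a (rep_id a) = s \<and>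
      (\<forall>b\<in>Obj C. \<forall>t\<in>Val (rep C J a) b. \<forall>r\<in>Val G b. \<psi> b (Pair (\<sigma> b t) r) = \<xi> b t))" for a s \<xi>
  have Q_ex: "\<exists>\<xi>. Q a s \<xi>" if a: "a \<in> Obj C" "s \<in> Val F a" for a s
  proof -
    obtain \<sigma> where \<sigma>: "nat_trans C (rep C J a) F \<sigma>" "\<sigma> a (rep_id a) = s" by (rule yoneda_ex[OF F a])
    have nt: "nat_trans C (psh_prod (rep C J a) G) X
      (nat_restrict C (psh_prod (rep C J a) G) (\<lambda>b v. \<psi> b (Pair (\<sigma> b (pair_fst v)) (pair_snd v))))"
    proof (rule nat_transI[OF presheaf_psh_prod[OF presheaf_rep PG]])
      fix b v assume "b \<in> Obj C" "v \<in> Val (psh_prod (rep C J a) G) b"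
      then show "\<psi> b (Pair (\<sigma> b (pair_fst v)) (pair_snd v)) \<in> Val X b"
        using nat_trans_in[OF \<psi>, of b] nat_trans_in[OF \<sigma>(1), of b] by (auto simp: Val_psh_prod)
    next
      fix f v assume f: "f \<in> Arr C" and "v \<in> Val (psh_prod (rep C J a) G) (Cod C f)"
      then obtain t r where v: "v = Pair t r" "t \<in> Val (rep C J a) (Cod C f)" "r \<in> Val G (Cod C f)"
        by (auto simp: Val_psh_prod)
      have "Pair (\<sigma> (Cod C f) t) r \<in> Val (psh_prod F G) (Cod C f)"
        using v nat_trans_in[OF \<sigma>(1)] f by (auto simp: Val_psh_prod)
      from nat_trans_act[OF \<psi> f this]
      show "\<psi> (Dom C f) (Pair (\<sigma> (Dom C f) (pair_fst (Act (psh_prod (rep C J a) G) f v)))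
          (pair_snd (Act (psh_prod (rep C J a) G) f v))) =
        Act X f (\<psi> (Cod C f) (Pair (\<sigma> (Cod C f) (pair_fst v)) (pair_snd v)))"
        using v nat_trans_act[OF \<sigma>(1) f] by simp
    qed
    let ?\<psi> = "nat_restrict C (psh_prod (rep C J a) G) (\<lambda>b v. \<psi> b (Pair (\<sigma> b (pair_fst v)) (pair_snd v)))"
    have "\<exists>\<xi>. nat_trans C (rep C J a) X \<xi> \<and>
      (\<forall>b\<in>Obj C. \<forall>t\<in>Val (rep C J a) b. \<forall>r\<in>Val G b. ?\<psi> b (Pair t r) = \<xi> b t)"
      using rep[OF a(1)] nt unfolding proj_bij_def by blast
    then obtain \<xi> where \<xi>: "nat_trans C (rep C J a) X \<xi>"
      "\<And>b t r. b \<in> Obj C \<Longrightarrow> t \<in> Val (rep C J a) b \<Longrightarrow> r \<in> Val G b \<Longrightarrow>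
        ?\<psi> b (Pair t r) = \<xi> b t"
      by blast
    have "Q a s \<xi>"
      unfolding Q_def using \<xi> \<sigma> by (auto simp: Val_psh_prod)
    then show ?thesis by blast
  qed
  have Q_unique: "\<xi> = \<xi>'" if a: "a \<in> Obj C" and Q: "Q a s \<xi>" "Q a s \<xi>'" for a s \<xi> \<xi>'
  proof -
    obtain \<sigma> \<sigma>' where \<sigma>: "nat_trans C (rep C J a) F \<sigma>" "\<sigma> a (rep_id a) = s"
      "\<And>b t r. b \<in> Obj C \<Longrightarrow> t \<in> Val (rep C J a) b \<Longrightarrow> r \<in> Val G b \<Longrightarrow> \<psi> b (Pair (\<sigma> b t) r) = \<xi> b t"
      and \<sigma>': "nat_trans C (rep C J a) F \<sigma>'" "\<sigma>' a (rep_id a) = s"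
      "\<And>b t r. b \<in> Obj C \<Longrightarrow> t \<in> Val (rep C J a) b \<Longrightarrow> r \<in> Val G b \<Longrightarrow> \<psi> b (Pair (\<sigma>' b t) r) = \<xi>' b t"
      using Q unfolding Q_def by blast
    have "\<sigma> = \<sigma>'" using yoneda_ext[OF F \<sigma>(1) \<sigma>'(1)] \<sigma>(2) \<sigma>'(2) by simp
    show ?thesis
    proof (rule proj_bij_inj[OF rep[OF a]])
      show "nat_trans C (rep C J a) X \<xi>" "nat_trans C (rep C J a) X \<xi>'" using Q by (simp_all add: Q_def)
      fix b r and t :: "('e, 'm) univ" assume "b \<in> Obj C" "t \<in> Val (rep C J a) b" "r \<in> Val G b"
      from \<sigma>(3)[OF this] \<sigma>'(3)[OF this] show "\<xi> b t = \<xi>' b t" unfolding \<open>\<sigma> = \<sigma>'\<close> by simp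
    qed
  qed
  define \<Xi> where "\<Xi> a s = (SOME \<xi>. Q a s \<xi>)" for a s
  have \<Xi>: "Q a s (\<Xi> a s)" if "a \<in> Obj C" "s \<in> Val F a" for a s
    unfolding \<Xi>_def using someI_ex[OF Q_ex[OF that]] .
  define \<phi> where "\<phi> = nat_restrict C F (\<lambda>a s. \<Xi> a s a (rep_id a))"
  have "nat_trans C F X \<phi>"
    unfolding \<phi>_def
  proof (rule nat_transI[OF PF])
    fix a s assume a: "a \<in> Obj C" "s \<in> Val F a"
    show "\<Xi> a s a (rep_id a) \<in> Val X a"
      using \<Xi>[OF a] nat_trans_in[of C "rep C J a" X "\<Xi> a s" a "rep_id a"] a(1) by (simp add: Q_def)
  next
    fix f s assume f: "f \<in> Arr C" and s: "s \<in> Val F (Cod C f)"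
    let ?a = "Cod C f" and ?b = "Dom C f"
    note Qs = \<Xi>[OF cod_obj[OF f] s]
    obtain \<sigma> where \<xi>: "nat_trans C (rep C J ?a) X (\<Xi> ?a s)" and \<sigma>: "nat_trans C (rep C J ?a) F \<sigma>" "\<sigma> ?a (rep_id ?a) = s"
      "\<And>b t r. b \<in> Obj C \<Longrightarrow> t \<in> Val (rep C J ?a) b \<Longrightarrow> r \<in> Val G b \<Longrightarrow> \<psi> b (Pair (\<sigma> b t) r) = \<Xi> ?a s b t"
      using Qs unfolding Q_def by blast
    have f_in: "(Rel (rep_arr f) :: ('e, 'm) univ) \<in> Val (rep C J ?a) ?b" using local_arrow_rep_arr[OF f] by (simp add: Val_rep)
    \<comment> \<open>The map of represented sheaves induced by \<open>f\<close>. Pulling the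
      descent for \<open>s\<close> back along \<tau> gives a descent for the restriction of
      \<open>s\<close>, and uniqueness turns this into naturality.\<close>
    obtain \<tau> :: "'o \<Rightarrow> ('e, 'm) univ \<Rightarrow> ('e, 'm) univ" where \<tau>: "nat_trans C (rep C J ?b) (rep C J ?a) \<tau>" "\<tau> ?b (rep_id ?b) = Rel (rep_arr f)"
      by (rule yoneda_ex[OF sheaf_rep dom_obj[OF f] f_in])
    have act_f: "Act H f (\<alpha> ?a (rep_id ?a)) = \<alpha> ?b (Rel (rep_arr f))" if "nat_trans C (rep C J ?a) H \<alpha>"
      for H :: "('o, 'm, ('e, 'm) univ) psh" and \<alpha>
      using nat_trans_act[OF that f rep_id_in[OF cod_obj[OF f]]] rep_res_rep_id[OF f refl] by simp
    have "Q ?b (Act F f s) (nat_restrict C (rep C J ?b) (\<lambda>b t. \<Xi> ?a s b (\<tau> b t)))"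
      unfolding Q_def
    proof (intro conjI exI[of _ "nat_restrict C (rep C J ?b) (\<lambda>b t. \<sigma> b (\<tau> b t))"] ballI)
      show "nat_trans C (rep C J ?b) X (nat_restrict C (rep C J ?b) (\<lambda>b t. \<Xi> ?a s b (\<tau> b t)))"
        by (rule nat_trans_comp[OF presheaf_rep \<tau>(1) \<xi>])
      show "nat_trans C (rep C J ?b) F (nat_restrict C (rep C J ?b) (\<lambda>b t. \<sigma> b (\<tau> b t)))"
        by (rule nat_trans_comp[OF presheaf_rep \<tau>(1) \<sigma>(1)])
      show "nat_restrict C (rep C J ?b) (\<lambda>b t. \<sigma> b (\<tau> b t)) ?b (rep_id ?b) = Act F f s"
        using act_f[OF \<sigma>(1)] \<sigma>(2) \<tau>(2) f by simp
      fix b r and t :: "('e, 'm) univ" assume "b \<in> Obj C" "t \<in> Val (rep C J ?b) b" "r \<in> Val G b"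
      then show "\<psi> b (Pair (nat_restrict C (rep C J ?b) (\<lambda>b t. \<sigma> b (\<tau> b t)) b t) r) =
        nat_restrict C (rep C J ?b) (\<lambda>b t. \<Xi> ?a s b (\<tau> b t)) b t"
        using \<sigma>(3) nat_trans_in[OF \<tau>(1)] by simp
    qed
    then have "\<Xi> ?b (Act F f s) = nat_restrict C (rep C J ?b) (\<lambda>b t. \<Xi> ?a s b (\<tau> b t))"
      using Q_unique[OF dom_obj[OF f] \<Xi>[OF dom_obj[OF f] presheaf_act[OF PF f s]]] by blast
    then show "\<Xi> ?b (Act F f s) ?b (rep_id ?b) = Act X f (\<Xi> ?a s ?a (rep_id ?a))"
      using act_f[OF \<xi>] \<tau>(2) f by simp
  qed
  moreover have "\<psi> a (Pair s r) = \<phi> a s" if a: "a \<in> Obj C" "s \<in> Val F a" "r \<in> Val G a" for a s r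
    using \<Xi>[OF a(1,2)] a unfolding Q_def \<phi>_def by auto
  ultimately show "\<exists>\<phi>. nat_trans C F X \<phi> \<and> (\<forall>a\<in>Obj C. \<forall>s\<in>Val F a. \<forall>r\<in>Val G a. \<psi> a (Pair s r) = \<phi> a s)"
    by blast
qed

text \<open>The constant object on \<open>X\<close> is local for simplicial weak equivalences, and
  for affine ones once \<open>X\<close> is hyperbolic. Locality replaces Hom in either localization
  by Hom of simplicial sheaves, after which each claim is a comparison of honest maps.\<close>

theorem hyperbolic_criterion:
  fixes X :: "('o, 'm, ('e, 'm) univ) psh"
  assumes enough: "enough_points C J TYPE(('e, 'm) univ)" and X: "sheaf C J X"
  shows "hyperbolic_sheaf C J A X \<longleftrightarrow>
            (\<forall>U\<in>Obj C.
               bij_betw (\<lambda>g. Comp (sheaf_cat C J) g (psh_proj C (rep C J U) (rep C J A)))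
                 (hom_set (sheaf_cat C J) (rep C J U) X)
                 (hom_set (sheaf_cat C J) (psh_prod (rep C J U) (rep C J A)) X))"
    and "sheaf C J Y \<Longrightarrow> \<exists>\<beta>. bij_betw \<beta> (hom_Hs C J (const_simplicial C Y) (const_simplicial C X))
                               (hom_set (sheaf_cat C J) Y X)"
    and "hyperbolic_sheaf C J A X \<Longrightarrow> sheaf C J Y \<Longrightarrow>
      \<exists>\<alpha>. bij_betw \<alpha> (hom_H C J A (const_simplicial C Y) (const_simplicial C X))
                               (hom_Hs C J (const_simplicial C Y) (const_simplicial C X))"
proof -
  let ?S = "simplicial_sheaf_cat C J :: (('o, 'm, ('e, 'm) univ) spsh, ('o, 'm, ('e, 'm) univ) spsh_arr) category"
  let ?W = "simplicial_weak_equivalences C J :: ('o, 'm, ('e, 'm) univ) spsh_arr set"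
  let ?X = "const_simplicial C X" and ?A = "rep C J A :: ('o, 'm, ('e, 'm) univ) psh"
  have cX: "simplicial_sheaf C J ?X" by (rule const_simplicial_sheaf[OF X])
  interpret S: cat ?S by (rule cat_simplicial_sheaf_cat)
  interpret S: local_object ?S ?W ?X
  proof
    show "?X \<in> Obj ?S" using cX by simp
    fix w assume w: "w \<in> ?W" "w \<in> Arr ?S"
    then obtain Y \<omega> Y' where w': "w = (Y, \<omega>, Y')" by auto
    interpret weak_equivalence C J Y Y' \<omega> X
      by unfold_locales (use enough X w(1) w' cover_sieve in auto)
    show "bij_betw (\<lambda>g. Comp ?S g w) (hom_set ?S (Cod ?S w) ?X) (hom_set ?S (Dom ?S w) ?X)"
      using precomp_bij by (simp add: w')
  qed
  have A: "sheaf C J ?A" by (rule sheaf_rep)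
  have precomp: "bij_betw (precomp_Hs C J f ?X) (hom_Hs C J (Cod ?S f) ?X) (hom_Hs C J (Dom ?S f) ?X) \<longleftrightarrow>
    bij_betw (\<lambda>g. Comp ?S g f) (hom_set ?S (Cod ?S f) ?X) (hom_set ?S (Dom ?S f) ?X)"
    if "f \<in> Arr ?S" for f
    unfolding precomp_Hs_def hom_Hs_def by (rule S.loc_precomp_bij_iff[OF that])
  have hyp: "hyperbolic C J A ?X \<longleftrightarrow> (\<forall>Y. simplicial_sheaf C J Y \<longrightarrow>
    bij_betw (\<lambda>g. Comp ?S g (spsh_proj C Y ?A)) (hom_set ?S Y ?X) (hom_set ?S (spsh_prod C Y ?A) ?X))"
  proof -
    have "bij_betw (precomp_Hs C J (spsh_proj C Y ?A) ?X) (hom_Hs C J Y ?X) (hom_Hs C J (spsh_prod C Y ?A) ?X) \<longleftrightarrow>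
      bij_betw (\<lambda>g. Comp ?S g (spsh_proj C Y ?A)) (hom_set ?S Y ?X) (hom_set ?S (spsh_prod C Y ?A) ?X)"
      if Y: "simplicial_sheaf C J Y" for Y
      using precomp[OF spsh_proj_arr[OF Y A]] by (simp add: spsh_proj_eq)
    then show ?thesis unfolding hyperbolic_def using cX by blast
  qed
  show "hyperbolic_sheaf C J A X \<longleftrightarrow>
            (\<forall>U\<in>Obj C.
               bij_betw (\<lambda>g. Comp (sheaf_cat C J) g (psh_proj C (rep C J U) ?A))
                 (hom_set (sheaf_cat C J) (rep C J U) X)
                 (hom_set (sheaf_cat C J) (psh_prod (rep C J U) ?A) X))"
  proof
    assume "hyperbolic_sheaf C J A X"
    then have "hyperbolic C J A ?X" by (simp add: hyperbolic_sheaf_def)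
    then show "\<forall>U\<in>Obj C.
               bij_betw (\<lambda>g. Comp (sheaf_cat C J) g (psh_proj C (rep C J U) ?A))
                 (hom_set (sheaf_cat C J) (rep C J U) X)
                 (hom_set (sheaf_cat C J) (psh_prod (rep C J U) ?A) X)"
      unfolding hyp by (intro ballI proj_bij_const sheaf_rep X) (use const_simplicial_sheaf[OF sheaf_rep] in blast)
  next
    assume *: "\<forall>U\<in>Obj C.
               bij_betw (\<lambda>g. Comp (sheaf_cat C J) g (psh_proj C (rep C J U) ?A))
                 (hom_set (sheaf_cat C J) (rep C J U) X)
                 (hom_set (sheaf_cat C J) (psh_prod (rep C J U) ?A) X)"
    have "proj_bij C ?A X (rep C J U)" if "U \<in> Obj C" for U
      using * that psh_proj_bij_iff[OF sheaf_rep A X] by blast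
    then have "proj_bij C ?A X F" if "sheaf C J F" for F
      by (rule proj_bij_rep_imp[OF that A X])
    then have "hyperbolic C J A ?X"
      unfolding hyp using spsh_proj_bij[OF _ A X] simplicial_sheaf_Lev by blast
    then show "hyperbolic_sheaf C J A X" using X by (simp add: hyperbolic_sheaf_def)
  qed
  fix Y :: "('o, 'm, ('e, 'm) univ) psh" assume Y: "sheaf C J Y"
  let ?Y = "const_simplicial C Y"
  have bij_Hs: "bij_betw (loc_class ?S ?W ?Y ?X) (hom_set ?S ?Y ?X) (hom_Hs C J ?Y ?X)"
    unfolding hom_Hs_def by (rule S.loc_class_bij)
  show "\<exists>\<beta>. bij_betw \<beta> (hom_Hs C J ?Y ?X) (hom_set (sheaf_cat C J) Y X)"
    using bij_betw_trans[OF bij_betw_inv_into[OF bij_Hs] bij_betw_inv_into[OF const_arr_bij[OF Y X]]] by blast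
  assume "hyperbolic_sheaf C J A X"
  then have "hyperbolic C J A ?X" by (simp add: hyperbolic_sheaf_def)
  \<comment> \<open>Affine weak equivalences are defined by bijectivity of Hom in the simplicial
    homotopy category into hyperbolic objects; for the hyperbolic object \<open>?X\<close> the
    equivalence \<open>precomp\<close> translates this into locality.\<close>
  then interpret H: local_object ?S "affine_weak_equivalences C J A" ?X
    by unfold_locales (use cX precomp in \<open>auto simp: affine_weak_equivalences_def\<close>)
  have "bij_betw (loc_class ?S (affine_weak_equivalences C J A) ?Y ?X) (hom_set ?S ?Y ?X) (hom_H C J A ?Y ?X)"
    unfolding hom_H_def by (rule H.loc_class_bij)
  then show "\<exists>\<alpha>. bij_betw \<alpha> (hom_H C J A ?Y ?X) (hom_Hs C J ?Y ?X)"
    using bij_betw_trans[OF bij_betw_inv_into bij_Hs] by blast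
qed

end

section \<open>Locally ringed spaces\<close>

lemma rs_cring: "ringed_space X \<Longrightarrow> openin (Top X) U \<Longrightarrow> cring (Sec X U)"
  by (simp add: ringed_space_def)

lemma rs_ring: "ringed_space X \<Longrightarrow> openin (Top X) U \<Longrightarrow> ring (Sec X U)"
  by (simp add: rs_cring cring.axioms(1))

lemma rs_res_hom:
  assumes "ringed_space X" "openin (Top X) U" "openin (Top X) V" "V \<subseteq> U"
  shows "Res X U V \<in> ring_hom (Sec X U) (Sec X V)"
proof -
  have "\<forall>U V. openin (Top X) U \<and> openin (Top X) V \<and> V \<subseteq> U \<longrightarrow> Res X U V \<in> ring_hom (Sec X U) (Sec X V)"
    using assms(1) unfolding ringed_space_def by (elim conjE)
  then show ?thesis using assms(2-) by blast
qed

lemma rs_res_closed: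
  "ringed_space X \<Longrightarrow> openin (Top X) U \<Longrightarrow> openin (Top X) V \<Longrightarrow> V \<subseteq> U \<Longrightarrow> s \<in> carrier (Sec X U) \<Longrightarrow>
    Res X U V s \<in> carrier (Sec X V)"
  by (rule ring_hom_closed[OF rs_res_hom])

lemma rs_res_id:
  assumes "ringed_space X" "openin (Top X) U" "s \<in> carrier (Sec X U)"
  shows "Res X U U s = s"
proof -
  have "\<forall>U. openin (Top X) U \<longrightarrow> (\<forall>s\<in>carrier (Sec X U). Res X U U s = s)"
    using assms(1) unfolding ringed_space_def by (elim conjE)
  then show ?thesis using assms(2-) by blast
qed

lemma rs_res_res:
  assumes "ringed_space X" "openin (Top X) U" "openin (Top X) V" "openin (Top X) W" "W \<subseteq> V" "V \<subseteq> U"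
    "s \<in> carrier (Sec X U)"
  shows "Res X V W (Res X U V s) = Res X U W s"
proof -
  have "\<forall>U V W. openin (Top X) U \<and> openin (Top X) V \<and> openin (Top X) W \<and> W \<subseteq> V \<and> V \<subseteq> U \<longrightarrow>
        (\<forall>s\<in>carrier (Sec X U). Res X V W (Res X U V s) = Res X U W s)"
    using assms(1) unfolding ringed_space_def by (elim conjE)
  then show ?thesis using assms(2-) by blast
qed

section \<open>Germs and stalks of ringed spaces\<close>

definition germ_rel :: "('p, 'r) rspace \<Rightarrow> 'p \<Rightarrow> 'p set \<Rightarrow> 'r \<Rightarrow> 'p set \<Rightarrow> 'r \<Rightarrow> bool" where
  "germ_rel X x U s V t \<longleftrightarrow>
     (\<exists>W. openin (Top X) W \<and> x \<in> W \<and> W \<subseteq> U \<inter> V \<and> Res X U W s = Res X V W t)"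

lemma germ_rel_trans:
  assumes X: "ringed_space X" and U: "openin (Top X) U" "openin (Top X) V" "openin (Top X) W"
    and s: "s \<in> carrier (Sec X U)" "t \<in> carrier (Sec X V)" "r \<in> carrier (Sec X W)"
    and rel: "germ_rel X x U s V t" "germ_rel X x V t W r"
  shows "germ_rel X x U s W r"
proof -
  obtain A B where A: "openin (Top X) A" "x \<in> A" "A \<subseteq> U \<inter> V" "Res X U A s = Res X V A t"
    and B: "openin (Top X) B" "x \<in> B" "B \<subseteq> V \<inter> W" "Res X V B t = Res X W B r"
    using rel unfolding germ_rel_def by blast
  have AB: "openin (Top X) (A \<inter> B)" using A B by blast
  have "Res X U (A \<inter> B) s = Res X A (A \<inter> B) (Res X U A s)"
    using A B AB by (intro rs_res_res[symmetric] X U s) auto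
  also have "\<dots> = Res X V (A \<inter> B) t"
    unfolding A(4) using A B AB by (intro rs_res_res X U s) auto
  also have "\<dots> = Res X B (A \<inter> B) (Res X V B t)"
    using A B AB by (intro rs_res_res[symmetric] X U s) auto
  also have "\<dots> = Res X W (A \<inter> B) r"
    unfolding B(4) using A B AB by (intro rs_res_res X U s) auto
  finally show ?thesis unfolding germ_rel_def using A B AB by (intro exI[of _ "A \<inter> B"]) auto
qed

lemma germ_rel_sym: "germ_rel X x U s V t \<Longrightarrow> germ_rel X x V t U s"
  unfolding germ_rel_def by (auto simp: Int_commute)

lemma germ_eq_Collect:
  "germ X x (U, s) = {(V, t). openin (Top X) V \<and> x \<in> V \<and> t \<in> carrier (Sec X V) \<and> germ_rel X x U s V t}"
  by (simp add: germ_def germ_rel_def)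

lemma germ_rel_refl: "openin (Top X) U \<Longrightarrow> x \<in> U \<Longrightarrow> germ_rel X x U s U s"
  unfolding germ_rel_def by blast

lemma in_germ: "openin (Top X) U \<Longrightarrow> x \<in> U \<Longrightarrow> s \<in> carrier (Sec X U) \<Longrightarrow> (U, s) \<in> germ X x (U, s)"
  by (simp add: germ_eq_Collect germ_rel_refl)

lemma germ_eq_iff:
  assumes X: "ringed_space X"
    and U: "openin (Top X) U" "x \<in> U" "s \<in> carrier (Sec X U)"
    and V: "openin (Top X) V" "x \<in> V" "t \<in> carrier (Sec X V)"
  shows "germ X x (U, s) = germ X x (V, t) \<longleftrightarrow> germ_rel X x U s V t"
proof
  assume "germ X x (U, s) = germ X x (V, t)"
  then show "germ_rel X x U s V t" using in_germ[OF V] by (auto simp: germ_eq_Collect)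
next
  assume rel: "germ_rel X x U s V t"
  show "germ X x (U, s) = germ X x (V, t)"
    unfolding germ_eq_Collect
    using germ_rel_trans[OF X U(1) V(1) _ U(3) V(3) _ rel]
      germ_rel_trans[OF X V(1) U(1) _ V(3) U(3) _ germ_rel_sym[OF rel]] by blast
qed

lemma germ_res:
  assumes X: "ringed_space X" and U: "openin (Top X) U" "s \<in> carrier (Sec X U)"
    and V: "openin (Top X) V" "V \<subseteq> U" "x \<in> V"
  shows "germ X x (V, Res X U V s) = germ X x (U, s)"
proof -
  have "Res X V V (Res X U V s) = Res X U V s" using rs_res_id[OF X V(1) rs_res_closed[OF X U(1) V(1,2) U(2)]] .
  then have "germ_rel X x V (Res X U V s) U s"
    unfolding germ_rel_def using V by (intro exI[of _ V]) auto
  then show ?thesis using rs_res_closed[OF X U(1) V(1,2) U(2)] U V by (subst germ_eq_iff[OF X]) auto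
qed

lemma carrier_stalkE:
  assumes "a \<in> carrier (stalk X x)"
  obtains U s where "openin (Top X) U" "x \<in> U" "s \<in> carrier (Sec X U)" "a = germ X x (U, s)"
  using assms unfolding stalk_def by auto

lemma carrier_stalkI:
  "openin (Top X) U \<Longrightarrow> x \<in> U \<Longrightarrow> s \<in> carrier (Sec X U) \<Longrightarrow> germ X x (U, s) \<in> carrier (stalk X x)"
  unfolding stalk_def by auto

lemma some_germ:
  assumes "openin (Top X) U" "x \<in> U" "s \<in> carrier (Sec X U)"
  obtains V t where "(SOME p. p \<in> germ X x (U, s)) = (V, t)" "openin (Top X) V" "x \<in> V"
    "t \<in> carrier (Sec X V)" "germ_rel X x U s V t"
proof -
  have "(SOME p. p \<in> germ X x (U, s)) \<in> germ X x (U, s)" by (rule someI) (rule in_germ[OF assms])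
  then show ?thesis using that unfolding germ_eq_Collect by auto
qed

text \<open>The stalk operations are defined through representatives chosen by \<open>SOME\<close>.
  The two premises on \<open>opn\<close> hold for addition and multiplication alike and make the
  result independent of the choice.\<close>

lemma germ_lift_germ:
  assumes X: "ringed_space X"
    and U: "openin (Top X) U" "x \<in> U" "s \<in> carrier (Sec X U)"
    and V: "openin (Top X) V" "x \<in> V" "t \<in> carrier (Sec X V)"
    and closed: "\<And>W a b. openin (Top X) W \<Longrightarrow> a \<in> carrier (Sec X W) \<Longrightarrow> b \<in> carrier (Sec X W) \<Longrightarrow>
      opn W a b \<in> carrier (Sec X W)"
    and res: "\<And>W W' a b. openin (Top X) W \<Longrightarrow> openin (Top X) W' \<Longrightarrow> W' \<subseteq> W \<Longrightarrow> a \<in> carrier (Sec X W) \<Longrightarrow>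
      b \<in> carrier (Sec X W) \<Longrightarrow> Res X W W' (opn W a b) = opn W' (Res X W W' a) (Res X W W' b)"
  shows "germ_lift X x opn (germ X x (U, s)) (germ X x (V, t)) =
    germ X x (U \<inter> V, opn (U \<inter> V) (Res X U (U \<inter> V) s) (Res X V (U \<inter> V) t))"
proof -
  obtain U' s' where s': "(SOME p. p \<in> germ X x (U, s)) = (U', s')" "openin (Top X) U'" "x \<in> U'"
    "s' \<in> carrier (Sec X U')" "germ_rel X x U s U' s'" by (rule some_germ[OF U])
  obtain V' t' where t': "(SOME p. p \<in> germ X x (V, t)) = (V', t')" "openin (Top X) V'" "x \<in> V'"
    "t' \<in> carrier (Sec X V')" "germ_rel X x V t V' t'" by (rule some_germ[OF V])
  obtain A B where A: "openin (Top X) A" "x \<in> A" "A \<subseteq> U \<inter> U'" "Res X U A s = Res X U' A s'"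
    and B: "openin (Top X) B" "x \<in> B" "B \<subseteq> V \<inter> V'" "Res X V B t = Res X V' B t'"
    using s'(5) t'(5) unfolding germ_rel_def by blast
  \<comment> \<open>On \<open>W\<close> the chosen representatives coincide with the given ones, and
    by \<open>eq\<close> both results can be computed from these common restrictions.\<close>
  define W where "W = A \<inter> B"
  have W: "openin (Top X) W" "x \<in> W" "W \<subseteq> A" "W \<subseteq> B" using A B by (auto simp: W_def)
  have eq: "Res X (U \<inter> V) W (opn (U \<inter> V) (Res X U (U \<inter> V) s) (Res X V (U \<inter> V) t)) =
      opn W (Res X A W (Res X U A s)) (Res X B W (Res X V B t))"
    if U: "openin (Top X) U" "s \<in> carrier (Sec X U)" and V: "openin (Top X) V" "t \<in> carrier (Sec X V)"
      and "A \<subseteq> U" "B \<subseteq> V" for U s V t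
  proof -
    have UV: "openin (Top X) (U \<inter> V)" "W \<subseteq> U \<inter> V" "W \<subseteq> U" "W \<subseteq> V" using U V W that(5,6) by auto
    have "Res X (U \<inter> V) W (opn (U \<inter> V) (Res X U (U \<inter> V) s) (Res X V (U \<inter> V) t)) =
      opn W (Res X (U \<inter> V) W (Res X U (U \<inter> V) s)) (Res X (U \<inter> V) W (Res X V (U \<inter> V) t))"
      using UV U V W by (intro res rs_res_closed[OF X]) auto
    also have "Res X (U \<inter> V) W (Res X U (U \<inter> V) s) = Res X U W s"
      using UV U W by (intro rs_res_res[OF X]) auto
    also have "Res X (U \<inter> V) W (Res X V (U \<inter> V) t) = Res X V W t"
      using UV V W by (intro rs_res_res[OF X]) auto
    also have "Res X U W s = Res X A W (Res X U A s)"
      using U W A that(5) by (intro rs_res_res[OF X, symmetric]) auto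
    also have "Res X V W t = Res X B W (Res X V B t)"
      using V W B that(6) by (intro rs_res_res[OF X, symmetric]) auto
    finally show ?thesis .
  qed
  have mem: "opn (U \<inter> V) (Res X U (U \<inter> V) s) (Res X V (U \<inter> V) t) \<in> carrier (Sec X (U \<inter> V))"
    if "openin (Top X) U" "s \<in> carrier (Sec X U)" "openin (Top X) V" "t \<in> carrier (Sec X V)" for U s V t
    using that by (intro closed rs_res_closed[OF X]) auto
  have "germ_lift X x opn (germ X x (U, s)) (germ X x (V, t)) =
    germ X x (U' \<inter> V', opn (U' \<inter> V') (Res X U' (U' \<inter> V') s') (Res X V' (U' \<inter> V') t'))"
    unfolding germ_lift_def s'(1) t'(1) by simp
  also have "\<dots> = germ X x (U \<inter> V, opn (U \<inter> V) (Res X U (U \<inter> V) s) (Res X V (U \<inter> V) t))"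
  proof (subst germ_eq_iff[OF X])
    show "germ_rel X x (U' \<inter> V') (opn (U' \<inter> V') (Res X U' (U' \<inter> V') s') (Res X V' (U' \<inter> V') t'))
      (U \<inter> V) (opn (U \<inter> V) (Res X U (U \<inter> V) s) (Res X V (U \<inter> V) t))"
      unfolding germ_rel_def
      using eq[OF U(1,3) V(1,3)] eq[OF s'(2,4) t'(2,4)] A B W by (intro exI[of _ W]) auto
  qed (use s' t' U V mem in auto)
  finally show ?thesis .
qed

lemma stalk_mult:
  assumes X: "ringed_space X"
    and U: "openin (Top X) U" "x \<in> U" "s \<in> carrier (Sec X U)"
    and V: "openin (Top X) V" "x \<in> V" "t \<in> carrier (Sec X V)"
  shows "germ X x (U, s) \<otimes>\<^bsub>stalk X x\<^esub> germ X x (V, t) =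
    germ X x (U \<inter> V, Res X U (U \<inter> V) s \<otimes>\<^bsub>Sec X (U \<inter> V)\<^esub> Res X V (U \<inter> V) t)"
proof -
  have "germ_lift X x (\<lambda>W. monoid.mult (Sec X W)) (germ X x (U, s)) (germ X x (V, t)) =
    germ X x (U \<inter> V, Res X U (U \<inter> V) s \<otimes>\<^bsub>Sec X (U \<inter> V)\<^esub> Res X V (U \<inter> V) t)"
    by (rule germ_lift_germ[OF X U V])
      (auto intro!: monoid.m_closed ring.is_monoid rs_ring[OF X] ring_hom_mult[OF rs_res_hom[OF X]])
  then show ?thesis by (simp add: stalk_def)
qed

lemma stalk_add:
  assumes X: "ringed_space X"
    and U: "openin (Top X) U" "x \<in> U" "s \<in> carrier (Sec X U)"
    and V: "openin (Top X) V" "x \<in> V" "t \<in> carrier (Sec X V)"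
  shows "germ X x (U, s) \<oplus>\<^bsub>stalk X x\<^esub> germ X x (V, t) =
    germ X x (U \<inter> V, Res X U (U \<inter> V) s \<oplus>\<^bsub>Sec X (U \<inter> V)\<^esub> Res X V (U \<inter> V) t)"
proof -
  have "germ_lift X x (\<lambda>W. ring.add (Sec X W)) (germ X x (U, s)) (germ X x (V, t)) =
    germ X x (U \<inter> V, Res X U (U \<inter> V) s \<oplus>\<^bsub>Sec X (U \<inter> V)\<^esub> Res X V (U \<inter> V) t)"
    by (rule germ_lift_germ[OF X U V])
      (auto intro!: ring.ring_simprules(1) rs_ring[OF X] ring_hom_add[OF rs_res_hom[OF X]])
  then show ?thesis by (simp add: stalk_def)
qed

lemma stalk_one: "\<one>\<^bsub>stalk X x\<^esub> = germ X x (points X, \<one>\<^bsub>global X\<^esub>)"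
  by (simp add: stalk_def)

text \<open>Invertibility of the germ expressed by sections, which keeps the choice of
  representatives out of the later arguments on local morphisms.\<close>

definition unit_at :: "('p, 'r) rspace \<Rightarrow> 'p \<Rightarrow> 'p set \<Rightarrow> 'r \<Rightarrow> bool" where
  "unit_at X x U s \<longleftrightarrow> (\<exists>W. openin (Top X) W \<and> x \<in> W \<and> W \<subseteq> U \<and> Res X U W s \<in> Units (Sec X W))"

lemma ring_hom_Units:
  assumes "h \<in> ring_hom R S" "monoid R" "monoid S" "a \<in> Units R"
  shows "h a \<in> Units S"
proof -
  obtain b where b: "a \<in> carrier R" "b \<in> carrier R" "b \<otimes>\<^bsub>R\<^esub> a = \<one>\<^bsub>R\<^esub>" "a \<otimes>\<^bsub>R\<^esub> b = \<one>\<^bsub>R\<^esub>"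
    using assms(4) by (auto simp: Units_def)
  then have "h b \<otimes>\<^bsub>S\<^esub> h a = \<one>\<^bsub>S\<^esub>" "h a \<otimes>\<^bsub>S\<^esub> h b = \<one>\<^bsub>S\<^esub>"
    using ring_hom_mult[OF assms(1)] ring_hom_one[OF assms(1)] by metis+
  then show ?thesis using b ring_hom_closed[OF assms(1)] by (auto simp: Units_def)
qed

text \<open>An inverse germ is represented on some neighbourhood and inverts the section on a
  possibly smaller one; conversely, an inverse over a neighbourhood represents an inverse
  germ.\<close>

lemma stalk_unit_iff:
  assumes X: "ringed_space X" and U: "openin (Top X) U" "x \<in> U" "s \<in> carrier (Sec X U)"
  shows "germ X x (U, s) \<in> Units (stalk X x) \<longleftrightarrow> unit_at X x U s"
proof
  have top: "openin (Top X) (points X)" by simp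
  have x: "x \<in> points X" using U openin_subset by blast
  have one: "\<one>\<^bsub>Sec X V\<^esub> \<in> carrier (Sec X V)" if "openin (Top X) V" for V
    using rs_ring[OF X that] by (simp add: ring.ring_simprules)
  {
    assume "germ X x (U, s) \<in> Units (stalk X x)"
    then obtain b where b: "b \<in> carrier (stalk X x)" "germ X x (U, s) \<otimes>\<^bsub>stalk X x\<^esub> b = \<one>\<^bsub>stalk X x\<^esub>"
      by (auto simp: Units_def)
    obtain V t where V: "openin (Top X) V" "x \<in> V" "t \<in> carrier (Sec X V)" "b = germ X x (V, t)"
      using b(1) by (rule carrier_stalkE)
    let ?st = "Res X U (U \<inter> V) s \<otimes>\<^bsub>Sec X (U \<inter> V)\<^esub> Res X V (U \<inter> V) t"
    have UV: "openin (Top X) (U \<inter> V)" using U V by blast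
    have res: "Res X U (U \<inter> V) s \<in> carrier (Sec X (U \<inter> V))" "Res X V (U \<inter> V) t \<in> carrier (Sec X (U \<inter> V))"
      using U V UV by (auto intro: rs_res_closed[OF X])
    have "?st \<in> carrier (Sec X (U \<inter> V))" using res rs_ring[OF X UV] by (simp add: ring.ring_simprules)
    moreover have "germ X x (U \<inter> V, ?st) = germ X x (points X, \<one>\<^bsub>global X\<^esub>)"
      using b(2) unfolding V(4) stalk_mult[OF X U V(1-3)] stalk_one .
    ultimately have "germ_rel X x (U \<inter> V) ?st (points X) \<one>\<^bsub>global X\<^esub>"
      using germ_eq_iff[OF X UV _ _ top x one[OF top]] U V by blast
    then obtain W where W: "openin (Top X) W" "x \<in> W" "W \<subseteq> U \<inter> V"
      "Res X (U \<inter> V) W ?st = Res X (points X) W \<one>\<^bsub>global X\<^esub>"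
      unfolding germ_rel_def by blast
    have hom: "Res X (U \<inter> V) W \<in> ring_hom (Sec X (U \<inter> V)) (Sec X W)"
      "Res X (points X) W \<in> ring_hom (global X) (Sec X W)"
      using W UV openin_subset[OF W(1)] by (auto intro!: rs_res_hom[OF X])
    have "Res X (U \<inter> V) W (Res X U (U \<inter> V) s) \<otimes>\<^bsub>Sec X W\<^esub> Res X (U \<inter> V) W (Res X V (U \<inter> V) t) = \<one>\<^bsub>Sec X W\<^esub>"
      using W(4) ring_hom_mult[OF hom(1) res] ring_hom_one[OF hom(2)] by simp
    moreover have "Res X (U \<inter> V) W (Res X U (U \<inter> V) s) = Res X U W s"
      using U V UV W by (intro rs_res_res[OF X]) auto
    moreover have "Res X (U \<inter> V) W (Res X V (U \<inter> V) t) \<in> carrier (Sec X W)" "Res X U W s \<in> carrier (Sec X W)"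
      using ring_hom_closed[OF hom(1) res(2)] rs_res_closed[OF X U(1) W(1) _ U(3)] W by auto
    ultimately have "Res X U W s \<in> Units (Sec X W)"
      using cring.cring_simprules(14)[OF rs_cring[OF X W(1)]] by (auto simp: Units_def intro!: bexI)
    then show "unit_at X x U s" unfolding unit_at_def using W by blast
  next
    assume "unit_at X x U s"
    then obtain W where W: "openin (Top X) W" "x \<in> W" "W \<subseteq> U" "Res X U W s \<in> Units (Sec X W)"
      unfolding unit_at_def by blast
    obtain t where t: "Res X U W s \<in> carrier (Sec X W)" "t \<in> carrier (Sec X W)"
      "t \<otimes>\<^bsub>Sec X W\<^esub> Res X U W s = \<one>\<^bsub>Sec X W\<^esub>" "Res X U W s \<otimes>\<^bsub>Sec X W\<^esub> t = \<one>\<^bsub>Sec X W\<^esub>"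
      using W(4) by (auto simp: Units_def)
    have g: "germ X x (U, s) = germ X x (W, Res X U W s)" using germ_res[OF X U(1,3) W(1,3,2)] by simp
    have id: "Res X W W r = r" if "r \<in> carrier (Sec X W)" for r using rs_res_id[OF X W(1) that] .
    have "germ X x (W, \<one>\<^bsub>Sec X W\<^esub>) = germ X x (points X, \<one>\<^bsub>global X\<^esub>)"
      using germ_res[OF X top one[OF top] W(1) _ W(2)] ring_hom_one[OF rs_res_hom[OF X top W(1)]] openin_subset[OF W(1)]
      by simp
    then have "germ X x (W, t) \<otimes>\<^bsub>stalk X x\<^esub> germ X x (U, s) = \<one>\<^bsub>stalk X x\<^esub>"
      "germ X x (U, s) \<otimes>\<^bsub>stalk X x\<^esub> germ X x (W, t) = \<one>\<^bsub>stalk X x\<^esub>"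
      unfolding g stalk_mult[OF X W(1,2) t(2) W(1,2) t(1)] stalk_mult[OF X W(1,2) t(1) W(1,2) t(2)] stalk_one
      using t id by simp_all
    then show "germ X x (U, s) \<in> Units (stalk X x)"
      using carrier_stalkI[OF U] carrier_stalkI[OF W(1,2) t(2)] by (auto simp: Units_def)
  }
qed

lemma unit_at_res:
  assumes X: "ringed_space X" and U: "openin (Top X) U" "s \<in> carrier (Sec X U)"
    and V: "openin (Top X) V" "V \<subseteq> U" "x \<in> V"
  shows "unit_at X x V (Res X U V s) \<longleftrightarrow> unit_at X x U s"
  using stalk_unit_iff[OF X U(1) _ U(2), of x] stalk_unit_iff[OF X V(1,3) rs_res_closed[OF X U(1) V(1,2) U(2)]]
    germ_res[OF X U V] V by auto

section \<open>Morphisms of locally ringed spaces\<close>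

lemma rsm_ext: "rs_morphism X Y f \<psi> \<Longrightarrow> f \<in> extensional (points X)"
  and rsm_cont: "rs_morphism X Y f \<psi> \<Longrightarrow> continuous_map (Top X) (Top Y) f"
  and rsm_S_ext: "rs_morphism X Y f \<psi> \<Longrightarrow> \<psi> \<in> extensional {V. openin (Top Y) V}"
  and rsm_S_ext': "rs_morphism X Y f \<psi> \<Longrightarrow> openin (Top Y) V \<Longrightarrow> \<psi> V \<in> extensional (carrier (Sec Y V))"
  and rsm_hom: "rs_morphism X Y f \<psi> \<Longrightarrow> openin (Top Y) V \<Longrightarrow> \<psi> V \<in> ring_hom (Sec Y V) (Sec X (preim X f V))"
  by (simp_all add: rs_morphism_def)

lemma rsm_nat:
  assumes "rs_morphism X Y f \<psi>" "openin (Top Y) V" "openin (Top Y) W" "W \<subseteq> V" "s \<in> carrier (Sec Y V)"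
  shows "\<psi> W (Res Y V W s) = Res X (preim X f V) (preim X f W) (\<psi> V s)"
proof -
  have "\<forall>V W. openin (Top Y) V \<and> openin (Top Y) W \<and> W \<subseteq> V \<longrightarrow>
        (\<forall>s\<in>carrier (Sec Y V). \<psi> W (Res Y V W s) = Res X (preim X f V) (preim X f W) (\<psi> V s))"
    using assms(1) unfolding rs_morphism_def by (elim conjE)
  then show ?thesis using assms(2-) by blast
qed

lemma rsm_closed: "rs_morphism X Y f \<psi> \<Longrightarrow> openin (Top Y) V \<Longrightarrow> s \<in> carrier (Sec Y V) \<Longrightarrow>
    \<psi> V s \<in> carrier (Sec X (preim X f V))"
  by (rule ring_hom_closed[OF rsm_hom])

lemma rsm_point: "rs_morphism X Y f \<psi> \<Longrightarrow> x \<in> points X \<Longrightarrow> f x \<in> points Y"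
  using rsm_cont[of X Y f \<psi>] by (auto simp: continuous_map_def)

lemma rsm_open: "rs_morphism X Y f \<psi> \<Longrightarrow> openin (Top Y) V \<Longrightarrow> openin (Top X) (preim X f V)"
  unfolding preim_def by (rule openin_continuous_map_preimage[OF rsm_cont])

lemma preim_mono: "V \<subseteq> W \<Longrightarrow> preim X f V \<subseteq> preim X f W"
  by (auto simp: preim_def)

lemma in_preim: "x \<in> preim X f V \<longleftrightarrow> x \<in> points X \<and> f x \<in> V"
  by (simp add: preim_def)

lemma stalk_hom_germ:
  assumes X: "ringed_space X" and Y: "ringed_space Y" and f: "rs_morphism X Y f \<psi>" and x: "x \<in> points X"
    and V: "openin (Top Y) V" "f x \<in> V" "s \<in> carrier (Sec Y V)"
  shows "stalk_hom X f \<psi> x (germ Y (f x) (V, s)) = germ X x (preim X f V, \<psi> V s)"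
proof -
  obtain W t where W: "(SOME p. p \<in> germ Y (f x) (V, s)) = (W, t)" "openin (Top Y) W" "f x \<in> W"
    "t \<in> carrier (Sec Y W)" "germ_rel Y (f x) V s W t" by (rule some_germ[OF V])
  obtain A where A: "openin (Top Y) A" "f x \<in> A" "A \<subseteq> V \<inter> W" "Res Y V A s = Res Y W A t"
    using W(5) unfolding germ_rel_def by blast
  have "Res X (preim X f W) (preim X f A) (\<psi> W t) = Res X (preim X f V) (preim X f A) (\<psi> V s)"
    using rsm_nat[OF f V(1) A(1) _ V(3)] rsm_nat[OF f W(2) A(1) _ W(4)] A by simp
  then have "germ_rel X x (preim X f W) (\<psi> W t) (preim X f V) (\<psi> V s)"
    unfolding germ_rel_def using rsm_open[OF f A(1)] A x
    by (intro exI[of _ "preim X f A"]) (auto simp: in_preim)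
  then have "germ X x (preim X f W, \<psi> W t) = germ X x (preim X f V, \<psi> V s)"
    using rsm_open[OF f] rsm_closed[OF f] V W x by (subst germ_eq_iff[OF X]) (auto simp: in_preim)
  then show ?thesis by (simp add: stalk_hom_def W(1))
qed

text \<open>Every element of a stalk is a germ, and on germs both the stalk map and invertibility
  are known. The resulting condition on sections is the form in which locality passes to composites
  and to open subspaces.\<close>

lemma lrs_morphism_iff:
  assumes X: "ringed_space X" and Y: "ringed_space Y"
  shows "lrs_morphism X Y f \<psi> \<longleftrightarrow> rs_morphism X Y f \<psi> \<and>
    (\<forall>x\<in>points X. \<forall>V s. openin (Top Y) V \<and> f x \<in> V \<and> s \<in> carrier (Sec Y V) \<and>
       unit_at X x (preim X f V) (\<psi> V s) \<longrightarrow> unit_at Y (f x) V s)"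
proof -
  have "(\<forall>a\<in>carrier (stalk Y (f x)). stalk_hom X f \<psi> x a \<in> Units (stalk X x) \<longrightarrow> a \<in> Units (stalk Y (f x))) \<longleftrightarrow>
     (\<forall>V s. openin (Top Y) V \<and> f x \<in> V \<and> s \<in> carrier (Sec Y V) \<and>
       unit_at X x (preim X f V) (\<psi> V s) \<longrightarrow> unit_at Y (f x) V s)" (is "?L \<longleftrightarrow> ?R")
    if f: "rs_morphism X Y f \<psi>" and x: "x \<in> points X" for x
  proof -
    have iff: "stalk_hom X f \<psi> x (germ Y (f x) (V, s)) \<in> Units (stalk X x) \<longleftrightarrow> unit_at X x (preim X f V) (\<psi> V s)"
      "germ Y (f x) (V, s) \<in> Units (stalk Y (f x)) \<longleftrightarrow> unit_at Y (f x) V s"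
      if V: "openin (Top Y) V" "f x \<in> V" "s \<in> carrier (Sec Y V)" for V s
      using stalk_hom_germ[OF X Y f x V] stalk_unit_iff[OF Y V]
        stalk_unit_iff[OF X rsm_open[OF f V(1)] _ rsm_closed[OF f V(1,3)], of x] x V by (auto simp: in_preim)
    show ?thesis
    proof
      assume L: ?L
      show ?R
      proof (intro allI impI)
        fix V s assume V: "openin (Top Y) V \<and> f x \<in> V \<and> s \<in> carrier (Sec Y V) \<and> unit_at X x (preim X f V) (\<psi> V s)"
        then show "unit_at Y (f x) V s" using L carrier_stalkI[of Y V "f x" s] iff[of V s] by blast
      qed
    next
      assume R: ?R
      show ?L
      proof (intro ballI impI)
        fix a assume a: "a \<in> carrier (stalk Y (f x))" "stalk_hom X f \<psi> x a \<in> Units (stalk X x)"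
        obtain V s where V: "openin (Top Y) V" "f x \<in> V" "s \<in> carrier (Sec Y V)" "a = germ Y (f x) (V, s)"
          using a(1) by (rule carrier_stalkE)
        then show "a \<in> Units (stalk Y (f x))" using R a(2) iff[OF V(1-3)] by blast
      qed
    qed
  qed
  then show ?thesis unfolding lrs_morphism_def by blast
qed

text \<open>Section maps of morphisms are extensional, so every composite has to be cut down to the
  carrier; the homomorphism laws survive because the carrier is closed under the operations.\<close>

lemma ring_hom_restrict_carrier:
  assumes "ring R" "h \<in> ring_hom R S"
  shows "(\<lambda>s\<in>carrier R. h s) \<in> ring_hom R S"
  using assms(2) ring.ring_simprules(1,5,6)[OF assms(1)] by (auto simp: ring_hom_def)

lemma preim_comp:
  assumes "rs_morphism X Y f \<psi>"
  shows "preim X (\<lambda>x\<in>points X. g (f x)) W = preim X f (preim Y g W)"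
  using rsm_point[OF assms] by (auto simp: preim_def)

lemma rs_morphism_comp:
  assumes Z: "ringed_space Z" and f: "rs_morphism X Y f \<psi>" and g: "rs_morphism Y Z g \<xi>"
  shows "rs_morphism X Z (\<lambda>x\<in>points X. g (f x))
    (\<lambda>V\<in>{V. openin (Top Z) V}. \<lambda>s\<in>carrier (Sec Z V). \<psi> (preim Y g V) (\<xi> V s))"
  unfolding rs_morphism_def preim_comp[OF f]
proof (intro conjI allI impI ballI)
  have "continuous_map (Top X) (Top Z) (g \<circ> f)"
    by (rule continuous_map_compose[OF rsm_cont[OF f] rsm_cont[OF g]])
  then show "continuous_map (Top X) (Top Z) (\<lambda>x\<in>points X. g (f x))"
    by (rule continuous_map_eq) simp
next
  fix V assume V: "openin (Top Z) V"
  have "\<psi> (preim Y g V) \<circ> \<xi> V \<in> ring_hom (Sec Z V) (Sec X (preim X f (preim Y g V)))"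
    by (rule ring_hom_trans[OF rsm_hom[OF g V] rsm_hom[OF f rsm_open[OF g V]]])
  then show "(\<lambda>V\<in>{V. openin (Top Z) V}. \<lambda>s\<in>carrier (Sec Z V). \<psi> (preim Y g V) (\<xi> V s)) V
    \<in> ring_hom (Sec Z V) (Sec X (preim X f (preim Y g V)))"
    using V ring_hom_restrict_carrier[OF rs_ring[OF Z V]] by (simp add: comp_def)
next
  fix V W s assume VW: "openin (Top Z) V \<and> openin (Top Z) W \<and> W \<subseteq> V" and s: "s \<in> carrier (Sec Z V)"
  have "\<psi> (preim Y g W) (\<xi> W (Res Z V W s)) =
    \<psi> (preim Y g W) (Res Y (preim Y g V) (preim Y g W) (\<xi> V s))"
    using rsm_nat[OF g _ _ _ s] VW by simp
  also have "\<dots> = Res X (preim X f (preim Y g V)) (preim X f (preim Y g W)) (\<psi> (preim Y g V) (\<xi> V s))"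
    using rsm_nat[OF f rsm_open[OF g] rsm_open[OF g] preim_mono rsm_closed[OF g _ s]] VW by blast
  finally show "(\<lambda>V\<in>{V. openin (Top Z) V}. \<lambda>s\<in>carrier (Sec Z V). \<psi> (preim Y g V) (\<xi> V s)) W (Res Z V W s) =
    Res X (preim X f (preim Y g V)) (preim X f (preim Y g W))
      ((\<lambda>V\<in>{V. openin (Top Z) V}. \<lambda>s\<in>carrier (Sec Z V). \<psi> (preim Y g V) (\<xi> V s)) V s)"
    using VW s rs_res_closed[OF Z] by simp
qed (auto simp: extensional_def)

lemma lrs_morphism_comp:
  assumes X: "ringed_space X" and Y: "ringed_space Y" and Z: "ringed_space Z"
    and f: "lrs_morphism X Y f \<psi>" and g: "lrs_morphism Y Z g \<xi>"
  shows "lrs_morphism X Z (\<lambda>x\<in>points X. g (f x))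
    (\<lambda>V\<in>{V. openin (Top Z) V}. \<lambda>s\<in>carrier (Sec Z V). \<psi> (preim Y g V) (\<xi> V s))"
proof -
  have f': "rs_morphism X Y f \<psi>" "\<And>x V s. x \<in> points X \<Longrightarrow> openin (Top Y) V \<Longrightarrow> f x \<in> V \<Longrightarrow>
      s \<in> carrier (Sec Y V) \<Longrightarrow> unit_at X x (preim X f V) (\<psi> V s) \<Longrightarrow> unit_at Y (f x) V s"
    using f unfolding lrs_morphism_iff[OF X Y] by blast+
  have g': "rs_morphism Y Z g \<xi>" "\<And>x V s. x \<in> points Y \<Longrightarrow> openin (Top Z) V \<Longrightarrow> g x \<in> V \<Longrightarrow>
      s \<in> carrier (Sec Z V) \<Longrightarrow> unit_at Y x (preim Y g V) (\<xi> V s) \<Longrightarrow> unit_at Z (g x) V s"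
    using g unfolding lrs_morphism_iff[OF Y Z] by blast+
  show ?thesis
    unfolding lrs_morphism_iff[OF X Z] preim_comp[OF f'(1)]
  proof (intro conjI rs_morphism_comp[OF Z f'(1) g'(1)] ballI allI impI)
    fix x V s assume x: "x \<in> points X" and V: "openin (Top Z) V \<and> (\<lambda>x\<in>points X. g (f x)) x \<in> V \<and> s \<in> carrier (Sec Z V) \<and>
       unit_at X x (preim X f (preim Y g V))
         ((\<lambda>V\<in>{V. openin (Top Z) V}. \<lambda>s\<in>carrier (Sec Z V). \<psi> (preim Y g V) (\<xi> V s)) V s)"
    then have "unit_at X x (preim X f (preim Y g V)) (\<psi> (preim Y g V) (\<xi> V s))" "g (f x) \<in> V"
      by (auto split: if_splits)
    then have "unit_at Y (f x) (preim Y g V) (\<xi> V s)"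
      using V x rsm_point[OF f'(1) x] rsm_closed[OF g'(1)] rsm_open[OF g'(1)]
      by (intro f'(2)) (auto simp: in_preim)
    then have "unit_at Z (g (f x)) V s" using V \<open>g (f x) \<in> V\<close> rsm_point[OF f'(1) x] by (intro g'(2)) auto
    then show "unit_at Z ((\<lambda>x\<in>points X. g (f x)) x) V s" using x by simp
  qed
qed

lemma preim_ide: "openin (Top X) V \<Longrightarrow> preim X (\<lambda>x\<in>points X. x) V = V"
  using openin_subset by (fastforce simp: preim_def)

lemma lrs_morphism_ide:
  assumes X: "ringed_space X"
  shows "lrs_morphism X X (\<lambda>x\<in>points X. x) (\<lambda>V\<in>{V. openin (Top X) V}. \<lambda>s\<in>carrier (Sec X V). s)"
proof -
  have "rs_morphism X X (\<lambda>x\<in>points X. x) (\<lambda>V\<in>{V. openin (Top X) V}. \<lambda>s\<in>carrier (Sec X V). s)"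
    unfolding rs_morphism_def
  proof (intro conjI allI impI ballI)
    show "continuous_map (Top X) (Top X) (\<lambda>x\<in>points X. x)"
      by (rule continuous_map_eq[OF continuous_map_id]) simp
  next
    fix V assume V: "openin (Top X) V"
    then show "(\<lambda>V\<in>{V. openin (Top X) V}. \<lambda>s\<in>carrier (Sec X V). s) V
      \<in> ring_hom (Sec X V) (Sec X (preim X (\<lambda>x\<in>points X. x) V))"
      unfolding preim_ide[OF V] using rs_ring[OF X V] by (simp add: ring_hom_def ring.ring_simprules)
  next
    fix V W s assume "openin (Top X) V \<and> openin (Top X) W \<and> W \<subseteq> V" "s \<in> carrier (Sec X V)"
    then show "(\<lambda>V\<in>{V. openin (Top X) V}. \<lambda>s\<in>carrier (Sec X V). s) W (Res X V W s) =
      Res X (preim X (\<lambda>x\<in>points X. x) V) (preim X (\<lambda>x\<in>points X. x) W)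
        ((\<lambda>V\<in>{V. openin (Top X) V}. \<lambda>s\<in>carrier (Sec X V). s) V s)"
      using rs_res_closed[OF X] by (simp add: preim_ide)
  qed (auto simp: extensional_def)
  then show ?thesis
    unfolding lrs_morphism_iff[OF X X] by (simp add: preim_ide)
qed

section \<open>Spaces over a base as a category\<close>

lemma over_obj_ringed: "over_obj B X \<Longrightarrow> ringed_space (Space X)"
  by (simp add: over_obj_def locally_ringed_space_def)

lemma over_obj_str: "over_obj B X \<Longrightarrow> rs_morphism (Space X) B (StrP X) (StrS X)"
  by (simp add: over_obj_def lrs_morphism_def)

lemma over_morphism_rs: "over_morphism B h \<Longrightarrow> rs_morphism (Space (Src h)) (Space (Tgt h)) (MapP h) (MapS h)"
  by (simp add: over_morphism_def lrs_morphism_def)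

lemma over_cat_simps [simp]:
  "Obj (over_cat B Ob) = Ob"
  "Arr (over_cat B Ob) = {h. Src h \<in> Ob \<and> Tgt h \<in> Ob \<and> over_morphism B h}"
  "Dom (over_cat B Ob) = Src" "Cod (over_cat B Ob) = Tgt"
  by (simp_all add: over_cat_def)

lemma over_cat_Ide:
  "Ide (over_cat B Ob) X = \<lparr>Src = X, Tgt = X, MapP = (\<lambda>x\<in>points (Space X). x),
     MapS = (\<lambda>V\<in>{V. openin (Top (Space X)) V}. \<lambda>s\<in>carrier (Sec (Space X) V). s)\<rparr>"
  by (simp add: over_cat_def)

lemma over_cat_Comp:
  "Comp (over_cat B Ob) g f = \<lparr>Src = Src f, Tgt = Tgt g,
     MapP = (\<lambda>x\<in>points (Space (Src f)). MapP g (MapP f x)),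
     MapS = (\<lambda>V\<in>{V. openin (Top (Space (Tgt g))) V}. \<lambda>s\<in>carrier (Sec (Space (Tgt g)) V).
        MapS f (preim (Space (Tgt f)) (MapP g) V) (MapS g V s))\<rparr>"
  by (simp add: over_cat_def)

lemma over_morphism_comp:
  assumes f: "over_morphism B f" "over_obj B (Src f)" and g: "over_morphism B g" "over_obj B (Tgt g)"
    and fg: "Tgt f = Src g" "over_obj B (Src g)"
  shows "over_morphism B (Comp (over_cat B Ob) g f)"
proof -
  let ?X = "Space (Src f)" and ?Y = "Space (Src g)" and ?Z = "Space (Tgt g)"
  have f': "rs_morphism ?X ?Y (MapP f) (MapS f)" using over_morphism_rs[OF f(1)] fg by simp
  have lrs: "lrs_morphism ?X ?Z (\<lambda>x\<in>points ?X. MapP g (MapP f x))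
    (\<lambda>V\<in>{V. openin (Top ?Z) V}. \<lambda>s\<in>carrier (Sec ?Z V). MapS f (preim ?Y (MapP g) V) (MapS g V s))"
    using f g fg by (intro lrs_morphism_comp over_obj_ringed) (auto simp: over_morphism_def)
  have pt: "StrP (Tgt g) (MapP g (MapP f x)) = StrP (Src f) x" if x: "x \<in> points ?X" for x
    using f(1) g(1) x rsm_point[OF f' x] fg(1) by (simp add: over_morphism_def)
  have sec: "MapS f (preim ?Y (MapP g) (preim ?Z (StrP (Tgt g)) V)) (MapS g (preim ?Z (StrP (Tgt g)) V) (StrS (Tgt g) V s))
    = StrS (Src f) V s" if V: "openin (Top B) V" "s \<in> carrier (Sec B V)" for V s
  proof -
    have "preim ?Y (MapP g) (preim ?Z (StrP (Tgt g)) V) = preim ?Y (StrP (Src g)) V"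
      using g(1) rsm_point[OF over_morphism_rs[OF g(1)]] by (auto simp: preim_def over_morphism_def)
    moreover have "MapS g (preim ?Z (StrP (Tgt g)) V) (StrS (Tgt g) V s) = StrS (Src g) V s"
      using g(1) V by (simp add: over_morphism_def)
    moreover have "MapS f (preim ?Y (StrP (Src g)) V) (StrS (Src g) V s) = StrS (Src f) V s"
      using f(1) V fg(1) by (simp add: over_morphism_def)
    ultimately show ?thesis by simp
  qed
  show ?thesis
    unfolding over_morphism_def over_cat_Comp
    using lrs pt sec rsm_open[OF over_obj_str[OF g(2)]] rsm_closed[OF over_obj_str[OF g(2)]] fg(1)
    by simp
qed

lemma over_morphism_ide:
  assumes "over_obj B X"
  shows "over_morphism B (Ide (over_cat B Ob) X)"
  using lrs_morphism_ide[OF over_obj_ringed[OF assms]] rsm_open[OF over_obj_str[OF assms]]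
    rsm_closed[OF over_obj_str[OF assms]]
  by (simp add: over_morphism_def over_cat_Ide)

text \<open>Both components of an arrow are extensional functions. This is why the laws of the
  category hold as equalities of records.\<close>

lemma over_arr_eqI:
  assumes "Src g = Src h" "Tgt g = Tgt h" "over_morphism B g" "over_morphism B h"
    and "\<And>x. x \<in> points (Space (Src h)) \<Longrightarrow> MapP g x = MapP h x"
    and "\<And>V s. openin (Top (Space (Tgt h))) V \<Longrightarrow> s \<in> carrier (Sec (Space (Tgt h)) V) \<Longrightarrow> MapS g V s = MapS h V s"
  shows "g = (h :: ('p, 'r) over_arr)"
proof (rule over_arr.equality)
  note g = over_morphism_rs[OF assms(3)] and h = over_morphism_rs[OF assms(4)]
  show "MapP g = MapP h"
    using rsm_ext[OF g] rsm_ext[OF h] assms(1,5) by (auto intro: extensionalityI)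
  have "MapS g V = MapS h V" if V: "openin (Top (Space (Tgt h))) V" for V
    using rsm_S_ext'[OF g] rsm_S_ext'[OF h V] V assms(2,6) by (auto intro: extensionalityI)
  then show "MapS g = MapS h"
    using rsm_S_ext[OF g] rsm_S_ext[OF h] assms(2) by (auto intro: extensionalityI)
qed (use assms in simp_all)

lemma cat_over_cat:
  assumes Ob: "\<And>X. X \<in> Ob \<Longrightarrow> over_obj B X"
  shows "cat (over_cat B Ob)"
proof unfold_locales
  let ?C = "over_cat B Ob"
  have comp: "Comp ?C g f \<in> Arr ?C" if "f \<in> Arr ?C" "g \<in> Arr ?C" "Cod ?C f = Dom ?C g" for f g
    using that over_morphism_comp[of B f g Ob] Ob by (auto simp: over_cat_Comp)
  then show "Comp ?C g f \<in> Arr ?C" if "f \<in> Arr ?C" "g \<in> Arr ?C" "Cod ?C f = Dom ?C g" for f g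
    using that .
  have ide: "Ide ?C a \<in> Arr ?C" if "a \<in> Obj ?C" for a
    using that over_morphism_ide[OF Ob] by (simp add: over_cat_Ide)
  then show "Ide ?C a \<in> Arr ?C" if "a \<in> Obj ?C" for a using that .
  show "Comp ?C f (Ide ?C a) = f" if f: "f \<in> Arr ?C" "Dom ?C f = a" for f a
  proof (rule over_arr_eqI)
    show "over_morphism B (Comp ?C f (Ide ?C a))"
      using comp[OF ide f(1)] f by (auto simp: over_cat_Ide)
    note r = over_morphism_rs[of B f]
    show "MapS (Comp ?C f (Ide ?C a)) V s = MapS f V s"
      if "openin (Top (Space (Tgt f))) V" "s \<in> carrier (Sec (Space (Tgt f)) V)" for V s
      using that f rsm_open[OF r that(1)] rsm_closed[OF r that] by (simp add: over_cat_Comp over_cat_Ide)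
  qed (use f in \<open>auto simp: over_cat_Comp over_cat_Ide\<close>)
  show "Comp ?C (Ide ?C a) f = f" if f: "f \<in> Arr ?C" "Cod ?C f = a" for f a
  proof (rule over_arr_eqI)
    note r = over_morphism_rs[of B f]
    show "over_morphism B (Comp ?C (Ide ?C a) f)"
      using comp[OF f(1) ide] f by (auto simp: over_cat_Ide)
    show "MapP (Comp ?C (Ide ?C a) f) x = MapP f x" if "x \<in> points (Space (Src f))" for x
      using that f rsm_point[OF r] by (auto simp: over_cat_Comp over_cat_Ide)
    show "MapS (Comp ?C (Ide ?C a) f) V s = MapS f V s"
      if "openin (Top (Space (Tgt f))) V" "s \<in> carrier (Sec (Space (Tgt f)) V)" for V s
      using that f by (simp add: over_cat_Comp over_cat_Ide preim_ide)
  qed (use f in \<open>auto simp: over_cat_Comp over_cat_Ide\<close>)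
  show "Comp ?C (Comp ?C h g) f = Comp ?C h (Comp ?C g f)"
    if f: "f \<in> Arr ?C" "g \<in> Arr ?C" "h \<in> Arr ?C" "Cod ?C f = Dom ?C g" "Cod ?C g = Dom ?C h" for f g h
  proof (rule over_arr_eqI)
    have gf: "Cod ?C (Comp ?C g f) = Dom ?C h" "Cod ?C f = Dom ?C (Comp ?C h g)"
      using f by (simp_all add: over_cat_Comp)
    show "over_morphism B (Comp ?C (Comp ?C h g) f)" "over_morphism B (Comp ?C h (Comp ?C g f))"
      using comp[OF f(1) comp[OF f(2,3,5)] gf(2)] comp[OF comp[OF f(1,2,4)] f(3) gf(1)] by simp_all
    have r: "rs_morphism (Space (Src f)) (Space (Src g)) (MapP f) (MapS f)"
      "rs_morphism (Space (Src g)) (Space (Src h)) (MapP g) (MapS g)"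
      "rs_morphism (Space (Src h)) (Space (Tgt h)) (MapP h) (MapS h)"
      using f over_morphism_rs[of B f] over_morphism_rs[of B g] over_morphism_rs[of B h] by auto
    show "MapP (Comp ?C (Comp ?C h g) f) x = MapP (Comp ?C h (Comp ?C g f)) x"
      if "x \<in> points (Space (Src (Comp ?C h (Comp ?C g f))))" for x
      using that f rsm_point[OF r(1)] by (simp add: over_cat_Comp)
    show "MapS (Comp ?C (Comp ?C h g) f) V s = MapS (Comp ?C h (Comp ?C g f)) V s"
      if "openin (Top (Space (Tgt (Comp ?C h (Comp ?C g f))))) V"
        "s \<in> carrier (Sec (Space (Tgt (Comp ?C h (Comp ?C g f)))) V)" for V s
    proof -
      have V: "openin (Top (Space (Tgt h))) V" "s \<in> carrier (Sec (Space (Tgt h)) V)"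
        using that by (simp_all add: over_cat_Comp)
      show ?thesis
        using V f rsm_open[OF r(3) V(1)] rsm_closed[OF r(3) V]
        by (simp add: over_cat_Comp preim_comp[OF r(2)])
    qed
  qed (simp_all add: over_cat_Comp)
qed (auto simp: over_cat_Ide over_cat_Comp)

section \<open>Open subspaces and open immersions\<close>

text \<open>An ideal \<open>J\<close> above the preimage of \<open>N\<close> has, under the inverse
  isomorphism \<open>k\<close>, a preimage above \<open>N\<close>; maximality of \<open>N\<close>
  decides which of the two extremes it is.\<close>

lemma maximalideal_vimage_iso:
  assumes R: "ring R" and S: "ring S" and h: "h \<in> ring_iso R S" and N: "maximalideal N S"
  shows "maximalideal {r \<in> carrier R. h r \<in> N} R"
proof -
  define k where "k = inv_into (carrier R) h"
  have bij: "bij_betw h (carrier R) (carrier S)" and hom: "h \<in> ring_hom R S"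
    using h by (auto simp: ring_iso_def)
  have k: "k \<in> ring_iso S R" unfolding k_def by (rule ring_iso_set_sym[OF R h])
  have hk: "h (k s) = s" if "s \<in> carrier S" for s
    using bij that unfolding k_def by (simp add: bij_betw_inv_into_right)
  have kh: "k (h r) = r" if "r \<in> carrier R" for r
    using bij that unfolding k_def by (simp add: bij_betw_inv_into_left)
  have k_in: "k s \<in> carrier R" if "s \<in> carrier S" for s using ring_iso_memE(1)[OF k that] .
  have h_in: "h r \<in> carrier S" if "r \<in> carrier R" for r using ring_iso_memE(1)[OF h that] .
  interpret h: ring_hom_ring R S h
    using R S hom by (simp add: ring_hom_ring_def ring_hom_ring_axioms_def)
  interpret k: ring_hom_ring S R k
    using R S k by (simp add: ring_hom_ring_def ring_hom_ring_axioms_def ring_iso_def)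
  interpret N: maximalideal N S by (rule N)
  have N_sub: "N \<subseteq> carrier S" using N.a_subset .
  show ?thesis
  proof (rule maximalidealI)
    show "ideal {r \<in> carrier R. h r \<in> N} R" by (rule h.ideal_vimage[OF N.is_ideal])
    show "carrier R \<noteq> {r \<in> carrier R. h r \<in> N}"
    proof
      assume "carrier R = {r \<in> carrier R. h r \<in> N}"
      then have "h (k s) \<in> N" if "s \<in> carrier S" for s using k_in[OF that] by blast
      then have "carrier S \<subseteq> N" using hk by auto
      then show False using N.I_notcarr N_sub by blast
    qed
    fix J assume J: "ideal J R" "{r \<in> carrier R. h r \<in> N} \<subseteq> J" "J \<subseteq> carrier R"
    have J': "ideal {s \<in> carrier S. k s \<in> J} S" by (rule k.ideal_vimage[OF J(1)])
    have "N \<subseteq> {s \<in> carrier S. k s \<in> J}" using N_sub J(2) hk k_in by auto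
    then have "{s \<in> carrier S. k s \<in> J} = N \<or> {s \<in> carrier S. k s \<in> J} = carrier S"
      using N.I_maximal[OF J'] by blast
    then show "J = {r \<in> carrier R. h r \<in> N} \<or> J = carrier R"
    proof
      assume eq: "{s \<in> carrier S. k s \<in> J} = N"
      have "J \<subseteq> {r \<in> carrier R. h r \<in> N}" unfolding eq[symmetric] using J(3) kh h_in by auto
      then show ?thesis using J(2) by blast
    next
      assume eq: "{s \<in> carrier S. k s \<in> J} = carrier S"
      have "carrier R \<subseteq> J"
      proof
        fix r assume r: "r \<in> carrier R"
        then have "h r \<in> {s \<in> carrier S. k s \<in> J}" unfolding eq by (rule h_in)
        then show "r \<in> J" using kh[OF r] by simp
      qed
      then show ?thesis using J(3) by blast
    qed
  qed
qed

text \<open>\<open>S\<close> is not known to be a ring in advance. As \<open>h\<close> preserves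
  zero, the ring structure transported along \<open>h\<close> is that of \<open>S\<close>, and then
  maximal ideals correspond along \<open>h\<close>.\<close>

lemma local_ring_iso:
  assumes R: "local_ring R" and h: "h \<in> ring_iso R S" and zero: "h \<zero>\<^bsub>R\<^esub> = \<zero>\<^bsub>S\<^esub>"
  shows "local_ring S"
proof -
  have cR: "cring R" using R by (simp add: local_ring_def)
  have S: "S\<lparr>zero := h \<zero>\<^bsub>R\<^esub>\<rparr> = S" using zero by simp
  have cS: "cring S" using cring.ring_iso_imp_img_cring[OF cR h] unfolding S .
  have rR: "ring R" and rS: "ring S" using cR cS by (auto simp: cring_def)
  define k where "k = inv_into (carrier R) h"
  have k: "k \<in> ring_iso S R" unfolding k_def by (rule ring_iso_set_sym[OF rR h])
  obtain M where M: "maximalideal M R" "\<And>N. maximalideal N R \<Longrightarrow> N = M"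
    using R unfolding local_ring_def by blast
  have "N = {s \<in> carrier S. k s \<in> M}" if N: "maximalideal N S" for N
  proof -
    have "N \<subseteq> carrier S" using maximalideal.axioms(1)[OF N] by (simp add: ideal.axioms(1) additive_subgroup.a_subset)
    moreover have "s \<in> N \<longleftrightarrow> k s \<in> M" if s: "s \<in> carrier S" for s
    proof -
      have "bij_betw h (carrier R) (carrier S)" using h by (simp add: ring_iso_def)
      then have "k s \<in> carrier R" "h (k s) = s"
        using s ring_iso_memE(1)[OF k s] unfolding k_def by (simp_all add: bij_betw_inv_into_right)
      moreover have "{r \<in> carrier R. h r \<in> N} = M" by (rule M(2)[OF maximalideal_vimage_iso[OF rR rS h N]])
      ultimately show ?thesis by auto
    qed
    ultimately show ?thesis by blast
  qed
  then show ?thesis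
    unfolding local_ring_def using cS maximalideal_vimage_iso[OF rS rR k M(1)] by blast
qed

section \<open>Open subspaces and their stalks\<close>

lemma open_sub_simps [simp]:
  "Top (open_sub X U) = subtopology (Top X) U" "Sec (open_sub X U) = Sec X" "Res (open_sub X U) = Res X"
  by (simp_all add: open_sub_def)

lemma open_sub_open_sub: "open_sub (open_sub X U) V = open_sub X (U \<inter> V)"
  by (simp add: open_sub_def subtopology_subtopology)

lemma points_open_sub: "openin (Top X) U \<Longrightarrow> points (open_sub X U) = U"
  using openin_subset by (auto simp: topspace_subtopology)

lemma openin_open_sub: "openin (Top X) U \<Longrightarrow> openin (Top (open_sub X U)) V \<longleftrightarrow> openin (Top X) V \<and> V \<subseteq> U"
  by (simp add: openin_open_subtopology)

lemma ringed_space_open_sub: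
  assumes X: "ringed_space X" and U: "openin (Top X) U"
  shows "ringed_space (open_sub X U)"
proof -
  have op: "openin (subtopology (Top X) U) V \<longleftrightarrow> openin (Top X) V \<and> V \<subseteq> U" for V
    using openin_open_sub[OF U, of V] by simp
  have glue: "\<forall>\<U> s. (\<forall>U\<in>\<U>. openin (Top X) U \<and> s U \<in> carrier (Sec X U)) \<and>
        (\<forall>U\<in>\<U>. \<forall>V\<in>\<U>. Res X U (U \<inter> V) (s U) = Res X V (U \<inter> V) (s V)) \<longrightarrow>
        (\<exists>!t. t \<in> carrier (Sec X (\<Union>\<U>)) \<and> (\<forall>U\<in>\<U>. Res X (\<Union>\<U>) U t = s U))"
    using X unfolding ringed_space_def by (elim conjE)
  have "\<exists>!t. t \<in> carrier (Sec X (\<Union>\<U>)) \<and> (\<forall>V\<in>\<U>. Res X (\<Union>\<U>) V t = s V)"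
    if "(\<forall>V\<in>\<U>. (openin (Top X) V \<and> V \<subseteq> U) \<and> s V \<in> carrier (Sec X V)) \<and>
        (\<forall>V\<in>\<U>. \<forall>W\<in>\<U>. Res X V (V \<inter> W) (s V) = Res X W (V \<inter> W) (s W))" for \<U> s
    by (rule glue[THEN spec, THEN spec, THEN mp]) (use that in blast)
  then have "\<forall>\<U> s. (\<forall>V\<in>\<U>. (openin (Top X) V \<and> V \<subseteq> U) \<and> s V \<in> carrier (Sec X V)) \<and>
        (\<forall>V\<in>\<U>. \<forall>W\<in>\<U>. Res X V (V \<inter> W) (s V) = Res X W (V \<inter> W) (s W)) \<longrightarrow>
      (\<exists>!t. t \<in> carrier (Sec X (\<Union>\<U>)) \<and> (\<forall>V\<in>\<U>. Res X (\<Union>\<U>) V t = s V))"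
    by blast
  then show ?thesis
    unfolding ringed_space_def[of "open_sub X U"] open_sub_simps op
    using rs_cring[OF X] rs_res_hom[OF X] rs_res_id[OF X] rs_res_res[OF X] by (intro conjI) auto
qed

lemma germ_open_sub:
  assumes "openin (Top X) U" "V \<subseteq> U"
  shows "germ (open_sub X U) x (V, s) = {(W, t) \<in> germ X x (V, s). W \<subseteq> U}"
  using assms unfolding germ_def by (auto simp: openin_open_subtopology)

lemma unit_at_open_sub:
  assumes "openin (Top X) U" "V \<subseteq> U"
  shows "unit_at (open_sub X U) x V s \<longleftrightarrow> unit_at X x V s"
  using assms unfolding unit_at_def by (auto simp: openin_open_subtopology)

text \<open>A germ is a set of representatives, so the stalks of a space and of an open subspace are
  different sets. The map \<open>g\<close> discards the representatives not contained in
  \<open>U\<close>; every germ at a point of \<open>U\<close> has representatives that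
  remain.\<close>

lemma stalk_open_sub_iso:
  assumes X: "ringed_space X" and U: "openin (Top X) U" and x: "x \<in> U"
  defines "g \<equiv> \<lambda>a. {(W, t) \<in> a. W \<subseteq> U}"
  shows "g \<in> ring_iso (stalk X x) (stalk (open_sub X U) x)" "g \<zero>\<^bsub>stalk X x\<^esub> = \<zero>\<^bsub>stalk (open_sub X U) x\<^esub>"
proof -
  let ?Y = "open_sub X U"
  note Y = ringed_space_open_sub[OF X U]
  have opY: "openin (Top ?Y) V \<longleftrightarrow> openin (Top X) V \<and> V \<subseteq> U" for V by (rule openin_open_sub[OF U])
  have g: "g (germ X x (V, s)) = germ ?Y x (V, s)" if "V \<subseteq> U" for V s
    unfolding g_def germ_open_sub[OF U that] ..
  have rep: "\<exists>V s. openin (Top X) V \<and> V \<subseteq> U \<and> x \<in> V \<and> s \<in> carrier (Sec X V) \<and> a = germ X x (V, s)"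
    if a: "a \<in> carrier (stalk X x)" for a
  proof -
    obtain V s where V: "openin (Top X) V" "x \<in> V" "s \<in> carrier (Sec X V)" "a = germ X x (V, s)"
      using a by (rule carrier_stalkE)
    then have "germ X x (V \<inter> U, Res X V (V \<inter> U) s) = a" using x U by (subst germ_res[OF X]) auto
    moreover have "Res X V (V \<inter> U) s \<in> carrier (Sec X (V \<inter> U))" using V U by (intro rs_res_closed[OF X]) auto
    ultimately show ?thesis using V x U by (intro exI[of _ "V \<inter> U"]) auto
  qed
  have const: "g (germ X x (points X, c (points X))) = germ ?Y x (U, c U)"
    if c: "\<And>V. openin (Top X) V \<Longrightarrow> c V \<in> carrier (Sec X V)"
      "\<And>V. openin (Top X) V \<Longrightarrow> Res X (points X) V (c (points X)) = c V" for c
  proof -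
    have "germ X x (points X, c (points X)) = germ X x (U, c U)"
      using germ_res[OF X _ c(1) U openin_subset[OF U] x] c(2)[OF U] by simp
    then show ?thesis using g by simp
  qed
  have ring: "ring (Sec X V)" if "openin (Top X) V" for V using rs_ring[OF X that] .
  have pY: "points ?Y = U" by (rule points_open_sub[OF U])
  have res_top: "Res X (points X) V \<in> ring_hom (global X) (Sec X V)" if "openin (Top X) V" for V
    by (rule rs_res_hom[OF X _ that openin_subset[OF that]]) simp
  show zero: "g \<zero>\<^bsub>stalk X x\<^esub> = \<zero>\<^bsub>stalk ?Y x\<^esub>"
    using const[of "\<lambda>V. \<zero>\<^bsub>Sec X V\<^esub>"] ring_hom_zero[OF res_top] ring
    by (simp add: stalk_def pY ring.ring_simprules(2) del: open_sub_simps(1))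
  have one: "g \<one>\<^bsub>stalk X x\<^esub> = \<one>\<^bsub>stalk ?Y x\<^esub>"
    using const[of "\<lambda>V. \<one>\<^bsub>Sec X V\<^esub>"] ring_hom_one[OF res_top] ring
    by (simp add: stalk_def pY ring.ring_simprules(6) del: open_sub_simps(1))
  show "g \<in> ring_iso (stalk X x) (stalk ?Y x)"
  proof (rule ring_iso_memI)
    fix a assume "a \<in> carrier (stalk X x)"
    then obtain V s where V: "openin (Top X) V" "V \<subseteq> U" "x \<in> V" "s \<in> carrier (Sec X V)" "a = germ X x (V, s)"
      using rep by blast
    then show "g a \<in> carrier (stalk ?Y x)" using carrier_stalkI[of ?Y V x s] opY g by simp
    fix b assume "b \<in> carrier (stalk X x)"
    then obtain W t where W: "openin (Top X) W" "W \<subseteq> U" "x \<in> W" "t \<in> carrier (Sec X W)" "b = germ X x (W, t)"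
      using rep by blast
    have VW: "V \<inter> W \<subseteq> U" using V by blast
    have opVW: "openin (Top ?Y) V" "openin (Top ?Y) W" using opY V W by auto
    show "g (a \<otimes>\<^bsub>stalk X x\<^esub> b) = g a \<otimes>\<^bsub>stalk ?Y x\<^esub> g b"
      using stalk_mult[OF X V(1,3,4) W(1,3,4)] stalk_mult[OF Y opVW(1) V(3) _ opVW(2) W(3), of s t] V(4) W(4)
      unfolding V(5) W(5) by (simp add: g[OF V(2)] g[OF W(2)] g[OF VW])
    show "g (a \<oplus>\<^bsub>stalk X x\<^esub> b) = g a \<oplus>\<^bsub>stalk ?Y x\<^esub> g b"
      using stalk_add[OF X V(1,3,4) W(1,3,4)] stalk_add[OF Y opVW(1) V(3) _ opVW(2) W(3), of s t] V(4) W(4)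
      unfolding V(5) W(5) by (simp add: g[OF V(2)] g[OF W(2)] g[OF VW])
  next
    show "g \<one>\<^bsub>stalk X x\<^esub> = \<one>\<^bsub>stalk ?Y x\<^esub>" by (rule one)
    show "bij_betw g (carrier (stalk X x)) (carrier (stalk ?Y x))"
    proof (rule bij_betw_imageI)
      show "inj_on g (carrier (stalk X x))"
      proof (rule inj_onI)
        fix a b assume "a \<in> carrier (stalk X x)" "b \<in> carrier (stalk X x)" and eq: "g a = g b"
        then obtain V s W t where V: "openin (Top X) V" "V \<subseteq> U" "x \<in> V" "s \<in> carrier (Sec X V)" "a = germ X x (V, s)"
          and W: "openin (Top X) W" "W \<subseteq> U" "x \<in> W" "t \<in> carrier (Sec X W)" "b = germ X x (W, t)"
          using rep by meson
        have "(W, t) \<in> g a" unfolding eq using in_germ[OF W(1,3,4)] W by (simp add: g_def)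
        then have "germ_rel X x V s W t" unfolding g_def V(5) by (simp add: germ_eq_Collect)
        then show "a = b" unfolding V(5) W(5) germ_eq_iff[OF X V(1,3,4) W(1,3,4)] .
      qed
      show "g ` carrier (stalk X x) = carrier (stalk ?Y x)"
      proof (intro subset_antisym subsetI)
        fix b assume "b \<in> g ` carrier (stalk X x)"
        then obtain V s where V: "openin (Top X) V" "V \<subseteq> U" "x \<in> V" "s \<in> carrier (Sec X V)" "b = g (germ X x (V, s))"
          using rep by blast
        then show "b \<in> carrier (stalk ?Y x)" using carrier_stalkI[of ?Y V x s] opY g by simp
      next
        fix b assume "b \<in> carrier (stalk ?Y x)"
        then obtain V s where V: "openin (Top ?Y) V" "x \<in> V" "s \<in> carrier (Sec ?Y V)" "b = germ ?Y x (V, s)"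
          by (rule carrier_stalkE)
        then have V': "openin (Top X) V" "V \<subseteq> U" "s \<in> carrier (Sec X V)" using opY by auto
        then show "b \<in> g ` carrier (stalk X x)"
          using carrier_stalkI[OF V'(1) V(2) V'(3)] g[OF V'(2)] V(4) by (metis imageI)
      qed
    qed
  qed
qed

lemma locally_ringed_open_sub:
  assumes X: "locally_ringed_space X" and U: "openin (Top X) U"
  shows "locally_ringed_space (open_sub X U)"
proof -
  have X': "ringed_space X" using X by (simp add: locally_ringed_space_def)
  have "local_ring (stalk (open_sub X U) x)" if "x \<in> points (open_sub X U)" for x
  proof -
    have x: "x \<in> U" "x \<in> points X" using that openin_subset[OF U] by (auto simp: points_open_sub[OF U])
    have "local_ring (stalk X x)" using X x by (simp add: locally_ringed_space_def)
    then show ?thesis by (rule local_ring_iso[OF _ stalk_open_sub_iso[OF X' U x(1)]])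
  qed
  then show ?thesis using ringed_space_open_sub[OF X' U] by (simp add: locally_ringed_space_def)
qed

definition incl_S :: "('p, 'r) rspace \<Rightarrow> 'p set \<Rightarrow> 'p set \<Rightarrow> 'r \<Rightarrow> 'r" where
  "incl_S X U = (\<lambda>V\<in>{V. openin (Top X) V}. \<lambda>s\<in>carrier (Sec X V). Res X V (V \<inter> U) s)"

lemma incl_S_apply [simp]:
  "openin (Top X) V \<Longrightarrow> s \<in> carrier (Sec X V) \<Longrightarrow> incl_S X U V s = Res X V (V \<inter> U) s"
  by (simp add: incl_S_def)

lemma preim_incl: "openin (Top X) U \<Longrightarrow> preim (open_sub X U) (\<lambda>x\<in>U. x) V = V \<inter> U"
  using points_open_sub[of X U] by (auto simp: preim_def)

lemma lrs_morphism_incl: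
  assumes X: "ringed_space X" and U: "openin (Top X) U"
  shows "lrs_morphism (open_sub X U) X (\<lambda>x\<in>U. x) (incl_S X U)"
proof -
  have rs: "rs_morphism (open_sub X U) X (\<lambda>x\<in>U. x) (incl_S X U)"
    unfolding rs_morphism_def preim_incl[OF U] open_sub_simps(2,3)
  proof (intro conjI allI impI ballI)
    show "(\<lambda>x\<in>U. x) \<in> extensional (points (open_sub X U))" by (simp add: points_open_sub[OF U] del: open_sub_simps)
    have "continuous_map (subtopology (Top X) U) (Top X) id" by (rule continuous_map_id_subt)
    then show "continuous_map (Top (open_sub X U)) (Top X) (\<lambda>x\<in>U. x)"
      unfolding open_sub_simps by (rule continuous_map_eq) simp
    show "incl_S X U \<in> extensional {V. openin (Top X) V}" by (simp add: incl_S_def)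
  next
    fix V assume V: "openin (Top X) V"
    show "incl_S X U V \<in> extensional (carrier (Sec X V))" using V by (simp add: incl_S_def)
    have "Res X V (V \<inter> U) \<in> ring_hom (Sec X V) (Sec X (V \<inter> U))" using V U by (intro rs_res_hom[OF X]) auto
    from ring_hom_restrict_carrier[OF rs_ring[OF X V] this] show "incl_S X U V \<in> ring_hom (Sec X V) (Sec X (V \<inter> U))"
      using V by (simp add: incl_S_def)
  next
    fix V W s assume VW: "openin (Top X) V \<and> openin (Top X) W \<and> W \<subseteq> V" and s: "s \<in> carrier (Sec X V)"
    have "Res X W (W \<inter> U) (Res X V W s) = Res X V (W \<inter> U) s" using VW U s by (intro rs_res_res[OF X]) auto
    also have "\<dots> = Res X (V \<inter> U) (W \<inter> U) (Res X V (V \<inter> U) s)" using VW U s by (intro rs_res_res[OF X, symmetric]) auto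
    finally show "incl_S X U W (Res X V W s) = Res X (V \<inter> U) (W \<inter> U) (incl_S X U V s)"
      using VW s rs_res_closed[OF X, of V W s] by simp
  qed
  show ?thesis
    unfolding lrs_morphism_iff[OF ringed_space_open_sub[OF X U] X] preim_incl[OF U]
  proof (intro conjI rs ballI allI impI)
    fix x V s assume "x \<in> points (open_sub X U)" and V: "openin (Top X) V \<and> (\<lambda>x\<in>U. x) x \<in> V \<and> s \<in> carrier (Sec X V) \<and>
      unit_at (open_sub X U) x (V \<inter> U) (incl_S X U V s)"
    then have x: "x \<in> U" by (simp add: points_open_sub[OF U] del: open_sub_simps)
    have "unit_at (open_sub X U) x (V \<inter> U) (incl_S X U V s)" "openin (Top X) V" "s \<in> carrier (Sec X V)"
      using V by auto
    then have "unit_at X x (V \<inter> U) (Res X V (V \<inter> U) s)" using unit_at_open_sub[OF U, of "V \<inter> U"] by simp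
    then show "unit_at X ((\<lambda>x\<in>U. x) x) V s" using unit_at_res[OF X, of V s "V \<inter> U" x] V U x by auto
  qed
qed

text \<open>Over an open set \<open>V\<close> inside \<open>U\<close> the section map is the
  restriction from \<open>V\<close> to itself, that is the identity.\<close>

lemma open_immersion_incl:
  assumes X: "ringed_space X" and U: "openin (Top X) U"
  shows "open_immersion (open_sub X U) X (\<lambda>x\<in>U. x) (incl_S X U)"
  unfolding open_immersion_def points_open_sub[OF U]
proof (intro conjI allI impI)
  show "rs_morphism (open_sub X U) X (\<lambda>x\<in>U. x) (incl_S X U)"
    using lrs_morphism_incl[OF X U] by (simp add: lrs_morphism_def)
  have img: "(\<lambda>x\<in>U. x) ` U = U" by simp
  show "openin (Top X) ((\<lambda>x\<in>U. x) ` U)" using U img by simp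
  have "homeomorphic_map (subtopology (Top X) U) (subtopology (Top X) U) id"
    unfolding homeomorphic_map_id ..
  then show "homeomorphic_map (Top (open_sub X U)) (subtopology (Top X) ((\<lambda>x\<in>U. x) ` U)) (\<lambda>x\<in>U. x)"
    unfolding img open_sub_simps by (rule homeomorphic_map_eq) simp
  fix V assume "openin (Top X) V \<and> V \<subseteq> (\<lambda>x\<in>U. x) ` U"
  then have V: "openin (Top X) V" "V \<subseteq> U" "V \<inter> U = V" by auto
  have id: "incl_S X U V s = s" if "s \<in> carrier (Sec X V)" for s using rs_res_id[OF X V(1) that] that V by simp
  note r = ring.ring_simprules[OF rs_ring[OF X V(1)]]
  show "incl_S X U V \<in> ring_iso (Sec X V) (Sec (open_sub X U) (preim (open_sub X U) (\<lambda>x\<in>U. x) V))"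
    unfolding preim_incl[OF U] V(3) open_sub_simps
    by (rule ring_iso_memI) (auto simp: id r bij_betw_def inj_on_def image_iff)
qed

section \<open>Open immersions\<close>

lemma openim_rs: "open_immersion X Y f \<psi> \<Longrightarrow> rs_morphism X Y f \<psi>"
  and openim_image: "open_immersion X Y f \<psi> \<Longrightarrow> openin (Top Y) (f ` points X)"
  and openim_homeo: "open_immersion X Y f \<psi> \<Longrightarrow> homeomorphic_map (Top X) (subtopology (Top Y) (f ` points X)) f"
  and openim_iso: "open_immersion X Y f \<psi> \<Longrightarrow> openin (Top Y) V \<Longrightarrow> V \<subseteq> f ` points X \<Longrightarrow>
    \<psi> V \<in> ring_iso (Sec Y V) (Sec X (preim X f V))"
  by (simp_all add: open_immersion_def)

lemma openim_inj: "open_immersion X Y f \<psi> \<Longrightarrow> inj_on f (points X)"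
  using homeomorphic_imp_injective_map[OF openim_homeo] .

lemma openim_open_image:
  assumes f: "open_immersion X Y f \<psi>" and V: "openin (Top X) V"
  shows "openin (Top Y) (f ` V)"
proof -
  have "openin (subtopology (Top Y) (f ` points X)) (f ` V)"
    using homeomorphic_imp_open_map[OF openim_homeo[OF f]] V by (simp add: open_map_def)
  then show ?thesis using openim_image[OF f] by (simp add: openin_open_subtopology)
qed

lemma preim_image:
  assumes "inj_on f (points X)" "V \<subseteq> points X"
  shows "preim X f (f ` V) = V"
  using assms by (auto simp: preim_def inj_on_def)

lemma openim_preim_image: "open_immersion X Y f \<psi> \<Longrightarrow> openin (Top X) V \<Longrightarrow> preim X f (f ` V) = V"
  by (rule preim_image[OF openim_inj openin_subset])

lemma open_immersion_comp:
  assumes Z: "ringed_space Z" and f: "open_immersion X Y f \<psi>" and g: "open_immersion Y Z g \<xi>"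
  shows "open_immersion X Z (\<lambda>x\<in>points X. g (f x))
    (\<lambda>V\<in>{V. openin (Top Z) V}. \<lambda>s\<in>carrier (Sec Z V). \<psi> (preim Y g V) (\<xi> V s))"
proof -
  note f' = openim_rs[OF f] and g' = openim_rs[OF g]
  let ?h = "\<lambda>x\<in>points X. g (f x)"
  have fX: "f ` points X \<subseteq> points Y" using rsm_point[OF f'] by blast
  have img: "?h ` points X = g ` f ` points X" by auto
  show ?thesis
    unfolding open_immersion_def
  proof (intro conjI allI impI rs_morphism_comp[OF Z f' g'])
    show "openin (Top Z) (?h ` points X)"
      unfolding img by (rule openim_open_image[OF g openim_image[OF f]])
    have "homeomorphic_map (subtopology (Top Y) (f ` points X))
      (subtopology (subtopology (Top Z) (g ` points Y)) (g ` f ` points X)) g"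
      by (rule homeomorphic_map_subtopologies[OF openim_homeo[OF g]])
        (use fX openin_subset[OF openim_image[OF g]] in auto)
    moreover have "subtopology (subtopology (Top Z) (g ` points Y)) (g ` f ` points X) = subtopology (Top Z) (g ` f ` points X)"
      unfolding subtopology_subtopology using fX by (intro arg_cong[of _ _ "subtopology (Top Z)"]) blast
    ultimately have "homeomorphic_map (Top X) (subtopology (Top Z) (g ` f ` points X)) (g \<circ> f)"
      using homeomorphic_map_compose[OF openim_homeo[OF f]] by metis
    then show "homeomorphic_map (Top X) (subtopology (Top Z) (?h ` points X)) ?h"
      unfolding img by (rule homeomorphic_map_eq) simp
    fix V assume V: "openin (Top Z) V \<and> V \<subseteq> ?h ` points X"
    have gV: "V \<subseteq> g ` points Y" using V fX img by blast
    have pV: "preim Y g V \<subseteq> f ` points X"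
    proof
      fix y assume y: "y \<in> preim Y g V"
      then obtain x where "x \<in> points X" "g y = g (f x)" using V by (auto simp: preim_def)
      then have "y = f x" using openim_inj[OF g] fX y by (auto simp: inj_on_def preim_def)
      then show "y \<in> f ` points X" using \<open>x \<in> points X\<close> by blast
    qed
    have "\<psi> (preim Y g V) \<circ> \<xi> V \<in> ring_iso (Sec Z V) (Sec X (preim X f (preim Y g V)))"
      using ring_iso_set_trans[OF openim_iso[OF g _ gV] openim_iso[OF f rsm_open[OF g'] pV]] V by blast
    then show "(\<lambda>V\<in>{V. openin (Top Z) V}. \<lambda>s\<in>carrier (Sec Z V). \<psi> (preim Y g V) (\<xi> V s)) V
      \<in> ring_iso (Sec Z V) (Sec X (preim X ?h V))"
      unfolding preim_comp[OF f'] using V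
      by (elim ring.ring_iso_restrict[OF rs_ring[OF Z], rotated 1]) auto
  qed
qed

text \<open>On points \<open>k\<close> is the inverse of \<open>f\<close> after \<open>h\<close>. A
  section over \<open>V\<close> is first transported to the image of \<open>V\<close> by \<sigma>,
  the inverse of \<psi> there, and then pulled back by \<xi>.\<close>

lemma open_immersion_factor:
  assumes W: "ringed_space W" and X: "ringed_space X" and Y: "ringed_space Y"
    and f: "open_immersion X Y f \<psi>" and h: "lrs_morphism W Y h \<xi>"
    and img: "h ` points W \<subseteq> f ` points X"
  obtains k \<omega> where "lrs_morphism W X k \<omega>" "\<And>x. x \<in> points W \<Longrightarrow> f (k x) = h x"
    "\<And>V s. openin (Top Y) V \<Longrightarrow> s \<in> carrier (Sec Y V) \<Longrightarrow> \<omega> (preim X f V) (\<psi> V s) = \<xi> V s"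
proof -
  note f' = openim_rs[OF f]
  have h': "rs_morphism W Y h \<xi>" using h by (simp add: lrs_morphism_def)
  note inj = openim_inj[OF f]
  define k where "k = (\<lambda>x\<in>points W. inv_into (points X) f (h x))"
  have k_in: "k x \<in> points X" and fk: "f (k x) = h x" if "x \<in> points W" for x
  proof -
    have "h x \<in> f ` points X" using img that by blast
    then show "k x \<in> points X" "f (k x) = h x"
      using that by (simp_all add: k_def inv_into_into f_inv_into_f)
  qed
  define \<sigma> where "\<sigma> V = inv_into (carrier (Sec Y (f ` V))) (\<psi> (f ` V))" for V
  have iso: "\<psi> (f ` V) \<in> ring_iso (Sec Y (f ` V)) (Sec X V)" and fV: "openin (Top Y) (f ` V)" if "openin (Top X) V" for V
    using openim_iso[OF f openim_open_image[OF f that]] openim_preim_image[OF f that] openin_subset[OF that]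
      openim_open_image[OF f that] by (auto simp: image_mono)
  have \<sigma>_iso: "\<sigma> V \<in> ring_iso (Sec X V) (Sec Y (f ` V))" if "openin (Top X) V" for V
    unfolding \<sigma>_def by (rule ring_iso_set_sym[OF rs_ring[OF Y fV[OF that]] iso[OF that]])
  have \<sigma>_in: "\<sigma> V s \<in> carrier (Sec Y (f ` V))" if "openin (Top X) V" "s \<in> carrier (Sec X V)" for V s
    using ring_iso_memE(1)[OF \<sigma>_iso[OF that(1)] that(2)] .
  have \<psi>\<sigma>: "\<psi> (f ` V) (\<sigma> V s) = s" if "openin (Top X) V" "s \<in> carrier (Sec X V)" for V s
    using ring_iso_memE(5)[OF iso[OF that(1)]] that(2) unfolding \<sigma>_def by (simp add: bij_betw_inv_into_right)
  have \<sigma>_eq: "\<sigma> V s = t" if "openin (Top X) V" "t \<in> carrier (Sec Y (f ` V))" "\<psi> (f ` V) t = s" for V s t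
    using ring_iso_memE(5)[OF iso[OF that(1)]] that(2,3) unfolding \<sigma>_def by (auto simp: bij_betw_inv_into_left)
  define \<omega> where "\<omega> = (\<lambda>V\<in>{V. openin (Top X) V}. \<lambda>s\<in>carrier (Sec X V). \<xi> (f ` V) (\<sigma> V s))"
  have \<omega>: "\<omega> V s = \<xi> (f ` V) (\<sigma> V s)" if "openin (Top X) V" "s \<in> carrier (Sec X V)" for V s
    using that by (simp add: \<omega>_def)
  have pre: "preim W h (f ` V) = preim W k V" if V: "openin (Top X) V" for V
  proof -
    have "h x \<in> f ` V \<longleftrightarrow> k x \<in> V" if x: "x \<in> points W" for x
      unfolding fk[OF x, symmetric] using inj_on_image_mem_iff[OF inj k_in[OF x] openin_subset[OF V]] .
    then show ?thesis by (auto simp: preim_def)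
  qed
  have pre': "preim W k (preim X f V) = preim W h V" for V
    using k_in fk by (auto simp: preim_def)
  have res: "\<sigma> V' (Res X V V' s) = Res Y (f ` V) (f ` V') (\<sigma> V s)"
    if V: "openin (Top X) V" "openin (Top X) V'" "V' \<subseteq> V" "s \<in> carrier (Sec X V)" for V V' s
  proof (rule \<sigma>_eq[OF V(2)])
    show "Res Y (f ` V) (f ` V') (\<sigma> V s) \<in> carrier (Sec Y (f ` V'))"
      using V by (intro rs_res_closed[OF Y] fV \<sigma>_in) auto
    have "\<psi> (f ` V') (Res Y (f ` V) (f ` V') (\<sigma> V s)) =
      Res X (preim X f (f ` V)) (preim X f (f ` V')) (\<psi> (f ` V) (\<sigma> V s))"
      using V by (intro rsm_nat[OF f'] fV \<sigma>_in) auto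
    then show "\<psi> (f ` V') (Res Y (f ` V) (f ` V') (\<sigma> V s)) = Res X V V' s"
      using V by (simp add: \<psi>\<sigma> openim_preim_image[OF f])
  qed
  have rs: "rs_morphism W X k \<omega>"
    unfolding rs_morphism_def
  proof (intro conjI allI impI ballI)
    show "k \<in> extensional (points W)" by (simp add: k_def)
    show "continuous_map (Top W) (Top X) k"
      unfolding continuous_map_def
    proof (intro conjI allI impI)
      show "k \<in> points W \<rightarrow> points X" using k_in by blast
      fix V assume "openin (Top X) V"
      then show "openin (Top W) {x \<in> points W. k x \<in> V}"
        using pre rsm_open[OF h' fV] by (simp add: preim_def)
    qed
    show "\<omega> \<in> extensional {V. openin (Top X) V}" by (simp add: \<omega>_def)
  next
    fix V assume V: "openin (Top X) V"
    show "\<omega> V \<in> extensional (carrier (Sec X V))" using V by (simp add: \<omega>_def)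
    have "\<xi> (f ` V) \<circ> \<sigma> V \<in> ring_hom (Sec X V) (Sec W (preim W h (f ` V)))"
      using \<sigma>_iso[OF V] by (intro ring_hom_trans[OF _ rsm_hom[OF h' fV[OF V]]]) (simp add: ring_iso_def)
    from ring_hom_restrict_carrier[OF rs_ring[OF X V] this] show "\<omega> V \<in> ring_hom (Sec X V) (Sec W (preim W k V))"
      using V by (simp add: \<omega>_def pre comp_def)
  next
    fix V V' s assume V: "openin (Top X) V \<and> openin (Top X) V' \<and> V' \<subseteq> V" and s: "s \<in> carrier (Sec X V)"
    have "\<omega> V' (Res X V V' s) = \<xi> (f ` V') (Res Y (f ` V) (f ` V') (\<sigma> V s))"
      using V s rs_res_closed[OF X, of V V' s] by (simp add: \<omega> res)
    also have "\<dots> = Res W (preim W h (f ` V)) (preim W h (f ` V')) (\<xi> (f ` V) (\<sigma> V s))"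
      using V s by (intro rsm_nat[OF h'] fV \<sigma>_in) auto
    also have "\<dots> = Res W (preim W k V) (preim W k V') (\<omega> V s)"
      using V s by (simp add: pre \<omega>)
    finally show "\<omega> V' (Res X V V' s) = Res W (preim W k V) (preim W k V') (\<omega> V s)" .
  qed
  \<comment> \<open>\<open>?U\<close> is the part of \<open>V\<close> inside the image of
    \<open>f\<close> and may be smaller than \<open>V\<close>; the preimages under \<open>h\<close>
    are nevertheless the same, because \<open>h\<close> maps into the image of
    \<open>f\<close>.\<close>
  have comm: "\<omega> (preim X f V) (\<psi> V s) = \<xi> V s" if V: "openin (Top Y) V" "s \<in> carrier (Sec Y V)" for V s
  proof -
    let ?U = "f ` preim X f V"
    have U: "openin (Top X) (preim X f V)" "openin (Top Y) ?U" "?U \<subseteq> V"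
      using rsm_open[OF f' V(1)] fV by (auto simp: preim_def)
    have "\<psi> ?U (Res Y V ?U s) = Res X (preim X f V) (preim X f ?U) (\<psi> V s)"
      by (rule rsm_nat[OF f' V(1) U(2,3) V(2)])
    then have "\<psi> ?U (Res Y V ?U s) = \<psi> V s"
      using openim_preim_image[OF f U(1)] rs_res_id[OF X U(1) rsm_closed[OF f' V]] by simp
    then have "\<sigma> (preim X f V) (\<psi> V s) = Res Y V ?U s"
      by (intro \<sigma>_eq[OF U(1) rs_res_closed[OF Y V(1) U(2,3) V(2)]])
    then have "\<omega> (preim X f V) (\<psi> V s) = \<xi> ?U (Res Y V ?U s)" using \<omega>[OF U(1) rsm_closed[OF f' V]] by simp
    also have "\<dots> = Res W (preim W h V) (preim W h ?U) (\<xi> V s)" by (rule rsm_nat[OF h' V(1) U(2,3) V(2)])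
    also have "preim W h ?U = preim W h V" using pre[OF U(1)] pre' by simp
    also have "Res W (preim W h V) (preim W h V) (\<xi> V s) = \<xi> V s"
      by (rule rs_res_id[OF W rsm_open[OF h' V(1)] rsm_closed[OF h' V]])
    finally show ?thesis .
  qed
  have "lrs_morphism W X k \<omega>"
    unfolding lrs_morphism_iff[OF W X]
  proof (intro conjI rs ballI allI impI)
    fix x V s assume x: "x \<in> points W" and V: "openin (Top X) V \<and> k x \<in> V \<and> s \<in> carrier (Sec X V) \<and>
      unit_at W x (preim W k V) (\<omega> V s)"
    \<comment> \<open>Locality of \<open>h\<close> yields a unit in \<open>Y\<close> near
      \<open>h x\<close>; the ring homomorphism \<psi> then carries it back to a unit in
      \<open>X\<close> near \<open>k x\<close>.\<close>
    have hunit: "\<And>V t. openin (Top Y) V \<Longrightarrow> h x \<in> V \<Longrightarrow> t \<in> carrier (Sec Y V) \<Longrightarrow>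
      unit_at W x (preim W h V) (\<xi> V t) \<Longrightarrow> unit_at Y (h x) V t"
      using h x unfolding lrs_morphism_iff[OF W Y] by blast
    have "h x \<in> f ` V" using V fk[OF x] by (metis imageI)
    then have "unit_at Y (h x) (f ` V) (\<sigma> V s)"
      using V by (intro hunit fV \<sigma>_in) (auto simp: \<omega> pre)
    then obtain A where A: "openin (Top Y) A" "h x \<in> A" "A \<subseteq> f ` V" "Res Y (f ` V) A (\<sigma> V s) \<in> Units (Sec Y A)"
      unfolding unit_at_def by blast
    let ?B = "preim X f A"
    have B: "openin (Top X) ?B" "k x \<in> ?B" "?B \<subseteq> V"
      using rsm_open[OF f' A(1)] k_in[OF x] fk[OF x] A(2,3) inj openin_subset[of "Top X" V] V
      by (auto simp: preim_def inj_on_def)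
    have "\<psi> A (Res Y (f ` V) A (\<sigma> V s)) = Res X (preim X f (f ` V)) ?B (\<psi> (f ` V) (\<sigma> V s))"
      using V A by (intro rsm_nat[OF f'] fV \<sigma>_in) auto
    then have eq: "\<psi> A (Res Y (f ` V) A (\<sigma> V s)) = Res X V ?B s"
      using V by (simp add: \<psi>\<sigma> openim_preim_image[OF f])
    have "\<psi> A (Res Y (f ` V) A (\<sigma> V s)) \<in> Units (Sec X ?B)"
      by (rule ring_hom_Units[OF rsm_hom[OF f' A(1)] _ _ A(4)])
        (simp_all add: ring.is_monoid rs_ring[OF Y A(1)] rs_ring[OF X B(1)])
    then show "unit_at X (k x) V s" unfolding unit_at_def eq using B by blast
  qed
  then show ?thesis using that fk comm by blast
qed

section \<open>Open subspaces of complex spaces\<close>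

abbreviation dist_n :: "nat \<Rightarrow> (nat \<Rightarrow> complex) \<Rightarrow> (nat \<Rightarrow> complex) \<Rightarrow> real" where
  "dist_n n w z \<equiv> (\<Sum>i<n. norm (w i - z i))"

lemma holomorphic_n_subset: "holomorphic_n n D g \<Longrightarrow> D' \<subseteq> D \<Longrightarrow> holomorphic_n n D' g"
  unfolding holomorphic_n_def by (meson subsetD)

lemma holomorphic_n_const: "holomorphic_n n D (\<lambda>w. c)"
  unfolding holomorphic_n_def by (intro ballI exI[of _ "\<lambda>i. 0"]) (auto intro!: exI[of _ 1] sum_nonneg mult_nonneg_nonneg)

lemma holomorphic_n_add:
  assumes "holomorphic_n n D f" "holomorphic_n n D g"
  shows "holomorphic_n n D (\<lambda>w. f w + g w)"
  unfolding holomorphic_n_def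
proof
  fix z assume z: "z \<in> D"
  obtain a where a: "\<And>\<epsilon>. \<epsilon> > 0 \<Longrightarrow> \<exists>\<delta>>0. \<forall>w\<in>D. dist_n n w z < \<delta> \<longrightarrow>
     norm (f w - f z - (\<Sum>i<n. a i * (w i - z i))) \<le> \<epsilon> * dist_n n w z"
    using assms(1) z unfolding holomorphic_n_def by meson
  obtain b where b: "\<And>\<epsilon>. \<epsilon> > 0 \<Longrightarrow> \<exists>\<delta>>0. \<forall>w\<in>D. dist_n n w z < \<delta> \<longrightarrow>
     norm (g w - g z - (\<Sum>i<n. b i * (w i - z i))) \<le> \<epsilon> * dist_n n w z"
    using assms(2) z unfolding holomorphic_n_def by meson
  show "\<exists>c. \<forall>\<epsilon>>0. \<exists>\<delta>>0. \<forall>w\<in>D. dist_n n w z < \<delta> \<longrightarrow>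
     norm (f w + g w - (f z + g z) - (\<Sum>i<n. c i * (w i - z i))) \<le> \<epsilon> * dist_n n w z"
  proof (intro exI[of _ "\<lambda>i. a i + b i"] allI impI)
    fix \<epsilon> :: real assume "\<epsilon> > 0"
    then have e: "\<epsilon> / 2 > 0" by simp
    obtain \<delta>1 where d1: "\<delta>1 > 0" "\<And>w. w \<in> D \<Longrightarrow> dist_n n w z < \<delta>1 \<Longrightarrow>
       norm (f w - f z - (\<Sum>i<n. a i * (w i - z i))) \<le> \<epsilon> / 2 * dist_n n w z" using a[OF e] by blast
    obtain \<delta>2 where d2: "\<delta>2 > 0" "\<And>w. w \<in> D \<Longrightarrow> dist_n n w z < \<delta>2 \<Longrightarrow>
       norm (g w - g z - (\<Sum>i<n. b i * (w i - z i))) \<le> \<epsilon> / 2 * dist_n n w z" using b[OF e] by blast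
    have "norm (f w + g w - (f z + g z) - (\<Sum>i<n. (a i + b i) * (w i - z i))) \<le> \<epsilon> * dist_n n w z"
      if w: "w \<in> D" "dist_n n w z < min \<delta>1 \<delta>2" for w
    proof -
      have "f w + g w - (f z + g z) - (\<Sum>i<n. (a i + b i) * (w i - z i)) =
        (f w - f z - (\<Sum>i<n. a i * (w i - z i))) + (g w - g z - (\<Sum>i<n. b i * (w i - z i)))"
        by (simp add: algebra_simps sum.distrib sum_subtractf)
      also have "norm \<dots> \<le> \<epsilon> / 2 * dist_n n w z + \<epsilon> / 2 * dist_n n w z"
        by (rule norm_triangle_le) (use d1(2)[OF w(1)] d2(2)[OF w(1)] w(2) in linarith)
      finally show ?thesis by simp
    qed
    then show "\<exists>\<delta>>0. \<forall>w\<in>D. dist_n n w z < \<delta> \<longrightarrow>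
     norm (f w + g w - (f z + g z) - (\<Sum>i<n. (a i + b i) * (w i - z i))) \<le> \<epsilon> * dist_n n w z"
      using d1(1) d2(1) by (intro exI[of _ "min \<delta>1 \<delta>2"]) auto
  qed
qed

lemma norm_linear_le: "norm (\<Sum>i<n. a i * (w i - z i)) \<le> (\<Sum>i<n. norm (a i)) * dist_n n w (z :: nat \<Rightarrow> complex)"
proof -
  have "norm (a i * (w i - z i)) \<le> norm (a i) * dist_n n w z" if "i < n" for i
  proof -
    have "norm (w i - z i) \<le> dist_n n w z"
      using that by (intro member_le_sum[of i "{..<n}" "\<lambda>i. norm (w i - z i)"]) auto
    then show ?thesis by (simp add: norm_mult mult_left_mono)
  qed
  then show ?thesis unfolding sum_distrib_right by (intro order_trans[OF norm_sum] sum_mono) auto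
qed

text \<open>With \<open>F\<close> and \<open>G\<close> the errors of the two linear approximations,
  the error for the product is \<open>F * g z + f z * G + (f w - f z) * (g w - g z)\<close>; each
  summand is kept below a third of \<epsilon> times the distance.\<close>

lemma holomorphic_n_mult:
  assumes "holomorphic_n n D f" "holomorphic_n n D g"
  shows "holomorphic_n n D (\<lambda>w. f w * g w)"
  unfolding holomorphic_n_def
proof
  fix z assume z: "z \<in> D"
  obtain a where a: "\<And>\<epsilon>. \<epsilon> > 0 \<Longrightarrow> \<exists>\<delta>>0. \<forall>w\<in>D. dist_n n w z < \<delta> \<longrightarrow>
     norm (f w - f z - (\<Sum>i<n. a i * (w i - z i))) \<le> \<epsilon> * dist_n n w z"
    using assms(1) z unfolding holomorphic_n_def by meson
  obtain b where b: "\<And>\<epsilon>. \<epsilon> > 0 \<Longrightarrow> \<exists>\<delta>>0. \<forall>w\<in>D. dist_n n w z < \<delta> \<longrightarrow>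
     norm (g w - g z - (\<Sum>i<n. b i * (w i - z i))) \<le> \<epsilon> * dist_n n w z"
    using assms(2) z unfolding holomorphic_n_def by meson
  \<comment> \<open>\<open>A\<close> and \<open>B\<close> will be Lipschitz constants of
    \<open>f\<close> and \<open>g\<close> at \<open>z\<close>: the linear part contributes the sum
    of the norms, and the error term contributes 1 because \<open>e1\<close> and \<open>e2\<close>
    are at most 1.\<close>
  define A where "A = (\<Sum>i<n. norm (a i)) + 1"
  define B where "B = (\<Sum>i<n. norm (b i)) + 1"
  have AB: "A > 0" "B > 0" unfolding A_def B_def by (smt (verit) sum_nonneg norm_ge_zero)+
  show "\<exists>c. \<forall>\<epsilon>>0. \<exists>\<delta>>0. \<forall>w\<in>D. dist_n n w z < \<delta> \<longrightarrow>
     norm (f w * g w - f z * g z - (\<Sum>i<n. c i * (w i - z i))) \<le> \<epsilon> * dist_n n w z"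
  proof (intro exI[of _ "\<lambda>i. a i * g z + f z * b i"] allI impI)
    fix \<epsilon> :: real assume e: "\<epsilon> > 0"
    \<comment> \<open>Aims at \<epsilon> / 3 after multiplication by the norm of \<open>g z\<close>;
      the summand 1 in the denominator is there because \<open>g z\<close> may vanish.\<close>
    define e1 where "e1 = min 1 (\<epsilon> / (3 * (norm (g z) + 1)))"
    define e2 where "e2 = min 1 (\<epsilon> / (3 * (norm (f z) + 1)))"
    have gz: "norm (g z) + 1 > 0" "norm (f z) + 1 > 0" by (simp_all add: add_nonneg_pos)
    have third: "\<epsilon> / (3 * c) * c = \<epsilon> / 3" if "c > 0" for c :: real using that by simp
    have e12: "e1 > 0" "e2 > 0" unfolding e1_def e2_def using e gz by simp_all
    obtain \<delta>1 where d1: "\<delta>1 > 0" "\<And>w. w \<in> D \<Longrightarrow> dist_n n w z < \<delta>1 \<Longrightarrow>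
       norm (f w - f z - (\<Sum>i<n. a i * (w i - z i))) \<le> e1 * dist_n n w z" using a[OF e12(1)] by blast
    obtain \<delta>2 where d2: "\<delta>2 > 0" "\<And>w. w \<in> D \<Longrightarrow> dist_n n w z < \<delta>2 \<Longrightarrow>
       norm (g w - g z - (\<Sum>i<n. b i * (w i - z i))) \<le> e2 * dist_n n w z" using b[OF e12(2)] by blast
    \<comment> \<open>The last entry makes \<open>A * B * s\<close> at most \<epsilon> / 3, which
      controls the quadratic summand.\<close>
    define \<delta> where "\<delta> = min (min \<delta>1 \<delta>2) (\<epsilon> / (3 * (A * B)))"
    have \<delta>: "\<delta> > 0" unfolding \<delta>_def using d1 d2 e AB by simp
    have "norm (f w * g w - f z * g z - (\<Sum>i<n. (a i * g z + f z * b i) * (w i - z i))) \<le> \<epsilon> * dist_n n w z"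
      if w: "w \<in> D" "dist_n n w z < \<delta>" for w
    proof -
      define s where "s = dist_n n w z"
      define F where "F = f w - f z - (\<Sum>i<n. a i * (w i - z i))"
      define G where "G = g w - g z - (\<Sum>i<n. b i * (w i - z i))"
      have s: "s \<ge> 0" "s < \<delta>1" "s < \<delta>2" "s \<le> \<epsilon> / (3 * (A * B))"
        using w(2) unfolding s_def \<delta>_def by (auto intro: sum_nonneg)
      have FG: "norm F \<le> e1 * s" "norm G \<le> e2 * s" using d1(2) d2(2) w(1) s unfolding F_def G_def s_def by auto
      have F1: "norm F * norm (g z) \<le> \<epsilon> / 3 * s"
      proof -
        have "e1 * norm (g z) \<le> \<epsilon> / (3 * (norm (g z) + 1)) * (norm (g z) + 1)"
          unfolding e1_def using e gz by (intro mult_mono) auto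
        then have e': "e1 * norm (g z) \<le> \<epsilon> / 3" unfolding third[OF gz(1)] .
        have "norm F * norm (g z) \<le> (e1 * norm (g z)) * s" using mult_right_mono[OF FG(1), of "norm (g z)"] by (simp add: ac_simps)
        also have "\<dots> \<le> \<epsilon> / 3 * s" by (rule mult_right_mono[OF e' s(1)])
        finally show ?thesis .
      qed
      have G1: "norm (f z) * norm G \<le> \<epsilon> / 3 * s"
      proof -
        have "e2 * norm (f z) \<le> \<epsilon> / (3 * (norm (f z) + 1)) * (norm (f z) + 1)"
          unfolding e2_def using e gz by (intro mult_mono) auto
        then have e': "e2 * norm (f z) \<le> \<epsilon> / 3" unfolding third[OF gz(2)] .
        have "norm (f z) * norm G \<le> (e2 * norm (f z)) * s" using mult_right_mono[OF FG(2), of "norm (f z)"] by (simp add: ac_simps)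
        also have "\<dots> \<le> \<epsilon> / 3 * s" by (rule mult_right_mono[OF e' s(1)])
        finally show ?thesis .
      qed
      have f: "norm (f w - f z) \<le> A * s"
      proof -
        have "norm (f w - f z) \<le> norm F + norm (\<Sum>i<n. a i * (w i - z i))"
          unfolding F_def using norm_triangle_sub by (metis norm_triangle_ineq diff_add_cancel)
        also have "\<dots> \<le> 1 * s + (\<Sum>i<n. norm (a i)) * s"
          unfolding s_def
        proof (rule add_mono[OF _ norm_linear_le])
          show "norm F \<le> 1 * dist_n n w z"
            using FG(1) mult_right_mono[of e1 1 s] s(1) unfolding e1_def s_def by linarith
        qed
        finally show ?thesis by (simp add: A_def algebra_simps)
      qed
      have g: "norm (g w - g z) \<le> B * s"
      proof -
        have "norm (g w - g z) \<le> norm G + norm (\<Sum>i<n. b i * (w i - z i))"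
          unfolding G_def using norm_triangle_sub by (metis norm_triangle_ineq diff_add_cancel)
        also have "\<dots> \<le> 1 * s + (\<Sum>i<n. norm (b i)) * s"
          unfolding s_def
        proof (rule add_mono[OF _ norm_linear_le])
          show "norm G \<le> 1 * dist_n n w z"
            using FG(2) mult_right_mono[of e2 1 s] s(1) unfolding e2_def s_def by linarith
        qed
        finally show ?thesis by (simp add: B_def algebra_simps)
      qed
      have fg: "norm (f w - f z) * norm (g w - g z) \<le> \<epsilon> / 3 * s"
      proof -
        have "norm (f w - f z) * norm (g w - g z) \<le> (A * s) * (B * s)"
          using f g s(1) AB by (intro mult_mono) auto
        also have "\<dots> = (A * B * s) * s" by simp
        also have "\<dots> \<le> \<epsilon> / 3 * s"
        proof (rule mult_right_mono[OF _ s(1)])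
          have "A * B * s \<le> A * B * (\<epsilon> / (3 * (A * B)))" using s(4) AB by (intro mult_left_mono) auto
          then show "A * B * s \<le> \<epsilon> / 3" using AB by simp
        qed
        finally show ?thesis .
      qed
      have lin: "(\<Sum>i<n. (a i * g z + f z * b i) * (w i - z i)) =
        (\<Sum>i<n. a i * (w i - z i)) * g z + f z * (\<Sum>i<n. b i * (w i - z i))"
        by (simp add: sum_distrib_left sum_distrib_right sum.distrib[symmetric] algebra_simps)
      have "f w * g w - f z * g z - (\<Sum>i<n. (a i * g z + f z * b i) * (w i - z i)) =
        F * g z + f z * G + (f w - f z) * (g w - g z)"
        unfolding lin F_def G_def by (simp add: algebra_simps)
      also have "norm \<dots> \<le> norm F * norm (g z) + norm (f z) * norm G + norm (f w - f z) * norm (g w - g z)"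
        by (intro norm_triangle_le add_mono) (simp_all add: norm_mult)
      also have "\<dots> \<le> \<epsilon> * s" using F1 G1 fg by (simp add: field_simps)
      finally show ?thesis unfolding s_def .
    qed
    then show "\<exists>\<delta>>0. \<forall>w\<in>D. dist_n n w z < \<delta> \<longrightarrow>
      norm (f w * g w - f z * g z - (\<Sum>i<n. (a i * g z + f z * b i) * (w i - z i))) \<le> \<epsilon> * dist_n n w z"
      using \<delta> by blast
  qed
qed

section \<open>Germs of the local model\<close>

definition hol_pair :: "nat \<Rightarrow> (nat \<Rightarrow> complex) set \<Rightarrow> (nat \<Rightarrow> complex) \<Rightarrow>
    (nat \<Rightarrow> complex) set \<Rightarrow> ((nat \<Rightarrow> complex) \<Rightarrow> complex) \<Rightarrow> bool" where
  "hol_pair n D z N g \<longleftrightarrow> openin (Cn n) N \<and> N \<subseteq> D \<and> z \<in> N \<and> holomorphic_n n N g"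

text \<open>Congruence near \<open>z\<close> modulo the ideal generated by \<open>fs\<close>; the
  functions \<open>h j\<close> are the coefficients.\<close>

definition hol_rel :: "nat \<Rightarrow> ((nat \<Rightarrow> complex) \<Rightarrow> complex) list \<Rightarrow> (nat \<Rightarrow> complex) \<Rightarrow>
    (nat \<Rightarrow> complex) set \<Rightarrow> ((nat \<Rightarrow> complex) \<Rightarrow> complex) \<Rightarrow>
    (nat \<Rightarrow> complex) set \<Rightarrow> ((nat \<Rightarrow> complex) \<Rightarrow> complex) \<Rightarrow> bool" where
  "hol_rel n fs z N g N' g' \<longleftrightarrow> (\<exists>M h. openin (Cn n) M \<and> z \<in> M \<and> M \<subseteq> N \<inter> N' \<and>
        (\<forall>j<length fs. holomorphic_n n M (h j)) \<and>
        (\<forall>w\<in>M. g w - g' w = (\<Sum>j<length fs. h j w * (fs ! j) w)))"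

lemma model_germ_eq:
  "model_germ n D fs z (N, g) = {(N', g'). hol_pair n D z N' g' \<and> hol_rel n fs z N g N' g'}"
  by (auto simp: model_germ_def hol_pair_def hol_rel_def)

lemma hol_relI:
  assumes "openin (Cn n) M" "z \<in> M" "M \<subseteq> N" "M \<subseteq> N'" "\<And>w. w \<in> M \<Longrightarrow> g w = g' w"
  shows "hol_rel n fs z N g N' g'"
  unfolding hol_rel_def using assms
  by (intro exI[of _ M] exI[of _ "\<lambda>j w. 0"]) (auto simp: holomorphic_n_const)

lemma hol_rel_sym: "hol_rel n fs z N g N' g' \<Longrightarrow> hol_rel n fs z N' g' N g"
proof -
  assume "hol_rel n fs z N g N' g'"
  then obtain M h where M: "openin (Cn n) M" "z \<in> M" "M \<subseteq> N \<inter> N'" "\<And>j. j < length fs \<Longrightarrow> holomorphic_n n M (h j)"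
    "\<And>w. w \<in> M \<Longrightarrow> g w - g' w = (\<Sum>j<length fs. h j w * (fs ! j) w)"
    unfolding hol_rel_def by blast
  have "holomorphic_n n M (\<lambda>w. - 1 * h j w)" if "j < length fs" for j
    by (rule holomorphic_n_mult[OF holomorphic_n_const M(4)[OF that]])
  moreover have "g' w - g w = (\<Sum>j<length fs. (- 1 * h j w) * (fs ! j) w)" if "w \<in> M" for w
    using M(5)[OF that] by (simp add: sum_negf) (metis minus_diff_eq)
  ultimately show ?thesis
    unfolding hol_rel_def using M by (intro exI[of _ M] exI[of _ "\<lambda>j w. - 1 * h j w"]) auto
qed

lemma hol_rel_trans:
  assumes "hol_rel n fs z N g N' g'" "hol_rel n fs z N' g' N'' g''"
  shows "hol_rel n fs z N g N'' g''"
proof -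
  obtain M h where M: "openin (Cn n) M" "z \<in> M" "M \<subseteq> N \<inter> N'" "\<And>j. j < length fs \<Longrightarrow> holomorphic_n n M (h j)"
    "\<And>w. w \<in> M \<Longrightarrow> g w - g' w = (\<Sum>j<length fs. h j w * (fs ! j) w)"
    using assms(1) unfolding hol_rel_def by blast
  obtain L k where L: "openin (Cn n) L" "z \<in> L" "L \<subseteq> N' \<inter> N''" "\<And>j. j < length fs \<Longrightarrow> holomorphic_n n L (k j)"
    "\<And>w. w \<in> L \<Longrightarrow> g' w - g'' w = (\<Sum>j<length fs. k j w * (fs ! j) w)"
    using assms(2) unfolding hol_rel_def by blast
  have "holomorphic_n n (M \<inter> L) (\<lambda>w. h j w + k j w)" if "j < length fs" for j
    by (intro holomorphic_n_add holomorphic_n_subset[OF M(4)[OF that]] holomorphic_n_subset[OF L(4)[OF that]]) auto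
  moreover have "g w - g'' w = (\<Sum>j<length fs. (h j w + k j w) * (fs ! j) w)" if "w \<in> M \<inter> L" for w
    using M(5)[of w] L(5)[of w] that by (simp add: algebra_simps sum.distrib)
  ultimately show ?thesis
    unfolding hol_rel_def using M(1-3) L(1-3)
    by (intro exI[of _ "M \<inter> L"] exI[of _ "\<lambda>j w. h j w + k j w"]) auto
qed

lemma hol_rel_add:
  assumes "hol_rel n fs z N g N' g'" "hol_rel n fs z K f K' f'"
  shows "hol_rel n fs z (N \<inter> K) (\<lambda>w. g w + f w) (N' \<inter> K') (\<lambda>w. g' w + f' w)"
proof -
  obtain M h where M: "openin (Cn n) M" "z \<in> M" "M \<subseteq> N \<inter> N'" "\<And>j. j < length fs \<Longrightarrow> holomorphic_n n M (h j)"
    "\<And>w. w \<in> M \<Longrightarrow> g w - g' w = (\<Sum>j<length fs. h j w * (fs ! j) w)"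
    using assms(1) unfolding hol_rel_def by blast
  obtain L k where L: "openin (Cn n) L" "z \<in> L" "L \<subseteq> K \<inter> K'" "\<And>j. j < length fs \<Longrightarrow> holomorphic_n n L (k j)"
    "\<And>w. w \<in> L \<Longrightarrow> f w - f' w = (\<Sum>j<length fs. k j w * (fs ! j) w)"
    using assms(2) unfolding hol_rel_def by blast
  have "holomorphic_n n (M \<inter> L) (\<lambda>w. h j w + k j w)" if "j < length fs" for j
    by (intro holomorphic_n_add holomorphic_n_subset[OF M(4)[OF that]] holomorphic_n_subset[OF L(4)[OF that]]) auto
  moreover have "(g w + f w) - (g' w + f' w) = (\<Sum>j<length fs. (h j w + k j w) * (fs ! j) w)" if "w \<in> M \<inter> L" for w
    using M(5)[of w] L(5)[of w] that by (simp add: algebra_simps sum.distrib)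
  ultimately show ?thesis
    unfolding hol_rel_def using M(1-3) L(1-3)
    by (intro exI[of _ "M \<inter> L"] exI[of _ "\<lambda>j w. h j w + k j w"]) auto
qed

text \<open>The products differ by \<open>(g w - g' w) * f w + g' w * (f w - f' w)\<close>, so the
  coefficients become \<open>h j w * f w + g' w * k j w\<close>; their holomorphy is where
  \<open>hol\<close> enters.\<close>

lemma hol_rel_mult:
  assumes "hol_rel n fs z N g N' g'" "hol_rel n fs z K f K' f'"
    and hol: "holomorphic_n n K f" "holomorphic_n n N' g'"
  shows "hol_rel n fs z (N \<inter> K) (\<lambda>w. g w * f w) (N' \<inter> K') (\<lambda>w. g' w * f' w)"
proof -
  obtain M h where M: "openin (Cn n) M" "z \<in> M" "M \<subseteq> N \<inter> N'" "\<And>j. j < length fs \<Longrightarrow> holomorphic_n n M (h j)"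
    "\<And>w. w \<in> M \<Longrightarrow> g w - g' w = (\<Sum>j<length fs. h j w * (fs ! j) w)"
    using assms(1) unfolding hol_rel_def by blast
  obtain L k where L: "openin (Cn n) L" "z \<in> L" "L \<subseteq> K \<inter> K'" "\<And>j. j < length fs \<Longrightarrow> holomorphic_n n L (k j)"
    "\<And>w. w \<in> L \<Longrightarrow> f w - f' w = (\<Sum>j<length fs. k j w * (fs ! j) w)"
    using assms(2) unfolding hol_rel_def by blast
  have "holomorphic_n n (M \<inter> L) (\<lambda>w. h j w * f w + g' w * k j w)" if "j < length fs" for j
    by (intro holomorphic_n_add holomorphic_n_mult holomorphic_n_subset[OF M(4)[OF that]]
        holomorphic_n_subset[OF L(4)[OF that]] holomorphic_n_subset[OF hol(1)] holomorphic_n_subset[OF hol(2)])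
      (use M(3) L(3) in auto)
  moreover have "g w * f w - g' w * f' w = (\<Sum>j<length fs. (h j w * f w + g' w * k j w) * (fs ! j) w)" if "w \<in> M \<inter> L" for w
  proof -
    have "g w * f w - g' w * f' w = (g w - g' w) * f w + g' w * (f w - f' w)" by (simp add: algebra_simps)
    also have "\<dots> = (\<Sum>j<length fs. h j w * (fs ! j) w) * f w + g' w * (\<Sum>j<length fs. k j w * (fs ! j) w)"
      using M(5)[of w] L(5)[of w] that by simp
    also have "\<dots> = (\<Sum>j<length fs. (h j w * f w + g' w * k j w) * (fs ! j) w)"
      by (simp add: sum_distrib_left sum_distrib_right sum.distrib[symmetric] algebra_simps)
    finally show ?thesis .
  qed
  ultimately show ?thesis
    unfolding hol_rel_def using M(1-3) L(1-3)
    by (intro exI[of _ "M \<inter> L"] exI[of _ "\<lambda>j w. h j w * f w + g' w * k j w"]) auto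
qed

lemma hol_rel_refl: "hol_pair n D z N g \<Longrightarrow> hol_rel n fs z N g N g"
  by (rule hol_relI[of n N]) (auto simp: hol_pair_def)

lemma in_model_germ: "hol_pair n D z N g \<Longrightarrow> (N, g) \<in> model_germ n D fs z (N, g)"
  by (simp add: model_germ_eq hol_rel_refl)

lemma model_germ_eq_iff:
  assumes "hol_pair n D z N g" "hol_pair n D z N' g'"
  shows "model_germ n D fs z (N, g) = model_germ n D fs z (N', g') \<longleftrightarrow> hol_rel n fs z N g N' g'"
proof
  assume "model_germ n D fs z (N, g) = model_germ n D fs z (N', g')"
  then show "hol_rel n fs z N g N' g'" using in_model_germ[OF assms(2)] by (auto simp: model_germ_eq)
next
  assume "hol_rel n fs z N g N' g'"
  then show "model_germ n D fs z (N, g) = model_germ n D fs z (N', g')"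
    unfolding model_germ_eq using hol_rel_trans hol_rel_sym by blast
qed

lemma some_model_germ:
  assumes "hol_pair n D z N g"
  obtains N' g' where "(SOME p. p \<in> model_germ n D fs z (N, g)) = (N', g')" "hol_pair n D z N' g'"
    "hol_rel n fs z N g N' g'"
proof -
  have "(SOME p. p \<in> model_germ n D fs z (N, g)) \<in> model_germ n D fs z (N, g)"
    by (rule someI) (rule in_model_germ[OF assms])
  then show ?thesis using that unfolding model_germ_eq by auto
qed

lemma hol_pair_add: "hol_pair n D z N g \<Longrightarrow> hol_pair n D z K f \<Longrightarrow> hol_pair n D z (N \<inter> K) (\<lambda>w. g w + f w)"
  unfolding hol_pair_def by (auto intro!: holomorphic_n_add elim: holomorphic_n_subset)

lemma hol_pair_mult: "hol_pair n D z N g \<Longrightarrow> hol_pair n D z K f \<Longrightarrow> hol_pair n D z (N \<inter> K) (\<lambda>w. g w * f w)"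
  unfolding hol_pair_def by (auto intro!: holomorphic_n_mult elim: holomorphic_n_subset)

lemma model_germ_lift_add:
  assumes g: "hol_pair n D z N g" and f: "hol_pair n D z K f"
  shows "model_germ_lift n D fs z (+) (model_germ n D fs z (N, g)) (model_germ n D fs z (K, f)) =
    model_germ n D fs z (N \<inter> K, \<lambda>w. g w + f w)"
proof -
  obtain N' g' where g': "(SOME p. p \<in> model_germ n D fs z (N, g)) = (N', g')" "hol_pair n D z N' g'"
    "hol_rel n fs z N g N' g'" by (rule some_model_germ[OF g])
  obtain K' f' where f': "(SOME p. p \<in> model_germ n D fs z (K, f)) = (K', f')" "hol_pair n D z K' f'"
    "hol_rel n fs z K f K' f'" by (rule some_model_germ[OF f])
  have "model_germ n D fs z (N' \<inter> K', \<lambda>w. g' w + f' w) = model_germ n D fs z (N \<inter> K, \<lambda>w. g w + f w)"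
    unfolding model_germ_eq_iff[OF hol_pair_add[OF g'(2) f'(2)] hol_pair_add[OF g f]]
    by (rule hol_rel_sym[OF hol_rel_add[OF g'(3) f'(3)]])
  then show ?thesis unfolding model_germ_lift_def g'(1) f'(1) by simp
qed

lemma model_germ_lift_mult:
  assumes g: "hol_pair n D z N g" and f: "hol_pair n D z K f"
  shows "model_germ_lift n D fs z (*) (model_germ n D fs z (N, g)) (model_germ n D fs z (K, f)) =
    model_germ n D fs z (N \<inter> K, \<lambda>w. g w * f w)"
proof -
  obtain N' g' where g': "(SOME p. p \<in> model_germ n D fs z (N, g)) = (N', g')" "hol_pair n D z N' g'"
    "hol_rel n fs z N g N' g'" by (rule some_model_germ[OF g])
  obtain K' f' where f': "(SOME p. p \<in> model_germ n D fs z (K, f)) = (K', f')" "hol_pair n D z K' f'"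
    "hol_rel n fs z K f K' f'" by (rule some_model_germ[OF f])
  have "hol_rel n fs z (N \<inter> K) (\<lambda>w. g w * f w) (N' \<inter> K') (\<lambda>w. g' w * f' w)"
    by (rule hol_rel_mult[OF g'(3) f'(3)]) (use f g'(2) in \<open>simp_all add: hol_pair_def\<close>)
  then have "model_germ n D fs z (N' \<inter> K', \<lambda>w. g' w * f' w) = model_germ n D fs z (N \<inter> K, \<lambda>w. g w * f w)"
    unfolding model_germ_eq_iff[OF hol_pair_mult[OF g'(2) f'(2)] hol_pair_mult[OF g f]]
    by (rule hol_rel_sym)
  then show ?thesis unfolding model_germ_lift_def g'(1) f'(1) by simp
qed

lemma hol_pair_subset: "hol_pair n D z N g \<Longrightarrow> D \<subseteq> D' \<Longrightarrow> hol_pair n D' z N g"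
  by (auto simp: hol_pair_def)

lemma hol_pair_const: "openin (Cn n) D \<Longrightarrow> z \<in> D \<Longrightarrow> hol_pair n D z D (\<lambda>w. c)"
  by (simp add: hol_pair_def holomorphic_n_const)

lemma hol_pair_point: "hol_pair n D z N g \<Longrightarrow> w \<in> N \<Longrightarrow> hol_pair n D w N g"
  by (simp add: hol_pair_def)

text \<open>Germs of functions defined near \<open>z\<close> on an open set, extended to germs for a larger one.\<close>

definition germ_up :: "nat \<Rightarrow> (nat \<Rightarrow> complex) set \<Rightarrow> ((nat \<Rightarrow> complex) \<Rightarrow> complex) list \<Rightarrow>
    (nat \<Rightarrow> complex) \<Rightarrow> hol_germ \<Rightarrow> hol_germ" where
  "germ_up n D fs z c = model_germ n D fs z (SOME p. p \<in> c)"

text \<open>The representative chosen in \<open>germ_up\<close> is congruent to the given one near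
  \<open>z\<close>, and congruence does not refer to the ambient open set.\<close>

lemma germ_up_germ:
  assumes D: "D' \<subseteq> D" and g: "hol_pair n D' z N g"
  shows "germ_up n D fs z (model_germ n D' fs z (N, g)) = model_germ n D fs z (N, g)"
proof -
  obtain N' g' where g': "(SOME p. p \<in> model_germ n D' fs z (N, g)) = (N', g')" "hol_pair n D' z N' g'"
    "hol_rel n fs z N g N' g'" by (rule some_model_germ[OF g])
  then show ?thesis
    unfolding germ_up_def g'(1) model_germ_eq_iff[OF hol_pair_subset[OF g'(2) D] hol_pair_subset[OF g D]]
    by (simp add: hol_rel_sym)
qed

section \<open>Sections of the local model and the shrinking of its open set\<close>

lemma complex_model_simps:
  "Top (complex_model n D fs) = subtopology (Cn n) (zero_locus D fs)"
  "Res (complex_model n D fs) U V s = restrict s V"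
  "\<one>\<^bsub>Sec (complex_model n D fs) V\<^esub> = model_const n D fs V 1"
  "s \<otimes>\<^bsub>Sec (complex_model n D fs) V\<^esub> t = (\<lambda>z\<in>V. model_germ_lift n D fs z (*) (s z) (t z))"
  "s \<oplus>\<^bsub>Sec (complex_model n D fs) V\<^esub> t = (\<lambda>z\<in>V. model_germ_lift n D fs z (+) (s z) (t z))"
  by (simp_all add: complex_model_def)

lemma complex_model_carrier:
  "s \<in> carrier (Sec (complex_model n D fs) V) \<longleftrightarrow> s \<in> extensional V \<and>
    (\<forall>z\<in>V. \<exists>N g. hol_pair n D z N g \<and> (\<forall>w\<in>N \<inter> V. s w = model_germ n D fs w (N, g)))"
  by (simp add: complex_model_def hol_pair_def conj_assoc)

lemma complex_model_carrierE:
  assumes "s \<in> carrier (Sec (complex_model n D fs) V)" "z \<in> V"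
  obtains N g where "hol_pair n D z N g" "\<And>w. w \<in> N \<Longrightarrow> w \<in> V \<Longrightarrow> s w = model_germ n D fs w (N, g)"
  using assms unfolding complex_model_carrier by (metis IntI)

lemma complex_model_carrierI:
  assumes "s \<in> extensional V"
    and "\<And>z. z \<in> V \<Longrightarrow> \<exists>N g. hol_pair n D z N g \<and> (\<forall>w\<in>N \<inter> V. s w = model_germ n D fs w (N, g))"
  shows "s \<in> carrier (Sec (complex_model n D fs) V)"
  unfolding complex_model_carrier using assms by blast

lemma complex_model_one_closed:
  assumes "openin (Cn n) D" "V \<subseteq> D"
  shows "model_const n D fs V c \<in> carrier (Sec (complex_model n D fs) V)"
proof (rule complex_model_carrierI)
  fix z assume "z \<in> V"
  then show "\<exists>N g. hol_pair n D z N g \<and> (\<forall>w\<in>N \<inter> V. model_const n D fs V c w = model_germ n D fs w (N, g))"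
    using assms hol_pair_const[of n D z c]
    by (intro exI[of _ D] exI[of _ "\<lambda>w. c"]) (auto simp: model_const_def)
qed (simp add: model_const_def)

text \<open>Near each point both sections are induced by holomorphic functions, whose sum and
  product on the common domain induce the results.\<close>

lemma complex_model_closed:
  assumes s: "s \<in> carrier (Sec (complex_model n D fs) V)" and t: "t \<in> carrier (Sec (complex_model n D fs) V)"
  shows "s \<oplus>\<^bsub>Sec (complex_model n D fs) V\<^esub> t \<in> carrier (Sec (complex_model n D fs) V)"
    and "s \<otimes>\<^bsub>Sec (complex_model n D fs) V\<^esub> t \<in> carrier (Sec (complex_model n D fs) V)"
proof -
  have *: "\<exists>N g K f. hol_pair n D z N g \<and> hol_pair n D z K f \<and>
    (\<forall>w\<in>(N \<inter> K) \<inter> V. s w = model_germ n D fs w (N, g) \<and> t w = model_germ n D fs w (K, f))" if z: "z \<in> V" for z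
  proof -
    obtain N g where "hol_pair n D z N g" "\<And>w. w \<in> N \<Longrightarrow> w \<in> V \<Longrightarrow> s w = model_germ n D fs w (N, g)"
      using complex_model_carrierE[OF s z] by blast
    moreover obtain K f where "hol_pair n D z K f" "\<And>w. w \<in> K \<Longrightarrow> w \<in> V \<Longrightarrow> t w = model_germ n D fs w (K, f)"
      using complex_model_carrierE[OF t z] by blast
    ultimately show ?thesis by blast
  qed
  show "s \<oplus>\<^bsub>Sec (complex_model n D fs) V\<^esub> t \<in> carrier (Sec (complex_model n D fs) V)"
  proof (rule complex_model_carrierI)
    fix z assume "z \<in> V"
    then obtain N g K f where g: "hol_pair n D z N g" "hol_pair n D z K f"
      "\<And>w. w \<in> (N \<inter> K) \<inter> V \<Longrightarrow> s w = model_germ n D fs w (N, g) \<and> t w = model_germ n D fs w (K, f)"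
      using * by blast
    have "(s \<oplus>\<^bsub>Sec (complex_model n D fs) V\<^esub> t) w = model_germ n D fs w (N \<inter> K, \<lambda>w. g w + f w)"
      if w: "w \<in> (N \<inter> K) \<inter> V" for w
      using g(3)[OF w] w model_germ_lift_add[OF hol_pair_point[OF g(1)] hol_pair_point[OF g(2)], of w fs]
      by (simp add: complex_model_simps)
    then show "\<exists>N g. hol_pair n D z N g \<and>
      (\<forall>w\<in>N \<inter> V. (s \<oplus>\<^bsub>Sec (complex_model n D fs) V\<^esub> t) w = model_germ n D fs w (N, g))"
      using hol_pair_add[OF g(1,2)] by blast
  qed (simp add: complex_model_simps)
  show "s \<otimes>\<^bsub>Sec (complex_model n D fs) V\<^esub> t \<in> carrier (Sec (complex_model n D fs) V)"
  proof (rule complex_model_carrierI)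
    fix z assume "z \<in> V"
    then obtain N g K f where g: "hol_pair n D z N g" "hol_pair n D z K f"
      "\<And>w. w \<in> (N \<inter> K) \<inter> V \<Longrightarrow> s w = model_germ n D fs w (N, g) \<and> t w = model_germ n D fs w (K, f)"
      using * by blast
    have "(s \<otimes>\<^bsub>Sec (complex_model n D fs) V\<^esub> t) w = model_germ n D fs w (N \<inter> K, \<lambda>w. g w * f w)"
      if w: "w \<in> (N \<inter> K) \<inter> V" for w
      using g(3)[OF w] w model_germ_lift_mult[OF hol_pair_point[OF g(1)] hol_pair_point[OF g(2)], of w fs]
      by (simp add: complex_model_simps)
    then show "\<exists>N g. hol_pair n D z N g \<and>
      (\<forall>w\<in>N \<inter> V. (s \<otimes>\<^bsub>Sec (complex_model n D fs) V\<^esub> t) w = model_germ n D fs w (N, g))"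
      using hol_pair_mult[OF g(1,2)] by blast
  qed (simp add: complex_model_simps)
qed

definition section_up :: "nat \<Rightarrow> (nat \<Rightarrow> complex) set \<Rightarrow> ((nat \<Rightarrow> complex) \<Rightarrow> complex) list \<Rightarrow>
    (nat \<Rightarrow> complex) set \<Rightarrow> ((nat \<Rightarrow> complex) \<Rightarrow> hol_germ) \<Rightarrow> (nat \<Rightarrow> complex) \<Rightarrow> hol_germ" where
  "section_up n D fs V s = (\<lambda>z\<in>V. germ_up n D fs z (s z))"

lemma section_up_const:
  assumes "openin (Cn n) D" "openin (Cn n) D'" "D' \<subseteq> D" "V \<subseteq> D'"
  shows "section_up n D fs V (model_const n D' fs V c) = model_const n D fs V c"
proof -
  have "germ_up n D fs z (model_germ n D' fs z (D', \<lambda>w. c)) = model_germ n D fs z (D, \<lambda>w. c)" if z: "z \<in> V" for z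
  proof -
    have p: "hol_pair n D' z D' (\<lambda>w. c)" "hol_pair n D z D (\<lambda>w. c)" using assms z by (auto intro!: hol_pair_const)
    have "hol_rel n fs z D' (\<lambda>w. c) D (\<lambda>w. c)" by (rule hol_relI[of n D']) (use assms z in auto)
    then show ?thesis
      unfolding germ_up_germ[OF assms(3) p(1)] model_germ_eq_iff[OF hol_pair_subset[OF p(1) assms(3)] p(2)] .
  qed
  then show ?thesis unfolding section_up_def model_const_def by (intro restrict_ext) simp
qed

text \<open>Germs formed in \<open>D\<close> also contain representatives that are not contained in
  \<open>D'\<close>, so the two section rings are different sets although they describe the same
  functions on \<open>V\<close>; extending every germ identifies them.\<close>

lemma section_up_iso:
  assumes D: "openin (Cn n) D" "openin (Cn n) D'" "D' \<subseteq> D" and V: "V \<subseteq> D'"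
  shows "section_up n D fs V \<in> ring_iso (Sec (complex_model n D' fs) V) (Sec (complex_model n D fs) V)"
proof -
  let ?S' = "Sec (complex_model n D' fs) V" and ?S = "Sec (complex_model n D fs) V"
  have pt: "\<exists>N g. hol_pair n D' z N g \<and> s z = model_germ n D' fs z (N, g) \<and>
      section_up n D fs V s z = model_germ n D fs z (N, g)"
    if s: "s \<in> carrier ?S'" and z: "z \<in> V" for s z
  proof -
    obtain N g where g: "hol_pair n D' z N g" "\<And>w. w \<in> N \<Longrightarrow> w \<in> V \<Longrightarrow> s w = model_germ n D' fs w (N, g)"
      using complex_model_carrierE[OF s z] by blast
    then have "s z = model_germ n D' fs z (N, g)" using z by (simp add: hol_pair_def)
    then show ?thesis
      using g(1) z germ_up_germ[OF D(3) g(1), of fs] by (auto simp: section_up_def)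
  qed
  show ?thesis
  proof (rule ring_iso_memI)
    fix s assume s: "s \<in> carrier ?S'"
    show "section_up n D fs V s \<in> carrier ?S"
    proof (rule complex_model_carrierI)
      fix z assume z: "z \<in> V"
      obtain N g where g: "hol_pair n D' z N g" "\<And>w. w \<in> N \<Longrightarrow> w \<in> V \<Longrightarrow> s w = model_germ n D' fs w (N, g)"
        using complex_model_carrierE[OF s z] by blast
      have "section_up n D fs V s w = model_germ n D fs w (N, g)" if "w \<in> N \<inter> V" for w
        using g(2)[of w] germ_up_germ[OF D(3) hol_pair_point[OF g(1)], of w fs] that by (simp add: section_up_def)
      then show "\<exists>N g. hol_pair n D z N g \<and> (\<forall>w\<in>N \<inter> V. section_up n D fs V s w = model_germ n D fs w (N, g))"
        using hol_pair_subset[OF g(1) D(3)] by blast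
    qed (simp add: section_up_def)
    fix t assume t: "t \<in> carrier ?S'"
    show "section_up n D fs V (s \<otimes>\<^bsub>?S'\<^esub> t) = section_up n D fs V s \<otimes>\<^bsub>?S\<^esub> section_up n D fs V t"
    proof
      fix z show "section_up n D fs V (s \<otimes>\<^bsub>?S'\<^esub> t) z = (section_up n D fs V s \<otimes>\<^bsub>?S\<^esub> section_up n D fs V t) z"
      proof (cases "z \<in> V")
        case True
        obtain N g where g: "hol_pair n D' z N g" "s z = model_germ n D' fs z (N, g)"
          "section_up n D fs V s z = model_germ n D fs z (N, g)" using pt[OF s True] by blast
        obtain K f where f: "hol_pair n D' z K f" "t z = model_germ n D' fs z (K, f)"
          "section_up n D fs V t z = model_germ n D fs z (K, f)" using pt[OF t True] by blast
        have "(s \<otimes>\<^bsub>?S'\<^esub> t) z = model_germ n D' fs z (N \<inter> K, \<lambda>w. g w * f w)"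
          using True g(2) f(2) model_germ_lift_mult[OF g(1) f(1)] by (simp add: complex_model_simps)
        then have "section_up n D fs V (s \<otimes>\<^bsub>?S'\<^esub> t) z = model_germ n D fs z (N \<inter> K, \<lambda>w. g w * f w)"
          using True germ_up_germ[OF D(3) hol_pair_mult[OF g(1) f(1)]] by (simp add: section_up_def)
        also have "\<dots> = (section_up n D fs V s \<otimes>\<^bsub>?S\<^esub> section_up n D fs V t) z"
          using True g(3) f(3) model_germ_lift_mult[OF hol_pair_subset[OF g(1) D(3)] hol_pair_subset[OF f(1) D(3)]]
          by (simp add: complex_model_simps)
        finally show ?thesis .
      qed (simp add: section_up_def complex_model_simps)
    qed
    show "section_up n D fs V (s \<oplus>\<^bsub>?S'\<^esub> t) = section_up n D fs V s \<oplus>\<^bsub>?S\<^esub> section_up n D fs V t"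
    proof
      fix z show "section_up n D fs V (s \<oplus>\<^bsub>?S'\<^esub> t) z = (section_up n D fs V s \<oplus>\<^bsub>?S\<^esub> section_up n D fs V t) z"
      proof (cases "z \<in> V")
        case True
        obtain N g where g: "hol_pair n D' z N g" "s z = model_germ n D' fs z (N, g)"
          "section_up n D fs V s z = model_germ n D fs z (N, g)" using pt[OF s True] by blast
        obtain K f where f: "hol_pair n D' z K f" "t z = model_germ n D' fs z (K, f)"
          "section_up n D fs V t z = model_germ n D fs z (K, f)" using pt[OF t True] by blast
        have "(s \<oplus>\<^bsub>?S'\<^esub> t) z = model_germ n D' fs z (N \<inter> K, \<lambda>w. g w + f w)"
          using True g(2) f(2) model_germ_lift_add[OF g(1) f(1)] by (simp add: complex_model_simps)
        then have "section_up n D fs V (s \<oplus>\<^bsub>?S'\<^esub> t) z = model_germ n D fs z (N \<inter> K, \<lambda>w. g w + f w)"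
          using True germ_up_germ[OF D(3) hol_pair_add[OF g(1) f(1)]] by (simp add: section_up_def)
        also have "\<dots> = (section_up n D fs V s \<oplus>\<^bsub>?S\<^esub> section_up n D fs V t) z"
          using True g(3) f(3) model_germ_lift_add[OF hol_pair_subset[OF g(1) D(3)] hol_pair_subset[OF f(1) D(3)]]
          by (simp add: complex_model_simps)
        finally show ?thesis .
      qed (simp add: section_up_def complex_model_simps)
    qed
  next
    show "section_up n D fs V \<one>\<^bsub>?S'\<^esub> = \<one>\<^bsub>?S\<^esub>"
      unfolding complex_model_simps by (rule section_up_const[OF D V])
    show "bij_betw (section_up n D fs V) (carrier ?S') (carrier ?S)"
    proof (rule bij_betw_imageI)
      show "inj_on (section_up n D fs V) (carrier ?S')"
      proof (rule inj_onI)
        fix s t assume s: "s \<in> carrier ?S'" and t: "t \<in> carrier ?S'" and eq: "section_up n D fs V s = section_up n D fs V t"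
        show "s = t"
        proof (rule extensionalityI[where A = V])
          show "s \<in> extensional V" "t \<in> extensional V" using s t by (auto simp: complex_model_carrier)
          fix z assume z: "z \<in> V"
          obtain N g where g: "hol_pair n D' z N g" "s z = model_germ n D' fs z (N, g)"
            "section_up n D fs V s z = model_germ n D fs z (N, g)" using pt[OF s z] by blast
          obtain K f where f: "hol_pair n D' z K f" "t z = model_germ n D' fs z (K, f)"
            "section_up n D fs V t z = model_germ n D fs z (K, f)" using pt[OF t z] by blast
          have "model_germ n D fs z (N, g) = model_germ n D fs z (K, f)" using eq g(3) f(3) by simp
          then show "s z = t z"
            unfolding g(2) f(2) model_germ_eq_iff[OF g(1) f(1)]
              model_germ_eq_iff[OF hol_pair_subset[OF g(1) D(3)] hol_pair_subset[OF f(1) D(3)]] .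
        qed
      qed
      show "section_up n D fs V ` carrier ?S' = carrier ?S"
      proof (intro subset_antisym subsetI)
        fix t assume "t \<in> section_up n D fs V ` carrier ?S'"
        then obtain s where s: "s \<in> carrier ?S'" "t = section_up n D fs V s" by blast
        show "t \<in> carrier ?S"
        proof (rule complex_model_carrierI)
          fix z assume z: "z \<in> V"
          obtain N g where g: "hol_pair n D' z N g" "\<And>w. w \<in> N \<Longrightarrow> w \<in> V \<Longrightarrow> s w = model_germ n D' fs w (N, g)"
            using complex_model_carrierE[OF s(1) z] by blast
          have "t w = model_germ n D fs w (N, g)" if "w \<in> N \<inter> V" for w
            using g(2)[of w] germ_up_germ[OF D(3) hol_pair_point[OF g(1)], of w fs] that s(2) by (simp add: section_up_def)
          then show "\<exists>N g. hol_pair n D z N g \<and> (\<forall>w\<in>N \<inter> V. t w = model_germ n D fs w (N, g))"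
            using hol_pair_subset[OF g(1) D(3)] by blast
        qed (simp add: section_up_def s(2))
      next
        fix t assume t: "t \<in> carrier ?S"
        \<comment> \<open>The inverse of the extension: at every point only the representatives
          inside \<open>D'\<close> are kept.\<close>
        define s where "s = (\<lambda>z\<in>V. {(N, g) \<in> t z. N \<subseteq> D'})"
        have loc: "\<exists>N g. hol_pair n D' z N g \<and> (\<forall>w\<in>N \<inter> V. s w = model_germ n D' fs w (N, g) \<and> t w = model_germ n D fs w (N, g))"
          if z: "z \<in> V" for z
        proof -
          obtain N g where g: "hol_pair n D z N g" "\<And>w. w \<in> N \<Longrightarrow> w \<in> V \<Longrightarrow> t w = model_germ n D fs w (N, g)"
            using complex_model_carrierE[OF t z] by blast
          \<comment> \<open>Shrinking the domain of \<open>g\<close> to \<open>N \<inter> D'\<close>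
            turns the local representative for \<open>D\<close> into one for \<open>D'\<close>
            without changing the germ for \<open>D\<close>.\<close>
          have p: "hol_pair n D' w (N \<inter> D') g" if "w \<in> N" "w \<in> V" for w
            using g(1) D V that unfolding hol_pair_def by (auto elim: holomorphic_n_subset)
          have tw: "t w = model_germ n D fs w (N \<inter> D', g)" if w: "w \<in> N" "w \<in> V" for w
          proof -
            have "hol_rel n fs w N g (N \<inter> D') g"
              by (rule hol_relI[of n "N \<inter> D'"]) (use p[OF w] in \<open>auto simp: hol_pair_def\<close>)
            then show ?thesis
              unfolding g(2)[OF w] model_germ_eq_iff[OF hol_pair_point[OF g(1) w(1)] hol_pair_subset[OF p[OF w] D(3)]] .
          qed
          have "s w = model_germ n D' fs w (N \<inter> D', g)" if w: "w \<in> N" "w \<in> V" for w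
            using w tw[OF w] D(3) by (auto simp: s_def model_germ_eq hol_pair_def)
          then show ?thesis using tw p[of z] z g(1) by (intro exI[of _ "N \<inter> D'"] exI[of _ g]) (auto simp: hol_pair_def)
        qed
        have "s \<in> carrier ?S'"
        proof (rule complex_model_carrierI)
          fix z assume "z \<in> V"
          from loc[OF this] show "\<exists>N g. hol_pair n D' z N g \<and> (\<forall>w\<in>N \<inter> V. s w = model_germ n D' fs w (N, g))"
            by blast
        qed (simp add: s_def)
        moreover have "section_up n D fs V s = t"
        proof (rule extensionalityI[where A = V])
          show "section_up n D fs V s \<in> extensional V" by (simp add: section_up_def)
          show "t \<in> extensional V" using t by (simp add: complex_model_carrier)
          fix z assume z: "z \<in> V"
          obtain N g where g: "hol_pair n D' z N g" "s z = model_germ n D' fs z (N, g)" "t z = model_germ n D fs z (N, g)"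
            using loc[OF z] z by (auto simp: hol_pair_def)
          then show "section_up n D fs V s z = t z"
            using germ_up_germ[OF D(3) g(1), of fs] z by (simp add: section_up_def)
        qed
        ultimately show "t \<in> section_up n D fs V ` carrier ?S'" by blast
      qed
    qed
  qed
qed

lemma section_up_restrict: "W \<subseteq> V \<Longrightarrow> section_up n D fs W (restrict s W) = restrict (section_up n D fs V s) W"
  by (auto simp: section_up_def restrict_def fun_eq_iff)

text \<open>The structure maps are the composite of the inclusion with those of \<open>X\<close>,
  written literally in the form produced by \<open>lrs_morphism_comp\<close>, from which locality is
  inherited.\<close>

definition over_sub :: "('p, 'r) rspace \<Rightarrow> ('p, 'r) over \<Rightarrow> 'p set \<Rightarrow> ('p, 'r) over" where
  "over_sub B X U =
     \<lparr>Space = open_sub (Space X) U,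
      StrP = (\<lambda>x\<in>points (open_sub (Space X) U). StrP X ((\<lambda>x\<in>U. x) x)),
      StrS = (\<lambda>V\<in>{V. openin (Top B) V}. \<lambda>s\<in>carrier (Sec B V).
        incl_S (Space X) U (preim (Space X) (StrP X) V) (StrS X V s))\<rparr>"

definition incl_arr :: "('p, 'r) rspace \<Rightarrow> ('p, 'r) over \<Rightarrow> 'p set \<Rightarrow> ('p, 'r) over_arr" where
  "incl_arr B X U = \<lparr>Src = over_sub B X U, Tgt = X, MapP = (\<lambda>x\<in>U. x), MapS = incl_S (Space X) U\<rparr>"

lemma Space_over_sub [simp]: "Space (over_sub B X U) = open_sub (Space X) U"
  by (simp add: over_sub_def)

lemma incl_arr_simps [simp]:
  "Src (incl_arr B X U) = over_sub B X U" "Tgt (incl_arr B X U) = X"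
  "MapP (incl_arr B X U) = (\<lambda>x\<in>U. x)" "MapS (incl_arr B X U) = incl_S (Space X) U"
  by (simp_all add: incl_arr_def)

lemma over_obj_over_sub:
  assumes B: "ringed_space B" and X: "over_obj B X" and U: "openin (Top (Space X)) U"
  shows "over_obj B (over_sub B X U)"
proof -
  note rX = over_obj_ringed[OF X]
  have "lrs_morphism (open_sub (Space X) U) B
      (\<lambda>x\<in>points (open_sub (Space X) U). StrP X ((\<lambda>x\<in>U. x) x))
      (\<lambda>V\<in>{V. openin (Top B) V}. \<lambda>s\<in>carrier (Sec B V). incl_S (Space X) U (preim (Space X) (StrP X) V) (StrS X V s))"
    using lrs_morphism_comp[OF ringed_space_open_sub[OF rX U] rX B lrs_morphism_incl[OF rX U]] X
    by (simp add: over_obj_def)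
  then show ?thesis
    using locally_ringed_open_sub[OF _ U] X unfolding over_obj_def by (simp add: over_sub_def)
qed

lemma over_morphism_incl:
  assumes X: "over_obj B X" and U: "openin (Top (Space X)) U"
  shows "over_morphism B (incl_arr B X U)"
  unfolding over_morphism_def
proof (intro conjI ballI allI impI)
  show "lrs_morphism (Space (Src (incl_arr B X U))) (Space (Tgt (incl_arr B X U))) (MapP (incl_arr B X U)) (MapS (incl_arr B X U))"
    using lrs_morphism_incl[OF over_obj_ringed[OF X] U] by simp
next
  fix x assume "x \<in> points (Space (Src (incl_arr B X U)))"
  then show "StrP (Tgt (incl_arr B X U)) (MapP (incl_arr B X U) x) = StrP (Src (incl_arr B X U)) x"
    by (simp add: over_sub_def)
next
  fix V s assume "openin (Top B) V" "s \<in> carrier (Sec B V)"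
  then show "MapS (incl_arr B X U) (preim (Space (Tgt (incl_arr B X U))) (StrP (Tgt (incl_arr B X U))) V)
    (StrS (Tgt (incl_arr B X U)) V s) = StrS (Src (incl_arr B X U)) V s"
    by (simp add: over_sub_def)
qed

lemma topspace_Cn_zero_locus: "openin (Cn n) D \<Longrightarrow> zero_locus D fs \<subseteq> topspace (Cn n)"
  using openin_subset[of "Cn n" D] by (auto simp: zero_locus_def)

text \<open>The chart sends the part of \<open>U\<close> inside \<open>N\<close> to a relatively
  open subset of the zero locus, cut out by some open \<open>D0\<close>. Inside
  \<open>D0 \<inter> D\<close> this subset is the full zero locus of the same functions
  \<open>fs\<close>, so the model only has to be shrunk.\<close>

lemma complex_chart_over_sub:
  assumes X: "over_obj B X" and \<phi>: "\<phi> \<in> ring_iso complex_ring (global B)"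
    and N: "openin (Top (Space X)) N" and chart: "complex_chart B \<phi> X U n D fs"
  obtains D' where "complex_chart B \<phi> (over_sub B X N) (U \<inter> N) n D' fs"
proof -
  let ?X = "Space X" and ?M = "complex_model n D fs"
  note rX = over_obj_ringed[OF X] and str = over_obj_str[OF X]
  have U: "openin (Top ?X) U" and D: "openin (Cn n) D" and hol: "\<forall>g\<in>set fs. holomorphic_n n D g"
    using chart by (auto simp: complex_chart_def)
  obtain f \<psi> where iso: "rs_iso (open_sub ?X U) ?M f \<psi>"
    and const: "\<And>c. \<psi> (zero_locus D fs) (model_const n D fs (zero_locus D fs) c) =
             Res ?X (points ?X) U (const_section B \<phi> X c)"
    using chart unfolding complex_chart_def by blast
  have rs: "rs_morphism (open_sub ?X U) ?M f \<psi>" and homeo: "homeomorphic_map (Top (open_sub ?X U)) (Top ?M) f"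
    and \<psi>: "\<And>V. openin (Top ?M) V \<Longrightarrow> \<psi> V \<in> ring_iso (Sec ?M V) (Sec ?X (preim (open_sub ?X U) f V))"
    using iso unfolding rs_iso_def by auto
  define U' where "U' = U \<inter> N"
  have U': "openin (Top ?X) U'" "U' \<subseteq> U" "U' \<subseteq> N" "openin (Top (open_sub ?X U)) U'"
    using U N by (auto simp: U'_def openin_open_subtopology)
  have pU: "points (open_sub ?X U) = U" by (rule points_open_sub[OF U])
  define Z where "Z = zero_locus D fs"
  have ZM: "points ?M = Z" using topspace_Cn_zero_locus[OF D] by (auto simp: complex_model_simps Z_def)
  have inj: "inj_on f U" using homeomorphic_imp_injective_map[OF homeo] pU by simp
  have fU': "openin (Top ?M) (f ` U')"
    using homeomorphic_imp_open_map[OF homeo] U'(4) by (simp add: open_map_def)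
  then obtain D0 where D0: "openin (Cn n) D0" "f ` U' = D0 \<inter> Z"
    by (auto simp: complex_model_simps openin_subtopology Z_def)
  define D' where "D' = D0 \<inter> D"
  have D': "openin (Cn n) D'" "D' \<subseteq> D" using D0 D by (auto simp: D'_def)
  let ?M' = "complex_model n D' fs"
  have Z': "zero_locus D' fs = f ` U'" unfolding D0(2) by (auto simp: D'_def Z_def zero_locus_def)
  have topM': "Top ?M' = subtopology (Top ?M) (f ` U')"
  proof -
    have "Z \<inter> f ` U' = f ` U'" using D0(2) by blast
    then show ?thesis by (simp add: complex_model_simps Z' subtopology_subtopology Z_def[symmetric])
  qed
  have opM': "openin (Top ?M') V \<longleftrightarrow> openin (Top ?M) V \<and> V \<subseteq> f ` U'" for V
    unfolding topM' by (rule openin_open_subtopology[OF fU'])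
  have subD': "V \<subseteq> D'" if "openin (Top ?M') V" for V
    using that unfolding opM' Z'[symmetric] by (auto simp: zero_locus_def)
  let ?S = "open_sub (open_sub ?X N) U'"
  have S: "?S = open_sub ?X U'" using U'(3) by (simp add: open_sub_open_sub Int_absorb1)
  have pS: "points ?S = U'" unfolding S by (rule points_open_sub[OF U'(1)])
  define f' where "f' = restrict f U'"
  define \<psi>' where "\<psi>' = (\<lambda>V\<in>{V. openin (Top ?M') V}. \<lambda>s\<in>carrier (Sec ?M' V). \<psi> V (section_up n D fs V s))"
  have pre: "preim ?S f' V = preim (open_sub ?X U) f V" if V: "openin (Top ?M') V" for V
  proof -
    have "x \<in> U'" if "x \<in> U" "f x \<in> V" for x
    proof -
      have "f x \<in> f ` U'" using that V unfolding opM' by blast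
      then show ?thesis using inj U'(2) that(1) by (auto simp: inj_on_def)
    qed
    then show ?thesis unfolding preim_def pS pU f'_def using U'(2) by auto
  qed
  have up: "section_up n D fs V \<in> ring_iso (Sec ?M' V) (Sec ?M V)" if "openin (Top ?M') V" for V
    by (rule section_up_iso[OF D D' subD'[OF that]])
  have \<psi>'_iso: "\<psi>' V \<in> ring_iso (Sec ?M' V) (Sec ?S (preim ?S f' V))" if V: "openin (Top ?M') V" for V
  proof -
    have comp: "\<psi> V \<circ> section_up n D fs V \<in> ring_iso (Sec ?M' V) (Sec ?S (preim ?S f' V))"
      using ring_iso_set_trans[OF up[OF V] \<psi>] V unfolding pre[OF V] by (simp add: opM')
    \<comment> \<open>\<open>\<psi>'\<close> is the extensional version of the composite; the
      isomorphism laws are transferred through agreement on the carrier, which contains the unit and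
      is closed under the operations.\<close>
    have eq: "\<psi>' V s = (\<psi> V \<circ> section_up n D fs V) s" if "s \<in> carrier (Sec ?M' V)" for s
      using that V by (simp add: \<psi>'_def)
    have one: "\<one>\<^bsub>Sec ?M' V\<^esub> \<in> carrier (Sec ?M' V)"
      unfolding complex_model_simps by (rule complex_model_one_closed[OF D'(1) subD'[OF V]])
    show ?thesis
    proof (rule ring_iso_memI)
      show "bij_betw (\<psi>' V) (carrier (Sec ?M' V)) (carrier (Sec ?S (preim ?S f' V)))"
        using ring_iso_memE(5)[OF comp] eq bij_betw_cong by blast
      show "\<psi>' V \<one>\<^bsub>Sec ?M' V\<^esub> = \<one>\<^bsub>Sec ?S (preim ?S f' V)\<^esub>"
        using eq[OF one] ring_iso_memE(4)[OF comp] by simp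
      fix s assume s: "s \<in> carrier (Sec ?M' V)"
      show "\<psi>' V s \<in> carrier (Sec ?S (preim ?S f' V))" using eq[OF s] ring_iso_memE(1)[OF comp s] by simp
      fix t assume t: "t \<in> carrier (Sec ?M' V)"
      show "\<psi>' V (s \<otimes>\<^bsub>Sec ?M' V\<^esub> t) = \<psi>' V s \<otimes>\<^bsub>Sec ?S (preim ?S f' V)\<^esub> \<psi>' V t"
        unfolding eq[OF s] eq[OF t] eq[OF complex_model_closed(2)[OF s t]] by (rule ring_iso_memE(2)[OF comp s t])
      show "\<psi>' V (s \<oplus>\<^bsub>Sec ?M' V\<^esub> t) = \<psi>' V s \<oplus>\<^bsub>Sec ?S (preim ?S f' V)\<^esub> \<psi>' V t"
        unfolding eq[OF s] eq[OF t] eq[OF complex_model_closed(1)[OF s t]] by (rule ring_iso_memE(3)[OF comp s t])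
    qed
  qed
  have homeo': "homeomorphic_map (Top ?S) (Top ?M') f'"
  proof -
    have "homeomorphic_map (subtopology (Top (open_sub ?X U)) U') (Top ?M') f"
      unfolding topM' by (rule homeomorphic_map_subtopologies[OF homeo])
        (use openin_subset[OF fU'] U'(2) in \<open>auto simp: pU simp del: open_sub_simps\<close>)
    moreover have "subtopology (Top (open_sub ?X U)) U' = Top ?S"
      using U'(2) by (simp add: S subtopology_subtopology Int_absorb1)
    ultimately have "homeomorphic_map (Top ?S) (Top ?M') f" by simp
    then show ?thesis by (rule homeomorphic_map_eq) (simp add: f'_def pS del: open_sub_simps)
  qed
  have "rs_morphism ?S ?M' f' \<psi>'"
    unfolding rs_morphism_def
  proof (intro conjI allI impI ballI)
    show "f' \<in> extensional (points ?S)" unfolding pS by (simp add: f'_def)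
    show "continuous_map (Top ?S) (Top ?M') f'" by (rule homeomorphic_imp_continuous_map[OF homeo'])
    show "\<psi>' \<in> extensional {V. openin (Top ?M') V}" by (simp add: \<psi>'_def)
  next
    fix V assume V: "openin (Top ?M') V"
    show "\<psi>' V \<in> extensional (carrier (Sec ?M' V))" using V by (simp add: \<psi>'_def)
    show "\<psi>' V \<in> ring_hom (Sec ?M' V) (Sec ?S (preim ?S f' V))" using \<psi>'_iso[OF V] by (simp add: ring_iso_def)
  next
    fix V W s assume VW: "openin (Top ?M') V \<and> openin (Top ?M') W \<and> W \<subseteq> V" and s: "s \<in> carrier (Sec ?M' V)"
    have VWM: "openin (Top ?M) V" "openin (Top ?M) W" using VW opM' by auto
    have sW: "restrict s W \<in> carrier (Sec ?M' W)"
    proof (rule complex_model_carrierI)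
      fix z assume z: "z \<in> W"
      then obtain N g where "hol_pair n D' z N g" "\<And>w. w \<in> N \<Longrightarrow> w \<in> V \<Longrightarrow> s w = model_germ n D' fs w (N, g)"
        using complex_model_carrierE[OF s] VW by blast
      then show "\<exists>N g. hol_pair n D' z N g \<and> (\<forall>w\<in>N \<inter> W. restrict s W w = model_germ n D' fs w (N, g))"
        using VW by (intro exI[of _ N] exI[of _ g]) auto
    qed simp
    have s_up: "section_up n D fs V s \<in> carrier (Sec ?M V)" using ring_iso_memE(1)[OF up s] VW by blast
    have "\<psi>' W (Res ?M' V W s) = \<psi> W (section_up n D fs W (restrict s W))"
      using sW VW by (simp add: \<psi>'_def complex_model_simps)
    also have "\<dots> = \<psi> W (Res ?M V W (section_up n D fs V s))"
      using VW section_up_restrict[of W V n D fs s] by (simp add: complex_model_simps)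
    also have "\<dots> = Res ?X (preim ?S f' V) (preim ?S f' W) (\<psi> V (section_up n D fs V s))"
      using rsm_nat[OF rs VWM _ s_up] VW pre by simp
    finally show "\<psi>' W (Res ?M' V W s) = Res ?S (preim ?S f' V) (preim ?S f' W) (\<psi>' V s)"
      using VW s by (simp add: \<psi>'_def)
  qed
  then have iso': "rs_iso ?S ?M' f' \<psi>'" unfolding rs_iso_def using homeo' \<psi>'_iso by blast
  have const': "\<psi>' (zero_locus D' fs) (model_const n D' fs (zero_locus D' fs) c) =
             Res (open_sub ?X N) (points (open_sub ?X N)) U' (const_section B \<phi> (over_sub B X N) c)" for c
  proof -
    let ?Z' = "f ` U'" and ?c = "const_section B \<phi> X c"
    have opZ': "openin (Top ?M') ?Z'" unfolding opM' using fU' by simp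
    have Z'Z: "?Z' \<subseteq> Z" using D0(2) by blast
    have opZ: "openin (Top ?M) Z" unfolding ZM[symmetric] by simp
    have "model_const n D' fs ?Z' c \<in> carrier (Sec ?M' ?Z')"
      by (rule complex_model_one_closed[OF D'(1) subD'[OF opZ']])
    then have "\<psi>' ?Z' (model_const n D' fs ?Z' c) = \<psi> ?Z' (model_const n D fs ?Z' c)"
      using opZ' section_up_const[OF D D' subD'[OF opZ']] by (simp add: \<psi>'_def)
    also have "model_const n D fs ?Z' c = Res ?M Z ?Z' (model_const n D fs Z c)"
      using Z'Z by (auto simp: complex_model_simps model_const_def fun_eq_iff)
    also have "\<psi> ?Z' \<dots> = Res ?X (preim (open_sub ?X U) f Z) (preim (open_sub ?X U) f ?Z') (\<psi> Z (model_const n D fs Z c))"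
      using rsm_nat[OF rs opZ fU' Z'Z complex_model_one_closed[OF D]] by (simp add: Z_def zero_locus_def subset_iff)
    also have "preim (open_sub ?X U) f Z = U"
      using rsm_point[OF rs] unfolding ZM pU by (auto simp: preim_def pU simp del: open_sub_simps)
    also have "preim (open_sub ?X U) f ?Z' = U'"
      using inj U'(2) by (auto simp: preim_def pU inj_on_def simp del: open_sub_simps)
    also have "\<psi> Z (model_const n D fs Z c) = Res ?X (points ?X) U ?c" using const unfolding Z_def .
    finally have 1: "\<psi>' ?Z' (model_const n D' fs ?Z' c) = Res ?X U U' (Res ?X (points ?X) U ?c)" .
    have top: "openin (Top B) (points B)" "openin (Top ?X) (points ?X)" by simp_all
    have pB: "preim ?X (StrP X) (points B) = points ?X" using rsm_point[OF str] by (auto simp: preim_def)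
    have \<phi>c: "\<phi> c \<in> carrier (global B)" using ring_iso_memE(1)[OF \<phi>, of c] by (simp add: complex_ring_def)
    have c_in: "?c \<in> carrier (Sec ?X (points ?X))"
      using rsm_closed[OF str top(1) \<phi>c] by (simp add: const_section_def pB)
    have c_N: "const_section B \<phi> (over_sub B X N) c = Res ?X (points ?X) N ?c"
      using \<phi>c c_in openin_subset[OF N] by (simp add: const_section_def over_sub_def pB Int_absorb1)
    \<comment> \<open>The chart compares constant sections over \<open>U\<close>, while those of the
      new object live over \<open>N\<close>; both are restrictions from the whole space and agree on
      \<open>U'\<close>.\<close>
    have "Res ?X U U' (Res ?X (points ?X) U ?c) = Res ?X (points ?X) U' ?c"
      by (rule rs_res_res[OF rX top(2) U U'(1,2) openin_subset[OF U] c_in])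
    also have "\<dots> = Res ?X N U' (Res ?X (points ?X) N ?c)"
      by (rule rs_res_res[OF rX top(2) N U'(1,3) openin_subset[OF N] c_in, symmetric])
    finally show ?thesis
      unfolding Z' 1 c_N points_open_sub[OF N] by simp
  qed
  have "complex_chart B \<phi> (over_sub B X N) U' n D' fs"
    unfolding complex_chart_def Space_over_sub
  proof (intro conjI exI[of _ f'] exI[of _ \<psi>'] iso' allI const' D'(1))
    show "openin (Top (open_sub ?X N)) U'" unfolding openin_open_sub[OF N] using U' by blast
    show "\<forall>g\<in>set fs. holomorphic_n n D' g" using hol D'(2) holomorphic_n_subset by blast
  qed
  then show ?thesis using that U'_def by blast
qed

lemma complex_space_over_sub:
  assumes B: "complex_point B \<phi>" and X: "complex_space B \<phi> X" and N: "openin (Top (Space X)) N"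
  shows "complex_space B \<phi> (over_sub B X N)"
  unfolding complex_space_def
proof (intro conjI ballI)
  have rB: "ringed_space B" and \<phi>: "\<phi> \<in> ring_iso complex_ring (global B)"
    using B by (auto simp: complex_point_def locally_ringed_space_def)
  have oX: "over_obj B X" using X by (simp add: complex_space_def)
  show "over_obj B (over_sub B X N)" by (rule over_obj_over_sub[OF rB oX N])
  show "Hausdorff_space (Top (Space (over_sub B X N)))"
    using X by (simp add: complex_space_def Hausdorff_space_subtopology)
  fix x assume "x \<in> points (Space (over_sub B X N))"
  then have x: "x \<in> N" "x \<in> points (Space X)" by auto
  then obtain U n D fs where "x \<in> U" "complex_chart B \<phi> X U n D fs"
    using X unfolding complex_space_def by meson
  then show "\<exists>U n D fs. x \<in> U \<and> complex_chart B \<phi> (over_sub B X N) U n D fs"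
    using complex_chart_over_sub[OF oX \<phi> N] x(1) by (metis IntI)
qed

section \<open>Enough points from neighbourhoods\<close>

text \<open>\<open>P a x\<close> is the set of the arrows to \<open>a\<close> which are neighbourhoods of the point \<open>x\<close> of \<open>a\<close>.\<close>

locale nbhd_site = site C J for C :: "('o, 'm) category" and J +
  fixes pts :: "'o \<Rightarrow> 'x set" and P :: "'o \<Rightarrow> 'x \<Rightarrow> 'm set"
  assumes P_arr: "f \<in> P a x \<Longrightarrow> f \<in> Arr C \<and> Cod C f = a"
    and P_ide: "a \<in> Obj C \<Longrightarrow> x \<in> pts a \<Longrightarrow> Ide C a \<in> P a x"
    and P_mono: "f \<in> P a x \<Longrightarrow> g \<in> Arr C \<Longrightarrow> h \<in> Arr C \<Longrightarrow> Cod C g = Dom C f \<Longrightarrow> Cod C h = Dom C f \<Longrightarrow>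
      Dom C g = Dom C h \<Longrightarrow> Comp C f g = Comp C f h \<Longrightarrow> g = h"
    and P_refine: "f \<in> P a x \<Longrightarrow> g \<in> P a x \<Longrightarrow> \<exists>k l. k \<in> Arr C \<and> l \<in> Arr C \<and> Cod C k = Dom C f \<and>
      Cod C l = Dom C g \<and> Dom C k = Dom C l \<and> Comp C f k \<in> P a x \<and> Comp C f k = Comp C g l"
    and P_cont: "f \<in> P a x \<Longrightarrow> g \<in> Arr C \<Longrightarrow> Dom C g = Dom C f \<Longrightarrow> R \<in> J (Cod C g) \<Longrightarrow>
      \<exists>k. k \<in> Arr C \<and> Cod C k = Dom C f \<and> Comp C f k \<in> P a x \<and> Comp C g k \<in> R"
    and P_cover: "a \<in> Obj C \<Longrightarrow> sieve C a R \<Longrightarrow> (\<And>x. x \<in> pts a \<Longrightarrow> \<exists>f\<in>P a x. f \<in> R) \<Longrightarrow> R \<in> J a"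
begin

section \<open>Germs of arrows and the fibre functors they define\<close>

definition nb_dom :: "'o \<Rightarrow> 'x \<Rightarrow> 'o \<Rightarrow> 'm \<Rightarrow> 'm \<Rightarrow> bool" where
  "nb_dom a x b f g \<longleftrightarrow> f \<in> P a x \<and> g \<in> Arr C \<and> Dom C g = Dom C f \<and> Cod C g = b"

definition nb_rel :: "'o \<Rightarrow> 'x \<Rightarrow> 'm \<Rightarrow> 'm \<Rightarrow> 'm \<Rightarrow> 'm \<Rightarrow> bool" where
  "nb_rel a x f g f' g' \<longleftrightarrow> (\<exists>k l. k \<in> Arr C \<and> l \<in> Arr C \<and> Cod C k = Dom C f \<and> Cod C l = Dom C f' \<and>
     Dom C k = Dom C l \<and> Comp C f k \<in> P a x \<and> Comp C f k = Comp C f' l \<and> Comp C g k = Comp C g' l)"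

definition nb_germ :: "'o \<Rightarrow> 'x \<Rightarrow> 'o \<Rightarrow> 'm \<Rightarrow> 'm \<Rightarrow> ('m \<times> 'm) set" where
  "nb_germ a x b f g = {(f', g'). nb_dom a x b f' g' \<and> nb_rel a x f g f' g'}"

text \<open>The fibre functor of the point \<open>x\<close> of \<open>a\<close>: germs at \<open>x\<close> of arrows from \<open>a\<close>.\<close>

definition nb_point :: "'o \<Rightarrow> 'x \<Rightarrow> ('o, 'm, ('e, 'm) univ) pt_functor" where
  "nb_point a x = (\<lambda>b. {Rel (nb_germ a x b f g) | f g. nb_dom a x b f g},
     \<lambda>h v. case v of
         Rel c \<Rightarrow> (case SOME p. p \<in> c of (f, g) \<Rightarrow> Rel (nb_germ a x (Cod C h) f (Comp C h g)))
       | _ \<Rightarrow> v)"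

lemma nb_rel_refine:
  assumes "nb_dom a x b f g" "k \<in> Arr C" "Cod C k = Dom C f" "Comp C f k \<in> P a x"
  shows "nb_rel a x (Comp C f k) (Comp C g k) f g"
proof -
  have f: "f \<in> Arr C" using assms(1) P_arr by (auto simp: nb_dom_def)
  show ?thesis
    unfolding nb_rel_def
    by (intro exI[of _ "Ide C (Dom C k)"] exI[of _ k]) (use assms f in \<open>simp add: nb_dom_def\<close>)
qed

lemma nb_rel_refl:
  assumes "nb_dom a x b f g"
  shows "nb_rel a x f g f g"
proof -
  have f: "f \<in> Arr C" "f \<in> P a x" using assms P_arr by (auto simp: nb_dom_def)
  then show ?thesis
    unfolding nb_rel_def by (intro exI[of _ "Ide C (Dom C f)"]) simp
qed

lemma nb_rel_sym: "nb_rel a x f g f' g' \<Longrightarrow> nb_rel a x f' g' f g"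
  unfolding nb_rel_def by metis

text \<open>Refining the two refinements once more gives two arrows to \<open>Dom C f'\<close> that
  agree after composition with \<open>f'\<close>. Neighbourhoods are monic by \<open>P_mono\<close>,
  so the arrows coincide and the two chains of equations can be joined.\<close>

lemma nb_rel_trans:
  assumes d: "nb_dom a x b f g" "nb_dom a x b f' g'" "nb_dom a x b f'' g''"
    and rel: "nb_rel a x f g f' g'" "nb_rel a x f' g' f'' g''"
  shows "nb_rel a x f g f'' g''"
proof -
  have f: "f \<in> Arr C" "f' \<in> Arr C" "f'' \<in> Arr C" "f' \<in> P a x"
    using d P_arr by (auto simp: nb_dom_def)
  have g: "g \<in> Arr C" "g' \<in> Arr C" "g'' \<in> Arr C" "Dom C g = Dom C f" "Dom C g' = Dom C f'" "Dom C g'' = Dom C f''"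
    using d by (auto simp: nb_dom_def)
  obtain k l where k: "k \<in> Arr C" "l \<in> Arr C" "Cod C k = Dom C f" "Cod C l = Dom C f'" "Dom C k = Dom C l"
    "Comp C f k \<in> P a x" "Comp C f k = Comp C f' l" "Comp C g k = Comp C g' l"
    using rel(1) unfolding nb_rel_def by blast
  obtain k' l' where k': "k' \<in> Arr C" "l' \<in> Arr C" "Cod C k' = Dom C f'" "Cod C l' = Dom C f''" "Dom C k' = Dom C l'"
    "Comp C f' k' \<in> P a x" "Comp C f' k' = Comp C f'' l'" "Comp C g' k' = Comp C g'' l'"
    using rel(2) unfolding nb_rel_def by blast
  obtain m m' where m: "m \<in> Arr C" "m' \<in> Arr C" "Cod C m = Dom C (Comp C f k)" "Cod C m' = Dom C (Comp C f' k')"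
    "Dom C m = Dom C m'" "Comp C (Comp C f k) m \<in> P a x" "Comp C (Comp C f k) m = Comp C (Comp C f' k') m'"
    using P_refine[OF k(6) k'(6)] by blast
  have mk: "Cod C m = Dom C k" "Cod C m' = Dom C k'" using m(3,4) k k' f by simp_all
  have a1: "Comp C (Comp C f k) m = Comp C f' (Comp C l m)"
    unfolding k(7) by (rule comp_assoc) (use k f m mk in simp_all)
  have a2: "Comp C (Comp C f' k') m' = Comp C f' (Comp C k' m')"
    by (rule comp_assoc) (use k' f m mk in simp_all)
  have a3: "Comp C (Comp C f' k') m' = Comp C f'' (Comp C l' m')"
    unfolding k'(7) by (rule comp_assoc) (use k' f m mk in simp_all)
  have a4: "Comp C (Comp C f k) m = Comp C f (Comp C k m)"
    by (rule comp_assoc) (use k f m mk in simp_all)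
  have "Comp C f' (Comp C l m) = Comp C f' (Comp C k' m')"
    by (rule trans[OF a1[symmetric] trans[OF m(7) a2]])
  then have lm: "Comp C l m = Comp C k' m'"
    by (rule P_mono[OF f(4), rotated 5]) (simp_all add: k(1-5) k'(1-5) m(1,2,5) mk)
  have 1: "Comp C f (Comp C k m) = Comp C f'' (Comp C l' m')"
    by (rule trans[OF a4[symmetric] trans[OF m(7) a3]])
  have "Comp C g (Comp C k m) = Comp C (Comp C g k) m"
    by (rule comp_assoc[symmetric]) (simp_all add: k(1-5) m(1,2,5) mk g)
  also have "\<dots> = Comp C g' (Comp C l m)" unfolding k(8)
    by (rule comp_assoc) (simp_all add: k(1-5) m(1,2,5) mk g)
  also have "\<dots> = Comp C (Comp C g' k') m'" unfolding lm
    by (rule comp_assoc[symmetric]) (simp_all add: k'(1-5) m(1,2,5) mk g)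
  also have "\<dots> = Comp C g'' (Comp C l' m')" unfolding k'(8)
    by (rule comp_assoc) (simp_all add: k'(1-5) m(1,2,5) mk g)
  finally have 2: "Comp C g (Comp C k m) = Comp C g'' (Comp C l' m')" .
  have 3: "Comp C f (Comp C k m) \<in> P a x" using m(6) unfolding a4 .
  show ?thesis
    unfolding nb_rel_def
    by (intro exI[of _ "Comp C k m"] exI[of _ "Comp C l' m'"] conjI)
      (rule 1 2 3 | simp add: k(1-5) k'(1-5) m(1,2,5) mk)+
qed

lemma nb_germ_eq_iff:
  assumes "nb_dom a x b f g" "nb_dom a x b f' g'"
  shows "nb_germ a x b f g = nb_germ a x b f' g' \<longleftrightarrow> nb_rel a x f g f' g'"
proof
  assume eq: "nb_germ a x b f g = nb_germ a x b f' g'"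
  have "(f', g') \<in> nb_germ a x b f' g'" using assms(2) nb_rel_refl[OF assms(2)] by (simp add: nb_germ_def)
  then show "nb_rel a x f g f' g'" unfolding eq[symmetric] by (simp add: nb_germ_def)
next
  assume rel: "nb_rel a x f g f' g'"
  show "nb_germ a x b f g = nb_germ a x b f' g'"
    unfolding nb_germ_def
    using nb_rel_trans[OF assms(1,2) _ rel] nb_rel_trans[OF assms(2,1) _ nb_rel_sym[OF rel]] by blast
qed

lemma nb_dom_comp:
  "nb_dom a x b f g \<Longrightarrow> h \<in> Arr C \<Longrightarrow> Dom C h = b \<Longrightarrow> nb_dom a x (Cod C h) f (Comp C h g)"
  by (auto simp: nb_dom_def)

lemma nb_rel_comp:
  assumes "nb_dom a x b f g" "nb_dom a x b f' g'" "nb_rel a x f g f' g'" and h: "h \<in> Arr C" "Dom C h = b"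
  shows "nb_rel a x f (Comp C h g) f' (Comp C h g')"
proof -
  obtain k l where k: "k \<in> Arr C" "l \<in> Arr C" "Cod C k = Dom C f" "Cod C l = Dom C f'" "Dom C k = Dom C l"
    "Comp C f k \<in> P a x" "Comp C f k = Comp C f' l" "Comp C g k = Comp C g' l"
    using assms(3) unfolding nb_rel_def by blast
  have "Comp C (Comp C h g) k = Comp C (Comp C h g') l"
    using k h assms(1,2) by (simp add: nb_dom_def comp_assoc)
  then show ?thesis unfolding nb_rel_def using k by blast
qed

lemma fst_nb_point: "fst (nb_point a x) b = {Rel (nb_germ a x b f g) | f g. nb_dom a x b f g}"
  by (simp add: nb_point_def)

text \<open>The action is defined on a representative chosen by \<open>SOME\<close>; compatibility
  of \<open>nb_rel\<close> with composition makes it independent of the choice.\<close>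

lemma snd_nb_point:
  assumes d: "nb_dom a x b f g" and h: "h \<in> Arr C" "Dom C h = b"
  shows "snd (nb_point a x) h (Rel (nb_germ a x b f g)) = Rel (nb_germ a x (Cod C h) f (Comp C h g))"
proof -
  define p where "p = (SOME p. p \<in> nb_germ a x b f g)"
  have "(f, g) \<in> nb_germ a x b f g" using d nb_rel_refl[OF d] by (simp add: nb_germ_def)
  then have "p \<in> nb_germ a x b f g" unfolding p_def by (rule someI)
  then obtain f' g' where p: "p = (f', g')" "nb_dom a x b f' g'" "nb_rel a x f g f' g'"
    by (auto simp: nb_germ_def)
  have "nb_germ a x (Cod C h) f' (Comp C h g') = nb_germ a x (Cod C h) f (Comp C h g)"
    unfolding nb_germ_eq_iff[OF nb_dom_comp[OF p(2) h] nb_dom_comp[OF d h]]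
    by (rule nb_rel_comp[OF p(2) d nb_rel_sym[OF p(3)] h])
  then show ?thesis unfolding nb_point_def by (simp add: p_def[symmetric] p(1))
qed

lemma nb_pointE:
  assumes "v \<in> fst (nb_point a x) b"
  obtains f g where "nb_dom a x b f g" "v = Rel (nb_germ a x b f g)"
  using assms unfolding fst_nb_point by blast

lemma nb_pointI: "nb_dom a x b f g \<Longrightarrow> Rel (nb_germ a x b f g) \<in> fst (nb_point a x) b"
  unfolding fst_nb_point by blast

lemma nb_dom_arr: "nb_dom a x b f g \<Longrightarrow> f \<in> Arr C \<and> g \<in> Arr C \<and> Dom C g = Dom C f \<and> Cod C g = b \<and> Cod C f = a"
  using P_arr by (auto simp: nb_dom_def)

lemma nb_dom_self: "f \<in> P a x \<Longrightarrow> nb_dom a x (Dom C f) f (Ide C (Dom C f))"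
  using P_arr by (simp add: nb_dom_def)

text \<open>Every germ is the image of the identity germ of a neighbourhood, under the arrow that
  represents it there. In this form it supplies the witnesses for continuity and for the two
  flatness conditions.\<close>

lemma snd_nb_point_self:
  assumes "nb_dom a x b f g" "k \<in> Arr C" "Cod C k = Dom C f" "Comp C f k \<in> P a x"
  shows "snd (nb_point a x) (Comp C g k) (Rel (nb_germ a x (Dom C k) (Comp C f k) (Ide C (Dom C k)))) =
    Rel (nb_germ a x b f g)"
proof -
  note f = nb_dom_arr[OF assms(1)]
  have d: "nb_dom a x (Dom C k) (Comp C f k) (Ide C (Dom C k))"
    using nb_dom_self[OF assms(4)] f assms by simp
  have d': "nb_dom a x b (Comp C f k) (Comp C g k)" using assms f by (simp add: nb_dom_def)
  have "snd (nb_point a x) (Comp C g k) (Rel (nb_germ a x (Dom C k) (Comp C f k) (Ide C (Dom C k)))) =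
    Rel (nb_germ a x b (Comp C f k) (Comp C g k))"
    using snd_nb_point[OF d, of "Comp C g k"] f assms by simp
  then show ?thesis using nb_germ_eq_iff[OF d' assms(1)] nb_rel_refine[OF assms] by simp
qed

text \<open>Continuity comes from \<open>P_cont\<close> and joint refinement of two elements from
  \<open>P_refine\<close>. For two arrows with equal germs, the refinements \<open>m\<close> and
  \<open>n\<close> witnessing the equality coincide by \<open>P_mono\<close>, so the arrows are
  equalized.\<close>

lemma nb_point_site_point:
  assumes a: "a \<in> Obj C" "x \<in> pts a"
  shows "site_point C J (nb_point a x :: ('o, 'm, ('e, 'm) univ) pt_functor)"
  unfolding site_point_def
proof (intro conjI ballI impI funcsetI)
  let ?u = "nb_point a x :: ('o, 'm, ('e, 'm) univ) pt_functor"
  {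
    fix f v assume f: "f \<in> Arr C" and "v \<in> fst ?u (Dom C f)"
    then obtain \<iota> k where k: "nb_dom a x (Dom C f) \<iota> k" "v = Rel (nb_germ a x (Dom C f) \<iota> k)" using nb_pointE by blast
    then show "snd ?u f v \<in> fst ?u (Cod C f)"
      by (simp add: snd_nb_point[OF k(1) f] nb_pointI[OF nb_dom_comp[OF k(1) f]])
  next
    fix b v assume b: "b \<in> Obj C" and "v \<in> fst ?u b"
    then obtain \<iota> k where k: "nb_dom a x b \<iota> k" "v = Rel (nb_germ a x b \<iota> k)" using nb_pointE by blast
    then show "snd ?u (Ide C b) v = v"
      using b nb_dom_arr[OF k(1)] by (simp add: snd_nb_point[OF k(1)])
  next
    fix f g v assume f: "f \<in> Arr C" "g \<in> Arr C" "Cod C f = Dom C g" and "v \<in> fst ?u (Dom C f)"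
    then obtain \<iota> k where k: "nb_dom a x (Dom C f) \<iota> k" "v = Rel (nb_germ a x (Dom C f) \<iota> k)" using nb_pointE by blast
    then show "snd ?u (Comp C g f) v = snd ?u g (snd ?u f v)"
      using f nb_dom_arr[OF k(1)] nb_dom_comp[OF k(1) f(1)]
      by (simp add: snd_nb_point[OF k(1)] snd_nb_point[of a x "Dom C g" \<iota> "Comp C f k"] comp_assoc)
  next
    fix b R v assume b: "b \<in> Obj C" "R \<in> J b" and "v \<in> fst ?u b"
    then obtain \<iota> k where k: "nb_dom a x b \<iota> k" "v = Rel (nb_germ a x b \<iota> k)" using nb_pointE by blast
    note arr = nb_dom_arr[OF k(1)]
    have \<iota>: "\<iota> \<in> P a x" using k(1) by (simp add: nb_dom_def)
    obtain l where l: "l \<in> Arr C" "Cod C l = Dom C \<iota>" "Comp C \<iota> l \<in> P a x" "Comp C k l \<in> R"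
      using P_cont[OF \<iota>, of k R] arr b by auto
    let ?z = "Rel (nb_germ a x (Dom C l) (Comp C \<iota> l) (Ide C (Dom C l))) :: ('e, 'm) univ"
    have "?z \<in> fst ?u (Dom C (Comp C k l))"
      using nb_dom_self[OF l(3)] l arr by (simp add: nb_pointI)
    moreover have "snd ?u (Comp C k l) ?z = v" by (simp add: snd_nb_point_self[OF k(1) l(1-3)] k(2))
    ultimately show "\<exists>f\<in>R. \<exists>y\<in>fst ?u (Dom C f). snd ?u f y = v" using l(4) by blast
  next
    have "Rel (nb_germ a x a (Ide C a) (Ide C a)) \<in> fst ?u a"
      using nb_dom_self[OF P_ide[OF a]] a by (simp add: nb_pointI)
    then show "\<exists>a\<in>Obj C. fst ?u a \<noteq> {}" using a by blast
  next
    fix b c v w assume b: "b \<in> Obj C" "c \<in> Obj C" and vw: "v \<in> fst ?u b" "w \<in> fst ?u c"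
    obtain \<iota> k where k: "nb_dom a x b \<iota> k" "v = Rel (nb_germ a x b \<iota> k)" using vw(1) nb_pointE by blast
    obtain \<kappa> l where l: "nb_dom a x c \<kappa> l" "w = Rel (nb_germ a x c \<kappa> l)" using vw(2) nb_pointE by blast
    have P: "\<iota> \<in> P a x" "\<kappa> \<in> P a x" using k(1) l(1) by (auto simp: nb_dom_def)
    obtain m n where m: "m \<in> Arr C" "n \<in> Arr C" "Cod C m = Dom C \<iota>" "Cod C n = Dom C \<kappa>" "Dom C m = Dom C n"
      "Comp C \<iota> m \<in> P a x" "Comp C \<iota> m = Comp C \<kappa> n" using P_refine[OF P] by blast
    note arr = nb_dom_arr[OF k(1)] nb_dom_arr[OF l(1)]
    let ?z = "Rel (nb_germ a x (Dom C m) (Comp C \<iota> m) (Ide C (Dom C m))) :: ('e, 'm) univ"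
    have "?z \<in> fst ?u (Dom C m)" using nb_dom_self[OF m(6)] m arr by (simp add: nb_pointI)
    moreover have "snd ?u (Comp C k m) ?z = v" by (simp add: snd_nb_point_self[OF k(1) m(1,3,6)] k(2))
    moreover have "snd ?u (Comp C l n) ?z = w"
      unfolding m(7) m(5) l(2) by (rule snd_nb_point_self[OF l(1) m(2,4)]) (use m(6,7) in simp)
    moreover have "Comp C k m \<in> hom_set C (Dom C m) b" "Comp C l n \<in> hom_set C (Dom C m) c"
      using arr m by (simp_all add: hom_set_def)
    ultimately show "\<exists>d\<in>Obj C. \<exists>f\<in>hom_set C d b. \<exists>g\<in>hom_set C d c. \<exists>z\<in>fst ?u d. snd ?u f z = v \<and> snd ?u g z = w"
      using dom_obj[OF m(1)] by blast
  next
    fix b c f g v assume b: "b \<in> Obj C" "c \<in> Obj C" and f: "f \<in> hom_set C b c" "g \<in> hom_set C b c"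
      and v: "v \<in> fst ?u b" "snd ?u f v = snd ?u g v"
    have f': "f \<in> Arr C" "Dom C f = b" "Cod C f = c" "g \<in> Arr C" "Dom C g = b" "Cod C g = c"
      using f by (auto simp: hom_set_def)
    obtain \<iota> k where k: "nb_dom a x b \<iota> k" "v = Rel (nb_germ a x b \<iota> k)" using v(1) nb_pointE by blast
    note arr = nb_dom_arr[OF k(1)]
    have \<iota>: "\<iota> \<in> P a x" using k(1) by (simp add: nb_dom_def)
    have "nb_germ a x c \<iota> (Comp C f k) = nb_germ a x c \<iota> (Comp C g k)"
      using v(2) f' k(2) by (simp add: snd_nb_point[OF k(1)])
    then have "nb_rel a x \<iota> (Comp C f k) \<iota> (Comp C g k)"
      using iffD1[OF nb_germ_eq_iff] nb_dom_comp[OF k(1) f'(1,2)] nb_dom_comp[OF k(1) f'(4,5)] f'(3,6) by metis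
    then obtain m n where m: "m \<in> Arr C" "n \<in> Arr C" "Cod C m = Dom C \<iota>" "Cod C n = Dom C \<iota>" "Dom C m = Dom C n"
      "Comp C \<iota> m \<in> P a x" "Comp C \<iota> m = Comp C \<iota> n" "Comp C (Comp C f k) m = Comp C (Comp C g k) n"
      unfolding nb_rel_def by blast
    have "m = n" by (rule P_mono[OF \<iota> m(1,2,3,4,5,7)])
    then have "Comp C f (Comp C k m) = Comp C g (Comp C k m)" using m(8) f' arr m by (simp add: comp_assoc)
    moreover have "Comp C k m \<in> arrows_to C b" using arr m by (simp add: arrows_to_def)
    moreover have "Rel (nb_germ a x (Dom C m) (Comp C \<iota> m) (Ide C (Dom C m))) \<in> fst ?u (Dom C (Comp C k m))"
      using nb_dom_self[OF m(6)] m arr by (simp add: nb_pointI)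
    moreover have "snd ?u (Comp C k m) (Rel (nb_germ a x (Dom C m) (Comp C \<iota> m) (Ide C (Dom C m)))) = v"
      by (simp add: snd_nb_point_self[OF k(1) m(1,3,6)] k(2))
    ultimately show "\<exists>h\<in>arrows_to C b. \<exists>z\<in>fst ?u (Dom C h). snd ?u h z = v \<and> Comp C f h = Comp C g h"
      by blast
  }
qed

text \<open>The germ of the identity: the point \<open>x\<close> itself as an element of the fibre
  over \<open>a\<close>.\<close>

abbreviation nb_origin :: "'o \<Rightarrow> 'x \<Rightarrow> ('e, 'm) univ" where
  "nb_origin a x \<equiv> Rel (nb_germ a x a (Ide C a) (Ide C a))"

lemma nb_origin_in: "a \<in> Obj C \<Longrightarrow> x \<in> pts a \<Longrightarrow> nb_origin a x \<in> fst (nb_point a x) a"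
  using nb_dom_self[OF P_ide] by (simp add: nb_pointI)

text \<open>Equality with the germ of the identity means a commuting triangle over some
  neighbourhood of \<open>x\<close>, hence a factorization of that neighbourhood through
  \<open>f\<close>. This is how statements on stalks are converted into covering sieves.\<close>

lemma nb_origin_lift:
  fixes z :: "('e, 'm) univ"
  assumes a: "a \<in> Obj C" "x \<in> pts a" and f: "f \<in> Arr C" "Cod C f = a"
    and z: "z \<in> fst (nb_point a x) (Dom C f)" "snd (nb_point a x) f z = nb_origin a x"
  obtains k where "k \<in> Arr C" "Cod C k = Dom C f" "Comp C f k \<in> P a x"
proof -
  obtain \<iota> k where k: "nb_dom a x (Dom C f) \<iota> k" "z = Rel (nb_germ a x (Dom C f) \<iota> k)" using z(1) nb_pointE by blast
  note arr = nb_dom_arr[OF k(1)]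
  have "nb_germ a x a \<iota> (Comp C f k) = nb_germ a x a (Ide C a) (Ide C a)"
    using z(2) f k(2) by (simp add: snd_nb_point[OF k(1)])
  then have "nb_rel a x \<iota> (Comp C f k) (Ide C a) (Ide C a)"
    using nb_germ_eq_iff[of a x a \<iota> "Comp C f k" "Ide C a" "Ide C a"] nb_dom_comp[OF k(1) f(1)] f
      nb_dom_self[OF P_ide[OF a]] a by simp
  then obtain m n where m: "m \<in> Arr C" "n \<in> Arr C" "Cod C m = Dom C \<iota>" "Cod C n = Dom C (Ide C a)" "Dom C m = Dom C n"
      "Comp C \<iota> m \<in> P a x" "Comp C \<iota> m = Comp C (Ide C a) n" "Comp C (Comp C f k) m = Comp C (Ide C a) n"
    unfolding nb_rel_def by blast
  have "Comp C f (Comp C k m) = Comp C \<iota> m" using m(7,8) f arr m(1-3) by (simp add: comp_assoc)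
  then show ?thesis using that[of "Comp C k m"] m arr f by simp
qed

text \<open>For injectivity and for surjectivity alike, the arrows along which the assertion holds
  form a sieve. Comparing germs at \<open>nb_origin\<close> puts a neighbourhood of every point into
  it, so it is covering by \<open>P_cover\<close>.\<close>

lemma enough_points_nbhd: "enough_points C J TYPE(('e, 'm) univ)"
  unfolding enough_points_def
proof (intro allI impI ballI)
  fix F G :: "('o, 'm, ('e, 'm) univ) psh" and \<eta> and a
  assume *: "sheaf C J F \<and> sheaf C J G \<and> nat_trans C F G \<eta> \<and>
        (\<forall>u :: ('o, 'm, ('e, 'm) univ) pt_functor. site_point C J u \<longrightarrow>
           bij_betw (psh_stalk_map C G u \<eta>) (psh_stalk C F u) (psh_stalk C G u))"
    and a: "a \<in> Obj C"
  have F: "sheaf C J F" and G: "sheaf C J G" and \<eta>: "nat_trans C F G \<eta>"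
    and bij: "\<And>u :: ('o, 'm, ('e, 'm) univ) pt_functor. site_point C J u \<Longrightarrow>
       bij_betw (psh_stalk_map C G u \<eta>) (psh_stalk C F u) (psh_stalk C G u)"
    using * by blast+
  note PF = sheaf_presheaf[OF F] and PG = sheaf_presheaf[OF G]
  \<comment> \<open>Proved for all objects at once, because the local preimages are shown to match
    over the sources of the arrows of the covering sieve.\<close>
  have inj: "s = t" if a: "a \<in> Obj C" and s: "s \<in> Val F a" "t \<in> Val F a" and eq: "\<eta> a s = \<eta> a t" for a s t
  proof -
    define R where "R = {h \<in> arrows_to C a. Act F h s = Act F h t}"
    have R: "sieve C a R"
      unfolding sieve_def
    proof (intro conjI ballI)
      fix f h assume "f \<in> R" "h \<in> arrows_to C (Dom C f)"
      then show "Comp C f h \<in> R"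
        using s presheaf_comp[OF PF, of h f] by (auto simp: R_def arrows_to_def)
    qed (auto simp: R_def)
    have "R \<in> J a"
    proof (rule P_cover[OF a R])
      fix x assume x: "x \<in> pts a"
      let ?u = "nb_point a x :: ('o, 'm, ('e, 'm) univ) pt_functor" and ?e = "nb_origin a x :: ('e, 'm) univ"
      have u: "site_point C J ?u" by (rule nb_point_site_point[OF a x])
      interpret point C J ?u by (intro point.intro point_axioms.intro u cat_axioms)
      have e: "?e \<in> fst ?u a" by (rule nb_origin_in[OF a x])
      have "germ_at F a ?e s = germ_at F a ?e t"
        by (rule inj_onD[OF bij_betw_imp_inj_on[OF bij[OF u]]])
          (simp_all add: psh_stalk_map_germ[OF PF PG \<eta> a e] s eq psh_stalkI[OF a e])
      then obtain f z where f: "f \<in> Arr C" "Cod C f = a" "z \<in> fst ?u (Dom C f)" "snd ?u f z = ?e" "Act F f s = Act F f t"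
        using germ_at_eq_sameE[OF PF a e s] by blast
      obtain k where k: "k \<in> Arr C" "Cod C k = Dom C f" "Comp C f k \<in> P a x"
        by (rule nb_origin_lift[OF a x f(1-4)])
      have "f \<in> R" using f by (simp add: R_def arrows_to_def)
      then show "\<exists>f\<in>P a x. f \<in> R" using sieve_comp[OF R _ k(1,2)] k(3) by blast
    qed
    then show "s = t" by (rule sheaf_eqI[OF F a _ R s]) (simp add: R_def)
  qed
  show "bij_betw (\<eta> a) (Val F a) (Val G a)"
  proof (rule bij_betw_imageI)
    show "inj_on (\<eta> a) (Val F a)" by (rule inj_onI) (rule inj[OF a])
    show "\<eta> a ` Val F a = Val G a"
    proof (intro subset_antisym subsetI)
      fix t assume "t \<in> \<eta> a ` Val F a"
      then show "t \<in> Val G a" using nat_trans_in[OF \<eta> a] by blast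
    next
      fix t assume t: "t \<in> Val G a"
      define R where "R = {h \<in> arrows_to C a. \<exists>s\<in>Val F (Dom C h). \<eta> (Dom C h) s = Act G h t}"
      have R: "sieve C a R"
        unfolding sieve_def
      proof (intro conjI ballI)
        fix f h assume "f \<in> R" "h \<in> arrows_to C (Dom C f)"
        then obtain s where f: "f \<in> Arr C" "Cod C f = a" "h \<in> Arr C" "Cod C h = Dom C f" "s \<in> Val F (Dom C f)"
          "\<eta> (Dom C f) s = Act G f t" by (auto simp: R_def arrows_to_def)
        have "\<eta> (Dom C h) (Act F h s) = Act G (Comp C f h) t"
          using nat_trans_act[OF \<eta> f(3), of s] presheaf_comp[OF PG f(3,1,4), of t] f t by simp
        moreover have "Act F h s \<in> Val F (Dom C h)" using presheaf_act[OF PF f(3), of s] f by simp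
        ultimately show "Comp C f h \<in> R" using f by (auto simp: R_def arrows_to_def)
      qed (auto simp: R_def)
      have RJ: "R \<in> J a"
      proof (rule P_cover[OF a R])
        fix x assume x: "x \<in> pts a"
        let ?u = "nb_point a x :: ('o, 'm, ('e, 'm) univ) pt_functor" and ?e = "nb_origin a x :: ('e, 'm) univ"
        have u: "site_point C J ?u" by (rule nb_point_site_point[OF a x])
        interpret point C J ?u by (intro point.intro point_axioms.intro u cat_axioms)
        have e: "?e \<in> fst ?u a" by (rule nb_origin_in[OF a x])
        have "germ_at G a ?e t \<in> psh_stalk_map C G ?u \<eta> ` psh_stalk C F ?u"
          unfolding bij_betw_imp_surj_on[OF bij[OF u]] by (rule psh_stalkI[OF a e t])
        then obtain b y s where s: "b \<in> Obj C" "y \<in> fst ?u b" "s \<in> Val F b"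
          "germ_at G a ?e t = psh_stalk_map C G ?u \<eta> (germ_at F b y s)"
          by (auto elim: psh_stalkE)
        have "germ_at G a ?e t = germ_at G b y (\<eta> b s)"
          using s(4) psh_stalk_map_germ[OF PF PG \<eta> s(1-3)] by simp
        then obtain f g z where f: "f \<in> Arr C" "g \<in> Arr C" "Dom C f = Dom C g" "Cod C f = a"
          "Cod C g = b" "z \<in> fst ?u (Dom C g)" "snd ?u f z = ?e" "snd ?u g z = y" "Act G f t = Act G g (\<eta> b s)"
          using germ_at_eqE[OF PG a e t s(1,2) nat_trans_in[OF \<eta> s(1,3)]] by blast
        have "\<eta> (Dom C f) (Act F g s) = Act G f t"
          using nat_trans_act[OF \<eta> f(2), of s] s f by simp
        moreover have "Act F g s \<in> Val F (Dom C f)" using presheaf_act[OF PF f(2), of s] s f by simp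
        ultimately have fR: "f \<in> R" using f by (auto simp: R_def arrows_to_def)
        obtain k where k: "k \<in> Arr C" "Cod C k = Dom C f" "Comp C f k \<in> P a x"
          using nb_origin_lift[OF a x f(1,4) _ f(7)] f(3,6) by auto
        then show "\<exists>f\<in>P a x. f \<in> R" using sieve_comp[OF R fR k(1,2)] by blast
      qed
      define \<sigma> where "\<sigma> h = (SOME s. s \<in> Val F (Dom C h) \<and> \<eta> (Dom C h) s = Act G h t)" for h
      have \<sigma>: "\<sigma> h \<in> Val F (Dom C h)" "\<eta> (Dom C h) (\<sigma> h) = Act G h t" if "h \<in> R" for h
      proof -
        have "\<exists>s. s \<in> Val F (Dom C h) \<and> \<eta> (Dom C h) s = Act G h t" using that by (auto simp: R_def)
        from someI_ex[OF this] show "\<sigma> h \<in> Val F (Dom C h)" "\<eta> (Dom C h) (\<sigma> h) = Act G h t"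
          unfolding \<sigma>_def by blast+
      qed
      have "matching_family C F R \<sigma>"
        unfolding matching_family_def
      proof (intro ballI conjI \<sigma>(1))
        fix f h assume fR: "f \<in> R" and "h \<in> arrows_to C (Dom C f)"
        then have h: "h \<in> Arr C" "Cod C h = Dom C f" by (auto simp: arrows_to_def)
        have f: "f \<in> Arr C" "Cod C f = a" using fR by (auto simp: R_def arrows_to_def)
        have fhR: "Comp C f h \<in> R" by (rule sieve_comp[OF R fR h])
        have D: "Dom C (Comp C f h) = Dom C h" using f h by simp
        show "Act F h (\<sigma> f) = \<sigma> (Comp C f h)"
        proof (rule inj[OF dom_obj[OF h(1)]])
          show "Act F h (\<sigma> f) \<in> Val F (Dom C h)" using presheaf_act[OF PF h(1), of "\<sigma> f"] \<sigma>(1)[OF fR] h by simp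
          show "\<sigma> (Comp C f h) \<in> Val F (Dom C h)" using \<sigma>(1)[OF fhR] D by simp
          have "\<eta> (Dom C h) (Act F h (\<sigma> f)) = Act G h (Act G f t)"
            using nat_trans_act[OF \<eta> h(1), of "\<sigma> f"] \<sigma>[OF fR] h by simp
          also have "\<dots> = Act G (Comp C f h) t" using presheaf_comp[OF PG h(1) f(1) h(2), of t] f t by simp
          also have "\<dots> = \<eta> (Dom C h) (\<sigma> (Comp C f h))" using \<sigma>(2)[OF fhR] D by simp
          finally show "\<eta> (Dom C h) (Act F h (\<sigma> f)) = \<eta> (Dom C h) (\<sigma> (Comp C f h))" .
        qed
      qed
      then obtain s where s: "s \<in> Val F a" "\<And>f. f \<in> R \<Longrightarrow> Act F f s = \<sigma> f"
        using sheaf_glue[OF F a RJ] by metis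
      have "\<eta> a s = t"
      proof (rule sheaf_eqI[OF G a RJ R nat_trans_in[OF \<eta> a s(1)] t])
        fix f assume fR: "f \<in> R"
        then have f: "f \<in> Arr C" "Cod C f = a" by (auto simp: R_def arrows_to_def)
        show "Act G f (\<eta> a s) = Act G f t"
          using nat_trans_act[OF \<eta> f(1), of s] f s \<sigma>(2)[OF fR] fR by simp
      qed
      then show "t \<in> \<eta> a ` Val F a" using s(1) by blast
    qed
  qed
qed

end

section \<open>The strong topology\<close>

definition open_arr :: "('p, 'r) over_arr \<Rightarrow> bool" where
  "open_arr f \<longleftrightarrow> open_immersion (Space (Src f)) (Space (Tgt f)) (MapP f) (MapS f)"

definition arr_image :: "('p, 'r) over_arr \<Rightarrow> 'p set" where
  "arr_image f = MapP f ` points (Space (Src f))"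

locale complex_base =
  fixes B :: "('p, 'r) rspace" and \<phi> :: "complex \<Rightarrow> 'r"
  assumes B: "complex_point B \<phi>"
begin

abbreviation S :: "(('p, 'r) over, ('p, 'r) over_arr) category" where "S \<equiv> complex_cat B \<phi>"

lemma S_simps [simp]:
  "Obj S = {X. complex_space B \<phi> X}"
  "Dom S = Src" "Cod S = Tgt"
  by (simp_all add: complex_cat_def)

lemma Arr_S: "f \<in> Arr S \<longleftrightarrow> complex_space B \<phi> (Src f) \<and> complex_space B \<phi> (Tgt f) \<and> over_morphism B f"
  by (simp add: complex_cat_def)

lemma complex_over: "complex_space B \<phi> X \<Longrightarrow> over_obj B X"
  by (simp add: complex_space_def)

lemma complex_ringed: "complex_space B \<phi> X \<Longrightarrow> ringed_space (Space X)"
  by (rule over_obj_ringed[OF complex_over])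

lemma cat_S: "cat S"
  unfolding complex_cat_def by (rule cat_over_cat) (simp add: complex_over)

sublocale cat S by (rule cat_S)

lemma Comp_simps:
  "MapP (Comp S g f) = (\<lambda>x\<in>points (Space (Src f)). MapP g (MapP f x))"
  "MapS (Comp S g f) = (\<lambda>V\<in>{V. openin (Top (Space (Tgt g))) V}. \<lambda>s\<in>carrier (Sec (Space (Tgt g)) V).
        MapS f (preim (Space (Tgt f)) (MapP g) V) (MapS g V s))"
  by (simp_all add: complex_cat_def over_cat_Comp)

lemma Src_Comp [simp]: "Src (Comp S g f) = Src f"
  and Tgt_Comp [simp]: "Tgt (Comp S g f) = Tgt g"
  by (simp_all add: complex_cat_def over_cat_Comp)

lemma Comp_point: "x \<in> points (Space (Src f)) \<Longrightarrow> MapP (Comp S g f) x = MapP g (MapP f x)"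
  by (simp add: Comp_simps)

lemma Comp_section:
  "openin (Top (Space (Tgt g))) V \<Longrightarrow> s \<in> carrier (Sec (Space (Tgt g)) V) \<Longrightarrow>
    MapS (Comp S g f) V s = MapS f (preim (Space (Tgt f)) (MapP g) V) (MapS g V s)"
  by (simp add: Comp_simps)

lemma arr_point: "f \<in> Arr S \<Longrightarrow> x \<in> points (Space (Src f)) \<Longrightarrow> MapP f x \<in> points (Space (Tgt f))"
  using rsm_point[OF over_morphism_rs, of B f x] by (simp add: Arr_S)

text \<open>\<open>open_immersion_factor\<close> provides the underlying morphism. Compatibility
  with the base holds because the structure maps of \<open>Src f\<close> and \<open>Src h\<close>
  are both pulled back from those of \<open>Tgt f\<close>.\<close>

lemma open_arr_factor:
  assumes f: "f \<in> Arr S" "open_arr f" and h: "h \<in> Arr S" "Tgt h = Tgt f"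
    and img: "arr_image h \<subseteq> arr_image f"
  obtains k where "k \<in> Arr S" "Src k = Src h" "Tgt k = Src f" "Comp S f k = h"
proof -
  let ?X = "Space (Src f)" and ?Y = "Space (Tgt f)" and ?W = "Space (Src h)"
  have f': "over_morphism B f" and h': "over_morphism B h" and
    cs: "complex_space B \<phi> (Src f)" "complex_space B \<phi> (Src h)" "complex_space B \<phi> (Tgt f)"
    using f(1) h(1) by (simp_all add: Arr_S)
  have imm: "open_immersion ?X ?Y (MapP f) (MapS f)" using f(2) by (simp add: open_arr_def)
  have lrs: "lrs_morphism ?W ?Y (MapP h) (MapS h)" using h' h(2) by (simp add: over_morphism_def)
  obtain k \<omega> where k: "lrs_morphism ?W ?X k \<omega>" "\<And>x. x \<in> points ?W \<Longrightarrow> MapP f (k x) = MapP h x"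
    "\<And>V s. openin (Top ?Y) V \<Longrightarrow> s \<in> carrier (Sec ?Y V) \<Longrightarrow> \<omega> (preim ?X (MapP f) V) (MapS f V s) = MapS h V s"
    using open_immersion_factor[OF cs(2,1,3)[THEN complex_ringed] imm lrs img[unfolded arr_image_def]] by blast
  have k': "rs_morphism ?W ?X k \<omega>" using k(1) by (simp add: lrs_morphism_def)
  define a where "a = \<lparr>Src = Src h, Tgt = Src f, MapP = k, MapS = \<omega>\<rparr>"
  have a: "Src a = Src h" "Tgt a = Src f" "MapP a = k" "MapS a = \<omega>" by (simp_all add: a_def)
  have "over_morphism B a"
    unfolding over_morphism_def a
  proof (intro conjI ballI allI impI k(1))
    fix x assume x: "x \<in> points ?W"
    have "StrP (Src f) (k x) = StrP (Tgt f) (MapP f (k x))"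
      using f' rsm_point[OF k' x] by (simp add: over_morphism_def)
    also have "\<dots> = StrP (Src h) x" using h' x k(2)[OF x] h(2) by (simp add: over_morphism_def)
    finally show "StrP (Src f) (k x) = StrP (Src h) x" .
  next
    fix V s assume V: "openin (Top B) V" and s: "s \<in> carrier (Sec B V)"
    let ?V = "preim ?Y (StrP (Tgt f)) V"
    note str = over_obj_str[OF complex_over[OF cs(3)]]
    have 1: "preim ?X (StrP (Src f)) V = preim ?X (MapP f) ?V"
      using f' rsm_point[OF over_morphism_rs[OF f']] by (auto simp: preim_def over_morphism_def)
    have 2: "StrS (Src f) V s = MapS f ?V (StrS (Tgt f) V s)"
      using f' V s by (simp add: over_morphism_def)
    have "\<omega> (preim ?X (StrP (Src f)) V) (StrS (Src f) V s) = MapS h ?V (StrS (Tgt f) V s)"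
      unfolding 1 2 by (rule k(3)[OF rsm_open[OF str V] rsm_closed[OF str V s]])
    also have "\<dots> = StrS (Src h) V s" using h' V s h(2) by (simp add: over_morphism_def)
    finally show "\<omega> (preim ?X (StrP (Src f)) V) (StrS (Src f) V s) = StrS (Src h) V s" .
  qed
  then have aS: "a \<in> Arr S" using cs a by (simp add: Arr_S)
  have "Comp S f a \<in> Arr S" by (rule arr_comp) (use aS f a in simp_all)
  then have "Comp S f a = h"
    using h' h(2) a k(2,3)
    by (intro over_arr_eqI[where B = B]) (simp_all add: Comp_point Comp_section Arr_S)
  then show ?thesis using that[OF aS] a by simp
qed

text \<open>On points by injectivity of \<open>f\<close>; on sections because every section over an
  open set \<open>V\<close> of the source comes, by the isomorphism over the image of
  \<open>V\<close>, from a section of the target.\<close>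

lemma open_arr_mono:
  assumes f: "f \<in> Arr S" "open_arr f" and g: "g \<in> Arr S" "Tgt g = Src f" and h: "h \<in> Arr S" "Tgt h = Src f"
    and src: "Src g = Src h" and eq: "Comp S f g = Comp S f h"
  shows "g = h"
proof (rule over_arr_eqI[where B = B])
  let ?X = "Space (Src f)" and ?Y = "Space (Tgt f)"
  have imm: "open_immersion ?X ?Y (MapP f) (MapS f)" using f(2) by (simp add: open_arr_def)
  show "Src g = Src h" "Tgt g = Tgt h" "over_morphism B g" "over_morphism B h" using assms by (simp_all add: Arr_S)
  {
    fix x assume x: "x \<in> points (Space (Src h))"
    have "MapP f (MapP g x) = MapP f (MapP h x)"
      using Comp_point[of x g f] Comp_point[of x h f] x src eq by simp
    then show "MapP g x = MapP h x"
      using inj_onD[OF openim_inj[OF imm]] arr_point[OF g(1), of x] arr_point[OF h(1) x] x src g(2) h(2) by simp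
  next
    fix V s assume "openin (Top (Space (Tgt h))) V" "s \<in> carrier (Sec (Space (Tgt h)) V)"
    then have V: "openin (Top ?X) V" and s: "s \<in> carrier (Sec ?X V)" by (simp_all add: h(2))
    let ?W = "MapP f ` V"
    have W: "openin (Top ?Y) ?W" by (rule openim_open_image[OF imm V])
    have W': "?W \<subseteq> MapP f ` points ?X" using openin_subset[OF V] by blast
    have p: "preim ?X (MapP f) ?W = V" by (rule openim_preim_image[OF imm V])
    have "bij_betw (MapS f ?W) (carrier (Sec ?Y ?W)) (carrier (Sec ?X V))"
      using openim_iso[OF imm W W'] unfolding p by (simp add: ring_iso_def)
    then obtain t where t: "t \<in> carrier (Sec ?Y ?W)" "MapS f ?W t = s"
      using s by (metis bij_betw_imp_surj_on imageE)
    show "MapS g V s = MapS h V s"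
      using Comp_section[OF W t(1), of g] Comp_section[OF W t(1), of h] eq g(2) h(2) p t(2) by simp
  }
qed

lemma open_arr_comp:
  assumes f: "f \<in> Arr S" "open_arr f" and k: "k \<in> Arr S" "open_arr k" "Tgt k = Src f"
  shows "open_arr (Comp S f k)"
proof -
  have "ringed_space (Space (Tgt f))" using f(1) by (simp add: complex_ringed Arr_S)
  from open_immersion_comp[OF this _ f(2)[unfolded open_arr_def], of "Space (Src k)" "MapP k" "MapS k"]
  show ?thesis using k by (simp add: open_arr_def Comp_simps)
qed

lemma arr_image_comp: "y \<in> arr_image k \<Longrightarrow> MapP f y \<in> arr_image (Comp S f k)"
  by (force simp: arr_image_def Comp_point)

lemma Ide_simps:
  "Src (Ide S X) = X" "Tgt (Ide S X) = X" "MapP (Ide S X) = (\<lambda>x\<in>points (Space X). x)"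
  "MapS (Ide S X) = (\<lambda>V\<in>{V. openin (Top (Space X)) V}. \<lambda>s\<in>carrier (Sec (Space X) V). s)"
  by (simp_all add: complex_cat_def over_cat_Ide)

lemma arr_image_Ide: "arr_image (Ide S X) = points (Space X)"
  by (simp add: arr_image_def Ide_simps)

lemma open_arr_Ide:
  assumes "complex_space B \<phi> X"
  shows "open_arr (Ide S X)"
proof -
  let ?X = "Space X" and ?f = "\<lambda>x\<in>points (Space X). x"
  let ?\<psi> = "\<lambda>V\<in>{V. openin (Top ?X) V}. \<lambda>s\<in>carrier (Sec ?X V). s"
  have rs: "rs_morphism ?X ?X ?f ?\<psi>"
    using lrs_morphism_ide[OF complex_ringed[OF assms]] by (simp add: lrs_morphism_def)
  have img: "?f ` points ?X = points ?X" by simp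
  have "homeomorphic_map (Top ?X) (Top ?X) id" by (rule homeomorphic_map_id[THEN iffD2]) simp
  then have hm: "homeomorphic_map (Top ?X) (Top ?X) ?f" by (rule homeomorphic_map_eq) simp
  show ?thesis
    unfolding open_arr_def Ide_simps open_immersion_def img subtopology_topspace
  proof (intro conjI rs hm openin_topspace allI impI)
    fix V assume V: "openin (Top ?X) V \<and> V \<subseteq> points ?X"
    then have p: "preim ?X ?f V = V" by (intro preim_ide) simp
    have "?\<psi> V \<in> ring_hom (Sec ?X V) (Sec ?X V)" using rsm_hom[OF rs, of V] V unfolding p by simp
    moreover have "bij_betw (?\<psi> V) (carrier (Sec ?X V)) (carrier (Sec ?X V))"
      using V by (auto simp: bij_betw_def inj_on_def)
    ultimately show "?\<psi> V \<in> ring_iso (Sec ?X V) (Sec ?X (preim ?X ?f V))"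
      unfolding p by (simp add: ring_iso_def)
  qed
qed

text \<open>The base change of an open immersion along \<open>h\<close> is the open subspace on the
  preimage of its image. That this subspace is an object of the site is
  \<open>complex_space_over_sub\<close>; the second projection exists by
  \<open>open_arr_factor\<close>.\<close>

lemma open_arr_lift:
  assumes h: "h \<in> Arr S" and i: "i \<in> Arr S" "open_arr i" "Tgt i = Tgt h"
    and x: "x \<in> points (Space (Src h))" "MapP h x \<in> arr_image i"
  obtains k l where "k \<in> Arr S" "Tgt k = Src h" "open_arr k" "x \<in> arr_image k"
    "l \<in> Arr S" "Tgt l = Src i" "Src l = Src k" "Comp S h k = Comp S i l"
proof -
  let ?X = "Space (Src h)"
  define N where "N = preim ?X (MapP h) (arr_image i)"
  have h': "rs_morphism ?X (Space (Tgt h)) (MapP h) (MapS h)"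
    by (rule over_morphism_rs[of B]) (use h in \<open>simp add: Arr_S\<close>)
  have cs: "complex_space B \<phi> (Src h)" using h by (simp add: Arr_S)
  have N: "openin (Top ?X) N"
    unfolding N_def using openim_image[OF i(2)[unfolded open_arr_def]]
    by (intro rsm_open[OF h']) (simp add: arr_image_def i(3))
  have pN: "points (open_sub ?X N) = N" by (rule points_open_sub[OF N])
  define k where "k = incl_arr B (Src h) N"
  have k: "k \<in> Arr S" "Tgt k = Src h" "Src k = over_sub B (Src h) N"
    using cs complex_space_over_sub[OF B cs N] over_morphism_incl[OF complex_over[OF cs] N]
    by (simp_all add: k_def Arr_S)
  have ok: "open_arr k"
    using open_immersion_incl[OF complex_ringed[OF cs] N] by (simp add: open_arr_def k_def)
  have xk: "x \<in> arr_image k" using x pN by (simp add: arr_image_def k_def N_def in_preim)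
  have hk: "Comp S h k \<in> Arr S" by (rule arr_comp) (use h k in simp_all)
  have "arr_image (Comp S h k) \<subseteq> arr_image i"
    using pN by (auto simp: arr_image_def[of "Comp S h k"] Comp_point k(3)) (simp add: k_def N_def in_preim)
  then obtain l where "l \<in> Arr S" "Src l = Src (Comp S h k)" "Tgt l = Src i" "Comp S i l = Comp S h k"
    using open_arr_factor[OF i(1,2) hk] i(3) by (metis Tgt_Comp)
  then show ?thesis using that[OF k(1,2) ok xk] by simp
qed

lemma strong_topology_iff:
  "R \<in> strong_topology S X \<longleftrightarrow> sieve S X R \<and>
     (\<forall>x\<in>points (Space X). \<exists>i\<in>R. x \<in> arr_image i \<and> open_arr i)"
proof -
  have "R \<subseteq> {f. Tgt f = X}" if "sieve S X R" using that by (auto simp: sieve_def arrows_to_def)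
  then have "open_arr i \<longleftrightarrow> open_immersion (Space (Src i)) (Space X) (MapP i) (MapS i)" if "sieve S X R" "i \<in> R" for i
    using that by (auto simp: open_arr_def)
  then show ?thesis unfolding strong_topology_def arr_image_def by (simp cong: conj_cong bex_cong)
qed

text \<open>A member of \<open>R\<close> that is an open immersion around the image of
  \<open>x\<close> is pulled back along \<open>h\<close>; the composite with \<open>h\<close>
  factors through this member and hence lies in the sieve.\<close>

lemma strong_lift:
  assumes h: "h \<in> Arr S" and R: "R \<in> strong_topology S (Tgt h)" and x: "x \<in> points (Space (Src h))"
  obtains k where "k \<in> Arr S" "Tgt k = Src h" "open_arr k" "x \<in> arr_image k" "Comp S h k \<in> R"
proof -
  have sR: "sieve S (Tgt h) R" using R by (simp add: strong_topology_iff)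
  obtain i where i: "i \<in> R" "MapP h x \<in> arr_image i" "open_arr i"
    using R arr_point[OF h x] unfolding strong_topology_iff by blast
  have i': "i \<in> Arr S" "Tgt i = Tgt h" using sR i(1) by (auto simp: sieve_def arrows_to_def)
  obtain k l where k: "k \<in> Arr S" "Tgt k = Src h" "open_arr k" "x \<in> arr_image k"
    "l \<in> Arr S" "Tgt l = Src i" "Src l = Src k" "Comp S h k = Comp S i l"
    by (rule open_arr_lift[OF h i'(1) i(3) i'(2) x i(2)])
  have "Comp S i l \<in> R" using sR i(1) k(5,6) by (simp add: sieve_def arrows_to_def)
  then show ?thesis using that[OF k(1-4)] k(8) by simp
qed

text \<open>Each axiom asks for an open immersion of the sieve around a given point: it is the
  identity, a pullback obtained from \<open>strong_lift\<close>, or a composite of two open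
  immersions.\<close>

lemma strong_topology_grothendieck: "grothendieck_topology S (strong_topology S)"
  unfolding grothendieck_topology_def
proof (intro ballI conjI allI impI)
  fix a assume a: "a \<in> Obj S"
  show "sieve S a R" if "R \<in> strong_topology S a" for R using that by (simp add: strong_topology_iff)
  have "Ide S a \<in> arrows_to S a" using a arr_ide[OF a] by (simp add: arrows_to_def Ide_simps)
  moreover have "sieve S a (arrows_to S a)" unfolding sieve_def
    using arr_comp by (auto simp: arrows_to_def)
  ultimately show "arrows_to S a \<in> strong_topology S a"
    using open_arr_Ide[of a] a by (auto simp: strong_topology_iff arr_image_Ide intro!: bexI[of _ "Ide S a"])
  {
    fix R h assume R: "R \<in> strong_topology S a" and "h \<in> arrows_to S a"
    then have h: "h \<in> Arr S" "Tgt h = a" by (simp_all add: arrows_to_def)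
    have sR: "sieve S a R" using R by (simp add: strong_topology_iff)
    have "sieve S (Src h) (sieve_pullback S R h)"
      unfolding sieve_def
    proof (intro conjI ballI)
      fix f k assume f: "f \<in> sieve_pullback S R h" and k: "k \<in> arrows_to S (Dom S f)"
      have 1: "Comp S (Comp S h f) k \<in> R"
        using sR f k unfolding sieve_def sieve_pullback_def by simp
      have 2: "f \<in> Arr S" "Tgt f = Src h" "k \<in> Arr S" "Tgt k = Src f"
        using f k by (simp_all add: sieve_pullback_def arrows_to_def)
      have "Comp S (Comp S h f) k = Comp S h (Comp S f k)" by (rule comp_assoc) (use 2 h in simp_all)
      moreover have "Comp S f k \<in> Arr S" by (rule arr_comp) (use 2 in simp_all)
      ultimately show "Comp S f k \<in> sieve_pullback S R h"
        using 1 2 by (simp add: sieve_pullback_def arrows_to_def)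
    qed (auto simp: sieve_pullback_def)
    then show "sieve_pullback S R h \<in> strong_topology S (Dom S h)"
      unfolding S_simps strong_topology_iff
    proof (intro conjI ballI)
      fix x assume "x \<in> points (Space (Src h))"
      then obtain k where "k \<in> Arr S" "Tgt k = Src h" "open_arr k" "x \<in> arr_image k" "Comp S h k \<in> R"
        using strong_lift[OF h(1)] R h(2) by metis
      then show "\<exists>i\<in>sieve_pullback S R h. x \<in> arr_image i \<and> open_arr i"
        by (intro bexI[of _ k]) (simp_all add: sieve_pullback_def arrows_to_def)
    qed
  }
  fix R R' assume R: "R \<in> strong_topology S a"
    and R': "sieve S a R' \<and> (\<forall>h\<in>R. sieve_pullback S R' h \<in> strong_topology S (Dom S h))"
  show "R' \<in> strong_topology S a"
    unfolding strong_topology_iff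
  proof (intro conjI ballI)
    fix x assume "x \<in> points (Space a)"
    then obtain i where i: "i \<in> R" "x \<in> arr_image i" "open_arr i" using R unfolding strong_topology_iff by blast
    have i': "i \<in> Arr S" using R i(1) by (auto simp: strong_topology_iff sieve_def arrows_to_def)
    obtain y where y: "y \<in> points (Space (Src i))" "x = MapP i y" using i(2) by (auto simp: arr_image_def)
    have "sieve_pullback S R' i \<in> strong_topology S (Src i)" using R' i(1) by simp
    then obtain k where k: "k \<in> sieve_pullback S R' i" "y \<in> arr_image k" "open_arr k"
      using y(1) unfolding strong_topology_iff by blast
    then have k': "k \<in> Arr S" "Tgt k = Src i" "Comp S i k \<in> R'" by (simp_all add: sieve_pullback_def arrows_to_def)
    show "\<exists>i\<in>R'. x \<in> arr_image i \<and> open_arr i"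
      using k'(3) arr_image_comp[OF k(2), of i] y(2) open_arr_comp[OF i' i(3) k'(1) k(3) k'(2)] by blast
  qed (use R' in blast)
qed

definition open_nbhd :: "('p, 'r) over \<Rightarrow> 'p \<Rightarrow> ('p, 'r) over_arr set" where
  "open_nbhd X x = {f \<in> Arr S. Tgt f = X \<and> open_arr f \<and> x \<in> arr_image f}"

text \<open>Open immersions around a point are monic, any two have a common refinement by
  \<open>open_arr_lift\<close>, and a covering sieve is reached after shrinking by
  \<open>strong_lift\<close>; the covering axiom is the definition of the strong topology.\<close>

sublocale strong: nbhd_site S "strong_topology S" "\<lambda>X. points (Space X)" open_nbhd
proof
  show "grothendieck_topology S (strong_topology S)" by (rule strong_topology_grothendieck)
  show "f \<in> Arr S \<and> Cod S f = a" if "f \<in> open_nbhd a x" for f a x using that by (simp add: open_nbhd_def)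
  show "Ide S a \<in> open_nbhd a x" if a: "a \<in> Obj S" "x \<in> points (Space a)" for a x
    using arr_ide[OF a(1)] a open_arr_Ide[of a] by (simp add: open_nbhd_def arr_image_Ide Ide_simps(2))
  show "g = h" if "f \<in> open_nbhd a x" "g \<in> Arr S" "h \<in> Arr S" "Cod S g = Dom S f" "Cod S h = Dom S f"
      "Dom S g = Dom S h" "Comp S f g = Comp S f h" for f g h a x
    by (rule open_arr_mono[of f]) (use that in \<open>simp_all add: open_nbhd_def\<close>)
next
  fix f g a x assume f: "f \<in> open_nbhd a x" and g: "g \<in> open_nbhd a x"
  obtain y where y: "y \<in> points (Space (Src f))" "x = MapP f y" using f by (auto simp: open_nbhd_def arr_image_def)
  have f': "f \<in> Arr S" "Tgt f = a" "open_arr f" and g': "g \<in> Arr S" "Tgt g = Tgt f" "open_arr g" "MapP f y \<in> arr_image g"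
    using f g y(2) by (simp_all add: open_nbhd_def)
  obtain k l where k: "k \<in> Arr S" "Tgt k = Src f" "open_arr k" "y \<in> arr_image k"
    "l \<in> Arr S" "Tgt l = Src g" "Src l = Src k" "Comp S f k = Comp S g l"
    by (rule open_arr_lift[OF f'(1) g'(1,3,2) y(1) g'(4)])
  have "Comp S f k \<in> Arr S" by (rule arr_comp) (use f' k in simp_all)
  then have "Comp S f k \<in> open_nbhd a x"
    using f' open_arr_comp[OF f'(1,3) k(1,3,2)] arr_image_comp[OF k(4), of f] y(2) by (simp add: open_nbhd_def)
  then show "\<exists>k l. k \<in> Arr S \<and> l \<in> Arr S \<and> Cod S k = Dom S f \<and> Cod S l = Dom S g \<and> Dom S k = Dom S l \<and>
      Comp S f k \<in> open_nbhd a x \<and> Comp S f k = Comp S g l"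
    using k by (intro exI[of _ k] exI[of _ l]) simp
next
  fix f g R a x assume f: "f \<in> open_nbhd a x" and g: "g \<in> Arr S" "Dom S g = Dom S f" and R: "R \<in> strong_topology S (Cod S g)"
  obtain y where y: "y \<in> points (Space (Src f))" "x = MapP f y" using f by (auto simp: open_nbhd_def arr_image_def)
  have f': "f \<in> Arr S" "Tgt f = a" "open_arr f" using f by (simp_all add: open_nbhd_def)
  obtain k where k: "k \<in> Arr S" "Tgt k = Src f" "open_arr k" "y \<in> arr_image k" "Comp S g k \<in> R"
    using strong_lift[OF g(1), of R y] R g(2) y(1) by auto
  have "Comp S f k \<in> Arr S" by (rule arr_comp) (use f' k in simp_all)
  then have "Comp S f k \<in> open_nbhd a x"
    using f' open_arr_comp[OF f'(1,3) k(1,3,2)] arr_image_comp[OF k(4), of f] y(2) by (simp add: open_nbhd_def)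
  then show "\<exists>k. k \<in> Arr S \<and> Cod S k = Dom S f \<and> Comp S f k \<in> open_nbhd a x \<and> Comp S g k \<in> R"
    using k by (intro exI[of _ k]) simp
next
  fix a R assume "a \<in> Obj S" "sieve S a R" and *: "\<And>x. x \<in> points (Space a) \<Longrightarrow> \<exists>f\<in>open_nbhd a x. f \<in> R"
  then show "R \<in> strong_topology S a"
    unfolding strong_topology_iff using * by (auto simp: open_nbhd_def)
qed

end

theorem theorem3p1:
  fixes S :: "(('p, 'r) over, ('p, 'r) over_arr) category"
    and T :: "('p, 'r) over \<Rightarrow> ('p, 'r) over_arr set set"
    and A :: "('p, 'r) over"
    and X :: "(('p, 'r) over, ('p, 'r) over_arr, ('e, ('p, 'r) over_arr) univ) psh"
  assumes site: "complex_site S T A \<or> algebraic_site S T A TYPE(('e, ('p, 'r) over_arr) univ)"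
    and X: "sheaf S T X"
  shows "(hyperbolic_sheaf S T A X \<longleftrightarrow>
            (\<forall>U\<in>Obj S.
               bij_betw (\<lambda>g. Comp (sheaf_cat S T) g (psh_proj S (rep S T U) (rep S T A)))
                 (hom_set (sheaf_cat S T) (rep S T U) X)
                 (hom_set (sheaf_cat S T) (psh_prod (rep S T U) (rep S T A)) X)))
       \<and> (hyperbolic_sheaf S T A X \<longrightarrow>
            (\<forall>Y. sheaf S T Y \<longrightarrow>
               (\<exists>\<alpha>. bij_betw \<alpha> (hom_H S T A (const_simplicial S Y) (const_simplicial S X))
                               (hom_Hs S T (const_simplicial S Y) (const_simplicial S X)))
             \<and> (\<exists>\<beta>. bij_betw \<beta> (hom_Hs S T (const_simplicial S Y) (const_simplicial S X))
                               (hom_set (sheaf_cat S T) Y X))))"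
proof -
  have "site S T \<and> enough_points S T TYPE(('e, ('p, 'r) over_arr) univ)"
    using site
  proof
    assume "complex_site S T A"
    then obtain B \<phi> where B: "complex_point B \<phi>" and S: "S = complex_cat B \<phi>" and T: "T = strong_topology S"
      by (auto simp: complex_site_def)
    interpret complex_base B \<phi> by (rule complex_base.intro[OF B])
    show ?thesis unfolding T unfolding S using strong.site_axioms strong.enough_points_nbhd by (rule conjI)
  next
    assume "algebraic_site S T A TYPE(('e, ('p, 'r) over_arr) univ)"
    then obtain B where S: "S = algebraic_cat B" and T: "grothendieck_topology S T"
      "enough_points S T TYPE(('e, ('p, 'r) over_arr) univ)"
      by (auto simp: algebraic_site_def)
    \<comment> \<open>Objects of the algebraic category are by definition spaces over
      \<open>B\<close>, so the general category of spaces over a base applies.\<close>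
    have "cat S" unfolding S algebraic_cat_def by (rule cat_over_cat) simp
    then show ?thesis using T by (auto intro: site.intro site_axioms.intro)
  qed
  then have "site S T" and enough: "enough_points S T TYPE(('e, ('p, 'r) over_arr) univ)" by blast+
  then interpret site S T by blast
  show ?thesis
    using hyperbolic_criterion(1)[OF enough X] hyperbolic_criterion(2)[OF enough X]
      hyperbolic_criterion(3)[OF enough X] by blast
qed

end
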